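(* Let $\omega$ be a Borel measure on $\mathbb R$ such that $$\int_{\mathbb R}\frac{d\omega(\lambda)}{1+\lambda^2}=1,\qquad\int_{\mathbb R}d\omega(\lambda)=\infty,$$ and let $H$ be the self-adjoint operator of multiplication by $\lambda$ in $L^2(\mathbb R;d\omega)$, $(Hf)(\lambda)=\lambda f(\lambda)$, $f\in\mathrm{dom}(H)=L^2(\mathbb R;(1+\lambda^2)d\omega)$. Define $\dot H$ to be the densely defined closed prime symmetric restriction of $H$, $$\dot H=H\big|_{\mathrm{dom}(\dot H)},\qquad\mathrm{dom}(\dot H)=\Bigl\{f\in\mathrm{dom}(H)\,\Big|\,\int_{\mathbb R}d\omega(\lambda)f(\lambda)=0\Bigr\},$$ with deficiency indices $(1,1)$. Then $\dot H$ admits a quasi-hermitian extension with empty spectrum if and only if for some $a>0$ and some $\alpha\in[0,\pi)$ the following representation holds: $$\int_{\mathbb R}d\omega(\lambda)\bigl((\lambda-z)^{-1}-\lambda(1+\lambda^2)^{-1}\bigr)=\frac{\sin(\alpha)-\cos(\alpha)\,(\cot(az)/\coth(a))}{\cos(\alpha)+\sin(\alpha)\,(\cot(az)/\coth(a))},\quad z\in\mathbb C\setminus\mathbb R.$$ In this case the measure $\omega$ is a pure point measure, $$\omega=\frac{\coth(a)(1+\cot^2(\alpha))}{a(1+\cot^2(\alpha)\coth^2(a))}\sum_{n\in\mathbb Z}\mu_{\{(\beta+\pi n)/a\}},$$ where $\mu_{\{x\}}$ denotes the Dirac measure supported at $x\in\mathbb R$ with mass one and $\beta=\beta(\alpha,a)\in[0,\pi)$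 is the solution of the equation $$\cot(\beta)+\cot(\alpha)\coth(a)=0\ \text{ if }\alpha\in(0,\pi),\quad\text{and}\quad\beta=0\ \text{ if }\alpha=0.$$ Moreover, the self-adjoint operator $H$ is unitarily equivalent to the differentiation operator $T_\rho$ in $L^2([0,2a])$ with $\rho=e^{-2i\beta}$.
   Context: A closed operator $S$ is a quasi-hermitian extension of a densely defined closed prime symmetric operator $\dot H$ with deficiency indices $(1,1)$ if $\dot H\subsetneqq S\subsetneqq\dot H^*$ and $S$ is not self-adjoint. A densely defined closed symmetric operator $\dot H$ with equal deficiency indices is prime if $\overline{\mathrm{lin.span}\{(H-z)^{-1}u_+\,|\,u_+\in\ker(\dot H^*-i),\ z\in\mathbb C\setminus\mathbb R\}}$ is the whole Hilbert space for a (equivalently, every) self-adjoint extension $H$ of $\dot H$. For $|\rho|=1$, $T_\rho$ is the operator $(T_\rho f)(x)=-if'(x)$, $x\in(0,2a)$, with domain $\{g\in L^2([0,2a])\,|\,g\in AC([0,2a]),\ g(0_+)=\rho g(2a_-),\ g'\in L^2([0,2a])\}$. For $\alpha=0$ the coefficient in the formula for $\omega$ is understood as its limit $\tanh(a)/a$ as $\alpha\downarrow0$. *)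

theory Defs
  imports "HOL-Analysis.Analysis" "HOL-Probability.Giry_Monad"
begin

section \<open>The Hilbert space of square-integrable functions\<close>

text \<open>
  Elements of the Hilbert space are represented by functions; functions that agree almost
  everywhere stand for the same element, so every notion below is stated modulo a.e. equality.
\<close>

definition L2_space :: "'a measure \<Rightarrow> ('a \<Rightarrow> complex) set" where
  "L2_space M = {f \<in> borel_measurable M. integrable M (\<lambda>x. (cmod (f x))\<^sup>2)}"

definition L2_inner :: "'a measure \<Rightarrow> ('a \<Rightarrow> complex) \<Rightarrow> ('a \<Rightarrow> complex) \<Rightarrow> complex" where
  "L2_inner M f g = (\<integral>x. f x * cnj (g x) \<partial>M)"

definition L2_norm :: "'a measure \<Rightarrow> ('a \<Rightarrow> complex) \<Rightarrow> real" where
  "L2_norm M f = sqrt (\<integral>x. (cmod (f x))\<^sup>2 \<partial>M)"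

definition ae_eq :: "'a measure \<Rightarrow> ('a \<Rightarrow> complex) \<Rightarrow> ('a \<Rightarrow> complex) \<Rightarrow> bool" where
  "ae_eq M f g \<longleftrightarrow> (AE x in M. f x = g x)"

definition L2_dense :: "'a measure \<Rightarrow> ('a \<Rightarrow> complex) set \<Rightarrow> bool" where
  "L2_dense M V \<longleftrightarrow> (\<forall>h\<in>L2_space M. \<forall>\<epsilon>>0. \<exists>f\<in>V. L2_norm M (\<lambda>x. h x - f x) < \<epsilon>)"

definition lin_span :: "('a \<Rightarrow> complex) set \<Rightarrow> ('a \<Rightarrow> complex) set" where
  "lin_span V = {(\<lambda>x. \<Sum>f\<in>F. c f * f x) | F c. finite F \<and> F \<subseteq> V}"

section \<open>Unbounded operators\<close>

text \<open>
  An operator is given by its graph, a set of pairs of representatives that is closed under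
  a.e. modification of either component. Inclusion of graphs is then extension of operators,
  and equality of graphs is equality of operators.
\<close>

type_synonym 'a graph = "(('a \<Rightarrow> complex) \<times> ('a \<Rightarrow> complex)) set"

definition linear_operator :: "'a measure \<Rightarrow> 'a graph \<Rightarrow> bool" where
  "linear_operator M A \<longleftrightarrow>
     A \<subseteq> L2_space M \<times> L2_space M \<and>
     (\<forall>(f, g)\<in>A. \<forall>f'\<in>L2_space M. \<forall>g'\<in>L2_space M.
        ae_eq M f f' \<longrightarrow> ae_eq M g g' \<longrightarrow> (f', g') \<in> A) \<and>
     ((\<lambda>x. 0), (\<lambda>x. 0)) \<in> A \<and>
     (\<forall>c. \<forall>(f, g)\<in>A. \<forall>(f', g')\<in>A. ((\<lambda>x. c * f x + f' x), (\<lambda>x. c * g x + g' x)) \<in> A) \<and>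
     (\<forall>(f, g)\<in>A. ae_eq M f (\<lambda>x. 0) \<longrightarrow> ae_eq M g (\<lambda>x. 0))"

definition densely_defined :: "'a measure \<Rightarrow> 'a graph \<Rightarrow> bool" where
  "densely_defined M A \<longleftrightarrow> L2_dense M (fst ` A)"

definition closed_operator :: "'a measure \<Rightarrow> 'a graph \<Rightarrow> bool" where
  "closed_operator M A \<longleftrightarrow>
     linear_operator M A \<and>
     (\<forall>fs gs. \<forall>f\<in>L2_space M. \<forall>g\<in>L2_space M.
        (\<forall>n::nat. (fs n, gs n) \<in> A) \<longrightarrow>
        (\<lambda>n. L2_norm M (\<lambda>x. fs n x - f x)) \<longlonglongrightarrow> 0 \<longrightarrow>
        (\<lambda>n. L2_norm M (\<lambda>x. gs n x - g x)) \<longlonglongrightarrow> 0 \<longrightarrow> (f, g) \<in> A)"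

definition adjoint_op :: "'a measure \<Rightarrow> 'a graph \<Rightarrow> 'a graph" where
  "adjoint_op M A =
     {(u, v). u \<in> L2_space M \<and> v \<in> L2_space M \<and>
        (\<forall>(f, g)\<in>A. L2_inner M g u = L2_inner M f v)}"

definition symmetric_op :: "'a measure \<Rightarrow> 'a graph \<Rightarrow> bool" where
  "symmetric_op M A \<longleftrightarrow> linear_operator M A \<and> densely_defined M A \<and> A \<subseteq> adjoint_op M A"

definition self_adjoint_op :: "'a measure \<Rightarrow> 'a graph \<Rightarrow> bool" where
  "self_adjoint_op M A \<longleftrightarrow> linear_operator M A \<and> densely_defined M A \<and> adjoint_op M A = A"

definition eigenspace :: "'a measure \<Rightarrow> 'a graph \<Rightarrow> complex \<Rightarrow> ('a \<Rightarrow> complex) set" where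
  "eigenspace M A z = {u. \<exists>v. (u, v) \<in> A \<and> ae_eq M v (\<lambda>x. z * u x)}"

definition one_dimensional :: "'a measure \<Rightarrow> ('a \<Rightarrow> complex) set \<Rightarrow> bool" where
  "one_dimensional M V \<longleftrightarrow>
     (\<exists>u\<in>V. \<not> ae_eq M u (\<lambda>x. 0) \<and> (\<forall>v\<in>V. \<exists>c. ae_eq M v (\<lambda>x. c * u x)))"

definition deficiency_indices_one_one :: "'a measure \<Rightarrow> 'a graph \<Rightarrow> bool" where
  "deficiency_indices_one_one M A \<longleftrightarrow>
     one_dimensional M (eigenspace M (adjoint_op M A) \<i>) \<and>
     one_dimensional M (eigenspace M (adjoint_op M A) (- \<i>))"

definition prime_op :: "'a measure \<Rightarrow> 'a graph \<Rightarrow> bool" where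
  "prime_op M A \<longleftrightarrow>
     (\<exists>H. self_adjoint_op M H \<and> A \<subseteq> H \<and>
        L2_dense M (lin_span
          {f. \<exists>g u z. Im z \<noteq> 0 \<and> u \<in> eigenspace M (adjoint_op M A) \<i> \<and>
                (f, g) \<in> H \<and> ae_eq M (\<lambda>x. g x - z * f x) u}))"

definition quasi_hermitian_extension :: "'a measure \<Rightarrow> 'a graph \<Rightarrow> 'a graph \<Rightarrow> bool" where
  "quasi_hermitian_extension M A S \<longleftrightarrow>
     closed_operator M S \<and> A \<subset> S \<and> S \<subset> adjoint_op M A \<and> \<not> self_adjoint_op M S"

definition resolvent_set :: "'a measure \<Rightarrow> 'a graph \<Rightarrow> complex set" where
  "resolvent_set M A =
     {z. (\<forall>(f, g)\<in>A. ae_eq M (\<lambda>x. g x - z * f x) (\<lambda>x. 0) \<longrightarrow> ae_eq M f (\<lambda>x. 0)) \<and>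
         (\<forall>h\<in>L2_space M. \<exists>(f, g)\<in>A. ae_eq M (\<lambda>x. g x - z * f x) h) \<and>
         (\<exists>C. \<forall>(f, g)\<in>A. L2_norm M f \<le> C * L2_norm M (\<lambda>x. g x - z * f x))}"

definition spectrum :: "'a measure \<Rightarrow> 'a graph \<Rightarrow> complex set" where
  "spectrum M A = - resolvent_set M A"

definition unitary_map ::
    "'a measure \<Rightarrow> 'b measure \<Rightarrow> (('a \<Rightarrow> complex) \<Rightarrow> ('b \<Rightarrow> complex)) \<Rightarrow> bool" where
  "unitary_map M N U \<longleftrightarrow>
     (\<forall>f\<in>L2_space M. U f \<in> L2_space N) \<and>
     (\<forall>c. \<forall>f\<in>L2_space M. \<forall>g\<in>L2_space M.
        ae_eq N (U (\<lambda>x. c * f x + g x)) (\<lambda>x. c * U f x + U g x)) \<and>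
     (\<forall>f\<in>L2_space M. \<forall>g\<in>L2_space M. L2_inner N (U f) (U g) = L2_inner M f g) \<and>
     (\<forall>h\<in>L2_space N. \<exists>f\<in>L2_space M. ae_eq N (U f) h)"

definition unitarily_equivalent ::
    "'a measure \<Rightarrow> 'a graph \<Rightarrow> 'b measure \<Rightarrow> 'b graph \<Rightarrow> bool" where
  "unitarily_equivalent M A N B \<longleftrightarrow>
     (\<exists>U. unitary_map M N U \<and>
        (\<forall>f\<in>L2_space M. \<forall>g\<in>L2_space M. (f, g) \<in> A \<longleftrightarrow> (U f, U g) \<in> B))"

section \<open>The multiplication operator and its symmetric restriction\<close>

definition mult_op :: "real measure \<Rightarrow> real graph" where
  "mult_op \<omega> =
     {(f, g). f \<in> L2_space (density \<omega> (\<lambda>x. ennreal (1 + x\<^sup>2))) \<and> g \<in> L2_space \<omega> \<and>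
        ae_eq \<omega> g (\<lambda>x. complex_of_real x * f x)}"

text \<open>
  For the measures considered here, every function in the domain of the multiplication operator
  is integrable (Cauchy--Schwarz), so the default value of the Bochner integral plays no role.
\<close>

definition mult_op_restr :: "real measure \<Rightarrow> real graph" where
  "mult_op_restr \<omega> = {(f, g) \<in> mult_op \<omega>. (\<integral>x. f x \<partial>\<omega>) = 0}"

section \<open>The differentiation operator\<close>

definition abs_continuous_on :: "real \<Rightarrow> real \<Rightarrow> (real \<Rightarrow> complex) \<Rightarrow> bool" where
  "abs_continuous_on c d f \<longleftrightarrow>
     (\<forall>\<epsilon>>0. \<exists>\<delta>>0. \<forall>D. finite D \<longrightarrow>
        (\<forall>(s, t)\<in>D. c \<le> s \<and> s \<le> t \<and> t \<le> d) \<longrightarrow>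
        pairwise (\<lambda>(s, t) (s', t'). {s<..<t} \<inter> {s'<..<t'} = {}) D \<longrightarrow>
        (\<Sum>(s, t)\<in>D. t - s) < \<delta> \<longrightarrow> (\<Sum>(s, t)\<in>D. cmod (f t - f s)) < \<epsilon>)"

text \<open>
  In the pair \<open>(f, h)\<close>, \<open>f\<close> has the absolutely continuous representative \<open>g\<close> and \<open>h\<close>
  represents \<open>-i g'\<close>.
\<close>

definition diff_op :: "real \<Rightarrow> complex \<Rightarrow> real graph" where
  "diff_op a \<rho> =
     (let M = lebesgue_on {0..2 * a} in
      {(f, h). f \<in> L2_space M \<and> h \<in> L2_space M \<and>
         (\<exists>g. ae_eq M f g \<and> abs_continuous_on 0 (2 * a) g \<and>
              Lim (at_right 0) g = \<rho> * Lim (at_left (2 * a)) g \<and>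
              (AE x in M. \<exists>g'. (g has_vector_derivative g') (at x) \<and> h x = - \<i> * g'))})"

section \<open>The Weyl function and the parameters of the measure\<close>

definition coth :: "real \<Rightarrow> real" where
  "coth a = cosh a / sinh a"

definition weyl_function :: "real measure \<Rightarrow> complex \<Rightarrow> complex" where
  "weyl_function \<omega> z =
     (\<integral>x. inverse (complex_of_real x - z) - complex_of_real (x * inverse (1 + x\<^sup>2)) \<partial>\<omega>)"

definition weyl_representation :: "real measure \<Rightarrow> real \<Rightarrow> real \<Rightarrow> bool" where
  "weyl_representation \<omega> a \<alpha> \<longleftrightarrow>
     (\<forall>z. Im z \<noteq> 0 \<longrightarrow>
        weyl_function \<omega> z =
          (of_real (sin \<alpha>) - of_real (cos \<alpha>) * (cot (of_real a * z) / of_real (coth a))) /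
          (of_real (cos \<alpha>) + of_real (sin \<alpha>) * (cot (of_real a * z) / of_real (coth a))))"

text \<open>
  The case distinction inserts the limit of the general formula as \<open>\<alpha>\<close> tends to \<open>0\<close>
  from the right.
\<close>

definition point_mass :: "real \<Rightarrow> real \<Rightarrow> real" where
  "point_mass a \<alpha> =
     (if \<alpha> = 0 then tanh a / a
      else coth a * (1 + (cot \<alpha>)\<^sup>2) / (a * (1 + (cot \<alpha>)\<^sup>2 * (coth a)\<^sup>2)))"

text \<open>
  For \<open>\<alpha> > 0\<close> the value \<open>\<beta> = 0\<close> has to be excluded explicitly: the cotangent is undefined
  there, whereas the library function satisfies \<open>cot 0 = 0\<close>.
\<close>

definition phase_angle :: "real \<Rightarrow> real \<Rightarrow> real \<Rightarrow> bool" where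
  "phase_angle a \<alpha> \<beta> \<longleftrightarrow>
     (if \<alpha> = 0 then \<beta> = 0 else 0 < \<beta> \<and> \<beta> < pi \<and> cot \<beta> + cot \<alpha> * coth a = 0)"

end

theory Submission
  imports Defs "HOL-Complex_Analysis.Complex_Analysis"
begin

text \<open>
  Write M for the Weyl function of \<omega>. An element (u, v) of the adjoint of the restricted
  multiplication operator satisfies v = x u - c for a constant c, called \<open>jump\<close>; its
  regularised integral of u is called \<open>trace\<close>. The boundary form of the adjoint is
  expressed by these two numbers (\<open>Green_identity\<close>), so the closed extensions
  strictly between the restriction and its adjoint are multiplication by x, which is jump = 0, and
  the operators \<open>ext w\<close>, which are trace = w * jump; \<open>ext w\<close> is
  self-adjoint precisely for real w (\<open>quasi_hermitian_extension_is_ext\<close>). The kernel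
  1 / (x - z) has jump 1 and trace M(z), and pairing a solution of (S - z) u = h with it gives
  jump * (w - M(z)) = \<integral> h / (x - z) d\<omega> (\<open>trace_resolvent\<close>). Away
  from the support of \<omega>, then, z lies in the resolvent set of \<open>ext w\<close> as soon
  as M(z) differs from w.

  If the spectrum of \<open>ext w\<close> is empty, the jump of the resolvent applied to a fixed
  kernel is an entire function of z, and 1 / (w - M) extends to an entire function
  (\<open>empty_spectrum_entire\<close>). Hence F = (cnj w - M) / (w - M) is entire with F(z) cnj
  (F (cnj z)) = 1, and, after exchanging w and cnj w if necessary, |F| is at least 1 in the upper
  half-plane because M maps that half-plane to itself. Such an F is a unimodular constant times
  exp(-i b z) with b >= 0 (\<open>entire_half_plane_exponential\<close>). With b = 2a this makes M
  a Moebius transform of exp(-2 i a z), and the normalisation M(i) = i, M(-i) = -i leaves the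
  angle \<alpha> as the only parameter (\<open>empty_spectrum_imp_weyl_representation\<close>).

  Conversely, let M be given by the cotangent formula. Its denominator is a multiple of sin(a z -
  \<beta>). Where this does not vanish on the real axis, M extends analytically with real values,
  and Im M(x + i y) = O(y) forces \<omega> to vanish locally
  (\<open>null_interval_of_bounded_slope\<close>); at each zero the limit of y Im M(x + i y) gives
  an atom, and all atoms have the same mass (\<open>mass_at_zero\<close>). Let w be the limit of
  M(z) as Im z tends to +\<infinity>. It has positive imaginary part and is not attained by M,
  because cos(a z) + i sin(a z) = exp(i a z) has no zeros; at an atom, where M has a pole, the
  resolvent of \<open>ext w\<close> still exists (\<open>resolvent_atom\<close>). So \<open>ext
  w\<close> is a quasi-hermitian extension with empty spectrum.

  For the unitary equivalence, the point masses at the nodes (\<beta> + \<pi> n) / a correspond to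
  the exponentials exp(i x (\<beta> + \<pi> n) / a) on [0, 2a]: after normalisation both are total
  families with the same Gram matrix. Under this correspondence the values f(node n) become
  Fourier coefficients, and multiplication by x becomes multiplication of the coefficients by the
  nodes. That this is the differentiation operator with g(0) = \<rho> g(2a)
  (\<open>diff_op_iff\<close>) rests on the fundamental theorem of calculus for absolutely
  continuous functions and on Lebesgue's differentiation theorem. Totality of the exponentials and
  primeness of the restriction both come from \<open>cyclic_vector_dense\<close>.
\<close>

section \<open>Square-integrable functions and the Riesz-Fischer theorem\<close>

lemma L2_spaceI: "f \<in> borel_measurable M \<Longrightarrow> integrable M (\<lambda>x. (cmod (f x))\<^sup>2) \<Longrightarrow> f \<in> L2_space M"
  by (simp add: L2_space_def)

lemma L2_measurable [measurable_dest]: "f \<in> L2_space M \<Longrightarrow> f \<in> borel_measurable M"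
  by (simp add: L2_space_def)

lemma L2_integrable_square: "f \<in> L2_space M \<Longrightarrow> integrable M (\<lambda>x. (cmod (f x))\<^sup>2)"
  by (simp add: L2_space_def)

lemma L2_zero [simp]: "(\<lambda>x. 0) \<in> L2_space M"
  by (simp add: L2_space_def)

lemma L2_dominated:
  assumes "g \<in> L2_space M" "f \<in> borel_measurable M" "AE x in M. cmod (f x) \<le> cmod (g x)"
  shows "f \<in> L2_space M"
proof (rule L2_spaceI)
  show "integrable M (\<lambda>x. (cmod (f x))\<^sup>2)"
    by (rule Bochner_Integration.integrable_bound[OF L2_integrable_square[OF assms(1)]])
       (use assms in \<open>auto intro!: power_mono elim!: eventually_mono\<close>)
qed fact

lemma L2_cong_AE: "f \<in> L2_space M \<Longrightarrow> g \<in> borel_measurable M \<Longrightarrow> ae_eq M f g \<Longrightarrow> g \<in> L2_space M"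
  unfolding ae_eq_def by (rule L2_dominated) (auto elim!: eventually_mono)

lemma L2_scale [simp]: "f \<in> L2_space M \<Longrightarrow> (\<lambda>x. c * f x) \<in> L2_space M"
  by (auto simp: L2_space_def norm_mult power_mult_distrib)

lemma cmod_add_square_le: "(cmod (a + b))\<^sup>2 \<le> 2 * (cmod a)\<^sup>2 + 2 * (cmod b)\<^sup>2"
proof -
  have "(cmod (a + b))\<^sup>2 \<le> (cmod a + cmod b)\<^sup>2"
    by (intro power_mono norm_triangle_ineq) auto
  also have "\<dots> \<le> 2 * (cmod a)\<^sup>2 + 2 * (cmod b)\<^sup>2"
    using sum_squares_bound[of "cmod a" "cmod b"] by (simp add: power2_sum)
  finally show ?thesis .
qed

lemma L2_add [simp]:
  assumes f: "f \<in> L2_space M" and g: "g \<in> L2_space M"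
  shows "(\<lambda>x. f x + g x) \<in> L2_space M"
proof (rule L2_spaceI)
  have "integrable M (\<lambda>x. 2 * (cmod (f x))\<^sup>2 + 2 * (cmod (g x))\<^sup>2)"
    using assms by (intro Bochner_Integration.integrable_add integrable_mult_right L2_integrable_square)
  then show "integrable M (\<lambda>x. (cmod (f x + g x))\<^sup>2)"
    by (rule Bochner_Integration.integrable_bound) (use assms cmod_add_square_le in \<open>auto simp: L2_measurable\<close>)
qed (use assms in \<open>simp add: L2_measurable\<close>)

lemma L2_uminus [simp]: "f \<in> L2_space M \<Longrightarrow> (\<lambda>x. - f x) \<in> L2_space M"
  using L2_scale[of f M "-1"] by simp

lemma L2_diff [simp]: "f \<in> L2_space M \<Longrightarrow> g \<in> L2_space M \<Longrightarrow> (\<lambda>x. f x - g x) \<in> L2_space M"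
  using L2_add[of f M "\<lambda>x. - g x"] by simp

lemma L2_sum: "(\<And>i. i \<in> I \<Longrightarrow> f i \<in> L2_space M) \<Longrightarrow> (\<lambda>x. \<Sum>i\<in>I. f i x) \<in> L2_space M"
  by (induction I rule: infinite_finite_induct) auto

lemma L2_cnj [simp]: "f \<in> L2_space M \<Longrightarrow> (\<lambda>x. cnj (f x)) \<in> L2_space M"
  unfolding L2_space_def
  by (auto intro: measurable_compose[OF _ borel_measurable_continuous_onI[of cnj]] continuous_intros)

lemma L2_mult_bounded:
  assumes "f \<in> L2_space M" "g \<in> borel_measurable M" "\<And>x. cmod (g x) \<le> C"
  shows "(\<lambda>x. g x * f x) \<in> L2_space M"
proof (rule L2_dominated)
  show "(\<lambda>x. of_real C * f x) \<in> L2_space M" using assms by simp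
  have "C \<ge> 0" using assms(3) norm_ge_zero order_trans by blast
  then show "AE x in M. cmod (g x * f x) \<le> cmod (of_real C * f x)"
    using assms by (auto simp: norm_mult intro!: mult_right_mono)
qed (use assms in \<open>simp add: L2_measurable\<close>)

lemma L2_mult_integrable [simp]:
  assumes "f \<in> L2_space M" "g \<in> L2_space M"
  shows "integrable M (\<lambda>x. f x * g x)"
proof -
  have "integrable M (\<lambda>x. (cmod (f x))\<^sup>2 + (cmod (g x))\<^sup>2)"
    using assms by (intro Bochner_Integration.integrable_add L2_integrable_square)
  then show ?thesis
  proof (rule Bochner_Integration.integrable_bound)
    have "cmod (f x) * cmod (g x) \<le> (cmod (f x))\<^sup>2 + (cmod (g x))\<^sup>2" for x
    proof -
      have "0 \<le> cmod (f x) * cmod (g x)" by simp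
      then show ?thesis using sum_squares_bound[of "cmod (f x)" "cmod (g x)"] by linarith
    qed
    then show "AE x in M. cmod (f x * g x) \<le> norm ((cmod (f x))\<^sup>2 + (cmod (g x))\<^sup>2)"
      by (auto simp: norm_mult)
  qed (use assms in \<open>simp add: L2_measurable\<close>)
qed

lemma L2_inner_integrable [simp]:
  "f \<in> L2_space M \<Longrightarrow> g \<in> L2_space M \<Longrightarrow> integrable M (\<lambda>x. f x * cnj (g x))"
  using L2_mult_integrable L2_cnj by blast

lemma L2_norm_nonneg [simp]: "0 \<le> L2_norm M f"
  by (simp add: L2_norm_def)

lemma L2_norm_square: "(L2_norm M f)\<^sup>2 = (\<integral>x. (cmod (f x))\<^sup>2 \<partial>M)"
  by (simp add: L2_norm_def)

lemma L2_inner_self: "L2_inner M f f = of_real ((L2_norm M f)\<^sup>2)"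
  unfolding L2_norm_square L2_inner_def
  by (subst integral_complex_of_real[symmetric]) (simp only: complex_norm_square[symmetric])

lemma L2_norm_cong_AE:
  assumes "f \<in> borel_measurable M" "g \<in> borel_measurable M" "AE x in M. f x = g x"
  shows "L2_norm M f = L2_norm M g"
  unfolding L2_norm_def
  by (intro arg_cong[where f = sqrt] integral_cong_AE) (use assms in \<open>auto elim!: eventually_mono\<close>)

lemma L2_norm_zero_iff:
  assumes "f \<in> L2_space M"
  shows "L2_norm M f = 0 \<longleftrightarrow> (AE x in M. f x = 0)"
  unfolding L2_norm_def
  using integral_nonneg_eq_0_iff_AE[OF L2_integrable_square[OF assms]] by simp

lemma L2_norm_scale: "L2_norm M (\<lambda>x. c * f x) = cmod c * L2_norm M f"
  by (simp add: L2_norm_def norm_mult power_mult_distrib real_sqrt_mult)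

lemma L2_norm_minus_commute: "L2_norm M (\<lambda>x. f x - g x) = L2_norm M (\<lambda>x. g x - f x)"
  by (simp add: L2_norm_def norm_minus_commute)

lemma L2_norm_mono:
  assumes "g \<in> L2_space M" "f \<in> borel_measurable M" "AE x in M. cmod (f x) \<le> cmod (g x)"
  shows "L2_norm M f \<le> L2_norm M g"
  unfolding L2_norm_def
  by (intro real_sqrt_le_mono integral_mono_AE L2_integrable_square L2_dominated[OF assms] assms)
     (use assms in \<open>auto elim!: eventually_mono intro: power_mono\<close>)

lemma L2_norm_nn_integral:
  assumes "f \<in> L2_space M"
  shows "(\<integral>\<^sup>+x. ennreal ((cmod (f x))\<^sup>2) \<partial>M) = ennreal ((L2_norm M f)\<^sup>2)"
  unfolding L2_norm_square
  by (rule nn_integral_eq_integral[OF L2_integrable_square[OF assms]]) auto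

lemma L2_Cauchy_Schwarz_abs:
  assumes f: "f \<in> L2_space M" and g: "g \<in> L2_space M"
  shows "(\<integral>x. cmod (f x) * cmod (g x) \<partial>M) \<le> L2_norm M f * L2_norm M g"
proof -
  have i: "integrable M (\<lambda>x. cmod (f x) * cmod (g x))"
    using integrable_norm[OF L2_mult_integrable[OF f g]] by (simp add: norm_mult)
  have "(ennreal (\<integral>x. cmod (f x) * cmod (g x) \<partial>M))\<^sup>2 =
      (\<integral>\<^sup>+x. ennreal (cmod (f x)) * ennreal (cmod (g x)) \<partial>M)\<^sup>2"
    by (subst nn_integral_eq_integral[OF i, symmetric]) (auto simp: ennreal_mult)
  also have "\<dots> \<le> (\<integral>\<^sup>+x. (ennreal (cmod (f x)))\<^sup>2 \<partial>M) * (\<integral>\<^sup>+x. (ennreal (cmod (g x)))\<^sup>2 \<partial>M)"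
    by (rule Cauchy_Schwarz_nn_integral) (use assms in \<open>auto simp: L2_measurable\<close>)
  also have "\<dots> = ennreal ((L2_norm M f)\<^sup>2) * ennreal ((L2_norm M g)\<^sup>2)"
    by (simp add: ennreal_power L2_norm_nn_integral[OF f] L2_norm_nn_integral[OF g])
  also have "\<dots> = (ennreal (L2_norm M f * L2_norm M g))\<^sup>2"
    by (simp add: ennreal_mult'' power_mult_distrib ennreal_power)
  finally have "(\<integral>x. cmod (f x) * cmod (g x) \<partial>M)\<^sup>2 \<le> (L2_norm M f * L2_norm M g)\<^sup>2"
    by (simp add: ennreal_power integral_nonneg_AE)
  then show ?thesis by (rule power2_le_imp_le) simp
qed

lemma L2_Cauchy_Schwarz:
  assumes f: "f \<in> L2_space M" and g: "g \<in> L2_space M"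
  shows "cmod (\<integral>x. f x * g x \<partial>M) \<le> L2_norm M f * L2_norm M g"
  using integral_norm_bound[of M "\<lambda>x. f x * g x"] L2_Cauchy_Schwarz_abs[OF f g]
  by (simp add: norm_mult)

lemma L2_norm_cnj [simp]: "L2_norm M (\<lambda>x. cnj (f x)) = L2_norm M f"
  by (simp add: L2_norm_def)

lemma L2_inner_bound:
  assumes "f \<in> L2_space M" "g \<in> L2_space M"
  shows "cmod (L2_inner M f g) \<le> L2_norm M f * L2_norm M g"
  using L2_Cauchy_Schwarz[OF assms(1) L2_cnj[OF assms(2)]] by (simp add: L2_inner_def)

lemma L2_norm_triangle:
  assumes f: "f \<in> L2_space M" and g: "g \<in> L2_space M"
  shows "L2_norm M (\<lambda>x. f x + g x) \<le> L2_norm M f + L2_norm M g"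
proof (rule power2_le_imp_le)
  have i: "integrable M (\<lambda>x. cmod (f x) * cmod (g x))"
    using integrable_norm[OF L2_mult_integrable[OF f g]] by (simp add: norm_mult)
  note ii = L2_integrable_square[OF f] L2_integrable_square[OF g]
  have "(L2_norm M (\<lambda>x. f x + g x))\<^sup>2 \<le>
     (\<integral>x. ((cmod (f x))\<^sup>2 + (cmod (g x))\<^sup>2) + 2 * (cmod (f x) * cmod (g x)) \<partial>M)"
    unfolding L2_norm_square
  proof (rule integral_mono)
    show "integrable M (\<lambda>x. (cmod (f x + g x))\<^sup>2)"
      using f g by (intro L2_integrable_square L2_add)
    show "(cmod (f x + g x))\<^sup>2 \<le> ((cmod (f x))\<^sup>2 + (cmod (g x))\<^sup>2) + 2 * (cmod (f x) * cmod (g x))" for x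
      using power_mono[OF norm_triangle_ineq[of "f x" "g x"], of 2] by (simp add: power2_sum)
  qed (use i ii in auto)
  also have "\<dots> = (L2_norm M f)\<^sup>2 + (L2_norm M g)\<^sup>2 + 2 * (\<integral>x. cmod (f x) * cmod (g x) \<partial>M)"
    using i ii by (simp add: L2_norm_square)
  also have "\<dots> \<le> (L2_norm M f + L2_norm M g)\<^sup>2"
    using L2_Cauchy_Schwarz_abs[OF f g] by (simp add: power2_sum)
  finally show "(L2_norm M (\<lambda>x. f x + g x))\<^sup>2 \<le> (L2_norm M f + L2_norm M g)\<^sup>2" .
qed simp

lemma L2_norm_triangle_diff:
  assumes "f \<in> L2_space M" "g \<in> L2_space M" "h \<in> L2_space M"
  shows "L2_norm M (\<lambda>x. f x - h x) \<le> L2_norm M (\<lambda>x. f x - g x) + L2_norm M (\<lambda>x. g x - h x)"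
  using L2_norm_triangle[of "\<lambda>x. f x - g x" M "\<lambda>x. g x - h x"] assms by simp

lemma L2_inner_tendsto:
  assumes "\<And>n::nat. F n \<in> L2_space M" "f \<in> L2_space M" "g \<in> L2_space M"
    and lim: "(\<lambda>n. L2_norm M (\<lambda>x. F n x - f x)) \<longlonglongrightarrow> 0"
  shows "(\<lambda>n. L2_inner M (F n) g) \<longlonglongrightarrow> L2_inner M f g"
proof (rule Lim_null[THEN iffD2], rule Lim_null_comparison)
  show "\<forall>\<^sub>F n in sequentially. cmod (L2_inner M (F n) g - L2_inner M f g) \<le>
      L2_norm M (\<lambda>x. F n x - f x) * L2_norm M g"
  proof (rule always_eventually, rule allI)
    fix n
    have "L2_inner M (F n) g - L2_inner M f g = L2_inner M (\<lambda>x. F n x - f x) g"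
      unfolding L2_inner_def using assms
      by (simp add: left_diff_distrib Bochner_Integration.integral_diff)
    then show "cmod (L2_inner M (F n) g - L2_inner M f g) \<le> L2_norm M (\<lambda>x. F n x - f x) * L2_norm M g"
      using L2_inner_bound[of "\<lambda>x. F n x - f x" M g] assms by simp
  qed
  show "(\<lambda>n. L2_norm M (\<lambda>x. F n x - f x) * L2_norm M g) \<longlonglongrightarrow> 0"
    using tendsto_mult_right[OF lim, of "L2_norm M g"] by simp
qed

lemma L2_inner_cnj: "cnj (L2_inner M f g) = L2_inner M g f"
  unfolding L2_inner_def
  by (simp flip: Bochner_Integration.integral_cnj add: mult.commute)

text \<open>
  A subsequence with squared increments below 8^-k has almost everywhere geometrically decreasing
  increments, hence a pointwise limit; Fatou's lemma turns the Cauchy estimate into convergence in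
  norm of the whole sequence.
\<close>
theorem L2_complete:
  assumes F: "\<And>n::nat. F n \<in> L2_space M"
    and cauchy: "\<And>e. e > 0 \<Longrightarrow> \<exists>N. \<forall>m\<ge>N. \<forall>n\<ge>N. L2_norm M (\<lambda>x. F m x - F n x) < e"
  shows "\<exists>f\<in>L2_space M. (\<lambda>n. L2_norm M (\<lambda>x. F n x - f x)) \<longlonglongrightarrow> 0"
proof -
  have [measurable]: "F n \<in> borel_measurable M" for n
    using F by (rule L2_measurable)
  have "\<exists>N. \<forall>m\<ge>N. \<forall>n\<ge>N. L2_norm M (\<lambda>x. F m x - F n x) < sqrt ((1/8) ^ k)" for k
    by (rule cauchy) simp
  then obtain N where N: "\<And>k m n. m \<ge> N k \<Longrightarrow> n \<ge> N k \<Longrightarrow> L2_norm M (\<lambda>x. F m x - F n x) < sqrt ((1/8) ^ k)"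
    by metis
  \<comment> \<open>adding k makes the subsequence of indices unbounded\<close>
  define r where "r k = k + (\<Sum>i\<le>k. N i)" for k
  have rN: "r k \<ge> N k" for k
    unfolding r_def using member_le_sum[of k "{..k}" N] by simp
  have r_ge: "r k \<ge> k" for k by (simp add: r_def)
  have r_mono: "r k \<le> r (Suc k)" for k by (simp add: r_def)
  define d where "d k x = (cmod (F (r (Suc k)) x - F (r k) x))\<^sup>2" for k x
  have [measurable]: "d k \<in> borel_measurable M" for k unfolding d_def by measurable
  have dk: "(\<integral>\<^sup>+x. ennreal (d k x) \<partial>M) \<le> ennreal ((1/8) ^ k)" for k
  proof -
    have "(L2_norm M (\<lambda>x. F (r (Suc k)) x - F (r k) x))\<^sup>2 \<le> (sqrt ((1/8) ^ k))\<^sup>2"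
      using N[of k "r (Suc k)" "r k"] rN[of k] r_mono[of k] by (intro power_mono) auto
    then show ?thesis
      unfolding d_def by (subst L2_norm_nn_integral) (use F in \<open>auto intro!: ennreal_leI\<close>)
  qed
  have "(\<integral>\<^sup>+x. (\<Sum>k. ennreal (4 ^ k * d k x)) \<partial>M) = (\<Sum>k. \<integral>\<^sup>+x. ennreal (4 ^ k * d k x) \<partial>M)"
    by (rule nn_integral_suminf) simp
  also have "\<dots> \<le> (\<Sum>k. ennreal ((1/2) ^ k))"
  proof (rule suminf_le)
    fix k
    have "(\<integral>\<^sup>+x. ennreal (4 ^ k * d k x) \<partial>M) = ennreal (4 ^ k) * (\<integral>\<^sup>+x. ennreal (d k x) \<partial>M)"
      by (subst nn_integral_cmult[symmetric]) (auto simp: ennreal_mult d_def)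
    also have "\<dots> \<le> ennreal (4 ^ k) * ennreal ((1/8) ^ k)"
      by (intro mult_left_mono dk) simp
    also have "\<dots> = ennreal ((1/2) ^ k)"
      by (subst ennreal_mult[symmetric]) (auto simp: power_mult_distrib[symmetric])
    finally show "(\<integral>\<^sup>+x. ennreal (4 ^ k * d k x) \<partial>M) \<le> ennreal ((1/2) ^ k)" .
  qed auto
  also have "\<dots> < \<infinity>"
    by (subst suminf_ennreal2) (auto intro: summable_geometric)
  finally have "AE x in M. (\<Sum>k. ennreal (4 ^ k * d k x)) \<noteq> \<infinity>"
    by (intro nn_integral_noteq_infinite) auto
  then have conv: "AE x in M. convergent (\<lambda>k. F (r k) x)"
  proof eventually_elim
    case (elim x)
    obtain C where C: "(\<Sum>k. ennreal (4 ^ k * d k x)) = ennreal C" "C \<ge> 0"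
      using elim by (cases "(\<Sum>k. ennreal (4 ^ k * d k x))") (auto simp: top_ennreal_def[symmetric])
    have b: "cmod (F (r (Suc k)) x - F (r k) x) \<le> sqrt C * (1/2) ^ k" for k
    proof -
      have "ennreal (4 ^ k * d k x) \<le> ennreal C"
        unfolding C(1)[symmetric] using sum_le_suminf[of "\<lambda>k. ennreal (4 ^ k * d k x)" "{k}"] by simp
      then have "4 ^ k * d k x \<le> C" using C by simp
      then have "(2 ^ k * cmod (F (r (Suc k)) x - F (r k) x))\<^sup>2 \<le> C"
        unfolding d_def power_mult_distrib by (simp add: power_mult[symmetric] mult.commute[of k 2] power_mult)
      then have "2 ^ k * cmod (F (r (Suc k)) x - F (r k) x) \<le> sqrt C"
        by (simp add: real_le_rsqrt)
      then show ?thesis by (simp add: field_simps power_one_over)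
    qed
    have "summable (\<lambda>k. F (r (Suc k)) x - F (r k) x)"
      by (rule summable_comparison_test'[where N=0 and g="\<lambda>k. sqrt C * (1/2) ^ k"])
         (use b in \<open>auto intro!: summable_mult summable_geometric\<close>)
    then have "convergent (\<lambda>n. F (r n) x - F (r 0) x)"
      by (simp add: summable_iff_convergent sum_lessThan_telescope[of "\<lambda>k. F (r k) x"])
    then show ?case
      by (simp add: convergent_diff_const_right_iff)
  qed
  define f where "f x = lim (\<lambda>k. F (r k) x)" for x
  have [measurable]: "f \<in> borel_measurable M"
    unfolding f_def by (rule borel_measurable_lim_metric) measurable
  have lim: "AE x in M. (\<lambda>k. F (r k) x) \<longlonglongrightarrow> f x"
    using conv by eventually_elim (auto simp: f_def convergent_LIMSEQ_iff)
  have fatou: "(\<integral>\<^sup>+x. ennreal ((cmod (F n x - f x))\<^sup>2) \<partial>M) \<le> ennreal (e\<^sup>2)"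
    if e: "e > 0" and n: "\<And>m. m \<ge> n \<Longrightarrow> L2_norm M (\<lambda>x. F n x - F m x) < e" for n e
  proof -
    have "(\<integral>\<^sup>+x. ennreal ((cmod (F n x - f x))\<^sup>2) \<partial>M) =
        (\<integral>\<^sup>+x. liminf (\<lambda>k. ennreal ((cmod (F n x - F (r k) x))\<^sup>2)) \<partial>M)"
    proof (rule nn_integral_cong_AE, use lim in eventually_elim)
      case (elim x)
      then have "(\<lambda>k. ennreal ((cmod (F n x - F (r k) x))\<^sup>2)) \<longlonglongrightarrow> ennreal ((cmod (F n x - f x))\<^sup>2)"
        by (intro tendsto_intros tendsto_ennrealI)
      from lim_imp_Liminf[OF _ this] show ?case by simp
    qed
    also have "\<dots> \<le> liminf (\<lambda>k. \<integral>\<^sup>+x. ennreal ((cmod (F n x - F (r k) x))\<^sup>2) \<partial>M)"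
      by (rule nn_integral_liminf) measurable
    also have "\<dots> \<le> ennreal (e\<^sup>2)"
    proof (rule Liminf_le)
      show "\<forall>\<^sub>F k in sequentially. (\<integral>\<^sup>+x. ennreal ((cmod (F n x - F (r k) x))\<^sup>2) \<partial>M) \<le> ennreal (e\<^sup>2)"
        using eventually_ge_at_top[of n]
      proof eventually_elim
        case (elim k)
        have "L2_norm M (\<lambda>x. F n x - F (r k) x) < e"
          using n[of "r k"] r_ge[of k] elim by simp
        then show ?case
          by (subst L2_norm_nn_integral) (use F e in \<open>auto intro!: ennreal_leI power_mono\<close>)
      qed
    qed simp
    finally show ?thesis .
  qed
  \<comment> \<open>Fatou also shows that the limit differs from F n by a square-integrable function\<close>
  have fat2: "(\<lambda>x. F n x - f x) \<in> L2_space M \<and> L2_norm M (\<lambda>x. F n x - f x) \<le> e"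
    if e: "e > 0" and n: "\<And>m. m \<ge> n \<Longrightarrow> L2_norm M (\<lambda>x. F n x - F m x) < e" for n e
  proof -
    note fa = fatou[OF that]
    have L: "(\<lambda>x. F n x - f x) \<in> L2_space M"
      by (rule L2_spaceI) (use fa in \<open>auto intro!: integrableI_nonneg simp: le_less_trans\<close>)
    then have "(L2_norm M (\<lambda>x. F n x - f x))\<^sup>2 \<le> e\<^sup>2"
      using fa unfolding L2_norm_nn_integral[OF L] by simp
    then show ?thesis using L e by (auto intro: power2_le_imp_le)
  qed
  obtain N1 where N1: "\<forall>m\<ge>N1. \<forall>n\<ge>N1. L2_norm M (\<lambda>x. F m x - F n x) < 1"
    using cauchy[of 1] by auto
  have "(\<lambda>x. F N1 x - f x) \<in> L2_space M" using fat2[of 1 N1] N1 by simp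
  then have "(\<lambda>x. F N1 x - (F N1 x - f x)) \<in> L2_space M" by (rule L2_diff[OF F])
  then have fL: "f \<in> L2_space M" by simp
  moreover have "(\<lambda>n. L2_norm M (\<lambda>x. F n x - f x)) \<longlonglongrightarrow> 0"
  proof (rule LIMSEQ_I)
    fix e :: real assume e: "e > 0"
    obtain N where "\<forall>m\<ge>N. \<forall>n\<ge>N. L2_norm M (\<lambda>x. F m x - F n x) < e / 2"
      using cauchy[of "e/2"] e by auto
    then have "L2_norm M (\<lambda>x. F n x - f x) \<le> e / 2" if "n \<ge> N" for n
      using fat2[of "e/2" n] that e by auto
    then show "\<exists>no. \<forall>n\<ge>no. norm (L2_norm M (\<lambda>x. F n x - f x) - 0) < e"
      using e by (intro exI[of _ N]) (auto intro: le_less_trans[of _ "e/2"])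
  qed
  ultimately show ?thesis by blast
qed

section \<open>Inner products, adjoints and cyclic vectors\<close>

lemma L2_inner_cong_AE:
  assumes "f \<in> L2_space M" "f' \<in> L2_space M" "g \<in> L2_space M" "g' \<in> L2_space M"
    and "ae_eq M f f'" "ae_eq M g g'"
  shows "L2_inner M f g = L2_inner M f' g'"
  unfolding L2_inner_def
proof (rule integral_cong_AE)
  have m: "(\<lambda>x. cnj (h x)) \<in> borel_measurable M" if "h \<in> L2_space M" for h
    using L2_cnj[OF that] by (rule L2_measurable)
  show "(\<lambda>x. f x * cnj (g x)) \<in> borel_measurable M" "(\<lambda>x. f' x * cnj (g' x)) \<in> borel_measurable M"
    using assms m by (auto intro!: borel_measurable_times L2_measurable)
  show "AE x in M. f x * cnj (g x) = f' x * cnj (g' x)"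
    using assms(5,6) unfolding ae_eq_def by eventually_elim simp
qed

lemma L2_inner_linear_left:
  assumes "f \<in> L2_space M" "g \<in> L2_space M" "h \<in> L2_space M"
  shows "L2_inner M (\<lambda>x. c * f x + g x) h = c * L2_inner M f h + L2_inner M g h"
proof -
  have "L2_inner M (\<lambda>x. c * f x + g x) h = (\<integral>x. c * (f x * cnj (h x)) + g x * cnj (h x) \<partial>M)"
    by (simp add: L2_inner_def algebra_simps)
  also have "\<dots> = c * L2_inner M f h + L2_inner M g h"
    unfolding L2_inner_def using assms by (subst Bochner_Integration.integral_add) auto
  finally show ?thesis .
qed

lemma L2_inner_linear_right:
  assumes "f \<in> L2_space M" "g \<in> L2_space M" "h \<in> L2_space M"
  shows "L2_inner M h (\<lambda>x. c * f x + g x) = cnj c * L2_inner M h f + L2_inner M h g"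
proof -
  have "cnj (L2_inner M h (\<lambda>x. c * f x + g x)) = cnj (cnj c * L2_inner M h f + L2_inner M h g)"
    using L2_inner_linear_left[OF assms, of c] by (simp add: L2_inner_cnj)
  then show ?thesis by (simp only: complex_cnj_cancel_iff)
qed

lemma L2_inner_diff_left:
  assumes "f \<in> L2_space M" "g \<in> L2_space M" "h \<in> L2_space M"
  shows "L2_inner M (\<lambda>x. f x - g x) h = L2_inner M f h - L2_inner M g h"
  using L2_inner_linear_left[of g M f h "-1"] assms by (simp add: algebra_simps)

lemma L2_inner_zero_left [simp]: "L2_inner M (\<lambda>x. 0) f = 0"
  and L2_inner_zero_right [simp]: "L2_inner M f (\<lambda>x. 0) = 0"
  by (simp_all add: L2_inner_def)

text \<open>
  Approximating v by f in D gives |v|^2 = <v - f, v> \<le> \<epsilon> |v|.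
\<close>
lemma orthogonal_to_dense_zero:
  assumes dense: "L2_dense M D" and D: "D \<subseteq> L2_space M" and v: "v \<in> L2_space M"
    and orth: "\<And>f. f \<in> D \<Longrightarrow> L2_inner M f v = 0"
  shows "ae_eq M v (\<lambda>x. 0)"
proof -
  have "L2_norm M v \<le> e" if e: "e > 0" for e
  proof -
    obtain f where f: "f \<in> D" "L2_norm M (\<lambda>x. v x - f x) < e"
      using dense v e unfolding L2_dense_def by blast
    have fL: "f \<in> L2_space M" using f D by auto
    have "of_real ((L2_norm M v)\<^sup>2) = L2_inner M (\<lambda>x. v x - f x) v"
      using L2_inner_diff_left[OF v fL v] orth[OF f(1)] by (simp add: L2_inner_self)
    then have "(L2_norm M v)\<^sup>2 \<le> L2_norm M (\<lambda>x. v x - f x) * L2_norm M v"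
      using L2_inner_bound[OF L2_diff[OF v fL] v] by (metis abs_power2 norm_of_real)
    also have "\<dots> \<le> e * L2_norm M v"
      using f by (intro mult_right_mono) auto
    finally show ?thesis
      using e by (cases "L2_norm M v = 0") (auto simp: power2_eq_square dest: mult_right_le_imp_le)
  qed
  then have "L2_norm M v \<le> 0" by (rule field_le_epsilon[of _ 0, simplified])
  then show ?thesis
    using L2_norm_zero_iff[OF v] L2_norm_nonneg[of M v] by (simp add: ae_eq_def)
qed

lemma adjoint_opD:
  assumes "(u, v) \<in> adjoint_op M B"
  shows "u \<in> L2_space M" "v \<in> L2_space M"
    "\<And>f g. (f, g) \<in> B \<Longrightarrow> L2_inner M g u = L2_inner M f v"
  using assms unfolding adjoint_op_def by blast+

lemma adjoint_opI:
  assumes "u \<in> L2_space M" "v \<in> L2_space M"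
    "\<And>f g. (f, g) \<in> B \<Longrightarrow> L2_inner M g u = L2_inner M f v"
  shows "(u, v) \<in> adjoint_op M B"
  using assms unfolding adjoint_op_def by blast

text \<open>
  The defining identities of the adjoint pass to limits in both components; density of the domain
  is what makes the adjoint single-valued.
\<close>
theorem closed_adjoint:
  assumes B: "B \<subseteq> L2_space M \<times> L2_space M" and dense: "densely_defined M B"
  shows "closed_operator M (adjoint_op M B)"
  unfolding closed_operator_def linear_operator_def
proof (intro conjI allI impI ballI)
  have BL: "f \<in> L2_space M" "g \<in> L2_space M" if "(f, g) \<in> B" for f g
    using that B by auto
  show "adjoint_op M B \<subseteq> L2_space M \<times> L2_space M"
    by (auto simp: adjoint_op_def)
  show "(\<lambda>x. 0, \<lambda>x. 0) \<in> adjoint_op M B"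
    by (auto simp: adjoint_op_def)
  fix p assume p: "p \<in> adjoint_op M B"
  obtain u v where p_eq: "p = (u, v)" by (cases p)
  note uv = p_eq adjoint_opD[OF p[unfolded p_eq]]
  show "case p of (f, g) \<Rightarrow> \<forall>f'\<in>L2_space M. \<forall>g'\<in>L2_space M.
          ae_eq M f f' \<longrightarrow> ae_eq M g g' \<longrightarrow> (f', g') \<in> adjoint_op M B"
  proof (unfold uv(1) prod.case, intro ballI impI)
    fix u' v' assume a: "u' \<in> L2_space M" "v' \<in> L2_space M" "ae_eq M u u'" "ae_eq M v v'"
    have r: "ae_eq M f f" for f by (simp add: ae_eq_def)
    have "L2_inner M g u' = L2_inner M f v'" if "(f, g) \<in> B" for f g
      using uv(4)[OF that] L2_inner_cong_AE[OF BL(2)[OF that] BL(2)[OF that] uv(2) a(1) r a(3)]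
        L2_inner_cong_AE[OF BL(1)[OF that] BL(1)[OF that] uv(3) a(2) r a(4)] by simp
    then show "(u', v') \<in> adjoint_op M B" using a by (auto simp: adjoint_op_def)
  qed
  show "case p of (f, g) \<Rightarrow> ae_eq M f (\<lambda>x. 0) \<longrightarrow> ae_eq M g (\<lambda>x. 0)"
  proof (unfold uv(1) prod.case, intro impI)
    assume u0: "ae_eq M u (\<lambda>x. 0)"
    show "ae_eq M v (\<lambda>x. 0)"
    proof (rule orthogonal_to_dense_zero[OF dense[unfolded densely_defined_def] _ uv(3)])
      show "fst ` B \<subseteq> L2_space M" using B by auto
      fix f assume "f \<in> fst ` B"
      then obtain g where fg: "(f, g) \<in> B" by auto
      have "L2_inner M g u = L2_inner M g (\<lambda>x. 0)"
        using BL[OF fg] uv(2) u0 by (intro L2_inner_cong_AE) (auto simp: ae_eq_def)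
      then show "L2_inner M f v = 0" using uv(4)[OF fg] by simp
    qed
  qed
  fix c
  show "case p of (f, g) \<Rightarrow> \<forall>(f', g')\<in>adjoint_op M B.
         (\<lambda>x. c * f x + f' x, \<lambda>x. c * g x + g' x) \<in> adjoint_op M B"
  proof (unfold uv(1) prod.case, intro ballI, clarify)
    fix u' v' assume a: "(u', v') \<in> adjoint_op M B"
    then show "(\<lambda>x. c * u x + u' x, \<lambda>x. c * v x + v' x) \<in> adjoint_op M B"
      using uv BL by (auto simp: adjoint_op_def L2_inner_linear_right)
  qed
next
  fix fs gs f g
  assume fL: "f \<in> L2_space M" and gL: "g \<in> L2_space M" and n: "\<forall>n::nat. (fs n, gs n) \<in> adjoint_op M B"
    and lf: "(\<lambda>n. L2_norm M (\<lambda>x. fs n x - f x)) \<longlonglongrightarrow> 0"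
    and lg: "(\<lambda>n. L2_norm M (\<lambda>x. gs n x - g x)) \<longlonglongrightarrow> 0"
  have "L2_inner M k f = L2_inner M h g" if hk: "(h, k) \<in> B" for h k
  proof -
    have hkL: "h \<in> L2_space M" "k \<in> L2_space M" using hk B by auto
    have "(\<lambda>n. L2_inner M (fs n) k) \<longlonglongrightarrow> L2_inner M f k"
      using n by (intro L2_inner_tendsto[OF _ fL hkL(2) lf]) (auto simp: adjoint_op_def)
    moreover have "(\<lambda>n. L2_inner M (gs n) h) \<longlonglongrightarrow> L2_inner M g h"
      using n by (intro L2_inner_tendsto[OF _ gL hkL(1) lg]) (auto simp: adjoint_op_def)
    moreover have "L2_inner M (fs m) k = L2_inner M (gs m) h" for m
    proof -
      have "L2_inner M k (fs m) = L2_inner M h (gs m)"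
        using n hk unfolding adjoint_op_def by blast
      then have "cnj (L2_inner M k (fs m)) = cnj (L2_inner M h (gs m))" by simp
      then show ?thesis unfolding L2_inner_cnj .
    qed
    ultimately have "L2_inner M f k = L2_inner M g h"
      by (simp add: LIMSEQ_unique)
    then have "cnj (L2_inner M f k) = cnj (L2_inner M g h)" by simp
    then show ?thesis unfolding L2_inner_cnj .
  qed
  then show "(f, g) \<in> adjoint_op M B" using fL gL by (auto simp: adjoint_op_def)
qed

lemma L2_dominated_convergence:
  assumes g: "g \<in> L2_space M" and F [measurable]: "\<And>n::nat. F n \<in> borel_measurable M"
    and f [measurable]: "f \<in> borel_measurable M"
    and bound: "\<And>n. AE x in M. cmod (F n x) \<le> cmod (g x)"
    and lim: "AE x in M. (\<lambda>n. F n x) \<longlonglongrightarrow> f x"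
  shows "f \<in> L2_space M" "(\<lambda>n. L2_norm M (\<lambda>x. F n x - f x)) \<longlonglongrightarrow> 0"
proof -
  have "AE x in M. \<forall>n. cmod (F n x) \<le> cmod (g x)"
    using bound by (simp add: AE_all_countable)
  then have fb: "AE x in M. cmod (f x) \<le> cmod (g x)"
    using lim
  proof eventually_elim
    case (elim x)
    show ?case
      by (rule tendsto_upperbound[OF tendsto_norm[OF elim(2)]]) (use elim in auto)
  qed
  then show "f \<in> L2_space M" by (intro L2_dominated[OF g]) auto
  have "(\<lambda>n. \<integral>x. (cmod (F n x - f x))\<^sup>2 \<partial>M) \<longlonglongrightarrow> (\<integral>x. 0 \<partial>M)"
  proof (rule integral_dominated_convergence[where w = "\<lambda>x. 4 * (cmod (g x))\<^sup>2"])
    show "integrable M (\<lambda>x. 4 * (cmod (g x))\<^sup>2)" using L2_integrable_square[OF g] by simp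
    show "AE x in M. (\<lambda>n. (cmod (F n x - f x))\<^sup>2) \<longlonglongrightarrow> 0"
      using lim
    proof eventually_elim
      case (elim x)
      have "(\<lambda>n. (cmod (F n x - f x))\<^sup>2) \<longlonglongrightarrow> (cmod (f x - f x))\<^sup>2"
        by (intro tendsto_intros elim)
      then show ?case by simp
    qed
    fix n
    show "AE x in M. norm ((cmod (F n x - f x))\<^sup>2) \<le> 4 * (cmod (g x))\<^sup>2"
      using bound[of n] fb
    proof eventually_elim
      case (elim x)
      have "cmod (F n x - f x) \<le> 2 * cmod (g x)"
        using norm_triangle_ineq4[of "F n x" "f x"] elim by linarith
      from power_mono[OF this, of 2] show ?case by simp
    qed
  qed auto
  then have "(\<lambda>n. sqrt (\<integral>x. (cmod (F n x - f x))\<^sup>2 \<partial>M)) \<longlonglongrightarrow> sqrt (\<integral>x. 0 \<partial>M)"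
    by (rule tendsto_real_sqrt)
  then show "(\<lambda>n. L2_norm M (\<lambda>x. F n x - f x)) \<longlonglongrightarrow> 0"
    by (simp add: L2_norm_def)
qed

text \<open>
  Being closed under limits in norm, such a set is automatically saturated under almost everywhere
  equality (\<open>closed_subspace_ae\<close>).
\<close>
definition closed_subspace :: "'a measure \<Rightarrow> ('a \<Rightarrow> complex) set \<Rightarrow> bool" where
  "closed_subspace M V \<longleftrightarrow> V \<subseteq> L2_space M \<and> (\<lambda>x. 0) \<in> V \<and>
     (\<forall>c. \<forall>f\<in>V. \<forall>g\<in>V. (\<lambda>x. c * f x + g x) \<in> V) \<and>
     (\<forall>f\<in>L2_space M. (\<forall>\<epsilon>>0. \<exists>g\<in>V. L2_norm M (\<lambda>x. f x - g x) < \<epsilon>) \<longrightarrow> f \<in> V)"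

lemma closed_subspace_limit:
  assumes V: "closed_subspace M V" and F: "\<And>n::nat. F n \<in> V" and f: "f \<in> L2_space M"
    and lim: "(\<lambda>n. L2_norm M (\<lambda>x. F n x - f x)) \<longlonglongrightarrow> 0"
  shows "f \<in> V"
proof -
  have "\<exists>g\<in>V. L2_norm M (\<lambda>x. f x - g x) < \<epsilon>" if "\<epsilon> > 0" for \<epsilon>
  proof -
    have "\<forall>\<^sub>F n in sequentially. L2_norm M (\<lambda>x. F n x - f x) < \<epsilon>"
      using lim that by (rule order_tendstoD)
    then obtain n where "L2_norm M (\<lambda>x. F n x - f x) < \<epsilon>"
      by (auto dest: eventually_happens)
    then show ?thesis using F[of n] by (auto simp: L2_norm_minus_commute)
  qed
  then show ?thesis using V f by (auto simp: closed_subspace_def)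
qed

lemma closed_subspace_zero: "closed_subspace M V \<Longrightarrow> (\<lambda>x. 0) \<in> V"
  by (simp add: closed_subspace_def)

lemma closed_subspace_linear:
  "closed_subspace M V \<Longrightarrow> f \<in> V \<Longrightarrow> g \<in> V \<Longrightarrow> (\<lambda>x. c * f x + g x) \<in> V"
  by (simp add: closed_subspace_def)

lemma closed_subspace_scale: "closed_subspace M V \<Longrightarrow> f \<in> V \<Longrightarrow> (\<lambda>x. c * f x) \<in> V"
  using closed_subspace_linear[of M V f "\<lambda>x. 0" c] by (simp add: closed_subspace_zero)

lemma closed_subspace_add: "closed_subspace M V \<Longrightarrow> f \<in> V \<Longrightarrow> g \<in> V \<Longrightarrow> (\<lambda>x. f x + g x) \<in> V"
  using closed_subspace_linear[of M V f g 1] by simp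

lemma closed_subspace_sum:
  "closed_subspace M V \<Longrightarrow> (\<And>i. i \<in> I \<Longrightarrow> f i \<in> V) \<Longrightarrow> (\<lambda>x. \<Sum>i\<in>I. f i x) \<in> V"
proof (induction I rule: infinite_finite_induct)
  case (insert i I) then show ?case by (auto intro!: closed_subspace_add)
qed (auto simp: closed_subspace_def)

lemma closed_subspace_closure:
  assumes W: "W \<subseteq> L2_space M" "(\<lambda>x. 0) \<in> W" "\<And>c f g. f \<in> W \<Longrightarrow> g \<in> W \<Longrightarrow> (\<lambda>x. c * f x + g x) \<in> W"
  shows "closed_subspace M {f \<in> L2_space M. \<forall>\<epsilon>>0. \<exists>g\<in>W. L2_norm M (\<lambda>x. f x - g x) < \<epsilon>}"
    (is "closed_subspace M ?V")
  unfolding closed_subspace_def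
proof (intro conjI allI ballI impI)
  show "?V \<subseteq> L2_space M" by auto
  have n0: "L2_norm M (\<lambda>x. 0) = 0" by (simp add: L2_norm_def)
  show "(\<lambda>x. 0) \<in> ?V"
    using W(2) n0 by (intro CollectI conjI L2_zero allI impI bexI[of _ "\<lambda>x. 0"]) simp_all
  fix c f g assume fg: "f \<in> ?V" "g \<in> ?V"
  have "\<exists>h\<in>W. L2_norm M (\<lambda>x. (c * f x + g x) - h x) < e" if e: "e > 0" for e
  proof -
    have "e / (2 * (cmod c + 1)) > 0" using e by (intro divide_pos_pos) (auto intro: add_nonneg_pos)
    then obtain f' where f': "f' \<in> W" "L2_norm M (\<lambda>x. f x - f' x) < e / (2 * (cmod c + 1))"
      using fg by blast
    obtain g' where g': "g' \<in> W" "L2_norm M (\<lambda>x. g x - g' x) < e / 2"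
      using fg e half_gt_zero[OF e] by blast
    have L: "f \<in> L2_space M" "f' \<in> L2_space M" "g \<in> L2_space M" "g' \<in> L2_space M"
      using fg f' g' W(1) by auto
    have "L2_norm M (\<lambda>x. (c * f x + g x) - (c * f' x + g' x)) =
        L2_norm M (\<lambda>x. c * (f x - f' x) + (g x - g' x))" by (simp add: algebra_simps)
    also have "\<dots> \<le> cmod c * L2_norm M (\<lambda>x. f x - f' x) + L2_norm M (\<lambda>x. g x - g' x)"
      using L2_norm_triangle[OF L2_scale[OF L2_diff[OF L(1,2)]] L2_diff[OF L(3,4)], of c]
      by (simp add: L2_norm_scale)
    also have "cmod c * L2_norm M (\<lambda>x. f x - f' x) \<le> (cmod c + 1) * (e / (2 * (cmod c + 1)))"
      using f'(2) by (intro mult_mono) auto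
    also have "(cmod c + 1) * (e / (2 * (cmod c + 1))) = e / 2"
      by (simp add: field_simps add_nonneg_eq_0_iff)
    finally have "L2_norm M (\<lambda>x. (c * f x + g x) - (c * f' x + g' x)) < e"
      using g'(2) by simp
    then show ?thesis using W(3)[OF f'(1) g'(1), of c] by (intro bexI)
  qed
  then show "(\<lambda>x. c * f x + g x) \<in> ?V" using fg by auto
next
  fix f assume f: "f \<in> L2_space M" and appr: "\<forall>\<epsilon>>0. \<exists>g\<in>?V. L2_norm M (\<lambda>x. f x - g x) < \<epsilon>"
  have "\<exists>h\<in>W. L2_norm M (\<lambda>x. f x - h x) < e" if e: "e > 0" for e
  proof -
    obtain g where g: "g \<in> ?V" "L2_norm M (\<lambda>x. f x - g x) < e / 2" using appr half_gt_zero[OF e] by blast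
    then obtain h where h: "h \<in> W" "L2_norm M (\<lambda>x. g x - h x) < e / 2" using half_gt_zero[OF e] by blast
    have "L2_norm M (\<lambda>x. f x - h x) < e"
      using L2_norm_triangle_diff[of f M g h] f g(1,2) h subsetD[OF W(1) h(1)] by simp
    with h show ?thesis by blast
  qed
  then show "f \<in> ?V" using f by auto
qed

lemma closed_subspace_ae:
  assumes V: "closed_subspace M V" and f: "f \<in> V" and ae: "AE x in M. f x = g x"
    and g [measurable]: "g \<in> borel_measurable M"
  shows "g \<in> V"
proof -
  have fL: "f \<in> L2_space M" using V f by (auto simp: closed_subspace_def)
  have gL: "g \<in> L2_space M" by (rule L2_cong_AE[OF fL g]) (use ae in \<open>simp add: ae_eq_def\<close>)
  have "L2_norm M (\<lambda>x. f x - g x) = 0"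
    using ae by (subst L2_norm_zero_iff[OF L2_diff[OF fL gL]]) (auto elim!: eventually_mono)
  then show ?thesis using closed_subspace_limit[OF V f gL] by simp
qed

text \<open>
  A measure-theoretic form of the spectral theorem for one unitary multiplication operator. A
  closed subspace invariant under \<zeta> and its conjugate is invariant under polynomials in the
  real and imaginary part of \<zeta>, by Stone-Weierstrass on the circle under continuous
  functions of \<zeta>, by monotone class arguments under indicators of sets \<zeta> -` C, and by
  assumption these are all measurable sets. Multiplying the almost everywhere nonzero vector k by
  simple functions approximating h / k then reaches every h.
\<close>
theorem cyclic_vector_dense:
  fixes \<zeta> :: "'a \<Rightarrow> complex"
  assumes V: "closed_subspace M V"
    and \<zeta>: "\<zeta> \<in> borel_measurable M" "\<And>x. cmod (\<zeta> x) = 1"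
    and inv: "\<And>f. f \<in> V \<Longrightarrow> (\<lambda>x. \<zeta> x * f x) \<in> V" "\<And>f. f \<in> V \<Longrightarrow> (\<lambda>x. cnj (\<zeta> x) * f x) \<in> V"
    and gen: "\<And>A. A \<in> sets M \<Longrightarrow> \<exists>C\<in>sets borel. AE x in M. x \<in> A \<longleftrightarrow> \<zeta> x \<in> C"
    and k: "k \<in> V" "AE x in M. k x \<noteq> 0"
  shows "V = L2_space M"
proof -
  note [measurable] = \<zeta>(1)
  have VL: "f \<in> L2_space M" if "f \<in> V" for f using that V by (auto simp: closed_subspace_def)
  have poly: "(\<lambda>x. of_real (p (\<zeta> x)) * f x) \<in> V" if "real_polynomial_function p" "f \<in> V" for p f
    using that
  proof (induction p arbitrary: f rule: real_polynomial_function.induct)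
    case (linear p)
    interpret bounded_linear p by fact
    define u v where "u = p 1" and "v = p \<i>"
    \<comment> \<open>a real-linear functional on the complex plane has the form A z + B cnj z\<close>
    have pz: "p z = Re z * u + Im z * v" for z
    proof -
      have "p z = p (Re z *\<^sub>R 1 + Im z *\<^sub>R \<i>)"
        by (rule arg_cong[where f = p]) (simp add: complex_eq_iff)
      then show ?thesis by (simp add: add scaleR u_def v_def)
    qed
    define A B :: complex where "A = Complex (u / 2) (- v / 2)" and "B = Complex (u / 2) (v / 2)"
    have "of_real (p z) = A * z + B * cnj z" for z
      unfolding pz A_def B_def by (simp add: complex_eq_iff algebra_simps)
    then have "(\<lambda>x. of_real (p (\<zeta> x)) * f x) = (\<lambda>x. A * (\<zeta> x * f x) + B * (cnj (\<zeta> x) * f x))"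
      by (simp add: algebra_simps)
    then show ?case
      using \<open>f \<in> V\<close> by (auto intro!: closed_subspace_add[OF V] closed_subspace_scale[OF V] inv)
  next
    case (const c) then show ?case by (auto intro: closed_subspace_scale[OF V])
  next
    case (add p q)
    then show ?case using closed_subspace_add[OF V, of "\<lambda>x. of_real (p (\<zeta> x)) * f x" "\<lambda>x. of_real (q (\<zeta> x)) * f x"]
      by (simp add: algebra_simps)
  next
    case (mult p q)
    have "(\<lambda>x. of_real (p (\<zeta> x)) * (of_real (q (\<zeta> x)) * f x)) \<in> V"
      using mult by blast
    then show ?case by (simp add: mult.assoc)
  qed
  have cont: "(\<lambda>x. of_real (\<phi> (\<zeta> x)) * f x) \<in> V"
    if \<phi>: "continuous_on UNIV \<phi>" "\<And>z. \<bar>\<phi> z\<bar> \<le> 1" and f: "f \<in> V" for \<phi> f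
  proof -
    have [measurable]: "\<phi> \<in> borel_measurable borel"
      using \<phi>(1) by (rule borel_measurable_continuous_onI)
    have L: "(\<lambda>x. of_real (\<phi> (\<zeta> x)) * f x) \<in> L2_space M"
      by (rule L2_mult_bounded[OF VL[OF f], where C = 1]) (use \<phi> in auto)
    have "\<exists>g\<in>V. L2_norm M (\<lambda>x. of_real (\<phi> (\<zeta> x)) * f x - g x) < e" if e: "e > 0" for e
    proof -
      define d where "d = e / (2 * (L2_norm M f + 1))"
      have d: "d > 0" unfolding d_def using e by (intro divide_pos_pos) (auto intro: add_nonneg_pos)
      have c: "continuous_on (sphere 0 1) \<phi>" using \<phi>(1) by (rule continuous_on_subset) auto
      obtain p where p: "real_polynomial_function p" "\<And>z. z \<in> sphere 0 1 \<Longrightarrow> \<bar>\<phi> z - p z\<bar> < d"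
        using Stone_Weierstrass_real_polynomial_function[OF compact_sphere c d] by blast
      have [measurable]: "p \<in> borel_measurable borel"
        using p(1) by (intro borel_measurable_continuous_onI continuous_on_polymonial_function)
          (simp add: real_polynomial_function_eq)
      have "L2_norm M (\<lambda>x. of_real (\<phi> (\<zeta> x)) * f x - of_real (p (\<zeta> x)) * f x) \<le>
          L2_norm M (\<lambda>x. of_real d * f x)"
      proof (rule L2_norm_mono)
        show "AE x in M. cmod (of_real (\<phi> (\<zeta> x)) * f x - of_real (p (\<zeta> x)) * f x) \<le> cmod (of_real d * f x)"
        proof (rule AE_I2)
          fix x
          have "\<bar>\<phi> (\<zeta> x) - p (\<zeta> x)\<bar> \<le> d" using p(2)[of "\<zeta> x"] \<zeta>(2) by simp
          moreover have "cmod (of_real (\<phi> (\<zeta> x)) * f x - of_real (p (\<zeta> x)) * f x) =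
            \<bar>\<phi> (\<zeta> x) - p (\<zeta> x)\<bar> * cmod (f x)"
            by (simp add: left_diff_distrib[symmetric] norm_mult del: of_real_diff flip: of_real_diff)
          ultimately show "cmod (of_real (\<phi> (\<zeta> x)) * f x - of_real (p (\<zeta> x)) * f x) \<le> cmod (of_real d * f x)"
            using d by (simp add: norm_mult mult_right_mono)
        qed
      qed (use VL[OF f] in \<open>auto simp: L2_measurable\<close>)
      also have "\<dots> = d * L2_norm M f" using d by (simp add: L2_norm_scale)
      also have "\<dots> < d * (2 * (L2_norm M f + 1))"
        using d L2_norm_nonneg[of M f] by (intro mult_strict_left_mono) (simp_all add: add_nonneg_pos)
      also have "\<dots> = e"
      proof -
        have "2 * (L2_norm M f + 1) > 0" by (simp add: add_nonneg_pos)
        then show ?thesis unfolding d_def by (simp del: distrib_left_numeral)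
      qed
      finally show ?thesis by (rule bexI[OF _ poly[OF p(1) f]])
    qed
    with L V show ?thesis by (auto simp: closed_subspace_def)
  qed
  have ind: "(\<lambda>x. indicator C (\<zeta> x) * f x) \<in> V" if "C \<in> sets borel" and f: "f \<in> V" for C f
  proof -
    have [measurable]: "f \<in> borel_measurable M" using VL[OF f] by (rule L2_measurable)
    have "sets (borel :: complex measure) = sigma_sets UNIV {S. open S}" by (simp add: borel_def)
    then have C: "C \<in> sigma_sets UNIV {S. open S}" using that by simp
    have "Int_stable {S :: complex set. open S}" "{S :: complex set. open S} \<subseteq> Pow UNIV"
      by (auto simp: Int_stable_def)
    from this C show ?thesis
    proof (induction rule: sigma_sets_induct_disjoint)
      case (basic U)
      then have U: "open U" by simp
      show ?case
      proof (cases "U = UNIV")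
        case False
        \<comment> \<open>continuous functions increasing to the indicator of the open set U\<close>
        define \<phi> where "\<phi> n z = min 1 (real n * infdist z (- U))" for n z
        have ne: "- U \<noteq> {}" using False by auto
        have \<phi>1: "\<bar>\<phi> n z\<bar> \<le> 1" for n z
          using infdist_nonneg[of z "- U"] by (auto simp: \<phi>_def)
        have \<phi>c: "continuous_on UNIV (\<phi> n)" for n
          unfolding \<phi>_def by (intro continuous_intros)
        have [measurable]: "\<phi> n \<in> borel_measurable borel" for n
          using \<phi>c by (rule borel_measurable_continuous_onI)
        have lim: "(\<lambda>n. \<phi> n z) \<longlonglongrightarrow> indicator U z" for z
        proof (cases "z \<in> U")
          case True
          have "infdist z (- U) \<noteq> 0"
            using True U ne in_closed_iff_infdist_zero[of "- U" z] by auto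
          then have pos: "infdist z (- U) > 0" using infdist_nonneg[of z "- U"] by linarith
          then obtain N where N: "1 < real N * infdist z (- U)" using ex_less_of_nat_mult by blast
          have "\<phi> n z = 1" if "n \<ge> N" for n
          proof -
            have "real N * infdist z (- U) \<le> real n * infdist z (- U)"
              using that pos by (intro mult_right_mono) auto
            then show ?thesis using N by (simp add: \<phi>_def)
          qed
          then have "\<forall>\<^sub>F n in sequentially. \<phi> n z = 1"
            by (auto simp: eventually_sequentially)
          then show ?thesis using True by (simp add: tendsto_eventually)
        next
          case False then show ?thesis by (simp add: \<phi>_def)
        qed
        have Om: "U \<in> sets borel" using U by simp
        note [measurable] = Om
        show ?thesis
        proof (rule closed_subspace_limit[OF V])
          show "(\<lambda>x. of_real (\<phi> n (\<zeta> x)) * f x) \<in> V" for n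
            by (rule cont[OF \<phi>c \<phi>1 f])
          have m1: "(\<lambda>x. indicator U (\<zeta> x) * f x) \<in> borel_measurable M" by measurable
          have b: "AE x in M. cmod (of_real (\<phi> n (\<zeta> x)) * f x) \<le> cmod (f x)" for n
            using \<phi>1 by (auto simp: norm_mult intro!: mult_left_le_one_le)
          have l: "AE x in M. (\<lambda>n. of_real (\<phi> n (\<zeta> x)) * f x) \<longlonglongrightarrow> indicator U (\<zeta> x) * f x"
          proof (rule AE_I2)
            fix x
            have "(\<lambda>n. of_real (\<phi> n (\<zeta> x)) * f x) \<longlonglongrightarrow> of_real (indicator U (\<zeta> x)) * f x"
              by (intro tendsto_intros lim)
            then show "(\<lambda>n. of_real (\<phi> n (\<zeta> x)) * f x) \<longlonglongrightarrow> indicator U (\<zeta> x) * f x"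
              by (cases "\<zeta> x \<in> U") simp_all
          qed
          show "(\<lambda>x. indicator U (\<zeta> x) * f x) \<in> L2_space M"
               "(\<lambda>n. L2_norm M (\<lambda>x. of_real (\<phi> n (\<zeta> x)) * f x - indicator U (\<zeta> x) * f x)) \<longlonglongrightarrow> 0"
            using L2_dominated_convergence[OF VL[OF f] _ m1 b l] by auto
        qed
      qed (use f in simp)
    next
      case empty then show ?case using V by (simp add: closed_subspace_def)
    next
      case (compl A)
      have "(\<lambda>x. (-1) * (indicator A (\<zeta> x) * f x) + f x) \<in> V"
        using closed_subspace_linear[OF V compl(2) f] .
      then show ?case by (simp add: indicator_compl algebra_simps flip: Compl_eq_Diff_UNIV)
    next
      case (union A)
      have Am: "A i \<in> sets borel" for i
        using union(2) by (auto simp: borel_def)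
      note [measurable] = Am
      have part: "(\<lambda>x. (\<Sum>i<n. indicator (A i) (\<zeta> x)) * f x) \<in> V" for n
        using closed_subspace_sum[OF V, of "{..<n}" "\<lambda>i x. indicator (A i) (\<zeta> x) * f x"] union
        by (simp add: sum_distrib_right)
      have part_eq: "(\<Sum>i<n. indicator (A i) z) = (indicator (\<Union>i<n. A i) z :: complex)" for n z
        using union(1) by (subst indicator_UN_disjoint) (auto simp: disjoint_family_on_def)
      define U where "U = (\<Union>i. A i)"
      have [measurable]: "U \<in> sets borel" unfolding U_def using Am by blast
      have "(\<lambda>x. indicator U (\<zeta> x) * f x) \<in> borel_measurable M" by measurable
      then have m1: "(\<lambda>x. indicator (\<Union>i. A i) (\<zeta> x) * f x) \<in> borel_measurable M"
        unfolding U_def .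
      have b: "AE x in M. cmod ((\<Sum>i<n. indicator (A i) (\<zeta> x)) * f x) \<le> cmod (f x)" for n
        unfolding part_eq by (auto simp: indicator_def)
      have l: "AE x in M. (\<lambda>n. (\<Sum>i<n. indicator (A i) (\<zeta> x)) * f x) \<longlonglongrightarrow> indicator (\<Union>i. A i) (\<zeta> x) * f x"
        unfolding part_eq by (intro AE_I2 tendsto_intros LIMSEQ_indicator_UN)
      have m2: "(\<lambda>x. (\<Sum>i<n. indicator (A i) (\<zeta> x)) * f x) \<in> borel_measurable M" for n by measurable
      show ?case
        by (rule closed_subspace_limit[OF V part L2_dominated_convergence[OF VL[OF f] m2 m1 b l]])
    qed
  qed
  have indM: "(\<lambda>x. indicator A x * f x) \<in> V" if A: "A \<in> sets M" and f: "f \<in> V" for A f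
  proof -
    obtain C where C: "C \<in> sets borel" "AE x in M. x \<in> A \<longleftrightarrow> \<zeta> x \<in> C" using gen[OF A] by blast
    have [measurable]: "f \<in> borel_measurable M" "A \<in> sets M" "C \<in> sets borel"
      using A C(1) L2_measurable[OF VL[OF f]] by auto
    have g: "(\<lambda>x. indicator C (\<zeta> x) * f x) \<in> V" by (rule ind[OF C(1) f])
    have ae: "AE x in M. indicator C (\<zeta> x) * f x = indicator A x * f x"
      using C(2) by eventually_elim (auto simp: indicator_def)
    have L: "(\<lambda>x. indicator A x * f x) \<in> L2_space M"
      using ae by (intro L2_cong_AE[OF VL[OF g]]) (auto simp: ae_eq_def)
    have z: "L2_norm M (\<lambda>x. indicator C (\<zeta> x) * f x - indicator A x * f x) = 0"
      using ae by (subst L2_norm_zero_iff[OF L2_diff[OF VL[OF g] L]]) (auto elim!: eventually_mono)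
    show ?thesis
      by (rule closed_subspace_limit[OF V g L]) (simp add: z)
  qed
  have "h \<in> V" if h: "h \<in> L2_space M" for h
  proof -
    have [measurable]: "h \<in> borel_measurable M" "k \<in> borel_measurable M"
      using h VL[OF k(1)] by (auto intro: L2_measurable)
    have gm: "(\<lambda>x. h x / k x) \<in> borel_measurable M" by measurable
    obtain s where s': "\<forall>i. simple_function M (s i)"
      "\<forall>x\<in>space M. (\<lambda>i. s i x) \<longlonglongrightarrow> h x / k x"
      "\<forall>i. \<forall>x\<in>space M. dist (s i x) 0 \<le> 2 * dist (h x / k x) 0"
      using borel_measurable_implies_sequence_metric[OF gm, of 0] by blast
    have s: "simple_function M (s i)" "x \<in> space M \<Longrightarrow> (\<lambda>i. s i x) \<longlonglongrightarrow> h x / k x"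
      "x \<in> space M \<Longrightarrow> norm (s i x) \<le> 2 * norm (h x / k x)" for i x
      using s' unfolding dist_0_norm[symmetric] by (auto simp: dist_commute)
    note [measurable] = borel_measurable_simple_function[OF s(1)]
    have b: "AE x in M. cmod (s i x * k x) \<le> cmod (2 * h x)" for i
      using k(2) AE_space
    proof eventually_elim
      case (elim x)
      then show ?case using s(3)[of x i] by (simp add: norm_mult norm_divide field_simps)
    qed
    have l: "AE x in M. (\<lambda>i. s i x * k x) \<longlonglongrightarrow> h x"
      using k(2) AE_space
    proof eventually_elim
      case (elim x)
      have "(\<lambda>i. s i x * k x) \<longlonglongrightarrow> h x / k x * k x" using s(2) elim by (intro tendsto_intros)
      then show ?case using elim by simp
    qed
    have "(\<lambda>x. s i x * k x) \<in> V" for i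
    proof -
      define A where "A y = s i -` {y} \<inter> space M" for y
      have A: "A y \<in> sets M" for y
        unfolding A_def using s(1) by (rule simple_functionD)
      have fin: "finite (s i ` space M)" using s(1) by (rule simple_functionD)
      have g: "(\<lambda>x. \<Sum>y\<in>s i ` space M. y * (indicator (A y) x * k x)) \<in> V"
        by (intro closed_subspace_sum[OF V] closed_subspace_scale[OF V] indM A k)
      show ?thesis
      proof (rule closed_subspace_ae[OF V g])
        show "AE x in M. (\<Sum>y\<in>s i ` space M. y * (indicator (A y) x * k x)) = s i x * k x"
        proof (rule AE_I2)
          fix x assume x: "x \<in> space M"
          have "(\<Sum>y\<in>s i ` space M. y * (indicator (A y) x * k x)) =
             (\<Sum>y\<in>s i ` space M. if y = s i x then s i x * k x else 0)"
            using x by (intro sum.cong) (auto simp: A_def indicator_def)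
          also have "\<dots> = s i x * k x" using fin x by simp
          finally show "(\<Sum>y\<in>s i ` space M. y * (indicator (A y) x * k x)) = s i x * k x" .
        qed
      qed simp
    qed
    then show ?thesis
      by (rule closed_subspace_limit[OF V _ h L2_dominated_convergence(2)[OF L2_scale[OF h] _ _ b l]]) simp_all
  qed
  then show ?thesis using VL by auto
qed

section \<open>Boundary values for multiplication by the independent variable\<close>

text \<open>
  The normalisation says that d\<omega> / (1 + x^2) is a probability measure; it is what gives
  M(i) = i.
\<close>
locale spectral_measure =
  fixes \<omega> :: "real measure"
  assumes sets_\<omega> [measurable_cong, simp]: "sets \<omega> = sets borel"
    and normalized: "(\<integral>\<^sup>+x. ennreal (1 / (1 + x\<^sup>2)) \<partial>\<omega>) = 1"
begin

lemma space_\<omega> [simp]: "space \<omega> = UNIV"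
  using sets_eq_imp_space_eq[OF sets_\<omega>] by simp

lemma weight_integrable [simp]: "integrable \<omega> (\<lambda>x. 1 / (1 + x\<^sup>2))"
  by (rule integrableI_nonneg) (auto simp: normalized)

lemma weight_integral [simp]: "(\<integral>x. 1 / (1 + x\<^sup>2) \<partial>\<omega>) = 1"
  by (subst integral_eq_nn_integral) (auto simp: normalized)

lemma weight_integrable_complex [simp]: "integrable \<omega> (\<lambda>x. 1 / (1 + (complex_of_real x)\<^sup>2))"
  using integrable_of_real[OF weight_integrable, where 'a=complex] by simp

lemma weight_integral_complex [simp]: "(\<integral>x. 1 / (1 + (complex_of_real x)\<^sup>2) \<partial>\<omega>) = 1"
  using integral_complex_of_real[of \<omega> "\<lambda>x. 1 / (1 + x\<^sup>2)"] by simp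

lemma one_plus_square_nonzero [simp]: "1 + (complex_of_real x)\<^sup>2 \<noteq> 0"
proof -
  have "1 + x\<^sup>2 \<noteq> 0" by (smt (verit) zero_le_power2)
  then have "complex_of_real (1 + x\<^sup>2) \<noteq> 0" by (simp only: of_real_eq_0_iff not_False_eq_True)
  then show ?thesis by simp
qed

lemma L2_of_decay:
  assumes [measurable]: "f \<in> borel_measurable borel" and b: "AE x in \<omega>. (cmod (f x))\<^sup>2 \<le> C / (1 + x\<^sup>2)"
  shows "f \<in> L2_space \<omega>"
proof (rule L2_spaceI)
  have "integrable \<omega> (\<lambda>x. C * (1 / (1 + x\<^sup>2)))" by (intro integrable_mult_right weight_integrable)
  then show "integrable \<omega> (\<lambda>x. (cmod (f x))\<^sup>2)"
  proof (rule Bochner_Integration.integrable_bound)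
    show "AE x in \<omega>. norm ((cmod (f x))\<^sup>2) \<le> norm (C * (1 / (1 + x\<^sup>2)))"
      using b
    proof eventually_elim
      case (elim x)
      have "C / (1 + x\<^sup>2) \<le> norm (C * (1 / (1 + x\<^sup>2)))"
        by (simp only: real_norm_def times_divide_eq_right mult_1_right abs_ge_self)
      with elim show ?case by (simp only: real_norm_def abs_power2 abs_norm_cancel)
    qed
  qed simp
qed simp

lemma resolvent_kernel_decay:
  assumes "\<delta> > 0" "\<delta> \<le> cmod (of_real x - z)"
  shows "(cmod (1 / (of_real x - z)))\<^sup>2 \<le> (2 + (1 + 2 * (cmod z)\<^sup>2) / \<delta>\<^sup>2) / (1 + x\<^sup>2)"
proof -
  define r where "r = cmod (of_real x - z)"
  have r: "r > 0" "\<delta>\<^sup>2 \<le> r\<^sup>2" using assms by (auto simp: r_def intro!: power_mono)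
  have "x\<^sup>2 = (cmod ((of_real x - z) + z))\<^sup>2" by simp
  also have "\<dots> \<le> 2 * r\<^sup>2 + 2 * (cmod z)\<^sup>2" unfolding r_def by (rule cmod_add_square_le)
  finally have x: "1 + x\<^sup>2 \<le> 2 * r\<^sup>2 + (1 + 2 * (cmod z)\<^sup>2) * 1" by simp
  have "1 \<le> r\<^sup>2 / \<delta>\<^sup>2" using r assms by (simp add: field_simps)
  then have "(1 + 2 * (cmod z)\<^sup>2) * 1 \<le> (1 + 2 * (cmod z)\<^sup>2) * (r\<^sup>2 / \<delta>\<^sup>2)"
    by (intro mult_left_mono) auto
  with x have "1 + x\<^sup>2 \<le> 2 * r\<^sup>2 + (1 + 2 * (cmod z)\<^sup>2) * (r\<^sup>2 / \<delta>\<^sup>2)"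
    by linarith
  also have "\<dots> = (2 + (1 + 2 * (cmod z)\<^sup>2) / \<delta>\<^sup>2) * r\<^sup>2"
    by (simp only: distrib_right times_divide_eq_right times_divide_eq_left)
  finally have "1 + x\<^sup>2 \<le> (2 + (1 + 2 * (cmod z)\<^sup>2) / \<delta>\<^sup>2) * r\<^sup>2" .
  moreover have "1 + x\<^sup>2 > 0" by (simp add: add_pos_nonneg)
  ultimately show ?thesis using r
    by (simp add: norm_divide power_divide r_def[symmetric] field_simps)
qed

lemma L2_resolvent_kernel:
  assumes "\<delta> > 0" "AE x in \<omega>. \<delta> \<le> cmod (of_real x - z)"
  shows "(\<lambda>x. 1 / (of_real x - z)) \<in> L2_space \<omega>"
proof (rule L2_of_decay[where C = "2 + (1 + 2 * (cmod z)\<^sup>2) / \<delta>\<^sup>2"])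
  show "AE x in \<omega>. (cmod (1 / (of_real x - z)))\<^sup>2 \<le> (2 + (1 + 2 * (cmod z)\<^sup>2) / \<delta>\<^sup>2) / (1 + x\<^sup>2)"
    using assms(2) by eventually_elim (rule resolvent_kernel_decay[OF assms(1)])
qed simp

lemma Im_le_distance: "\<bar>Im z\<bar> \<le> cmod (of_real x - z)"
  using abs_Im_le_cmod[of "of_real x - z"] by simp

lemma nonreal_distance: "Im z \<noteq> 0 \<Longrightarrow> of_real x - z \<noteq> 0"
  using Im_le_distance[of z x] by auto

lemma L2_nonreal_kernel [simp]: "Im z \<noteq> 0 \<Longrightarrow> (\<lambda>x. 1 / (of_real x - z)) \<in> L2_space \<omega>"
  using Im_le_distance by (intro L2_resolvent_kernel[where \<delta> = "\<bar>Im z\<bar>"]) auto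

lemma L2_weight [simp]: "(\<lambda>x. c / (1 + (of_real x)\<^sup>2)) \<in> L2_space \<omega>"
  and L2_weight_id [simp]: "(\<lambda>x. c * of_real x / (1 + (of_real x)\<^sup>2)) \<in> L2_space \<omega>"
proof -
  have e: "1 + (of_real x)\<^sup>2 = (of_real x - \<i>) * (of_real x - (-\<i>))" for x
    by (simp add: power2_eq_square algebra_simps)
  have "(\<lambda>x. (c / (2 * \<i>)) * (1 / (of_real x - \<i>)) + (- c / (2 * \<i>)) * (1 / (of_real x - (-\<i>)))) \<in> L2_space \<omega>"
       "(\<lambda>x. (c / 2) * (1 / (of_real x - \<i>)) + (c / 2) * (1 / (of_real x - (-\<i>)))) \<in> L2_space \<omega>"
    by (intro L2_add L2_scale L2_nonreal_kernel; simp)+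
  moreover have "(c / (2 * \<i>)) * (1 / (of_real x - \<i>)) + (- c / (2 * \<i>)) * (1 / (of_real x - (-\<i>)))
     = c / (1 + (of_real x)\<^sup>2)"
    "(c / 2) * (1 / (of_real x - \<i>)) + (c / 2) * (1 / (of_real x - (-\<i>)))
     = c * of_real x / (1 + (of_real x)\<^sup>2)" for x
  proof -
    define a b where "a = of_real x - \<i>" and "b = of_real x - (-\<i>)"
    have ab: "a \<noteq> 0" "b \<noteq> 0" "b - a = 2 * \<i>" "a + b = 2 * of_real x"
      using nonreal_distance[of \<i> x] nonreal_distance[of "-\<i>" x] by (simp_all add: a_def b_def)
    have "(c / (2 * \<i>)) * (1 / a) + (- c / (2 * \<i>)) * (1 / b) = c / (2 * \<i>) * ((b - a) / (a * b))"
      using ab(1,2) by (simp add: diff_divide_distrib algebra_simps)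
    moreover have "c / d * (d / e) = c / e" if "d \<noteq> 0" for d e :: complex
      using that by simp
    ultimately show "(c / (2 * \<i>)) * (1 / (of_real x - \<i>)) + (- c / (2 * \<i>)) * (1 / (of_real x - (-\<i>)))
       = c / (1 + (of_real x)\<^sup>2)"
      unfolding e a_def[symmetric] b_def[symmetric] ab(3) by (metis complex_i_not_zero mult_eq_0_iff zero_neq_numeral)
    have "(c / 2) * (1 / a) + (c / 2) * (1 / b) = c / 2 * ((a + b) / (a * b))"
      using ab(1,2) by (simp add: add_divide_distrib algebra_simps)
    then show "(c / 2) * (1 / (of_real x - \<i>)) + (c / 2) * (1 / (of_real x - (-\<i>)))
       = c * of_real x / (1 + (of_real x)\<^sup>2)"
      unfolding e a_def[symmetric] b_def[symmetric] ab(4) by simp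
  qed
  ultimately show "(\<lambda>x. c / (1 + (of_real x)\<^sup>2)) \<in> L2_space \<omega>"
     "(\<lambda>x. c * of_real x / (1 + (of_real x)\<^sup>2)) \<in> L2_space \<omega>" by simp_all
qed

lemma mult_op_iff:
  "(f, g) \<in> mult_op \<omega> \<longleftrightarrow> f \<in> L2_space \<omega> \<and> g \<in> L2_space \<omega> \<and> (AE x in \<omega>. g x = of_real x * f x)"
proof -
  have "f \<in> L2_space (density \<omega> (\<lambda>x. ennreal (1 + x\<^sup>2))) \<longleftrightarrow> f \<in> L2_space \<omega>"
    if g: "g \<in> L2_space \<omega>" and ae: "AE x in \<omega>. g x = of_real x * f x"
  proof -
    have dm: "integrable (density \<omega> (\<lambda>x. ennreal (1 + x\<^sup>2))) (\<lambda>x. (cmod (f x))\<^sup>2) \<longleftrightarrow>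
        integrable \<omega> (\<lambda>x. (1 + x\<^sup>2) * (cmod (f x))\<^sup>2)" if [measurable]: "f \<in> borel_measurable borel"
      by (subst integrable_real_density) auto
    have cong: "integrable \<omega> (\<lambda>x. (1 + x\<^sup>2) * (cmod (f x))\<^sup>2) \<longleftrightarrow>
        integrable \<omega> (\<lambda>x. (cmod (f x))\<^sup>2 + (cmod (g x))\<^sup>2)" if [measurable]: "f \<in> borel_measurable borel"
    proof (rule integrable_cong_AE)
      show "AE x in \<omega>. (1 + x\<^sup>2) * (cmod (f x))\<^sup>2 = (cmod (f x))\<^sup>2 + (cmod (g x))\<^sup>2"
        using ae by eventually_elim (simp add: norm_mult power_mult_distrib algebra_simps)
    qed (use g in \<open>auto simp: L2_measurable\<close>)
    have "integrable \<omega> (\<lambda>x. (cmod (f x))\<^sup>2)"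
      if [measurable]: "f \<in> borel_measurable borel"
        and i: "integrable \<omega> (\<lambda>x. (cmod (f x))\<^sup>2 + (cmod (g x))\<^sup>2)"
      using Bochner_Integration.integrable_diff[OF i L2_integrable_square[OF g]] by simp
    moreover have "integrable \<omega> (\<lambda>x. (cmod (f x))\<^sup>2 + (cmod (g x))\<^sup>2)"
      if "integrable \<omega> (\<lambda>x. (cmod (f x))\<^sup>2)"
      using Bochner_Integration.integrable_add[OF that L2_integrable_square[OF g]] by simp
    ultimately have "integrable (density \<omega> (\<lambda>x. ennreal (1 + x\<^sup>2))) (\<lambda>x. (cmod (f x))\<^sup>2) \<longleftrightarrow>
        integrable \<omega> (\<lambda>x. (cmod (f x))\<^sup>2)" if "f \<in> borel_measurable borel"
      unfolding dm[OF that] cong[OF that] using that by blast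
    moreover have "borel_measurable (density \<omega> (\<lambda>x. ennreal (1 + x\<^sup>2))) = borel_measurable borel"
      "borel_measurable \<omega> = borel_measurable borel"
      by (simp_all cong: measurable_cong_sets)
    ultimately show ?thesis unfolding L2_space_def by blast
  qed
  then show ?thesis unfolding mult_op_def ae_eq_def by blast
qed

text \<open>
  Both f and x f are square-integrable, so f is the product of the square-integrable functions 1 /
  (x - i) and (x - i) f.
\<close>
lemma mult_op_integrable:
  assumes "(f, g) \<in> mult_op \<omega>"
  shows "integrable \<omega> f"
proof -
  have f: "f \<in> L2_space \<omega>" "g \<in> L2_space \<omega>" and ae: "AE x in \<omega>. g x = of_real x * f x"
    using assms by (auto simp: mult_op_iff)
  have i: "integrable \<omega> (\<lambda>x. 1 / (of_real x - \<i>) * (g x - \<i> * f x))"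
    using f by (intro L2_mult_integrable L2_diff L2_scale L2_nonreal_kernel) auto
  show ?thesis
  proof (rule integrable_cong_AE_imp[OF i])
    show "AE x in \<omega>. 1 / (of_real x - \<i>) * (g x - \<i> * f x) = f x"
      using ae
    proof eventually_elim
      case (elim x)
      then show ?case using nonreal_distance[of \<i> x] by (simp add: field_simps)
    qed
  qed (use f in \<open>simp add: L2_measurable\<close>)
qed

text \<open>
  This will turn out to be the adjoint of the restricted operator
  (\<open>adjoint_restr_eq\<close>).
\<close>
definition max_op :: "real graph" where
  "max_op = {(u, v). u \<in> L2_space \<omega> \<and> v \<in> L2_space \<omega> \<and>
     (\<exists>c. AE x in \<omega>. v x = of_real x * u x - c)}"

text \<open>
  On \<open>max_op\<close> the function x u - v is a constant, recovered here as its mean with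
  respect to the probability measure d\<omega> / (1 + x^2); the formula is linear and makes sense
  for all u and v.
\<close>
definition jump :: "(real \<Rightarrow> complex) \<Rightarrow> (real \<Rightarrow> complex) \<Rightarrow> complex" where
  "jump u v = (\<integral>x. (of_real x * u x - v x) / (1 + (of_real x)\<^sup>2) \<partial>\<omega>)"

text \<open>
  An element of \<open>max_op\<close> behaves like jump / x at infinity and need not be
  integrable. The subtracted multiple of x / (1 + x^2) is the one that occurs in the Weyl
  function, so the trace of 1 / (x - z) is M(z).
\<close>
definition trace :: "(real \<Rightarrow> complex) \<Rightarrow> (real \<Rightarrow> complex) \<Rightarrow> complex" where
  "trace u v = (\<integral>x. u x - jump u v * of_real x / (1 + (of_real x)\<^sup>2) \<partial>\<omega>)"

lemma jump_eq:
  assumes "u \<in> borel_measurable borel" "v \<in> borel_measurable borel" "AE x in \<omega>. v x = of_real x * u x - c"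
  shows "jump u v = c"
proof -
  have "jump u v = (\<integral>x. c * (1 / (1 + (of_real x)\<^sup>2)) \<partial>\<omega>)"
    unfolding jump_def by (rule integral_cong_AE) (use assms in \<open>auto elim!: eventually_mono\<close>)
  then show ?thesis by (simp del: times_divide_eq_right)
qed

lemma max_opD:
  assumes "(u, v) \<in> max_op"
  shows "u \<in> L2_space \<omega>" "v \<in> L2_space \<omega>" "AE x in \<omega>. v x = of_real x * u x - jump u v"
proof -
  show L: "u \<in> L2_space \<omega>" "v \<in> L2_space \<omega>" using assms by (auto simp: max_op_def)
  obtain c where c: "AE x in \<omega>. v x = of_real x * u x - c" using assms by (auto simp: max_op_def)
  have "jump u v = c" using L by (intro jump_eq c) (auto dest: L2_measurable)
  then show "AE x in \<omega>. v x = of_real x * u x - jump u v" using c by simp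
qed

lemma max_opI:
  assumes "u \<in> L2_space \<omega>" "v \<in> L2_space \<omega>" "AE x in \<omega>. v x = of_real x * u x - c"
  shows "(u, v) \<in> max_op" "jump u v = c"
proof -
  show "(u, v) \<in> max_op" using assms by (auto simp: max_op_def)
  show "jump u v = c" using assms by (intro jump_eq) (auto dest: L2_measurable)
qed

lemma max_op_subset: "max_op \<subseteq> L2_space \<omega> \<times> L2_space \<omega>"
  by (auto simp: max_op_def)

text \<open>
  Subtracting the multiple of x / (1 + x^2) with the same jump lands in the domain of
  multiplication by x.
\<close>
lemma max_op_regular_part:
  assumes "(u, v) \<in> max_op"
  shows "(\<lambda>x. u x - jump u v * of_real x / (1 + (of_real x)\<^sup>2), \<lambda>x. v x + jump u v / (1 + (of_real x)\<^sup>2)) \<in> mult_op \<omega>"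
  unfolding mult_op_iff
proof (intro conjI)
  note D = max_opD[OF assms]
  show "(\<lambda>x. u x - jump u v * of_real x / (1 + (of_real x)\<^sup>2)) \<in> L2_space \<omega>"
       "(\<lambda>x. v x + jump u v / (1 + (of_real x)\<^sup>2)) \<in> L2_space \<omega>"
    using D by auto
  show "AE x in \<omega>. v x + jump u v / (1 + (of_real x)\<^sup>2) = of_real x * (u x - jump u v * of_real x / (1 + (of_real x)\<^sup>2))"
    using D(3)
  proof eventually_elim
    case (elim x)
    have "jump u v * (of_real x)\<^sup>2 / (1 + (of_real x)\<^sup>2) = jump u v - jump u v / (1 + (of_real x)\<^sup>2)"
      by (simp add: divide_simps) (simp add: algebra_simps)
    then show ?case unfolding elim by (simp add: algebra_simps power2_eq_square)
  qed
qed

lemma trace_integrable: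
  "(u, v) \<in> max_op \<Longrightarrow> integrable \<omega> (\<lambda>x. u x - jump u v * of_real x / (1 + (of_real x)\<^sup>2))"
  by (rule mult_op_integrable[OF max_op_regular_part])

lemma mult_op_eq: "mult_op \<omega> = {(u, v) \<in> max_op. jump u v = 0}"
proof (intro equalityI subsetI)
  fix p assume "p \<in> mult_op \<omega>"
  then obtain u v where p: "p = (u, v)" "(u, v) \<in> mult_op \<omega>" by (cases p) auto
  then have "u \<in> L2_space \<omega>" "v \<in> L2_space \<omega>" "AE x in \<omega>. v x = of_real x * u x - 0"
    by (auto simp: mult_op_iff)
  from max_opI[OF this] show "p \<in> {(u, v) \<in> max_op. jump u v = 0}" using p by simp
next
  fix p assume "p \<in> {(u, v) \<in> max_op. jump u v = 0}"
  then obtain u v where p: "p = (u, v)" "(u, v) \<in> max_op" "jump u v = 0" by (cases p) auto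
  then show "p \<in> mult_op \<omega>" using max_opD[OF p(2)] by (simp add: mult_op_iff)
qed

lemma trace_regular: "jump u v = 0 \<Longrightarrow> trace u v = (\<integral>x. u x \<partial>\<omega>)"
  by (simp add: trace_def)

lemma mult_op_restr_eq: "mult_op_restr \<omega> = {(u, v) \<in> max_op. jump u v = 0 \<and> trace u v = 0}"
  unfolding mult_op_restr_def mult_op_eq by (auto simp: trace_regular)

lemma boundary_linear:
  assumes "(u, v) \<in> max_op" "(u', v') \<in> max_op"
  shows "(\<lambda>x. c * u x + u' x, \<lambda>x. c * v x + v' x) \<in> max_op"
    "jump (\<lambda>x. c * u x + u' x) (\<lambda>x. c * v x + v' x) = c * jump u v + jump u' v'"
    "trace (\<lambda>x. c * u x + u' x) (\<lambda>x. c * v x + v' x) = c * trace u v + trace u' v'"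
proof -
  note D = max_opD[OF assms(1)] max_opD[OF assms(2)]
  have "AE x in \<omega>. c * v x + v' x = of_real x * (c * u x + u' x) - (c * jump u v + jump u' v')"
    using D(3,6)
  proof eventually_elim
    case (elim x)
    show ?case unfolding elim by (simp add: algebra_simps)
  qed
  from max_opI[OF _ _ this] show "(\<lambda>x. c * u x + u' x, \<lambda>x. c * v x + v' x) \<in> max_op"
    and j: "jump (\<lambda>x. c * u x + u' x) (\<lambda>x. c * v x + v' x) = c * jump u v + jump u' v'"
    using D by auto
  have "trace (\<lambda>x. c * u x + u' x) (\<lambda>x. c * v x + v' x) =
     (\<integral>x. c * (u x - jump u v * of_real x / (1 + (of_real x)\<^sup>2)) +
           (u' x - jump u' v' * of_real x / (1 + (of_real x)\<^sup>2)) \<partial>\<omega>)"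
    unfolding trace_def j by (rule arg_cong[where f = "integral\<^sup>L \<omega>"]) (auto simp: algebra_simps add_divide_distrib)
  also have "\<dots> = c * trace u v + trace u' v'"
    unfolding trace_def using trace_integrable[OF assms(1)] trace_integrable[OF assms(2)]
    by (subst Bochner_Integration.integral_add) auto
  finally show "trace (\<lambda>x. c * u x + u' x) (\<lambda>x. c * v x + v' x) = c * trace u v + trace u' v'" .
qed

text \<open>
  Since v = x u - jump, the terms containing x cancel in v cnj u' - u cnj v', and what is left
  pairs the jump of one element with u of the other. Regularising u and u' by multiples of the
  same real function x / (1 + x^2) changes nothing, so traces appear.
\<close>
lemma Green_identity:
  assumes "(u, v) \<in> max_op" "(u', v') \<in> max_op"
  shows "L2_inner \<omega> v u' - L2_inner \<omega> u v' = trace u v * cnj (jump u' v') - jump u v * cnj (trace u' v')"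
proof -
  note D = max_opD[OF assms(1)] max_opD[OF assms(2)]
  define w where "w x = u x - jump u v * of_real x / (1 + (of_real x)\<^sup>2)" for x
  define w' where "w' x = u' x - jump u' v' * of_real x / (1 + (of_real x)\<^sup>2)" for x
  have tr: "trace u v = (\<integral>x. w x \<partial>\<omega>)" "trace u' v' = (\<integral>x. w' x \<partial>\<omega>)"
    by (simp_all only: trace_def w_def w'_def)
  have i: "integrable \<omega> w" "integrable \<omega> w'"
    unfolding w_def w'_def by (intro trace_integrable assms)+
  have [measurable]: "w \<in> borel_measurable \<omega>" "w' \<in> borel_measurable \<omega>" using i by auto
  have [measurable]: "(\<lambda>x. cnj (w' x)) \<in> borel_measurable \<omega>"
    using integrable_cnj[OF i(2)] by (rule borel_measurable_integrable)
  have "L2_inner \<omega> v u' - L2_inner \<omega> u v' = (\<integral>x. v x * cnj (u' x) - u x * cnj (v' x) \<partial>\<omega>)"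
    unfolding L2_inner_def using D by (subst Bochner_Integration.integral_diff) auto
  also have "\<dots> = (\<integral>x. cnj (jump u' v') * w x - jump u v * cnj (w' x) \<partial>\<omega>)"
  proof (rule integral_cong_AE)
    have "integrable \<omega> (\<lambda>x. v x * cnj (u' x) - u x * cnj (v' x))" using D by auto
    then show "(\<lambda>x. v x * cnj (u' x) - u x * cnj (v' x)) \<in> borel_measurable \<omega>"
      by (rule borel_measurable_integrable)
    show "AE x in \<omega>. v x * cnj (u' x) - u x * cnj (v' x) = cnj (jump u' v') * w x - jump u v * cnj (w' x)"
      using D(3,6)
    proof eventually_elim
      case (elim x)
      show ?case unfolding elim w_def w'_def by (simp add: algebra_simps)
    qed
  qed measurable
  also have "\<dots> = trace u v * cnj (jump u' v') - jump u v * cnj (trace u' v')"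
    using i tr by (subst Bochner_Integration.integral_diff) (auto simp: mult.commute)
  finally show ?thesis .
qed

text \<open>
  Together with \<open>boundary_v\<close> an explicit element of \<open>max_op\<close> with jump c
  and trace t.
\<close>
definition boundary_u :: "complex \<Rightarrow> complex \<Rightarrow> real \<Rightarrow> complex" where
  "boundary_u c t x = (c * of_real x + t) / (1 + (of_real x)\<^sup>2)"

definition boundary_v :: "complex \<Rightarrow> complex \<Rightarrow> real \<Rightarrow> complex" where
  "boundary_v c t x = (t * of_real x - c) / (1 + (of_real x)\<^sup>2)"

lemma boundary_surjective:
  "(boundary_u c t, boundary_v c t) \<in> max_op"
  "jump (boundary_u c t) (boundary_v c t) = c" "trace (boundary_u c t) (boundary_v c t) = t"
proof -
  have "boundary_u c t = (\<lambda>x. c * of_real x / (1 + (of_real x)\<^sup>2) + t / (1 + (of_real x)\<^sup>2))"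
       "boundary_v c t = (\<lambda>x. t * of_real x / (1 + (of_real x)\<^sup>2) - c / (1 + (of_real x)\<^sup>2))"
    by (simp_all add: fun_eq_iff boundary_u_def boundary_v_def add_divide_distrib diff_divide_distrib)
  then have L: "boundary_u c t \<in> L2_space \<omega>" "boundary_v c t \<in> L2_space \<omega>" by simp_all
  have "AE x in \<omega>. boundary_v c t x = of_real x * boundary_u c t x - c"
    by (simp add: boundary_u_def boundary_v_def divide_simps) (simp add: algebra_simps power2_eq_square)
  from max_opI[OF L this] show "(boundary_u c t, boundary_v c t) \<in> max_op"
    and j: "jump (boundary_u c t) (boundary_v c t) = c" .
  have "trace (boundary_u c t) (boundary_v c t) = (\<integral>x. t * (1 / (1 + (of_real x)\<^sup>2)) \<partial>\<omega>)"
    unfolding trace_def j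
    by (rule arg_cong[where f = "integral\<^sup>L \<omega>"]) (simp add: fun_eq_iff boundary_u_def add_divide_distrib)
  then show "trace (boundary_u c t) (boundary_v c t) = t" by (simp del: times_divide_eq_right)
qed

lemma restr_subset_mult_op: "mult_op_restr \<omega> \<subseteq> mult_op \<omega>"
  by (auto simp: mult_op_restr_def)

text \<open>
  For (u, v) in the adjoint let q = x u - v - jump u v. The function q / (1 + x^2) has integral
  zero, so it belongs to the domain of the restriction; testing the adjoint relation against it
  yields \<integral> |q|^2 / (1 + x^2) d\<omega> = 0.
\<close>
lemma adjoint_restr_eq: "adjoint_op \<omega> (mult_op_restr \<omega>) = max_op"
proof (intro equalityI subsetI)
  fix p assume "p \<in> max_op"
  then obtain u' v' where p: "p = (u', v')" "(u', v') \<in> max_op" by (cases p) auto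
  have "L2_inner \<omega> g u' = L2_inner \<omega> f v'" if "(f, g) \<in> mult_op_restr \<omega>" for f g
    using Green_identity[of f g u' v'] that p(2) by (auto simp: mult_op_restr_eq)
  then show "p \<in> adjoint_op \<omega> (mult_op_restr \<omega>)"
    using max_opD[OF p(2)] unfolding p(1) by (intro adjoint_opI)
next
  fix p assume pa: "p \<in> adjoint_op \<omega> (mult_op_restr \<omega>)"
  obtain u v where p: "p = (u, v)" by (cases p)
  note D = adjoint_opD[OF pa[unfolded p]]
  define c where "c = jump u v"
  define q where "q x = of_real x * u x - v x - c" for x
  define f where "f x = q x / (1 + (of_real x)\<^sup>2)" for x
  have f_eq: "f = (\<lambda>x. (of_real x / (1 + (of_real x)\<^sup>2)) * u x - (1 / (1 + (of_real x)\<^sup>2)) * v x - c / (1 + (of_real x)\<^sup>2))"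
    by (simp add: f_def q_def fun_eq_iff diff_divide_distrib)
  have g_eq: "(\<lambda>x. of_real x * f x) = (\<lambda>x. ((of_real x)\<^sup>2 / (1 + (of_real x)\<^sup>2)) * u x - (of_real x / (1 + (of_real x)\<^sup>2)) * v x - c * of_real x / (1 + (of_real x)\<^sup>2))"
    by (simp add: f_def q_def fun_eq_iff diff_divide_distrib add_divide_distrib power2_eq_square algebra_simps)
  have pos: "1 + x\<^sup>2 > 0" for x :: real by (simp add: add_pos_nonneg)
  have norm_w: "cmod (1 + (of_real x)\<^sup>2) = 1 + x\<^sup>2" for x :: real
  proof -
    have "1 + (complex_of_real x)\<^sup>2 = of_real (1 + x\<^sup>2)" by simp
    then show ?thesis using pos[of x] by (simp only: norm_of_real abs_of_pos)
  qed
  have b0: "cmod (1 / (1 + (of_real x)\<^sup>2)) \<le> 1" for x :: real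
    using pos[of x] by (simp add: norm_divide norm_w)
  have "\<bar>x\<bar> \<le> 1 + x\<^sup>2" for x :: real
  proof -
    have "2 * \<bar>x\<bar> * 1 \<le> \<bar>x\<bar>\<^sup>2 + 1\<^sup>2" by (rule sum_squares_bound)
    then show ?thesis by simp
  qed
  then have b1: "cmod (of_real x / (1 + (of_real x)\<^sup>2)) \<le> 1" for x :: real
    using pos[of x] by (simp add: norm_divide norm_w)
  have b2: "cmod ((of_real x)\<^sup>2 / (1 + (of_real x)\<^sup>2)) \<le> 1" for x :: real
    using pos[of x] by (simp add: norm_divide norm_w norm_power)
  have fL: "f \<in> L2_space \<omega>"
    unfolding f_eq by (intro L2_diff L2_weight L2_mult_bounded[where C=1] D b1 b0) auto
  have gL: "(\<lambda>x. of_real x * f x) \<in> L2_space \<omega>"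
    unfolding g_eq by (intro L2_diff L2_weight_id L2_mult_bounded[where C=1] D b1 b2) auto
  have fm: "(f, \<lambda>x. of_real x * f x) \<in> mult_op \<omega>"
    using fL gL by (simp add: mult_op_iff)
  have int_f: "(\<integral>x. f x \<partial>\<omega>) = 0"
  proof -
    have "(\<integral>x. f x \<partial>\<omega>) + c * (\<integral>x. 1 / (1 + (of_real x)\<^sup>2) \<partial>\<omega>) = (\<integral>x. f x + c * (1 / (1 + (of_real x)\<^sup>2)) \<partial>\<omega>)"
      using mult_op_integrable[OF fm]
      by (subst Bochner_Integration.integral_add) (auto simp del: times_divide_eq_right)
    also have "\<dots> = c" unfolding c_def jump_def
      by (rule arg_cong[where f = "integral\<^sup>L \<omega>"]) (simp add: fun_eq_iff f_def q_def diff_divide_distrib c_def jump_def)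
    finally show ?thesis by simp
  qed
  have "(f, \<lambda>x. of_real x * f x) \<in> mult_op_restr \<omega>"
    using fm int_f by (simp add: mult_op_restr_def)
  then have "L2_inner \<omega> (\<lambda>x. of_real x * f x) u - L2_inner \<omega> f v = 0" using D(3) by simp
  then have e0: "(\<integral>x. (of_real x * f x) * cnj (u x) - f x * cnj (v x) \<partial>\<omega>) = 0"
    unfolding L2_inner_def using fL gL D
    by (subst Bochner_Integration.integral_diff) auto
  have i0: "integrable \<omega> (\<lambda>x. (of_real x * f x) * cnj (u x) - f x * cnj (v x))"
    using fL gL D by (intro Bochner_Integration.integrable_diff L2_inner_integrable) auto
  \<comment> \<open>with c = jump u v, the integrand of the adjoint relation tested against f is |q|^2 / (1 + x^2)
    up to cnj c * f, whose integral vanishes\<close>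
  have eq: "(of_real x * f x) * cnj (u x) - f x * cnj (v x) - cnj c * f x = of_real ((cmod (q x))\<^sup>2 / (1 + x\<^sup>2))" for x
  proof -
    have "(of_real x * f x) * cnj (u x) - f x * cnj (v x) - cnj c * f x = f x * cnj (q x)"
      by (simp add: q_def algebra_simps)
    also have "\<dots> = of_real ((cmod (q x))\<^sup>2 / (1 + x\<^sup>2))"
      by (simp add: f_def complex_norm_square[symmetric])
    finally show ?thesis .
  qed
  have iq: "integrable \<omega> (\<lambda>x. complex_of_real ((cmod (q x))\<^sup>2 / (1 + x\<^sup>2)))"
    unfolding eq[symmetric]
    by (rule Bochner_Integration.integrable_diff[OF i0 integrable_mult_right[OF mult_op_integrable[OF fm]]])
  then have iq': "integrable \<omega> (\<lambda>x. (cmod (q x))\<^sup>2 / (1 + x\<^sup>2))"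
    by (simp only: complex_of_real_integrable_eq)
  have "complex_of_real (\<integral>x. (cmod (q x))\<^sup>2 / (1 + x\<^sup>2) \<partial>\<omega>) = 0"
    unfolding integral_complex_of_real[symmetric] eq[symmetric]
    by (simp only: Bochner_Integration.integral_diff[OF i0 integrable_mult_right[OF mult_op_integrable[OF fm]]]
        e0 Bochner_Integration.integral_mult_right_zero int_f mult_zero_right diff_0_right)
  then have "AE x in \<omega>. (cmod (q x))\<^sup>2 / (1 + x\<^sup>2) = 0"
    using integral_nonneg_eq_0_iff_AE[OF iq'] pos by (auto simp: less_imp_le)
  then have "AE x in \<omega>. v x = of_real x * u x - c"
  proof eventually_elim
    case (elim x)
    then have "q x = 0" using pos[of x] by (simp add: less_imp_neq[symmetric])
    then show ?case by (simp add: q_def algebra_simps)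
  qed
  then show "p \<in> max_op" using D unfolding p by (intro max_opI)
qed

lemma zero_in_restr: "(\<lambda>x. 0, \<lambda>x. 0) \<in> mult_op_restr \<omega>"
  by (simp add: mult_op_restr_def mult_op_iff)

text \<open>
  Adjoints become linear algebra in the boundary values (jump, trace).
\<close>
lemma adjoint_between:
  assumes B: "mult_op_restr \<omega> \<subseteq> B" "B \<subseteq> max_op"
  shows "adjoint_op \<omega> B = {(u', v') \<in> max_op. \<forall>(u, v)\<in>B. trace u v * cnj (jump u' v') = jump u v * cnj (trace u' v')}"
proof (intro equalityI subsetI)
  fix p assume p: "p \<in> adjoint_op \<omega> B"
  obtain u' v' where uv: "p = (u', v')" by (cases p)
  have "p \<in> adjoint_op \<omega> (mult_op_restr \<omega>)" using p B unfolding uv adjoint_op_def by blast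
  then have m: "(u', v') \<in> max_op" by (simp add: adjoint_restr_eq uv)
  have "trace u v * cnj (jump u' v') = jump u v * cnj (trace u' v')" if "(u, v) \<in> B" for u v
    using Green_identity[of u v u' v'] m that B adjoint_opD(3)[OF p[unfolded uv] that] by auto
  then show "p \<in> {(u', v') \<in> max_op. \<forall>(u, v)\<in>B. trace u v * cnj (jump u' v') = jump u v * cnj (trace u' v')}"
    using m uv by blast
next
  fix p assume "p \<in> {(u', v') \<in> max_op. \<forall>(u, v)\<in>B. trace u v * cnj (jump u' v') = jump u v * cnj (trace u' v')}"
  then obtain u' v' where uv: "p = (u', v')" "(u', v') \<in> max_op"
    "\<And>u v. (u, v) \<in> B \<Longrightarrow> trace u v * cnj (jump u' v') = jump u v * cnj (trace u' v')"
    by (cases p) auto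
  have "L2_inner \<omega> v u' = L2_inner \<omega> u v'" if "(u, v) \<in> B" for u v
    using Green_identity[of u v u' v'] uv(2) uv(3)[OF that] that B by auto
  then show "p \<in> adjoint_op \<omega> B"
    using max_opD[OF uv(2)] unfolding uv(1) by (intro adjoint_opI)
qed

text \<open>
  The boundary condition selects a line in the two-dimensional space of boundary values; the
  remaining line, jump = 0, is multiplication by x.
\<close>
definition ext :: "complex \<Rightarrow> real graph" where
  "ext w = {(u, v) \<in> max_op. trace u v = w * jump u v}"

lemma ext_between: "mult_op_restr \<omega> \<subseteq> ext w" "ext w \<subseteq> max_op"
  by (auto simp: ext_def mult_op_restr_eq)

lemma mult_op_between: "mult_op_restr \<omega> \<subseteq> mult_op \<omega>" "mult_op \<omega> \<subseteq> max_op"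
  by (auto simp: mult_op_eq mult_op_restr_eq)

lemma adjoint_ext: "adjoint_op \<omega> (ext w) = ext (cnj w)"
proof (rule set_eqI)
  fix p :: "(real \<Rightarrow> complex) \<times> (real \<Rightarrow> complex)"
  obtain u' v' where p: "p = (u', v')" by (cases p)
  have "(\<forall>(u, v)\<in>ext w. trace u v * cnj (jump u' v') = jump u v * cnj (trace u' v')) \<longleftrightarrow> trace u' v' = cnj w * jump u' v'"
  proof
    assume a: "\<forall>(u, v)\<in>ext w. trace u v * cnj (jump u' v') = jump u v * cnj (trace u' v')"
    have "(boundary_u 1 w, boundary_v 1 w) \<in> ext w" using boundary_surjective[of 1 w] by (simp add: ext_def)
    with a have "w * cnj (jump u' v') = cnj (trace u' v')"
      using boundary_surjective[of 1 w] by auto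
    then have "cnj (cnj (trace u' v')) = cnj (w * cnj (jump u' v'))" by simp
    then show "trace u' v' = cnj w * jump u' v'" by simp
  qed (auto simp: ext_def)
  then show "p \<in> adjoint_op \<omega> (ext w) \<longleftrightarrow> p \<in> ext (cnj w)"
    unfolding adjoint_between[OF ext_between] p by (simp add: ext_def)
qed

lemma adjoint_mult_op: "adjoint_op \<omega> (mult_op \<omega>) = mult_op \<omega>"
proof (rule set_eqI)
  fix p :: "(real \<Rightarrow> complex) \<times> (real \<Rightarrow> complex)"
  obtain u' v' where p: "p = (u', v')" by (cases p)
  have "(\<forall>(u, v)\<in>mult_op \<omega>. trace u v * cnj (jump u' v') = jump u v * cnj (trace u' v')) \<longleftrightarrow> jump u' v' = 0"
  proof
    assume a: "\<forall>(u, v)\<in>mult_op \<omega>. trace u v * cnj (jump u' v') = jump u v * cnj (trace u' v')"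
    have "(boundary_u 0 1, boundary_v 0 1) \<in> mult_op \<omega>" using boundary_surjective[of 0 1] by (simp add: mult_op_eq)
    with a show "jump u' v' = 0" using boundary_surjective[of 0 1] by auto
  qed (auto simp: mult_op_eq)
  then show "p \<in> adjoint_op \<omega> (mult_op \<omega>) \<longleftrightarrow> p \<in> mult_op \<omega>"
    unfolding adjoint_between[OF mult_op_between] p by (simp add: mult_op_eq)
qed

lemma adjoint_max_op: "adjoint_op \<omega> max_op = mult_op_restr \<omega>"
proof (rule set_eqI)
  fix p :: "(real \<Rightarrow> complex) \<times> (real \<Rightarrow> complex)"
  obtain u' v' where p: "p = (u', v')" by (cases p)
  have "(\<forall>(u, v)\<in>max_op. trace u v * cnj (jump u' v') = jump u v * cnj (trace u' v')) \<longleftrightarrow>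
      jump u' v' = 0 \<and> trace u' v' = 0"
  proof
    assume a: "\<forall>(u, v)\<in>max_op. trace u v * cnj (jump u' v') = jump u v * cnj (trace u' v')"
    show "jump u' v' = 0 \<and> trace u' v' = 0"
      using a boundary_surjective[of 0 1] boundary_surjective[of 1 0] by fastforce
  qed auto
  moreover have "mult_op_restr \<omega> \<subseteq> max_op" by (auto simp: mult_op_restr_eq)
  ultimately show "p \<in> adjoint_op \<omega> max_op \<longleftrightarrow> p \<in> mult_op_restr \<omega>"
    unfolding adjoint_between[OF \<open>mult_op_restr \<omega> \<subseteq> max_op\<close> order_refl] p by (simp add: mult_op_restr_eq)
qed

lemma eigenspace_max_op:
  assumes z: "Im z \<noteq> 0"
  shows "u \<in> eigenspace \<omega> max_op z \<longleftrightarrow> u \<in> borel_measurable borel \<and> (\<exists>c. AE x in \<omega>. u x = c * (1 / (of_real x - z)))"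
proof
  assume "u \<in> eigenspace \<omega> max_op z"
  then obtain v where v: "(u, v) \<in> max_op" "AE x in \<omega>. v x = z * u x"
    by (auto simp: eigenspace_def ae_eq_def)
  note D = max_opD[OF v(1)]
  have "AE x in \<omega>. u x = jump u v * (1 / (of_real x - z))"
    using v(2) D(3) by eventually_elim (use nonreal_distance[OF z] in \<open>auto simp: field_simps\<close>)
  then show "u \<in> borel_measurable borel \<and> (\<exists>c. AE x in \<omega>. u x = c * (1 / (of_real x - z)))"
    using L2_measurable[OF D(1)] by auto
next
  assume "u \<in> borel_measurable borel \<and> (\<exists>c. AE x in \<omega>. u x = c * (1 / (of_real x - z)))"
  then obtain c where u: "u \<in> borel_measurable borel" "AE x in \<omega>. u x = c * (1 / (of_real x - z))" by blast
  have uL: "u \<in> L2_space \<omega>"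
    by (rule L2_cong_AE[OF L2_scale[OF L2_nonreal_kernel[OF z], of c]])
       (use u in \<open>auto simp: ae_eq_def elim!: eventually_mono\<close>)
  have "AE x in \<omega>. z * u x = of_real x * u x - c"
    using u(2) by eventually_elim (use nonreal_distance[OF z] in \<open>auto simp: field_simps\<close>)
  from max_opI(1)[OF uL L2_scale[OF uL] this] show "u \<in> eigenspace \<omega> max_op z"
    by (auto simp: eigenspace_def ae_eq_def)
qed

lemma not_AE_False: "\<not> (AE x in \<omega>. False)"
proof
  assume "AE x in \<omega>. False"
  then have "(\<integral>\<^sup>+x. ennreal (1 / (1 + x\<^sup>2)) \<partial>\<omega>) = (\<integral>\<^sup>+x. 0 \<partial>\<omega>)"
    by (intro nn_integral_cong_AE) auto
  then show False by (simp add: normalized)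
qed

lemma eigenspace_one_dimensional:
  assumes z: "Im z \<noteq> 0"
  shows "one_dimensional \<omega> (eigenspace \<omega> max_op z)"
  unfolding one_dimensional_def
proof (intro bexI conjI ballI)
  show "(\<lambda>x. 1 / (of_real x - z)) \<in> eigenspace \<omega> max_op z"
    unfolding eigenspace_max_op[OF z] by (auto intro!: exI[of _ 1])
  show "\<not> ae_eq \<omega> (\<lambda>x. 1 / (of_real x - z)) (\<lambda>x. 0)"
    using nonreal_distance[OF z] not_AE_False by (simp add: ae_eq_def)
qed (auto simp: eigenspace_max_op[OF z] ae_eq_def)

end

section \<open>Primeness and quasi-hermitian extensions\<close>

lemma lin_spanE:
  assumes "g \<in> lin_span S"
  obtains F c where "g = (\<lambda>x. \<Sum>h\<in>F. c h * h x)" "finite F" "F \<subseteq> S"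
  using assms unfolding lin_span_def by blast

lemma lin_span_superset: "V \<subseteq> lin_span V"
proof
  fix f assume "f \<in> V"
  then show "f \<in> lin_span V"
    unfolding lin_span_def by (intro CollectI exI[of _ "{f}"] exI[of _ "\<lambda>_. 1"]) (auto simp: fun_eq_iff)
qed

lemma lin_span_zero: "(\<lambda>x. 0) \<in> lin_span V"
  unfolding lin_span_def by (intro CollectI exI[of _ "{}"] exI[of _ "\<lambda>_. 1"]) auto

lemma lin_span_linear:
  assumes "f \<in> lin_span V" "g \<in> lin_span V"
  shows "(\<lambda>x. c * f x + g x) \<in> lin_span V"
proof -
  obtain F a where F: "f = (\<lambda>x. \<Sum>h\<in>F. a h * h x)" "finite F" "F \<subseteq> V"
    using assms(1) unfolding lin_span_def by blast
  obtain G b where G: "g = (\<lambda>x. \<Sum>h\<in>G. b h * h x)" "finite G" "G \<subseteq> V"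
    using assms(2) unfolding lin_span_def by blast
  define d where "d h = c * (if h \<in> F then a h else 0) + (if h \<in> G then b h else 0)" for h
  have "c * f x + g x = (\<Sum>h\<in>F \<union> G. d h * h x)" for x
  proof -
    have "f x = (\<Sum>h\<in>F \<union> G. (if h \<in> F then a h else 0) * h x)"
      unfolding F(1) using F G by (intro sum.mono_neutral_cong_left) auto
    moreover have "g x = (\<Sum>h\<in>F \<union> G. (if h \<in> G then b h else 0) * h x)"
      unfolding G(1) using F G by (intro sum.mono_neutral_cong_left) auto
    ultimately show ?thesis
      by (simp only: d_def sum_distrib_left distrib_right sum.distrib mult.assoc)
  qed
  then show ?thesis
    unfolding lin_span_def using F G by (intro CollectI exI[of _ "F \<union> G"] exI[of _ d]) (auto simp: fun_eq_iff)
qed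

text \<open>
  The closure is taken inside the square-integrable functions, so that density of the linear span
  amounts to \<open>closed_span M S = L2_space M\<close>.
\<close>
definition closed_span :: "'a measure \<Rightarrow> ('a \<Rightarrow> complex) set \<Rightarrow> ('a \<Rightarrow> complex) set" where
  "closed_span M S = {f \<in> L2_space M. \<forall>\<epsilon>>0. \<exists>g\<in>lin_span S. L2_norm M (\<lambda>x. f x - g x) < \<epsilon>}"

text \<open>
  Multiplication by a bounded function is continuous, so it suffices to know where it sends the
  spanning set.
\<close>
lemma mult_closed_span:
  assumes S: "S \<subseteq> L2_space M" and r [measurable]: "r \<in> borel_measurable M"
    and b: "\<And>x. cmod (r x) \<le> 1"
    and inv: "\<And>f. f \<in> S \<Longrightarrow> (\<lambda>x. r x * f x) \<in> V"
    and V: "closed_subspace M V"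
    and f: "f \<in> L2_space M" and appr: "\<And>\<epsilon>. \<epsilon> > 0 \<Longrightarrow> \<exists>g\<in>lin_span S. L2_norm M (\<lambda>x. f x - g x) < \<epsilon>"
  shows "(\<lambda>x. r x * f x) \<in> V"
proof -
  have spanV: "(\<lambda>x. r x * g x) \<in> V" if "g \<in> lin_span S" for g
  proof -
    from that obtain F c where g: "g = (\<lambda>x. \<Sum>h\<in>F. c h * h x)" "F \<subseteq> S"
      by (rule lin_spanE)
    have "(\<lambda>x. \<Sum>h\<in>F. c h * (r x * h x)) \<in> V"
      using g by (auto intro!: closed_subspace_sum[OF V] closed_subspace_scale[OF V] inv)
    then show ?thesis unfolding g by (simp add: sum_distrib_left algebra_simps)
  qed
  have spanL: "g \<in> L2_space M" if "g \<in> lin_span S" for g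
  proof -
    from that obtain F c where g: "g = (\<lambda>x. \<Sum>h\<in>F. c h * h x)" "F \<subseteq> S"
      by (rule lin_spanE)
    then show ?thesis using S by (auto intro!: L2_sum L2_scale)
  qed
  have rL: "(\<lambda>x. r x * f x) \<in> L2_space M"
    by (rule L2_mult_bounded[OF f _ b]) simp
  have "\<exists>h\<in>V. L2_norm M (\<lambda>x. r x * f x - h x) < \<epsilon>" if "\<epsilon> > 0" for \<epsilon>
  proof -
    obtain g where g: "g \<in> lin_span S" "L2_norm M (\<lambda>x. f x - g x) < \<epsilon>" using appr \<open>\<epsilon> > 0\<close> by blast
    note gL = spanL[OF g(1)]
    have "L2_norm M (\<lambda>x. r x * f x - r x * g x) \<le> L2_norm M (\<lambda>x. f x - g x)"
    proof (rule L2_norm_mono)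
      show "AE x in M. cmod (r x * f x - r x * g x) \<le> cmod (f x - g x)"
        using b by (auto simp: right_diff_distrib[symmetric] norm_mult intro!: mult_left_le_one_le)
    qed (use L2_measurable[OF f] L2_measurable[OF gL] in \<open>auto intro: L2_diff f gL\<close>)
    then show ?thesis using g(2) by (intro bexI[OF _ spanV[OF g(1)]]) simp
  qed
  then show ?thesis using V rL by (simp add: closed_subspace_def)
qed

lemma lin_span_L2:
  assumes "S \<subseteq> L2_space M"
  shows "lin_span S \<subseteq> L2_space M"
proof
  fix g assume "g \<in> lin_span S"
  then obtain F c where g: "g = (\<lambda>x. \<Sum>h\<in>F. c h * h x)" "F \<subseteq> S"
    by (rule lin_spanE)
  then show "g \<in> L2_space M" using assms by (auto intro!: L2_sum L2_scale)
qed

lemma closed_subspace_closed_span: "S \<subseteq> L2_space M \<Longrightarrow> closed_subspace M (closed_span M S)"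
  unfolding closed_span_def
  by (rule closed_subspace_closure[OF lin_span_L2 lin_span_zero lin_span_linear])

lemma closed_span_superset:
  assumes "S \<subseteq> L2_space M"
  shows "S \<subseteq> closed_span M S"
proof
  fix f assume f: "f \<in> S"
  then have "f \<in> lin_span S" using lin_span_superset by blast
  moreover have "L2_norm M (\<lambda>x. f x - f x) = 0" by (simp add: L2_norm_def)
  ultimately show "f \<in> closed_span M S" unfolding closed_span_def
    using f assms by (auto intro!: bexI[of _ f])
qed

context spectral_measure
begin

text \<open>
  Up to null sets the vectors (H - z)^-1 u_+ are the multiples of 1 / ((x - z) (x - i)). By the
  resolvent identity their closed span is invariant under multiplication by 1 / (x - i) and 1 / (x
  + i), hence under the Cayley transform (x + i) / (x - i) and its conjugate. The Cayley transform
  is an injective unimodular function, so \<open>cyclic_vector_dense\<close> applies.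
\<close>
theorem prime_mult_op_restr:
  assumes sa: "self_adjoint_op \<omega> (mult_op \<omega>)"
  shows "prime_op \<omega> (mult_op_restr \<omega>)"
proof -
  define S where "S = {f. \<exists>g u z. Im z \<noteq> 0 \<and> u \<in> eigenspace \<omega> (adjoint_op \<omega> (mult_op_restr \<omega>)) \<i> \<and>
                (f, g) \<in> mult_op \<omega> \<and> ae_eq \<omega> (\<lambda>x. g x - z * f x) u}"
  define R where "R z x = 1 / (complex_of_real x - z)" for z x
  have [measurable]: "R z \<in> borel_measurable borel" for z unfolding R_def by measurable
  have RL: "R z \<in> L2_space \<omega>" if "Im z \<noteq> 0" for z unfolding R_def using that by simp
  have Rb: "cmod (R z x) \<le> 1" if "\<bar>Im z\<bar> \<ge> 1" for z x
  proof -
    have "1 \<le> cmod (of_real x - z)" using Im_le_distance[of z x] that by linarith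
    then show ?thesis unfolding R_def norm_divide norm_one by (intro divide_le_eq_1_pos[THEN iffD2]) auto
  qed
  have SL: "S \<subseteq> L2_space \<omega>" by (auto simp: S_def mult_op_iff)
  have RR_L: "(\<lambda>x. R z x * R \<i> x) \<in> L2_space \<omega>" if "Im z \<noteq> 0" for z
  proof (rule L2_mult_bounded[where C = "1 / \<bar>Im z\<bar>"])
    show "cmod (R z x) \<le> 1 / \<bar>Im z\<bar>" for x
      using Im_le_distance[of z x] nonreal_distance[OF that, of x] that
      by (auto simp: R_def norm_divide intro!: divide_left_mono mult_pos_pos)
  qed (use RL[of \<i>] in auto)
  have S_gen: "(\<lambda>x. R z x * R \<i> x) \<in> S" if z: "Im z \<noteq> 0" for z
  proof -
    have u: "R \<i> \<in> eigenspace \<omega> max_op \<i>"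
      by (subst eigenspace_max_op) (auto simp: R_def intro!: exI[of _ 1])
    have e: "of_real x * (R z x * R \<i> x) = R \<i> x + z * (R z x * R \<i> x)" for x
      using nonreal_distance[OF z, of x] nonreal_distance[of \<i> x] by (simp add: R_def divide_simps)
    have L: "(\<lambda>x. of_real x * (R z x * R \<i> x)) \<in> L2_space \<omega>"
      unfolding e using RR_L[OF z] RL[of \<i>] by (intro L2_add L2_scale) auto
    have "(\<lambda>x. R z x * R \<i> x, \<lambda>x. of_real x * (R z x * R \<i> x)) \<in> mult_op \<omega>"
      using RR_L[OF z] L by (simp add: mult_op_iff)
    moreover have "ae_eq \<omega> (\<lambda>x. of_real x * (R z x * R \<i> x) - z * (R z x * R \<i> x)) (R \<i>)"
      unfolding e by (simp add: ae_eq_def)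
    ultimately show ?thesis unfolding S_def adjoint_restr_eq using z u by blast
  qed
  have S_form: "\<exists>c z. Im z \<noteq> 0 \<and> (AE x in \<omega>. f x = c * (R z x * R \<i> x))" if "f \<in> S" for f
  proof -
    from that obtain g u z where z: "Im z \<noteq> 0" and u: "u \<in> eigenspace \<omega> max_op \<i>" and fg: "(f, g) \<in> mult_op \<omega>"
      and ae: "AE x in \<omega>. g x - z * f x = u x"
      unfolding S_def adjoint_restr_eq ae_eq_def by blast
    obtain c where c: "AE x in \<omega>. u x = c * (1 / (of_real x - \<i>))"
      using u by (subst (asm) eigenspace_max_op) auto
    have "AE x in \<omega>. g x = of_real x * f x" using fg by (simp add: mult_op_iff)
    then have "AE x in \<omega>. f x = c * (R z x * R \<i> x)"
      using ae c
    proof eventually_elim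
      case (elim x)
      then have "(of_real x - z) * f x = c * R \<i> x" by (simp add: R_def algebra_simps)
      then have "f x = c * R \<i> x / (of_real x - z)"
        using nonreal_distance[OF z, of x] by (simp only: eq_divide_eq not_False_eq_True if_True mult.commute)
      then show ?case by (simp add: R_def)
    qed
    then show ?thesis using z by blast
  qed
  define V where "V = closed_span \<omega> S"
  have V: "closed_subspace \<omega> V"
    unfolding V_def by (rule closed_subspace_closed_span[OF SL])
  have SV: "f \<in> V" if "f \<in> S" for f
    using that closed_span_superset[OF SL] unfolding V_def by blast
  \<comment> \<open>the resolvent identity, by partial fractions\<close>
  have R2: "(\<lambda>x. R s x * (R z x * R \<i> x)) \<in> V" if s: "Im s \<noteq> 0" and z: "Im z \<noteq> 0" and ne: "s \<noteq> z" for s z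
  proof -
    have e: "R s x * (R z x * R \<i> x) = (1 / (z - s)) * (R z x * R \<i> x) + (- 1 / (z - s)) * (R s x * R \<i> x)" for x
    proof -
      define a b where "a = of_real x - s" and "b = of_real x - z"
      have "a \<noteq> 0" "b \<noteq> 0" "a - b = z - s" "a - b \<noteq> 0"
        using nonreal_distance[OF s, of x] nonreal_distance[OF z, of x] ne by (auto simp: a_def b_def)
      then have "1 / a * (1 / b) = (1 / (z - s)) * (1 / b) + (- 1 / (z - s)) * (1 / a)"
        by (simp only: flip: \<open>a - b = z - s\<close>) (simp add: divide_simps)
      then have "R s x * R z x = (1 / (z - s)) * R z x + (- 1 / (z - s)) * R s x"
        by (simp only: R_def a_def b_def)
      then have "R s x * R z x * R \<i> x = ((1 / (z - s)) * R z x + (- 1 / (z - s)) * R s x) * R \<i> x"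
        by (simp only:)
      then show ?thesis by (simp only: distrib_right mult.assoc)
    qed
    show ?thesis unfolding e using s z
      by (intro closed_subspace_add[OF V] closed_subspace_scale[OF V] SV S_gen)
  qed
  have R2': "(\<lambda>x. R s x * (R z x * R \<i> x)) \<in> V" if s: "s = \<i> \<or> s = - \<i>" and z: "Im z \<noteq> 0" for s z
  proof (cases "s = z")
    case True
    \<comment> \<open>for s = z partial fractions are not available; s is approximated from outside the strip |Im z| <
      1, where the kernels are bounded by one\<close>
    define zz where "zz n = s * of_real (1 + 1 / real (Suc n))" for n
    have zz: "\<bar>Im (zz n)\<bar> \<ge> 1" "zz n \<noteq> s" "Im (zz n) \<noteq> 0" for n
    proof -
      have "1 / real (Suc n) > 0" by simp
      have s1: "\<bar>Im s\<bar> = 1" using s by auto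
      have "Im (zz n) = Im s * (1 + 1 / real (Suc n))"
        unfolding zz_def by (simp only: times_complex.sel Re_complex_of_real Im_complex_of_real mult_zero_right add_0)
      then have "\<bar>Im (zz n)\<bar> = 1 + 1 / real (Suc n)"
        using s1 \<open>1 / real (Suc n) > 0\<close> by (simp add: abs_mult)
      moreover note s1
      ultimately have "\<bar>Im (zz n)\<bar> > 1" "\<bar>Im s\<bar> = 1"
        using \<open>1 / real (Suc n) > 0\<close> by linarith+
      then show "\<bar>Im (zz n)\<bar> \<ge> 1" "zz n \<noteq> s" "Im (zz n) \<noteq> 0" by auto
    qed
    have s1: "\<bar>Im s\<bar> \<ge> 1" "Im s \<noteq> 0" using s by auto
    have "(\<lambda>n. 1 + 1 / real (Suc n)) \<longlonglongrightarrow> 1 + 0"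
      by (intro tendsto_add tendsto_const LIMSEQ_Suc lim_1_over_n)
    then have "zz \<longlonglongrightarrow> s * of_real (1 + 0)"
      unfolding zz_def by (intro tendsto_mult tendsto_const tendsto_of_real)
    then have zzl: "zz \<longlonglongrightarrow> s" by simp
    have m: "(\<lambda>x. R s x * (R s x * R \<i> x)) \<in> borel_measurable \<omega>"
        "\<And>n. (\<lambda>x. R s x * (R (zz n) x * R \<i> x)) \<in> borel_measurable \<omega>" by measurable
    have b: "AE x in \<omega>. cmod (R s x * (R (zz n) x * R \<i> x)) \<le> cmod (R \<i> x)" for n
    proof (rule AE_I2)
      fix x
      have "cmod (R s x) * (cmod (R (zz n) x) * cmod (R \<i> x)) \<le> 1 * (1 * cmod (R \<i> x))"
        using Rb[OF s1(1), of x] Rb[OF zz(1), of n x] by (intro mult_mono) auto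
      then show "cmod (R s x * (R (zz n) x * R \<i> x)) \<le> cmod (R \<i> x)" by (simp add: norm_mult)
    qed
    have l: "AE x in \<omega>. (\<lambda>n. R s x * (R (zz n) x * R \<i> x)) \<longlonglongrightarrow> R s x * (R s x * R \<i> x)"
      using nonreal_distance[OF s1(2)] unfolding R_def
      by (intro AE_I2 tendsto_intros zzl) auto
    have "(\<lambda>x. R s x * (R s x * R \<i> x)) \<in> V"
      using closed_subspace_limit[OF V R2 L2_dominated_convergence[OF RL m(2) m(1) b l]] zz s1 by auto
    then show ?thesis using True by simp
  qed (use R2[OF _ z] s in auto)
  have inv: "(\<lambda>x. R s x * f x) \<in> V" if s: "s = \<i> \<or> s = - \<i>" and f: "f \<in> V" for s f
  proof (rule mult_closed_span[OF SL])
    show "cmod (R s x) \<le> 1" for x using s by (intro Rb) auto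
    show "f \<in> L2_space \<omega>" "\<And>\<epsilon>. \<epsilon> > 0 \<Longrightarrow> \<exists>g\<in>lin_span S. L2_norm \<omega> (\<lambda>x. f x - g x) < \<epsilon>"
      using f unfolding V_def closed_span_def by auto
    fix g assume g: "g \<in> S"
    then obtain c z where z: "Im z \<noteq> 0" "AE x in \<omega>. g x = c * (R z x * R \<i> x)"
      using S_form by blast
    have gm [measurable]: "g \<in> borel_measurable borel" using g SL L2_measurable by fastforce
    show "(\<lambda>x. R s x * g x) \<in> V"
    proof (rule closed_subspace_ae[OF V])
      show "(\<lambda>x. c * (R s x * (R z x * R \<i> x))) \<in> V"
        by (intro closed_subspace_scale[OF V] R2' s z)
      show "AE x in \<omega>. c * (R s x * (R z x * R \<i> x)) = R s x * g x"
        using z(2) by eventually_elim simp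
    qed measurable
  qed (use V in auto)
  define \<zeta> where "\<zeta> x = 1 + 2 * \<i> * R \<i> x" for x
  have \<zeta>: "\<zeta> x = (of_real x + \<i>) / (of_real x - \<i>)" for x
    using nonreal_distance[of \<i> x] by (simp add: \<zeta>_def R_def divide_simps)
  have cnjR: "cnj (R \<i> x) = R (- \<i>) x" for x by (simp add: R_def)
  have VL: "V = L2_space \<omega>"
  proof (rule cyclic_vector_dense[OF V])
    show "\<zeta> \<in> borel_measurable \<omega>" unfolding \<zeta>_def by measurable
    show "cmod (\<zeta> x) = 1" for x
    proof -
      have "cmod (of_real x + \<i>) = cmod (cnj (of_real x - \<i>))" by simp
      then have "cmod (of_real x + \<i>) = cmod (of_real x - \<i>)" by (simp only: complex_mod_cnj)
      then show ?thesis unfolding \<zeta> norm_divide using nonreal_distance[of \<i> x] by simp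
    qed
    show "(\<lambda>x. \<zeta> x * f x) \<in> V" if "f \<in> V" for f
    proof -
      have "(\<lambda>x. f x + (2 * \<i>) * (R \<i> x * f x)) \<in> V"
        using that by (intro closed_subspace_add[OF V] closed_subspace_scale[OF V] inv) auto
      then show ?thesis by (simp add: \<zeta>_def algebra_simps)
    qed
    show "(\<lambda>x. cnj (\<zeta> x) * f x) \<in> V" if "f \<in> V" for f
    proof -
      have "(\<lambda>x. f x + (- 2 * \<i>) * (R (- \<i>) x * f x)) \<in> V"
        using that by (intro closed_subspace_add[OF V] closed_subspace_scale[OF V] inv) auto
      then show ?thesis by (simp add: \<zeta>_def cnjR algebra_simps)
    qed
    show "(\<lambda>x. R (- \<i>) x * R \<i> x) \<in> V" by (intro SV S_gen) simp
    show "AE x in \<omega>. R (- \<i>) x * R \<i> x \<noteq> 0"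
      using nonreal_distance[of \<i>] nonreal_distance[of "- \<i>"] by (auto simp: R_def)
    fix A assume A: "A \<in> sets \<omega>"
    \<comment> \<open>the inverse of the Cayley transform\<close>
    define \<xi> where "\<xi> z = Re (\<i> * (z + 1) / (z - 1))" for z
    have inv: "\<xi> (\<zeta> x) = x" for x
    proof -
      define d where "d = of_real x - \<i>"
      have d: "d \<noteq> 0" using nonreal_distance[of \<i> x] by (simp add: d_def)
      have "\<zeta> x + 1 = 2 * of_real x / d" "\<zeta> x - 1 = 2 * \<i> / d"
        unfolding \<zeta> using d by (simp_all add: d_def divide_simps)
      then have "\<i> * (\<zeta> x + 1) / (\<zeta> x - 1) = of_real x" using d by simp
      then show ?thesis by (simp add: \<xi>_def)
    qed
    have [measurable]: "\<xi> \<in> borel_measurable borel" unfolding \<xi>_def by measurable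
    have "\<xi> -` A \<inter> space borel \<in> sets borel" using A by (intro measurable_sets) auto
    then show "\<exists>C\<in>sets borel. AE x in \<omega>. (x \<in> A) = (\<zeta> x \<in> C)"
      using inv by (intro bexI[of _ "\<xi> -` A"]) auto
  qed
  have "L2_dense \<omega> (lin_span S)"
    unfolding L2_dense_def using VL unfolding V_def closed_span_def by blast
  then show ?thesis
    unfolding prime_op_def S_def using sa restr_subset_mult_op by blast
qed

lemma emeasure_interval_finite: "emeasure \<omega> {- real n..real n} < \<infinity>"
proof -
  have pos: "1 + x\<^sup>2 > 0" for x :: real by (simp add: add_pos_nonneg)
  have "emeasure \<omega> {- real n..real n} = (\<integral>\<^sup>+x. indicator {- real n..real n} x \<partial>\<omega>)" by simp
  also have "\<dots> \<le> (\<integral>\<^sup>+x. ennreal (1 + (real n)\<^sup>2) * ennreal (1 / (1 + x\<^sup>2)) \<partial>\<omega>)"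
  proof (rule nn_integral_mono)
    fix x :: real
    show "indicator {- real n..real n} x \<le> ennreal (1 + (real n)\<^sup>2) * ennreal (1 / (1 + x\<^sup>2))"
    proof (cases "x \<in> {- real n..real n}")
      case True
      then have "x\<^sup>2 \<le> (real n)\<^sup>2" by (intro abs_le_square_iff[THEN iffD1]) auto
      then have "1 \<le> (1 + (real n)\<^sup>2) * (1 / (1 + x\<^sup>2))" using pos[of x] by (simp add: field_simps)
      then have "ennreal 1 \<le> ennreal ((1 + (real n)\<^sup>2) * (1 / (1 + x\<^sup>2)))" by (rule ennreal_leI)
      then show ?thesis using True pos[of x] by (subst ennreal_mult[symmetric]) auto
    qed simp
  qed
  also have "\<dots> = ennreal (1 + (real n)\<^sup>2)"
    by (subst nn_integral_cmult) (auto simp: normalized)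
  finally show ?thesis by (simp add: le_less_trans)
qed

end

locale infinite_spectral_measure = spectral_measure +
  assumes infinite_mass: "(\<integral>\<^sup>+x. 1 \<partial>\<omega>) = \<infinity>"
begin

text \<open>
  This is where the infinite total mass of \<omega> enters.
\<close>
lemma measure_interval_unbounded: "filterlim (\<lambda>n. measure \<omega> {- real n..real n}) at_top sequentially"
proof -
  have inc: "incseq (\<lambda>n. {- real n..real n})" by (auto simp: incseq_def)
  have un: "(\<Union>n. {- real n..real n}) = UNIV"
  proof -
    have "\<exists>n. x \<in> {- real n..real n}" for x
    proof -
      obtain n where "\<bar>x\<bar> \<le> real n" using real_arch_simple by blast
      then have "x \<in> {- real n..real n}" by auto
      then show ?thesis by blast
    qed
    then show ?thesis by blast
  qed
  have "(\<lambda>n. emeasure \<omega> {- real n..real n}) \<longlonglongrightarrow> emeasure \<omega> (\<Union>n. {- real n..real n})"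
    by (rule Lim_emeasure_incseq) (use inc in auto)
  then have l: "(\<lambda>n. emeasure \<omega> {- real n..real n}) \<longlonglongrightarrow> \<infinity>"
    using infinite_mass by (simp add: un)
  show ?thesis unfolding filterlim_at_top
  proof
    fix Z :: real
    have "\<forall>\<^sub>F n in sequentially. ennreal Z < emeasure \<omega> {- real n..real n}"
      using l by (rule order_tendstoD) simp
    then show "\<forall>\<^sub>F n in sequentially. Z \<le> measure \<omega> {- real n..real n}"
    proof eventually_elim
      case (elim n)
      then have "ennreal Z < ennreal (measure \<omega> {- real n..real n})"
        using emeasure_interval_finite[of n] by (simp add: emeasure_eq_ennreal_measure less_top[symmetric])
      then show ?case by (cases "Z \<ge> 0") (auto simp: ennreal_less_iff intro: order_trans[of Z 0])
    qed
  qed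
qed

text \<open>
  A truncated function lies in the domain of multiplication by x but may have integral m \<noteq>
  0. Subtracting m / \<mu> on an interval of mass \<mu> corrects the integral at the cost |m| /
  sqrt \<mu> in norm, which is small since \<mu> can be taken arbitrarily large.
\<close>
lemma dense_restr: "densely_defined \<omega> (mult_op_restr \<omega>)"
  unfolding densely_defined_def L2_dense_def
proof (intro ballI allI impI)
  fix h and e :: real assume h: "h \<in> L2_space \<omega>" and e: "e > 0"
  have [measurable]: "h \<in> borel_measurable borel" using L2_measurable[OF h] by simp
  define I where "I n = {- real n..real n}" for n
  have Im [measurable]: "I n \<in> sets borel" for n by (simp add: I_def)
  have Ifin: "emeasure \<omega> (I n) < \<infinity>" for n unfolding I_def by (rule emeasure_interval_finite)
  have restr: "(f, \<lambda>x. of_real x * f x) \<in> mult_op \<omega>"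
    if f: "f \<in> L2_space \<omega>" and z: "\<And>x. x \<notin> I n \<Longrightarrow> f x = 0" for f n
  proof -
    have [measurable]: "f \<in> borel_measurable borel" using L2_measurable[OF f] by simp
    have "(\<lambda>x. of_real x * f x) \<in> L2_space \<omega>"
    proof (rule L2_dominated[OF L2_scale[OF f, of "of_real (real n)"]])
      show "AE x in \<omega>. cmod (of_real x * f x) \<le> cmod (of_real (real n) * f x)"
      proof (rule AE_I2)
        fix x show "cmod (of_real x * f x) \<le> cmod (of_real (real n) * f x)"
          by (cases "x \<in> I n") (auto simp: z norm_mult I_def intro!: mult_right_mono)
      qed
    qed simp
    then show ?thesis using f by (simp add: mult_op_iff)
  qed
  define H where "H n x = indicator (I n) x * h x" for n x
  have b: "AE x in \<omega>. cmod (H n x) \<le> cmod (h x)" for n by (auto simp: H_def indicator_def)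
  have l: "AE x in \<omega>. (\<lambda>n. H n x) \<longlonglongrightarrow> h x"
  proof (rule AE_I2)
    fix x :: real
    obtain N where N: "\<bar>x\<bar> \<le> real N" using real_arch_simple by blast
    have "H n x = h x" if "n \<ge> N" for n
    proof -
      have "real N \<le> real n" using that by simp
      then have "x \<in> I n" using N unfolding I_def by auto
      then show ?thesis by (simp add: H_def)
    qed
    then show "(\<lambda>n. H n x) \<longlonglongrightarrow> h x"
      by (intro tendsto_eventually) (auto simp: eventually_sequentially)
  qed
  have [measurable]: "H n \<in> borel_measurable borel" for n unfolding H_def by measurable
  have Hl: "(\<lambda>n. L2_norm \<omega> (\<lambda>x. H n x - h x)) \<longlonglongrightarrow> 0"
    by (rule L2_dominated_convergence(2)[OF h _ _ b l]) simp_all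
  obtain n where n: "L2_norm \<omega> (\<lambda>x. H n x - h x) < e / 2"
    using order_tendstoD(2)[OF Hl, of "e/2"] e by (auto dest: eventually_happens)
  have HL: "H n \<in> L2_space \<omega>" by (rule L2_dominated[OF h _ b]) simp
  define m where "m = (\<integral>x. H n x \<partial>\<omega>)"
  have Hm: "(H n, \<lambda>x. of_real x * H n x) \<in> mult_op \<omega>"
    by (rule restr[OF HL, of n]) (simp add: H_def)
  note Hi = mult_op_integrable[OF Hm]
  have "\<forall>\<^sub>F k in sequentially. (2 * (cmod m + 1) / e)\<^sup>2 + 1 \<le> measure \<omega> (I k)"
    using measure_interval_unbounded unfolding filterlim_at_top I_def by blast
  then obtain k where k: "(2 * (cmod m + 1) / e)\<^sup>2 + 1 \<le> measure \<omega> (I k)"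
    by (auto dest: eventually_happens)
  define \<mu> where "\<mu> = measure \<omega> (I k)"
  have \<mu>: "\<mu> > 0" "(2 * (cmod m + 1) / e)\<^sup>2 < \<mu>"
    using k zero_le_power2[of "2 * (cmod m + 1) / e"] unfolding \<mu>_def by linarith+
  define q where "q x = (m / of_real \<mu>) * indicator (I k) x" for x
  have sq: "(cmod (q x))\<^sup>2 = (cmod m / \<mu>)\<^sup>2 * indicator (I k) x" for x
    using \<mu> by (auto simp: q_def norm_mult norm_divide indicator_def)
  have qL: "q \<in> L2_space \<omega>"
  proof (rule L2_spaceI)
    show "q \<in> borel_measurable \<omega>" unfolding q_def by measurable
    show "integrable \<omega> (\<lambda>x. (cmod (q x))\<^sup>2)" unfolding sq using Ifin[of k] by simp
  qed
  have "(L2_norm \<omega> q)\<^sup>2 = (cmod m / \<mu>)\<^sup>2 * \<mu>"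
    unfolding L2_norm_square sq using Ifin[of k] by (simp add: \<mu>_def)
  also have "\<dots> = (cmod m)\<^sup>2 / \<mu>" using \<mu> by (simp add: power2_eq_square)
  also have "\<dots> < (e / 2)\<^sup>2"
  proof -
    have "(cmod m)\<^sup>2 \<le> (cmod m + 1)\<^sup>2" by (intro power_mono) auto
    also have "\<dots> = (e / 2)\<^sup>2 * (2 * (cmod m + 1) / e)\<^sup>2"
      unfolding power_mult_distrib[symmetric] using e by simp
    also have "\<dots> < (e / 2)\<^sup>2 * \<mu>" using \<mu> e by (intro mult_strict_left_mono) auto
    finally show ?thesis using \<mu> by (simp add: pos_divide_less_eq)
  qed
  finally have qn: "L2_norm \<omega> q < e / 2" by (rule power_less_imp_less_base) (use e in simp)
  have qm: "(q, \<lambda>x. of_real x * q x) \<in> mult_op \<omega>"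
    by (rule restr[OF qL, of k]) (simp add: q_def)
  have "(\<integral>x. indicator (I k) x \<partial>\<omega>) = complex_of_real \<mu>"
    using integral_complex_of_real[of \<omega> "indicator (I k)"] by (simp add: \<mu>_def of_real_indicator)
  then have qi: "(\<integral>x. q x \<partial>\<omega>) = m" unfolding q_def using \<mu> by simp
  define f where "f x = H n x - q x" for x
  have fL: "f \<in> L2_space \<omega>" unfolding f_def using HL qL by simp
  have "(\<lambda>x. of_real x * f x) \<in> L2_space \<omega>"
    using Hm qm by (simp add: f_def mult_op_iff right_diff_distrib)
  then have fm: "(f, \<lambda>x. of_real x * f x) \<in> mult_op \<omega>" using fL by (simp add: mult_op_iff)
  have "(\<integral>x. f x \<partial>\<omega>) = 0"
    unfolding f_def using Hi mult_op_integrable[OF qm] qi by (simp add: m_def)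
  then have "(f, \<lambda>x. of_real x * f x) \<in> mult_op_restr \<omega>" using fm by (simp add: mult_op_restr_def)
  moreover have "L2_norm \<omega> (\<lambda>x. h x - f x) < e"
  proof -
    have "L2_norm \<omega> (\<lambda>x. h x - f x) = L2_norm \<omega> (\<lambda>x. (h x - H n x) + q x)"
      by (simp add: f_def algebra_simps)
    also have "\<dots> \<le> L2_norm \<omega> (\<lambda>x. h x - H n x) + L2_norm \<omega> q"
      using h HL qL by (intro L2_norm_triangle) auto
    also have "\<dots> < e" using n qn by (simp add: L2_norm_minus_commute[of \<omega> h])
    finally show ?thesis .
  qed
  ultimately show "\<exists>f\<in>fst ` mult_op_restr \<omega>. L2_norm \<omega> (\<lambda>x. h x - f x) < e"
    by (intro bexI[of _ f]) force+
qed

lemma dense_between: "mult_op_restr \<omega> \<subseteq> B \<Longrightarrow> densely_defined \<omega> B"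
  using dense_restr unfolding densely_defined_def L2_dense_def by (meson image_mono subset_iff)

lemma closed_adjoint_between:
  assumes "mult_op_restr \<omega> \<subseteq> B" "B \<subseteq> max_op"
  shows "closed_operator \<omega> (adjoint_op \<omega> B)"
  by (rule closed_adjoint) (use assms max_op_subset dense_between in auto)

lemma closed_mult_op: "closed_operator \<omega> (mult_op \<omega>)"
  using closed_adjoint_between[OF mult_op_between] by (simp add: adjoint_mult_op)

lemma self_adjoint_mult_op: "self_adjoint_op \<omega> (mult_op \<omega>)"
  using closed_mult_op dense_between[OF mult_op_between(1)]
  by (simp add: self_adjoint_op_def closed_operator_def adjoint_mult_op)

lemma closed_mult_op_restr: "closed_operator \<omega> (mult_op_restr \<omega>)"
  using closed_adjoint_between[of max_op] mult_op_between by (auto simp: adjoint_max_op)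

lemma symmetric_mult_op_restr: "symmetric_op \<omega> (mult_op_restr \<omega>)"
  using closed_mult_op_restr dense_restr mult_op_between
  by (auto simp: symmetric_op_def closed_operator_def adjoint_restr_eq)

lemma deficiency_mult_op_restr: "deficiency_indices_one_one \<omega> (mult_op_restr \<omega>)"
  unfolding deficiency_indices_one_one_def adjoint_restr_eq
  by (auto intro: eigenspace_one_dimensional)

lemma closed_ext: "closed_operator \<omega> (ext w)"
  using closed_adjoint_between[OF ext_between, of "cnj w"] by (simp add: adjoint_ext)

lemma self_adjoint_ext_iff: "self_adjoint_op \<omega> (ext w) \<longleftrightarrow> Im w = 0"
proof
  assume "self_adjoint_op \<omega> (ext w)"
  then have "ext (cnj w) = ext w" by (simp add: self_adjoint_op_def adjoint_ext)
  moreover have "(boundary_u 1 w, boundary_v 1 w) \<in> ext w"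
    using boundary_surjective[of 1 w] by (simp add: ext_def)
  ultimately have "(boundary_u 1 w, boundary_v 1 w) \<in> ext (cnj w)" by simp
  then have "w = cnj w" using boundary_surjective[of 1 w] by (simp add: ext_def)
  then show "Im w = 0" by (simp add: complex_eq_iff)
next
  assume "Im w = 0"
  then have "cnj w = w" by (simp add: complex_eq_iff)
  then show "self_adjoint_op \<omega> (ext w)"
    using closed_ext[of w] dense_between[OF ext_between(1)]
    by (simp add: self_adjoint_op_def closed_operator_def adjoint_ext)
qed

lemma quasi_hermitian_ext:
  assumes "Im w \<noteq> 0"
  shows "quasi_hermitian_extension \<omega> (mult_op_restr \<omega>) (ext w)"
proof -
  have "(boundary_u 1 w, boundary_v 1 w) \<in> ext w" "(boundary_u 1 w, boundary_v 1 w) \<notin> mult_op_restr \<omega>"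
    using boundary_surjective[of 1 w] by (simp_all add: ext_def mult_op_restr_eq)
  moreover have "(boundary_u 0 1, boundary_v 0 1) \<in> max_op" "(boundary_u 0 1, boundary_v 0 1) \<notin> ext w"
    using boundary_surjective[of 0 1] by (simp_all add: ext_def)
  ultimately show ?thesis
    unfolding quasi_hermitian_extension_def adjoint_restr_eq
    using closed_ext ext_between[of w] self_adjoint_ext_iff assms by blast
qed

text \<open>
  The boundary values of an intermediate operator form a linear subspace of \<complex>^2 that is
  neither zero nor everything, hence a line. The line jump = 0 is excluded because it gives a
  self-adjoint operator.
\<close>
theorem quasi_hermitian_extension_is_ext:
  assumes "quasi_hermitian_extension \<omega> (mult_op_restr \<omega>) S"
  obtains w where "S = ext w" "Im w \<noteq> 0"
proof -
  have S: "closed_operator \<omega> S" "mult_op_restr \<omega> \<subset> S" "S \<subset> max_op" "\<not> self_adjoint_op \<omega> S"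
    using assms by (auto simp: quasi_hermitian_extension_def adjoint_restr_eq)
  have lin: "(\<lambda>x. c * f x + f' x, \<lambda>x. c * g x + g' x) \<in> S" if "(f, g) \<in> S" "(f', g') \<in> S" for c f g f' g'
  proof -
    have "\<forall>c. \<forall>(f, g)\<in>S. \<forall>(f', g')\<in>S. (\<lambda>x. c * f x + f' x, \<lambda>x. c * g x + g' x) \<in> S"
      using S(1) unfolding closed_operator_def linear_operator_def by (elim conjE) assumption
    from this[rule_format, OF that(1), simplified, rule_format, OF that(2)] show ?thesis by simp
  qed
  \<comment> \<open>membership in S depends on the boundary values only\<close>
  have bv: "(u', v') \<in> S" if uv: "(u, v) \<in> S" and m: "(u', v') \<in> max_op"
    and e: "jump u' v' = jump u v" "trace u' v' = trace u v" for u v u' v'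
  proof -
    have uvm: "(u, v) \<in> max_op" using uv S(3) by blast
    have "(\<lambda>x. (-1) * u x + u' x, \<lambda>x. (-1) * v x + v' x) \<in> mult_op_restr \<omega>"
      using boundary_linear[OF uvm m, of "-1"] e by (simp add: mult_op_restr_eq)
    then have "(\<lambda>x. (-1) * u x + u' x, \<lambda>x. (-1) * v x + v' x) \<in> S" using S(2) by blast
    from lin[OF uv this, of 1] show ?thesis by simp
  qed
  have comb: "(u', v') \<in> S" if uv: "(u1, v1) \<in> S" "(u2, v2) \<in> S" and m: "(u', v') \<in> max_op"
    and e: "jump u' v' = a * jump u1 v1 + b * jump u2 v2" "trace u' v' = a * trace u1 v1 + b * trace u2 v2"
    for u1 v1 u2 v2 u' v' a b
  proof -
    have "(\<lambda>x. a * u1 x + (b * u2 x + 0), \<lambda>x. a * v1 x + (b * v2 x + 0)) \<in> S"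
      using zero_in_restr S(2) by (intro lin uv) auto
    then have i: "(\<lambda>x. a * u1 x + b * u2 x, \<lambda>x. a * v1 x + b * v2 x) \<in> S" by simp
    have m12: "(u1, v1) \<in> max_op" "(u2, v2) \<in> max_op" using uv S(3) by auto
    have m0: "(\<lambda>x. 0, \<lambda>x. 0) \<in> max_op" "jump (\<lambda>x. 0) (\<lambda>x. 0) = 0" "trace (\<lambda>x. 0) (\<lambda>x. 0) = 0"
      using zero_in_restr by (auto simp: mult_op_restr_eq)
    note b2 = boundary_linear[OF m12(2) m0(1), of b, unfolded m0 add_0_right]
    note b1 = boundary_linear[OF m12(1) b2(1), of a]
    show ?thesis
      by (rule bv[OF i m]) (simp_all add: b1(2,3) b2(2,3) e)
  qed
  obtain u0 v0 where uv0: "(u0, v0) \<in> S" "(u0, v0) \<notin> mult_op_restr \<omega>"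
    using S(2) by auto
  define c0 t0 where "c0 = jump u0 v0" and "t0 = trace u0 v0"
  have nz: "c0 \<noteq> 0 \<or> t0 \<noteq> 0" using uv0 S(3) by (auto simp: mult_op_restr_eq c0_def t0_def)
  \<comment> \<open>some element of the adjoint lies outside S, so the boundary values of S are not all of the plane\<close>
  obtain u9 v9 where uv9: "(u9, v9) \<in> max_op" "(u9, v9) \<notin> S" using S(3) by auto
  have line: "jump u v * t0 = trace u v * c0" if uv: "(u, v) \<in> S" for u v
  proof (rule ccontr)
    assume ne: "jump u v * t0 \<noteq> trace u v * c0"
    define D where "D = jump u v * t0 - trace u v * c0"
    have D: "D \<noteq> 0" using ne by (simp add: D_def)
    \<comment> \<open>Cramer's rule: independent boundary values would generate those of (u9, v9)\<close>
    define a where "a = (jump u9 v9 * t0 - trace u9 v9 * c0) / D"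
    define b where "b = (jump u v * trace u9 v9 - trace u v * jump u9 v9) / D"
    have "jump u9 v9 = (jump u9 v9 * D) / D" "trace u9 v9 = (trace u9 v9 * D) / D" using D by simp_all
    then have "jump u9 v9 = a * jump u v + b * c0" "trace u9 v9 = a * trace u v + b * t0"
      unfolding a_def b_def by (simp_all add: D_def add_divide_distrib[symmetric] diff_divide_distrib[symmetric] algebra_simps)
    then have "(u9, v9) \<in> S" using comb[OF uv uv0(1) uv9(1), of a b] by (simp add: c0_def t0_def)
    then show False using uv9 by blast
  qed
  have full: "(u, v) \<in> S" if m: "(u, v) \<in> max_op" and e: "jump u v = a * c0" "trace u v = a * t0" for u v a
    using comb[OF uv0(1) uv0(1) m, of a 0] e by (simp add: c0_def t0_def)
  have c0: "c0 \<noteq> 0"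
  proof
    assume c0: "c0 = 0"
    then have t0: "t0 \<noteq> 0" using nz by simp
    have "S = mult_op \<omega>"
    proof (rule set_eqI)
      fix p :: "(real \<Rightarrow> complex) \<times> (real \<Rightarrow> complex)"
      obtain u v where p: "p = (u, v)" by (cases p)
      show "p \<in> S \<longleftrightarrow> p \<in> mult_op \<omega>"
        using line[of u v] full[of u v "trace u v / t0"] c0 t0 S(3) unfolding p mult_op_eq by auto
    qed
    then show False using S(4) self_adjoint_mult_op by simp
  qed
  define w where "w = t0 / c0"
  have Sw: "S = ext w"
  proof (rule set_eqI)
    fix p :: "(real \<Rightarrow> complex) \<times> (real \<Rightarrow> complex)"
    obtain u v where p: "p = (u, v)" by (cases p)
    show "p \<in> S \<longleftrightarrow> p \<in> ext w"
    proof
      assume pS: "p \<in> S"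
      then have "trace u v = w * jump u v" using line[of u v] c0 by (simp add: p w_def field_simps)
      then show "p \<in> ext w" using S(3) pS by (auto simp: p ext_def)
    next
      assume "p \<in> ext w"
      then have "(u, v) \<in> max_op" "trace u v = w * jump u v" by (auto simp: p ext_def)
      then show "p \<in> S" using full[of u v "jump u v / c0"] c0 by (simp add: p w_def)
    qed
  qed
  moreover have "Im w \<noteq> 0" using S(4) self_adjoint_ext_iff unfolding Sw by blast
  ultimately show ?thesis by (rule that)
qed

end

section \<open>The Weyl function and resolvents\<close>

lemma nonneg_mult_self_eq_one: "0 \<le> x \<Longrightarrow> x * x = 1 \<Longrightarrow> x = (1::real)"
  using square_eq_1_iff[of x] by linarith

text \<open>
  F has no zeros; let g be its logarithm, normalised by g(0) = 0. The hypotheses say that Re g has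
  the sign of Im z, and the claim is that k(z) = g(z) / z is constant. On the circle |\<zeta>| = r
  the function q(\<zeta>) = i k(\<zeta>) (r^2 - \<zeta>^2) / r^2 has real part 2 Im \<zeta> Re
  g(\<zeta>) / r^2 \<ge> 0, hence also inside the disc. Since q(0) = i k(0) does not depend on r,
  the Schwarz lemma bounds q, and with it k, on |z| = r / 2 uniformly in r; Liouville's theorem
  finishes the proof.
\<close>
lemma entire_half_plane_exponential:
  fixes F :: "complex \<Rightarrow> complex"
  assumes hol: "F holomorphic_on UNIV"
    and refl: "\<And>z. F z * cnj (F (cnj z)) = 1"
    and upper: "\<And>z. Im z > 0 \<Longrightarrow> cmod (F z) \<ge> 1"
  shows "\<exists>b\<ge>0. \<forall>z. F z = F 0 * exp (- \<i> * of_real b * z)"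
proof -
  have nz: "F z \<noteq> 0" for z using refl[of z] by auto
  obtain g0 where g0_hol: "g0 holomorphic_on UNIV" and exp_g0: "\<And>z. exp (g0 z) = F z"
    by (rule holomorphic_logarithm_exists[of UNIV F 0]) (auto simp: hol nz)
  note g0 = g0_hol exp_g0[symmetric]
  define g where "g z = g0 z - g0 0" for z
  have g_hol: "g holomorphic_on UNIV" unfolding g_def by (intro holomorphic_intros g0)
  have g_zero: "g 0 = 0" by (simp add: g_def)
  have Re_g: "exp (Re (g z)) = cmod (F z) / cmod (F 0)" for z
    by (simp add: g_def g0(2) exp_diff)
  have mod1: "cmod (F z) * cmod (F (cnj z)) = 1" for z
    using arg_cong[OF refl[of z], of cmod] by (simp add: norm_mult)
  have real_mod1: "cmod (F (of_real x)) = 1" for x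
    by (rule nonneg_mult_self_eq_one[OF norm_ge_zero]) (use mod1[of "of_real x"] in simp)
  have F0: "cmod (F 0) = 1" using real_mod1[of 0] by simp
  have sgn: "Re (g z) * Im z \<ge> 0" for z
  proof -
    have e: "exp (Re (g z)) = cmod (F z)" using Re_g[of z] F0 by simp
    consider "Im z > 0" | "Im z < 0" | "Im z = 0" by linarith
    then show ?thesis
    proof cases
      case 1
      then have "exp (Re (g z)) \<ge> 1" using e upper by simp
      then show ?thesis using 1 by (simp add: one_le_exp_iff)
    next
      case 2
      then have "cmod (F (cnj z)) \<ge> 1" by (intro upper) simp
      then have "cmod (F z) * 1 \<le> cmod (F z) * cmod (F (cnj z))" by (intro mult_left_mono) auto
      then have "exp (Re (g z)) \<le> 1" using e mod1[of z] by simp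
      then show ?thesis using 2 by (simp add: mult_nonpos_nonpos)
    qed simp
  qed
  define k where "k z = (if z = 0 then deriv g 0 else (g z - g 0) / (z - 0))" for z
  have k_hol: "k holomorphic_on UNIV"
    unfolding k_def using pole_lemma[OF g_hol, of 0] by simp
  have gk: "g z = z * k z" for z using g_zero by (simp add: k_def)
  \<comment> \<open>K = 1 + q(0); the summand 1 keeps the real part of K away from zero\<close>
  define K where "K = 1 + \<i> * k 0"
  have k_bound: "cmod (k z) \<le> 4 * (2 * \<bar>Re K\<bar> + cmod K + 1)" for z
  proof (cases "z = 0")
    case True
    have "cmod (k 0) = cmod (K - 1)" by (simp add: K_def norm_mult)
    also have "\<dots> \<le> cmod K + 1" using norm_triangle_ineq4[of K 1] by simp
    also have "\<dots> \<le> 4 * (2 * \<bar>Re K\<bar> + cmod K + 1)"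
    proof -
      have "x + 1 \<le> 4 * (2 * y + x + 1)" if "0 \<le> x" "0 \<le> y" for x y :: real
        using that by (simp add: algebra_simps)
      then show ?thesis by simp
    qed
    finally show ?thesis unfolding True .
  next
    case False
    define r where "r = 2 * cmod z"
    have r: "r > 0" using False by (simp add: r_def)
    define q where "q \<zeta> = \<i> * k \<zeta> * ((of_real r)\<^sup>2 - \<zeta>\<^sup>2) / (of_real r)\<^sup>2" for \<zeta>
    have q_hol: "q holomorphic_on UNIV"
      unfolding q_def using r by (intro holomorphic_intros k_hol) auto
    have q_circle: "Re (q \<zeta>) \<ge> 0" if "cmod \<zeta> = r" for \<zeta>
    proof -
      have nz: "\<zeta> \<noteq> 0" using that r by auto
      have rr: "(of_real r)\<^sup>2 = \<zeta> * cnj \<zeta>"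
        using complex_norm_square[of \<zeta>] that by simp
      have "(of_real r)\<^sup>2 - \<zeta>\<^sup>2 = \<zeta> * (cnj \<zeta> - \<zeta>)" unfolding rr by (simp add: power2_eq_square algebra_simps)
      also have "cnj \<zeta> - \<zeta> = - 2 * \<i> * of_real (Im \<zeta>)" by (simp add: complex_eq_iff)
      finally have "q \<zeta> = \<i> * k \<zeta> * (\<zeta> * (- 2 * \<i> * of_real (Im \<zeta>))) / (of_real r)\<^sup>2"
        unfolding q_def by (simp only:)
      also have "\<i> * k \<zeta> * (\<zeta> * (- 2 * \<i> * of_real (Im \<zeta>))) = 2 * of_real (Im \<zeta>) * g \<zeta>"
        unfolding gk by (simp add: algebra_simps)
      finally have "q \<zeta> = 2 * of_real (Im \<zeta>) * g \<zeta> / (of_real r)\<^sup>2" .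
      also have "\<dots> = of_real (2 * Im \<zeta> / r\<^sup>2) * g \<zeta>" by simp
      finally have "Re (q \<zeta>) = 2 / r\<^sup>2 * (Re (g \<zeta>) * Im \<zeta>)" by simp
      then show ?thesis using sgn[of \<zeta>] r by simp
    qed
    have q_disc: "Re (q \<zeta>) \<ge> 0" if "cmod \<zeta> < r" for \<zeta>
    proof -
      have h: "(\<lambda>\<zeta>. exp (- q \<zeta>)) holomorphic_on UNIV" by (intro holomorphic_intros q_hol)
      have "cmod (exp (- q \<zeta>)) \<le> 1"
      proof (rule maximum_modulus_frontier[where S = "cball 0 r" and f = "\<lambda>\<zeta>. exp (- q \<zeta>)"])
        show "(\<lambda>\<zeta>. exp (- q \<zeta>)) holomorphic_on interior (cball 0 r)"
          using h by (rule holomorphic_on_subset) auto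
        show "continuous_on (closure (cball 0 r)) (\<lambda>\<zeta>. exp (- q \<zeta>))"
          using holomorphic_on_imp_continuous_on[OF h] by (rule continuous_on_subset) auto
        show "cmod (exp (- q y)) \<le> 1" if "y \<in> frontier (cball 0 r)" for y
          using q_circle[of y] that r by (simp add: frontier_cball sphere_def)
        show "\<zeta> \<in> cball 0 r" using that by simp
      qed auto
      then show ?thesis by simp
    qed
    \<comment> \<open>a Moebius transform from the right half-plane to the unit disc, sending the value K at the
      centre to 0\<close>
    define f where "f \<zeta> = (1 + q (of_real r * \<zeta>) - K) / (1 + q (of_real r * \<zeta>) + cnj K)" for \<zeta>
    have q0: "1 + q 0 = K" using r by (simp add: q_def K_def)
    have ReK: "Re K \<ge> 1" using q_disc[of 0] r by (simp flip: q0)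
    have den: "Re (1 + q (of_real r * \<zeta>) + cnj K) > 0" "cmod (1 + q (of_real r * \<zeta>) - K) < cmod (1 + q (of_real r * \<zeta>) + cnj K)"
      if "cmod \<zeta> < 1" for \<zeta>
    proof -
      define Q where "Q = 1 + q (of_real r * \<zeta>)"
      have Q: "Re Q \<ge> 1" using q_disc[of "of_real r * \<zeta>"] that r by (simp add: norm_mult Q_def)
      then show "Re (1 + q (of_real r * \<zeta>) + cnj K) > 0" using ReK by (simp add: Q_def)
      have "(Re Q - Re K)\<^sup>2 < (Re Q + Re K)\<^sup>2"
        using Q ReK by (simp add: power2_diff power2_sum)
      then have "(cmod (Q - K))\<^sup>2 < (cmod (Q + cnj K))\<^sup>2" by (simp add: cmod_power2)
      then show "cmod (1 + q (of_real r * \<zeta>) - K) < cmod (1 + q (of_real r * \<zeta>) + cnj K)"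
        unfolding Q_def by (rule power_less_imp_less_base) simp
    qed
    have "cmod (f (z / of_real r)) \<le> cmod (z / of_real r)"
    proof (rule Schwarz_Lemma(1))
      have qr: "(\<lambda>\<zeta>. q (of_real r * \<zeta>)) holomorphic_on ball 0 1"
        using holomorphic_on_compose_gen[of "\<lambda>\<zeta>. of_real r * \<zeta>" "ball 0 1" q UNIV] q_hol
        by (auto simp: o_def intro!: holomorphic_intros)
      show "f holomorphic_on ball 0 1" unfolding f_def
      proof (intro holomorphic_intros qr)
        fix \<zeta> :: complex assume "\<zeta> \<in> ball 0 1"
        then have "Re (1 + q (of_real r * \<zeta>) + cnj K) > 0" by (intro den(1)) simp
        then show "1 + q (of_real r * \<zeta>) + cnj K \<noteq> 0"
          by (metis less_irrefl zero_complex.sel(1))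
      qed
      show "f 0 = 0" by (simp add: f_def q0)
      show "cmod (f \<zeta>) < 1" if "cmod \<zeta> < 1" for \<zeta>
      proof -
        have "0 < cmod (1 + q (of_real r * \<zeta>) + cnj K)"
          using den(2)[OF that] norm_ge_zero le_less_trans by blast
        then show ?thesis using den(2)[OF that] by (simp only: f_def norm_divide divide_less_eq_1_pos)
      qed
      show "cmod (z / of_real r) < 1" using False by (simp add: r_def norm_divide)
    qed
    also have "\<dots> = 1 / 2" using False by (simp add: r_def norm_divide)
    finally have fz: "cmod (f (z / of_real r)) \<le> 1 / 2" .
    have rz: "of_real r * (z / of_real r) = z" using r by simp
    have "cmod (z / of_real r) < 1" using False by (simp add: r_def norm_divide)
    note den = den[OF this, unfolded rz]
    have "cmod (1 + q z - K) \<le> 1 / 2 * cmod (1 + q z + cnj K)"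
    proof -
      have "0 < cmod (1 + q z + cnj K)" using den(2) norm_ge_zero le_less_trans by blast
      then show ?thesis using fz unfolding f_def rz norm_divide by (simp only: pos_divide_le_eq)
    qed
    also have "cmod (1 + q z + cnj K) \<le> cmod (1 + q z - K) + 2 * \<bar>Re K\<bar>"
    proof -
      have "1 + q z + cnj K = (1 + q z - K) + of_real (2 * Re K)" by (simp add: complex_eq_iff)
      then show ?thesis using norm_triangle_ineq[of "1 + q z - K" "of_real (2 * Re K)"]
        by (simp only: norm_of_real abs_mult)
    qed
    finally have "cmod (1 + q z - K) \<le> 2 * \<bar>Re K\<bar>" by simp
    moreover have "cmod (q z) \<le> cmod (1 + q z - K) + cmod (K - 1)"
      using norm_triangle_ineq[of "1 + q z - K" "K - 1"] by simp
    moreover have "cmod (K - 1) \<le> cmod K + 1" using norm_triangle_ineq4[of K 1] by simp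
    ultimately have qz: "cmod (q z) \<le> 2 * \<bar>Re K\<bar> + cmod K + 1" by linarith
    have "3 * (cmod z)\<^sup>2 \<le> cmod ((of_real r)\<^sup>2 - z\<^sup>2)"
    proof -
      have "cmod ((of_real r)\<^sup>2) - cmod (z\<^sup>2) \<le> cmod ((of_real r)\<^sup>2 - z\<^sup>2)" by (rule norm_triangle_ineq2)
      moreover have "cmod ((of_real r)\<^sup>2) = 4 * (cmod z)\<^sup>2" "cmod (z\<^sup>2) = (cmod z)\<^sup>2"
        using r by (simp_all add: norm_power r_def power_mult_distrib)
      ultimately show ?thesis by simp
    qed
    then have "cmod (k z) * (3 * (cmod z)\<^sup>2) \<le> cmod (k z) * cmod ((of_real r)\<^sup>2 - z\<^sup>2)"
      by (intro mult_left_mono) auto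
    also have "\<dots> = cmod (q z) * r\<^sup>2"
      using r by (simp add: q_def norm_mult norm_divide norm_power)
    also have "\<dots> \<le> (2 * \<bar>Re K\<bar> + cmod K + 1) * r\<^sup>2"
      using qz by (intro mult_right_mono) auto
    also have "\<dots> = 4 * (2 * \<bar>Re K\<bar> + cmod K + 1) * (cmod z)\<^sup>2"
      by (simp add: r_def power_mult_distrib)
    finally have "cmod (k z) * 3 * (cmod z)\<^sup>2 \<le> 4 * (2 * \<bar>Re K\<bar> + cmod K + 1) * (cmod z)\<^sup>2"
      by (simp only: mult.assoc)
    then have "cmod (k z) * 3 \<le> 4 * (2 * \<bar>Re K\<bar> + cmod K + 1)"
      by (rule mult_right_le_imp_le) (use False in simp)
    then show ?thesis using norm_ge_zero[of "k z"] by linarith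
  qed
  have "bounded (range k)" unfolding bounded_iff using k_bound by blast
  then obtain c where c: "\<And>z. k z = c"
    using Liouville_theorem[OF k_hol] by (auto simp: constant_on_def)
  have gc: "g z = c * z" for z using gk c by simp
  have Re_c: "Re c = 0"
  proof -
    have "cmod (F 1) = 1" using real_mod1[of 1] by simp
    then have "exp (Re (g 1)) = 1" using Re_g[of 1] F0 by simp
    then show ?thesis by (simp add: gc)
  qed
  have Im_c: "Im c \<le> 0" using sgn[of \<i>] by (simp add: gc)
  define b where "b = - Im c"
  have "c = - \<i> * of_real b" using Re_c by (simp add: complex_eq_iff b_def)
  then have gz: "g z = - \<i> * of_real b * z" for z by (simp only: gc)
  have Fg: "F z = F 0 * exp (g z)" for z by (simp add: g_def g0(2) flip: exp_add)
  have "F z = F 0 * exp (- \<i> * of_real b * z)" for z using Fg[of z] unfolding gz .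
  moreover have "b \<ge> 0" using Im_c by (simp add: b_def)
  ultimately show ?thesis by blast
qed

context spectral_measure
begin

definition kernel :: "complex \<Rightarrow> real \<Rightarrow> complex" where
  "kernel z x = 1 / (complex_of_real x - z)"

lemma L2_kernel [simp]: "Im z \<noteq> 0 \<Longrightarrow> kernel z \<in> L2_space \<omega>"
  unfolding kernel_def by simp

lemma cnj_kernel: "cnj (kernel z x) = kernel (cnj z) x"
  by (simp add: kernel_def)

text \<open>
  The hypotheses are arranged so as to cover nonreal z as well as real z at positive distance from
  the support of \<omega>.
\<close>
lemma weyl_function_kernel:
  assumes "kernel z \<in> L2_space \<omega>" "AE x in \<omega>. of_real x \<noteq> z"
  shows "(kernel z, \<lambda>x. z * kernel z x) \<in> max_op" "jump (kernel z) (\<lambda>x. z * kernel z x) = 1"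
    "trace (kernel z) (\<lambda>x. z * kernel z x) = weyl_function \<omega> z"
proof -
  have ae: "AE x in \<omega>. z * kernel z x = of_real x * kernel z x - 1"
    using assms(2) by eventually_elim (simp add: kernel_def divide_simps)
  show "(kernel z, \<lambda>x. z * kernel z x) \<in> max_op" and j: "jump (kernel z) (\<lambda>x. z * kernel z x) = 1"
    using max_opI[OF assms(1) L2_scale[OF assms(1)] ae] by auto
  show "trace (kernel z) (\<lambda>x. z * kernel z x) = weyl_function \<omega> z"
    unfolding trace_def j weyl_function_def
    by (rule arg_cong[where f = "integral\<^sup>L \<omega>"]) (simp add: fun_eq_iff kernel_def divide_inverse)
qed

lemma nonreal_AE: "Im z \<noteq> 0 \<Longrightarrow> AE x in \<omega>. of_real x \<noteq> z"
  by (auto simp: complex_eq_iff)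

lemma weyl_function_nonreal:
  assumes "Im z \<noteq> 0"
  shows "(kernel z, \<lambda>x. z * kernel z x) \<in> max_op" "jump (kernel z) (\<lambda>x. z * kernel z x) = 1"
    "trace (kernel z) (\<lambda>x. z * kernel z x) = weyl_function \<omega> z"
  using weyl_function_kernel[OF L2_kernel[OF assms] nonreal_AE[OF assms]] by auto

lemma weyl_function_cnj: "weyl_function \<omega> (cnj z) = cnj (weyl_function \<omega> z)"
  unfolding weyl_function_def by (simp flip: Bochner_Integration.integral_cnj)

lemma weyl_function_i [simp]: "weyl_function \<omega> \<i> = \<i>"
proof -
  have "weyl_function \<omega> \<i> = (\<integral>x. \<i> * (1 / (1 + (of_real x)\<^sup>2)) \<partial>\<omega>)"
    unfolding weyl_function_def
  proof (rule arg_cong[where f = "integral\<^sup>L \<omega>"], rule ext)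
    fix x :: real
    have e: "1 + (complex_of_real x)\<^sup>2 = (of_real x - \<i>) * (of_real x + \<i>)"
      by (simp add: power2_eq_square algebra_simps)
    have nz: "of_real x - \<i> \<noteq> 0" "of_real x + \<i> \<noteq> 0"
      using nonreal_distance[of \<i> x] nonreal_distance[of "- \<i>" x] by auto
    have "inverse (of_real x - \<i>) = (of_real x + \<i>) / (1 + (complex_of_real x)\<^sup>2)"
    proof -
      have "inverse a = b / (a * b)" if "a \<noteq> 0" "b \<noteq> 0" for a b :: complex
        using that by (simp add: divide_inverse)
      from this[OF nz] show ?thesis unfolding e .
    qed
    then show "inverse (complex_of_real x - \<i>) - complex_of_real (x * inverse (1 + x\<^sup>2)) = \<i> * (1 / (1 + (of_real x)\<^sup>2))"
      by (simp add: divide_inverse algebra_simps)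
  qed
  also have "\<dots> = \<i>" by (simp del: times_divide_eq_right)
  finally show ?thesis .
qed

lemma weyl_function_minus_i [simp]: "weyl_function \<omega> (- \<i>) = - \<i>"
  using weyl_function_cnj[of \<i>] by simp

text \<open>
  Green's identity for the kernels at z and at cnj z0.
\<close>
lemma weyl_function_difference:
  assumes z: "Im z \<noteq> 0" "Im z0 \<noteq> 0"
  shows "weyl_function \<omega> z - weyl_function \<omega> z0 = (z - z0) * (\<integral>x. kernel z0 x * kernel z x \<partial>\<omega>)"
proof -
  have c: "Im (cnj z0) \<noteq> 0" using z by simp
  have "weyl_function \<omega> z - weyl_function \<omega> z0 =
     L2_inner \<omega> (\<lambda>x. z * kernel z x) (kernel (cnj z0)) - L2_inner \<omega> (kernel z) (\<lambda>x. cnj z0 * kernel (cnj z0) x)"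
    using Green_identity[OF weyl_function_nonreal(1)[OF z(1)] weyl_function_nonreal(1)[OF c]]
      weyl_function_nonreal(2,3)[OF z(1)] weyl_function_nonreal(2,3)[OF c] weyl_function_cnj[of z0] by simp
  also have "\<dots> = (z - z0) * (\<integral>x. kernel z0 x * kernel z x \<partial>\<omega>)"
    unfolding L2_inner_def complex_cnj_mult cnj_kernel by (simp add: algebra_simps)
  finally show ?thesis .
qed

lemma Im_weyl_function:
  assumes z: "Im z \<noteq> 0"
  shows "Im (weyl_function \<omega> z) = Im z * (L2_norm \<omega> (kernel z))\<^sup>2"
proof -
  have c: "Im (cnj z) \<noteq> 0" using z by simp
  have "weyl_function \<omega> z - cnj (weyl_function \<omega> z) = (z - cnj z) * (\<integral>x. kernel (cnj z) x * kernel z x \<partial>\<omega>)"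
    using weyl_function_difference[OF z c] by (simp only: weyl_function_cnj)
  also have "(\<integral>x. kernel (cnj z) x * kernel z x \<partial>\<omega>) = L2_inner \<omega> (kernel z) (kernel z)"
    unfolding L2_inner_def by (rule arg_cong[where f = "integral\<^sup>L \<omega>"]) (simp add: fun_eq_iff cnj_kernel)
  finally have "weyl_function \<omega> z - cnj (weyl_function \<omega> z) = (z - cnj z) * of_real ((L2_norm \<omega> (kernel z))\<^sup>2)"
    by (simp only: L2_inner_self)
  then show ?thesis by (simp add: complex_eq_iff)
qed

lemma kernel_norm_pos: "Im z \<noteq> 0 \<Longrightarrow> L2_norm \<omega> (kernel z) > 0"
proof -
  assume z: "Im z \<noteq> 0"
  have "\<not> (AE x in \<omega>. kernel z x = 0)"
    using not_AE_False nonreal_distance[OF z] by (simp add: kernel_def)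
  then have "L2_norm \<omega> (kernel z) \<noteq> 0" using L2_norm_zero_iff[OF L2_kernel[OF z]] by simp
  then show ?thesis using L2_norm_nonneg[of \<omega> "kernel z"] by linarith
qed

lemma Im_weyl_function_sgn:
  assumes "Im z \<noteq> 0"
  shows "Im z * Im (weyl_function \<omega> z) > 0"
proof -
  have "Im z * Im (weyl_function \<omega> z) = (Im z * L2_norm \<omega> (kernel z))\<^sup>2"
    unfolding Im_weyl_function[OF assms] by (simp add: power2_eq_square)
  then show ?thesis using kernel_norm_pos[OF assms] assms by simp
qed

text \<open>
  Cauchy-Schwarz in the defining integral of the jump: both x / (1 + x^2) and 1 / (1 + x^2) have
  norm at most one.
\<close>
lemma jump_bound:
  assumes "(u, v) \<in> max_op"
  shows "cmod (jump u v) \<le> L2_norm \<omega> u + L2_norm \<omega> v"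
proof -
  note D = max_opD[OF assms]
  have pos: "1 + x\<^sup>2 > 0" for x :: real by (simp add: add_pos_nonneg)
  have norm_w: "cmod (1 + (of_real x)\<^sup>2) = 1 + x\<^sup>2" for x :: real
  proof -
    have "1 + (complex_of_real x)\<^sup>2 = of_real (1 + x\<^sup>2)" by simp
    then show ?thesis using pos[of x] by (simp only: norm_of_real abs_of_pos)
  qed
  define p where "p x = 1 * of_real x / (1 + (complex_of_real x)\<^sup>2)" for x
  define q where "q x = 1 / (1 + (complex_of_real x)\<^sup>2)" for x
  have pL: "p \<in> L2_space \<omega>" "q \<in> L2_space \<omega>" unfolding p_def q_def by (rule L2_weight_id L2_weight)+
  have small: "(cmod (p x))\<^sup>2 \<le> 1 / (1 + x\<^sup>2)" "(cmod (q x))\<^sup>2 \<le> 1 / (1 + x\<^sup>2)" for x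
    using pos[of x] unfolding p_def q_def norm_divide norm_w
    by (simp_all add: power_divide norm_mult power2_eq_square divide_simps)
  have "(L2_norm \<omega> f)\<^sup>2 \<le> 1\<^sup>2" if "f \<in> L2_space \<omega>" "\<And>x. (cmod (f x))\<^sup>2 \<le> 1 / (1 + x\<^sup>2)" for f
  proof -
    have "(\<integral>x. (cmod (f x))\<^sup>2 \<partial>\<omega>) \<le> (\<integral>x. 1 / (1 + x\<^sup>2) \<partial>\<omega>)"
      using that by (intro integral_mono L2_integrable_square weight_integrable) auto
    then show ?thesis unfolding L2_norm_square by simp
  qed
  then have n1: "L2_norm \<omega> p \<le> 1" "L2_norm \<omega> q \<le> 1"
    using pL small by (meson power2_le_imp_le zero_le_one)+
  have "jump u v = (\<integral>x. p x * u x - q x * v x \<partial>\<omega>)"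
    unfolding jump_def by (rule arg_cong[where f = "integral\<^sup>L \<omega>"]) (simp add: fun_eq_iff p_def q_def diff_divide_distrib)
  also have "\<dots> = (\<integral>x. p x * u x \<partial>\<omega>) - (\<integral>x. q x * v x \<partial>\<omega>)"
    using pL D by (intro Bochner_Integration.integral_diff L2_mult_integrable)
  finally have "cmod (jump u v) \<le> cmod (\<integral>x. p x * u x \<partial>\<omega>) + cmod (\<integral>x. q x * v x \<partial>\<omega>)"
    by (simp add: norm_triangle_ineq4)
  also have "\<dots> \<le> L2_norm \<omega> p * L2_norm \<omega> u + L2_norm \<omega> q * L2_norm \<omega> v"
    using pL D by (intro add_mono L2_Cauchy_Schwarz)
  also have "\<dots> \<le> 1 * L2_norm \<omega> u + 1 * L2_norm \<omega> v"
    using n1 by (intro add_mono mult_right_mono) auto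
  finally show ?thesis by simp
qed

lemma ext_linear:
  assumes "(u, v) \<in> ext w" "(u', v') \<in> ext w"
  shows "(\<lambda>x. c * u x + u' x, \<lambda>x. c * v x + v' x) \<in> ext w"
  using assms boundary_linear[of u v u' v' c] by (simp add: ext_def algebra_simps)

text \<open>
  Green's identity between (u, v) and the kernel at cnj z, in which v - z u = h is the only
  contribution from the interior. This is Krein's resolvent formula in terms of boundary values.
\<close>
lemma trace_resolvent:
  assumes k: "kernel z \<in> L2_space \<omega>" "AE x in \<omega>. of_real x \<noteq> z"
    and uv: "(u, v) \<in> max_op" and h: "h \<in> L2_space \<omega>" and eq: "AE x in \<omega>. v x - z * u x = h x"
  shows "trace u v - jump u v * weyl_function \<omega> z = (\<integral>x. h x * kernel z x \<partial>\<omega>)"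
proof -
  have kL: "kernel (cnj z) \<in> L2_space \<omega>"
    using L2_cnj[OF k(1)] by (simp add: cnj_kernel)
  have "AE x in \<omega>. of_real x \<noteq> cnj z"
    using k(2) by eventually_elim (metis complex_cnj_cnj complex_cnj_complex_of_real)
  note W = weyl_function_kernel[OF kL this]
  note D = max_opD[OF uv]
  have "trace u v - jump u v * weyl_function \<omega> z = L2_inner \<omega> v (kernel (cnj z)) - L2_inner \<omega> u (\<lambda>x. cnj z * kernel (cnj z) x)"
    using Green_identity[OF uv W(1)] W(2,3) weyl_function_cnj[of z] by simp
  also have "\<dots> = L2_inner \<omega> v (kernel (cnj z)) - L2_inner \<omega> (\<lambda>x. z * u x) (kernel (cnj z))"
    unfolding L2_inner_def complex_cnj_mult by (simp add: algebra_simps)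
  also have "\<dots> = L2_inner \<omega> (\<lambda>x. v x - z * u x) (kernel (cnj z))"
    using D kL by (intro L2_inner_diff_left[symmetric]) auto
  also have "\<dots> = L2_inner \<omega> h (kernel (cnj z))"
    using D kL h eq by (intro L2_inner_cong_AE) (auto simp: ae_eq_def)
  also have "\<dots> = (\<integral>x. h x * kernel z x \<partial>\<omega>)" unfolding L2_inner_def cnj_kernel by simp
  finally show ?thesis .
qed

lemma resolvent_jump:
  assumes z: "Im z \<noteq> 0" and uv: "(u, v) \<in> ext w" and h: "h \<in> L2_space \<omega>"
    and eq: "AE x in \<omega>. v x - z * u x = h x"
  shows "jump u v * (w - weyl_function \<omega> z) = (\<integral>x. h x * kernel z x \<partial>\<omega>)"
  using trace_resolvent[OF L2_kernel[OF z] nonreal_AE[OF z] _ h eq] uv by (simp add: ext_def algebra_simps)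

text \<open>
  Let z0 = \<plusminus>i with M(z0) = z0 \<noteq> w, and let c(z) be the jump of the resolvent of
  \<open>ext w\<close> at z applied to 1 / (x - z0). The jump is continuous in the graph norm, so
  c is entire. By \<open>resolvent_jump\<close> and \<open>weyl_function_difference\<close>, (z -
  z0) c(z) (w - M(z)) = M(z) - z0, that is, 1 + (z - z0) c(z) = (w - z0) / (w - M(z)).
\<close>
theorem empty_spectrum_entire:
  assumes sp: "spectrum \<omega> (ext w) = {}" and w: "Im w \<noteq> 0"
  shows "\<exists>N. N holomorphic_on UNIV \<and> (\<forall>z. Im z \<noteq> 0 \<longrightarrow> N z * (w - weyl_function \<omega> z) = 1)"
proof -
  have res: "z \<in> resolvent_set \<omega> (ext w)" for z using sp by (auto simp: spectrum_def)
  define z0 where "z0 = (if Im w > 0 then - \<i> else \<i>)"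
  have z0: "Im z0 \<noteq> 0" "weyl_function \<omega> z0 = z0" "w \<noteq> z0"
    using w by (auto simp: z0_def split: if_splits)
  define h where "h = kernel z0"
  have hL: "h \<in> L2_space \<omega>" unfolding h_def using z0 by simp
  have solve: "\<exists>u v. (u, v) \<in> ext w \<and> (AE x in \<omega>. v x - z * u x = f x)" if "f \<in> L2_space \<omega>" for z f
    using res[of z] that unfolding resolvent_set_def ae_eq_def by fast
  have "\<forall>z. \<exists>u v. (u, v) \<in> ext w \<and> (AE x in \<omega>. v x - z * u x = h x)" using solve[OF hL] by blast
  from this[THEN choice] obtain u where "\<forall>z. \<exists>v. (u z, v) \<in> ext w \<and> (AE x in \<omega>. v x - z * u z x = h x)" ..
  from this[THEN choice] obtain v where "\<forall>z. (u z, v z) \<in> ext w \<and> (AE x in \<omega>. v z x - z * u z x = h x)" ..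
  then have uv: "(u z, v z) \<in> ext w" "AE x in \<omega>. v z x - z * u z x = h x" for z by auto
  define c where "c z = jump (u z) (v z)" for z
  have extL: "f \<in> L2_space \<omega>" "g \<in> L2_space \<omega>" "(f, g) \<in> max_op" if "(f, g) \<in> ext w" for f g
    using that max_opD by (auto simp: ext_def)
  have deriv: "\<exists>d. (c has_field_derivative d) (at z1)" for z1
  proof -
    obtain C0 where C0: "\<And>f g. (f, g) \<in> ext w \<Longrightarrow> L2_norm \<omega> f \<le> C0 * L2_norm \<omega> (\<lambda>x. g x - z1 * f x)"
      using res[of z1] unfolding resolvent_set_def by blast
    \<comment> \<open>enlarging the resolvent bound makes it positive, so that 1 / (2 * C) is a radius\<close>
    define C where "C = max C0 1"
    have C: "C \<ge> 1" by (simp add: C_def)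
    have C1: "L2_norm \<omega> f \<le> C * L2_norm \<omega> (\<lambda>x. g x - z1 * f x)" if "(f, g) \<in> ext w" for f g
      using C0[OF that] mult_right_mono[of C0 C "L2_norm \<omega> (\<lambda>x. g x - z1 * f x)"] by (simp add: C_def)
    have near: "L2_norm \<omega> f \<le> 2 * C * L2_norm \<omega> (\<lambda>x. g x - z * f x)"
      if fg: "(f, g) \<in> ext w" and z: "cmod (z - z1) \<le> 1 / (2 * C)" for f g z
    proof -
      note L = extL[OF fg]
      have "L2_norm \<omega> (\<lambda>x. g x - z1 * f x) = L2_norm \<omega> (\<lambda>x. (g x - z * f x) + (z - z1) * f x)"
        by (simp add: algebra_simps)
      also have "\<dots> \<le> L2_norm \<omega> (\<lambda>x. g x - z * f x) + cmod (z - z1) * L2_norm \<omega> f"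
        using L2_norm_triangle[of "\<lambda>x. g x - z * f x" \<omega> "\<lambda>x. (z - z1) * f x"] L by (simp add: L2_norm_scale)
      also have "\<dots> \<le> L2_norm \<omega> (\<lambda>x. g x - z * f x) + 1 / (2 * C) * L2_norm \<omega> f"
        using z by (intro add_mono mult_right_mono) auto
      finally have "L2_norm \<omega> f \<le> C * (L2_norm \<omega> (\<lambda>x. g x - z * f x) + 1 / (2 * C) * L2_norm \<omega> f)"
        using C1[OF fg] C by (meson mult_left_mono order_trans zero_le_one)
      also have "\<dots> = C * L2_norm \<omega> (\<lambda>x. g x - z * f x) + L2_norm \<omega> f / 2"
        using C by (simp add: distrib_left)
      finally show ?thesis by simp
    qed
    \<comment> \<open>the derivative of the resolvent is its square: a is the resolvent at z1 applied to u z1\<close>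
    obtain a a' where a: "(a, a') \<in> ext w" "AE x in \<omega>. a' x - z1 * a x = u z1 x"
      using solve[OF extL(1)[OF uv(1)], of z1 z1] by blast
    define K where "K = (1 + (cmod z1 + 1)) * (2 * C * L2_norm \<omega> a) + L2_norm \<omega> a"
    have quot: "cmod (c z - c z1 - (z - z1) * jump a a') \<le> K * (cmod (z - z1))\<^sup>2"
      if z: "cmod (z - z1) \<le> 1 / (2 * C)" for z
    proof -
      \<comment> \<open>the remainder of the linear approximation of u satisfies (S - z) D = (z - z1)^2 a\<close>
      define D D' where "D x = (- (z - z1)) * a x + ((- 1) * u z1 x + u z x)"
        and "D' x = (- (z - z1)) * a' x + ((- 1) * v z1 x + v z x)" for x
      have D: "(D, D') \<in> ext w" unfolding D_def D'_def by (intro ext_linear a uv)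
      note DL = extL[OF D]
      have diff: "(\<lambda>x. (- 1) * u z1 x + u z x, \<lambda>x. (- 1) * v z1 x + v z x) \<in> max_op"
        by (rule extL(3)[OF ext_linear[OF uv(1) uv(1)]])
      have jD: "jump D D' = c z - c z1 - (z - z1) * jump a a'"
      proof -
        have Deq: "D = (\<lambda>x. (- (z - z1)) * a x + ((- 1) * u z1 x + u z x))"
          "D' = (\<lambda>x. (- (z - z1)) * a' x + ((- 1) * v z1 x + v z x))"
          by (simp_all add: D_def D'_def fun_eq_iff)
        show ?thesis
          unfolding Deq c_def boundary_linear(2)[OF extL(3)[OF a(1)] diff, of "- (z - z1)"]
            boundary_linear(2)[OF extL(3)[OF uv(1)[of z1]] extL(3)[OF uv(1)[of z]], of "- 1"]
          by (simp add: algebra_simps)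
      qed
      have ae: "AE x in \<omega>. D' x - z * D x = (z - z1)\<^sup>2 * a x"
        using a(2) uv(2)[of z] uv(2)[of z1]
      proof eventually_elim
        case (elim x)
        have e: "a' x = u z1 x + z1 * a x" "v z x = h x + z * u z x" "v z1 x = h x + z1 * u z1 x"
          using elim by (simp_all add: algebra_simps)
        show ?case unfolding D_def D'_def e by (simp add: power2_eq_square algebra_simps)
      qed
      have nD: "L2_norm \<omega> (\<lambda>x. D' x - z * D x) = (cmod (z - z1))\<^sup>2 * L2_norm \<omega> a"
      proof -
        have "L2_norm \<omega> (\<lambda>x. D' x - z * D x) = L2_norm \<omega> (\<lambda>x. (z - z1)\<^sup>2 * a x)"
          using DL extL[OF a(1)] ae by (intro L2_norm_cong_AE L2_measurable) auto
        then show ?thesis by (simp add: L2_norm_scale norm_power)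
      qed
      have D1: "L2_norm \<omega> D \<le> 2 * C * L2_norm \<omega> a * (cmod (z - z1))\<^sup>2"
        using near[OF D z] nD by (simp add: algebra_simps)
      have "1 / (2 * C) \<le> 1" using C by simp
      then have "cmod (z - z1) \<le> 1" using z by linarith
      then have "cmod z \<le> cmod z1 + 1" using norm_triangle_ineq2[of z z1] by linarith
      have "L2_norm \<omega> D' = L2_norm \<omega> (\<lambda>x. (D' x - z * D x) + z * D x)" by simp
      also have "\<dots> \<le> L2_norm \<omega> (\<lambda>x. D' x - z * D x) + cmod z * L2_norm \<omega> D"
        using L2_norm_triangle[of "\<lambda>x. D' x - z * D x" \<omega> "\<lambda>x. z * D x"] DL by (simp add: L2_norm_scale)
      also have "\<dots> \<le> (cmod (z - z1))\<^sup>2 * L2_norm \<omega> a + (cmod z1 + 1) * (2 * C * L2_norm \<omega> a * (cmod (z - z1))\<^sup>2)"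
        unfolding nD using \<open>cmod z \<le> cmod z1 + 1\<close> D1 by (intro add_mono mult_mono) auto
      finally have D2: "L2_norm \<omega> D' \<le> (cmod (z - z1))\<^sup>2 * L2_norm \<omega> a + (cmod z1 + 1) * (2 * C * L2_norm \<omega> a * (cmod (z - z1))\<^sup>2)" .
      have "cmod (jump D D') \<le> L2_norm \<omega> D + L2_norm \<omega> D'" by (rule jump_bound[OF DL(3)])
      also have "\<dots> \<le> K * (cmod (z - z1))\<^sup>2" using D1 D2 unfolding K_def by (simp add: algebra_simps)
      finally show ?thesis unfolding jD .
    qed
    have "((\<lambda>z. (c z - c z1) / (z - z1) - jump a a') \<longlongrightarrow> 0) (at z1)"
    proof (rule Lim_null_comparison)
      have "\<forall>\<^sub>F z in at z1. cmod (z - z1) < 1 / (2 * C) \<and> z \<noteq> z1"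
        using C unfolding eventually_at by (intro exI[of _ "1 / (2 * C)"]) (auto simp: dist_norm)
      then show "\<forall>\<^sub>F z in at z1. cmod ((c z - c z1) / (z - z1) - jump a a') \<le> K * cmod (z - z1)"
      proof eventually_elim
        case (elim z)
        then have ne: "cmod (z - z1) > 0" by simp
        have "(c z - c z1) / (z - z1) - jump a a' = (c z - c z1 - (z - z1) * jump a a') / (z - z1)"
          using elim by (simp add: diff_divide_distrib)
        then have "cmod ((c z - c z1) / (z - z1) - jump a a') = cmod (c z - c z1 - (z - z1) * jump a a') / cmod (z - z1)"
          by (simp only: norm_divide)
        also have "\<dots> \<le> K * (cmod (z - z1))\<^sup>2 / cmod (z - z1)"
          using quot[of z] elim ne by (intro divide_right_mono) auto
        also have "\<dots> = K * cmod (z - z1)" using ne by (simp add: power2_eq_square)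
        finally show ?case .
      qed
      have "((\<lambda>z. K * cmod (z - z1)) \<longlongrightarrow> K * cmod (z1 - z1)) (at z1)"
        by (intro tendsto_intros)
      then show "((\<lambda>z. K * cmod (z - z1)) \<longlongrightarrow> 0) (at z1)" by simp
    qed
    then have "((\<lambda>z. (c z - c z1) / (z - z1)) \<longlongrightarrow> jump a a') (at z1)"
      by (simp add: LIM_zero_iff)
    then show ?thesis by (auto simp: has_field_derivative_iff)
  qed
  define N where "N z = (1 + (z - z0) * c z) / (w - z0)" for z
  have "c holomorphic_on UNIV"
    using deriv by (auto simp: holomorphic_on_def field_differentiable_def)
  then have Nh: "N holomorphic_on UNIV" unfolding N_def using z0 by (intro holomorphic_intros) auto
  have "N z * (w - weyl_function \<omega> z) = 1" if z: "Im z \<noteq> 0" for z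
  proof -
    have "(z - z0) * (c z * (w - weyl_function \<omega> z)) = weyl_function \<omega> z - z0"
      using resolvent_jump[OF z uv(1) hL uv(2)] weyl_function_difference[OF z z0(1)] z0(2)
      unfolding c_def h_def by simp
    then have "(1 + (z - z0) * c z) * (w - weyl_function \<omega> z) = w - z0"
      by (simp add: algebra_simps)
    then show ?thesis unfolding N_def using z0(3) by simp
  qed
  then show ?thesis using Nh by blast
qed

end

section \<open>Empty spectrum forces the cotangent formula\<close>

definition weyl_rhs :: "real \<Rightarrow> real \<Rightarrow> complex \<Rightarrow> complex" where
  "weyl_rhs a \<alpha> z = (of_real (sin \<alpha>) - of_real (cos \<alpha>) * (cot (of_real a * z) / of_real (coth a))) /
          (of_real (cos \<alpha>) + of_real (sin \<alpha>) * (cot (of_real a * z) / of_real (coth a)))"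

lemma weyl_representation_iff:
  "weyl_representation \<omega> a \<alpha> \<longleftrightarrow> (\<forall>z. Im z \<noteq> 0 \<longrightarrow> weyl_function \<omega> z = weyl_rhs a \<alpha> z)"
  by (simp add: weyl_representation_def weyl_rhs_def)

lemma inverse_coth: "1 / coth a = tanh a"
  by (simp add: coth_def tanh_def)

lemma sin_nonreal: "Im z \<noteq> 0 \<Longrightarrow> sin z \<noteq> 0"
  by (auto simp: Complex_Transcendental.sin_eq_0)

text \<open>
  Multiplying through by sin(a z) exhibits M as a quotient of entire functions, from which poles
  and residues can be read off.
\<close>
lemma weyl_rhs_sin_cos:
  assumes "sin (of_real a * z) \<noteq> 0"
  shows "weyl_rhs a \<alpha> z =
    (of_real (sin \<alpha>) * sin (of_real a * z) - of_real (cos \<alpha> * tanh a) * cos (of_real a * z)) /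
    (of_real (cos \<alpha>) * sin (of_real a * z) + of_real (sin \<alpha> * tanh a) * cos (of_real a * z))"
proof -
  define S where "S = sin (of_real a * z)"
  have S: "S \<noteq> 0" using assms by (simp add: S_def)
  have t: "cot (of_real a * z) / of_real (coth a) = of_real (tanh a) * cos (of_real a * z) / S"
    by (simp add: inverse_coth[symmetric] cot_def S_def)
  have e: "p / q = (p * S) / (q * S)" for p q :: complex using S by simp
  have "weyl_rhs a \<alpha> z = ((of_real (sin \<alpha>) - of_real (cos \<alpha>) * (of_real (tanh a) * cos (of_real a * z) / S)) * S) /
     ((of_real (cos \<alpha>) + of_real (sin \<alpha>) * (of_real (tanh a) * cos (of_real a * z) / S)) * S)"
    unfolding weyl_rhs_def t by (rule e)
  also have "\<dots> = (of_real (sin \<alpha>) * S - of_real (cos \<alpha> * tanh a) * cos (of_real a * z)) /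
    (of_real (cos \<alpha>) * S + of_real (sin \<alpha> * tanh a) * cos (of_real a * z))"
    using S by (simp add: left_diff_distrib distrib_right mult.assoc)
  finally show ?thesis by (simp add: S_def)
qed

text \<open>
  The cotangent formula is a Moebius transform of exp(-2 i a z), the form in which it is compared
  with an exponential function.
\<close>
lemma weyl_rhs_exp:
  assumes a: "a > 0" and z: "Im z \<noteq> 0"
  shows "weyl_rhs a \<alpha> z =
    ((of_real (sin \<alpha>) + \<i> * of_real (tanh a * cos \<alpha>)) * exp (- 2 * \<i> * of_real a * z) - (of_real (sin \<alpha>) - \<i> * of_real (tanh a * cos \<alpha>))) /
    ((of_real (cos \<alpha>) - \<i> * of_real (tanh a * sin \<alpha>)) * exp (- 2 * \<i> * of_real a * z) - (of_real (cos \<alpha>) + \<i> * of_real (tanh a * sin \<alpha>)))"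
proof -
  define e where "e = exp (- \<i> * of_real a * z)"
  define t s c where "t = complex_of_real (tanh a)" and "s = complex_of_real (sin \<alpha>)" and "c = complex_of_real (cos \<alpha>)"
  have e0: "e \<noteq> 0" by (simp add: e_def)
  have e2: "exp (- 2 * \<i> * of_real a * z) = e * e"
    by (simp add: e_def mult_ac flip: exp_add)
  have ei: "exp (\<i> * (of_real a * z)) = 1 / e"
    by (simp add: e_def exp_minus divide_inverse algebra_simps)
  have em: "exp (- (\<i> * (of_real a * z))) = e" by (simp add: e_def algebra_simps)
  have sc: "sin (of_real a * z) = (1 / e - e) / (2 * \<i>)" "cos (of_real a * z) = (1 / e + e) / 2"
    by (simp_all add: sin_exp_eq cos_exp_eq ei em)
  have "sin (of_real a * z) \<noteq> 0" using a z by (intro sin_nonreal) simp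
  note weyl_rhs_sin_cos[OF this, of \<alpha>]
  also have "of_real (sin \<alpha>) * sin (of_real a * z) - of_real (cos \<alpha> * tanh a) * cos (of_real a * z)
      = (\<i> / (2 * e)) * ((s + \<i> * (t * c)) * (e * e) - (s - \<i> * (t * c)))"
    unfolding sc using e0 by (simp add: s_def c_def t_def field_simps)
  also have "of_real (cos \<alpha>) * sin (of_real a * z) + of_real (sin \<alpha> * tanh a) * cos (of_real a * z)
      = (\<i> / (2 * e)) * ((c - \<i> * (t * s)) * (e * e) - (c + \<i> * (t * s)))"
    unfolding sc using e0 by (simp add: s_def c_def t_def field_simps)
  also have "(\<i> / (2 * e)) * ((s + \<i> * (t * c)) * (e * e) - (s - \<i> * (t * c))) / ((\<i> / (2 * e)) * ((c - \<i> * (t * s)) * (e * e) - (c + \<i> * (t * s))))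
     = ((s + \<i> * (t * c)) * (e * e) - (s - \<i> * (t * c))) / ((c - \<i> * (t * s)) * (e * e) - (c + \<i> * (t * s)))"
    using e0 by (intro mult_divide_mult_cancel_left) simp
  finally show ?thesis unfolding e2 by (simp add: s_def c_def t_def)
qed

text \<open>
  Write F = exp(-2 i \<phi>) with 0 \<le> \<phi> < \<pi>. The equation asks that (cos \<alpha>,
  \<tau> sin \<alpha>) be a positive multiple of (cos \<phi>, sin \<phi>), that is, \<alpha> is
  the polar angle of (cos \<phi>, sin \<phi> / \<tau>).
\<close>
lemma phase_of_unit:
  assumes "cmod F = 1" and \<tau>: "\<tau> > 0"
  obtains \<alpha> where "0 \<le> \<alpha>" "\<alpha> < pi"
    "F * (of_real (cos \<alpha>) + \<i> * of_real (\<tau> * sin \<alpha>)) = of_real (cos \<alpha>) - \<i> * of_real (\<tau> * sin \<alpha>)"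
proof -
  define \<phi>0 where "\<phi>0 = Arg2pi F"
  have \<phi>0: "F = exp (\<i> * of_real \<phi>0)" "0 \<le> \<phi>0" "\<phi>0 < 2 * pi"
    using Arg2pi_eq[of F] Arg2pi_ge_0[of F] Arg2pi_lt_2pi[of F] assms(1) by (simp_all add: \<phi>0_def)
  \<comment> \<open>minus half the argument, shifted into [0, \<pi>)\<close>
  define \<phi> where "\<phi> = (if \<phi>0 = 0 then 0 else pi - \<phi>0 / 2)"
  have \<phi>: "0 \<le> \<phi>" "\<phi> < pi" using \<phi>0 by (auto simp: \<phi>_def)
  have F: "F = exp (- 2 * \<i> * of_real \<phi>)"
  proof (cases "\<phi>0 = 0")
    case False
    have "exp (- 2 * \<i> * of_real \<phi>) = exp (\<i> * of_real \<phi>0 - 2 * of_real pi * \<i>)"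
      using False by (intro arg_cong[where f = exp]) (simp add: \<phi>_def algebra_simps)
    then show ?thesis unfolding \<phi>0(1) by (simp add: exp_diff)
  qed (simp add: \<phi>_def \<phi>0(1))
  define l where "l = sqrt ((cos \<phi>)\<^sup>2 + (sin \<phi> / \<tau>)\<^sup>2)"
  have "(cos \<phi>)\<^sup>2 + (sin \<phi> / \<tau>)\<^sup>2 \<noteq> 0"
  proof
    assume "(cos \<phi>)\<^sup>2 + (sin \<phi> / \<tau>)\<^sup>2 = 0"
    then have "cos \<phi> = 0" "sin \<phi> = 0" using \<tau> by (auto simp: sum_power2_eq_zero_iff)
    then show False using sin_cos_squared_add[of \<phi>] by simp
  qed
  then have l: "l > 0" unfolding l_def by (simp add: less_le)
  have l2: "l\<^sup>2 = (cos \<phi>)\<^sup>2 + (sin \<phi> / \<tau>)\<^sup>2" unfolding l_def by simp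
  have sp: "sin \<phi> \<ge> 0" using \<phi> by (intro sin_ge_zero) auto
  have "(x / l)\<^sup>2 + (y / l)\<^sup>2 = (x\<^sup>2 + y\<^sup>2) / l\<^sup>2" for x y
    by (simp add: power_divide add_divide_distrib)
  from this[of "cos \<phi>" "sin \<phi> / \<tau>"] have "(cos \<phi> / l)\<^sup>2 + (sin \<phi> / \<tau> / l)\<^sup>2 = 1"
    unfolding l2[symmetric] using l by simp
  then obtain \<alpha> where \<alpha>: "0 \<le> \<alpha>" "\<alpha> \<le> pi" "cos \<phi> / l = cos \<alpha>" "sin \<phi> / \<tau> / l = sin \<alpha>"
    using sincos_total_pi[of "sin \<phi> / \<tau> / l" "cos \<phi> / l"] sp \<tau> l by auto
  have "\<alpha> \<noteq> pi"
  proof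
    assume "\<alpha> = pi"
    then have "sin \<phi> = 0" "cos \<phi> < 0" using \<alpha>(3,4) \<tau> l by (auto simp: field_simps)
    moreover have "\<phi> = 0" using \<open>sin \<phi> = 0\<close> \<phi> sin_gt_zero[of \<phi>] by (cases "\<phi> = 0") auto
    ultimately show False by simp
  qed
  have e: "of_real (cos \<alpha>) + \<i> * of_real (\<tau> * sin \<alpha>) = exp (\<i> * of_real \<phi>) / of_real l"
    "of_real (cos \<alpha>) - \<i> * of_real (\<tau> * sin \<alpha>) = exp (- (\<i> * of_real \<phi>)) / of_real l"
    using \<tau> l by (simp_all add: complex_eq_iff \<alpha>(3,4)[symmetric] Re_exp Im_exp)
  have "F * (of_real (cos \<alpha>) + \<i> * of_real (\<tau> * sin \<alpha>)) = of_real (cos \<alpha>) - \<i> * of_real (\<tau> * sin \<alpha>)"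
    unfolding e F by (simp flip: exp_add)
  then show ?thesis using that \<alpha>(1,2) \<open>\<alpha> \<noteq> pi\<close> by auto
qed

context spectral_measure
begin

text \<open>
  With the entire function N = 1 / (w - M) one has (cnj w - M) / (w - M) = 1 - (w - cnj w) N,
  which is therefore entire and, by the symmetry M(cnj z) = cnj M(z), unimodular on the real axis.
  Solving for M after \<open>entire_half_plane_exponential\<close> gives a Moebius transform of
  exp(-2 i a z). The angle \<alpha> is chosen so that its pole agrees with that of the cotangent
  formula; the values at i and -i then fix the numerator.
\<close>
theorem empty_spectrum_imp_weyl_representation:
  assumes sp: "spectrum \<omega> (ext w) = {}" and w: "Im w \<noteq> 0"
  shows "\<exists>a>0. \<exists>\<alpha>\<in>{0..<pi}. weyl_representation \<omega> a \<alpha>"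
proof -
  define M where "M = weyl_function \<omega>"
  have M_cnj: "M (cnj z) = cnj (M z)" for z by (simp add: M_def weyl_function_cnj)
  have M_sgn: "Im z * Im (M z) > 0" if "Im z \<noteq> 0" for z
    unfolding M_def by (rule Im_weyl_function_sgn[OF that])
  obtain N where N: "N holomorphic_on UNIV" "\<And>z. Im z \<noteq> 0 \<Longrightarrow> N z * (w - M z) = 1"
    using empty_spectrum_entire[OF sp w] unfolding M_def by blast
  define E where "E z = 1 - (w - cnj w) * N z" for z
  have E_hol: "E holomorphic_on UNIV" unfolding E_def by (intro holomorphic_intros N)
  have E_M: "E z * (w - M z) = cnj w - M z" if "Im z \<noteq> 0" for z
  proof -
    have "E z * (w - M z) = (w - M z) - (w - cnj w) * (N z * (w - M z))"
      by (simp add: E_def algebra_simps)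
    then show ?thesis using N(2)[OF that] by simp
  qed
  have E_refl0: "E z * cnj (E (cnj z)) = 1" if z: "Im z \<noteq> 0" for z
  proof -
    have nz: "w - M z \<noteq> 0" using N(2)[OF z] by auto
    have nz': "cnj w - M z \<noteq> 0"
    proof
      assume "cnj w - M z = 0"
      then have "cnj (cnj w - M z) = 0" by simp
      then have "w - M (cnj z) = 0" by (simp add: M_cnj)
      then show False using N(2)[of "cnj z"] z by auto
    qed
    have "cnj (E (cnj z) * (w - M (cnj z))) = cnj (cnj w - M (cnj z))"
      using E_M[of "cnj z"] z by simp
    then have "cnj (E (cnj z)) * (cnj w - M z) = w - M z" by (simp add: M_cnj)
    then have "(E z * (w - M z)) * (cnj (E (cnj z)) * (cnj w - M z)) = (cnj w - M z) * (w - M z)"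
      using E_M[OF z] by simp
    then have "(E z * cnj (E (cnj z))) * ((w - M z) * (cnj w - M z)) = 1 * ((w - M z) * (cnj w - M z))"
      by (simp add: algebra_simps)
    then show ?thesis using nz nz' by (simp only: mult_cancel_right mult_eq_0_iff) simp
  qed
  \<comment> \<open>by continuity the identity extends to the real axis\<close>
  have E_refl: "E z * cnj (E (cnj z)) = 1" for z
  proof (cases "Im z = 0")
    case True
    have cE: "isCont E y" for y
      using holomorphic_on_imp_continuous_on[OF E_hol] by (simp add: continuous_on_eq_continuous_at)
    define y where "y n = z + \<i> * of_real (inverse (real (Suc n)))" for n
    have "y \<longlonglongrightarrow> z + \<i> * of_real 0"
      unfolding y_def by (intro tendsto_intros tendsto_of_real LIMSEQ_inverse_real_of_nat)
    then have y: "y \<longlonglongrightarrow> z" by simp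
    then have "(\<lambda>n. E (y n) * cnj (E (cnj (y n)))) \<longlonglongrightarrow> E z * cnj (E (cnj z))"
      by (intro tendsto_mult tendsto_cnj isCont_tendsto_compose[OF cE])
    moreover have "E (y n) * cnj (E (cnj (y n))) = 1" for n
      using True by (intro E_refl0) (simp add: y_def)
    ultimately show ?thesis by (simp add: LIMSEQ_const_iff)
  qed (rule E_refl0)
  have E_nz: "E z \<noteq> 0" for z using E_refl[of z] by auto
  \<comment> \<open>passing to the parameter in the upper half-plane replaces F by its reciprocal\<close>
  define w' where "w' = (if Im w > 0 then w else cnj w)"
  have w': "Im w' > 0" using w by (auto simp: w'_def)
  define F where "F z = (if Im w > 0 then E z else inverse (E z))" for z
  have F_hol: "F holomorphic_on UNIV"
    unfolding F_def using E_hol E_nz by (cases "Im w > 0") (auto intro!: holomorphic_intros)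
  have F_refl: "F z * cnj (F (cnj z)) = 1" for z
  proof -
    have "inverse (E z) * cnj (inverse (E (cnj z))) = inverse (E z * cnj (E (cnj z)))"
      by (simp only: complex_cnj_inverse inverse_mult_distrib)
    then show ?thesis using E_refl[of z] unfolding F_def by simp
  qed
  have F_M: "F z * (w' - M z) = cnj w' - M z" if "Im z \<noteq> 0" for z
    using E_M[OF that] E_nz[of z] unfolding F_def w'_def by (auto simp: field_simps)
  have F_upper: "cmod (F z) \<ge> 1" if z: "Im z > 0" for z
  proof -
    have Mz: "Im (M z) > 0" using M_sgn[of z] z by (simp add: zero_less_mult_iff)
    have "(Im w' - Im (M z))\<^sup>2 \<le> (- Im w' - Im (M z))\<^sup>2"
      using w' Mz by (simp add: power2_eq_square algebra_simps)
    then have "(cmod (w' - M z))\<^sup>2 \<le> (cmod (cnj w' - M z))\<^sup>2" by (simp add: cmod_power2)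
    then have le: "cmod (w' - M z) \<le> cmod (cnj w' - M z)" by (rule power2_le_imp_le) simp
    have "cmod (F z) * cmod (w' - M z) = cmod (cnj w' - M z)"
      using arg_cong[OF F_M[of z], of cmod] z by (simp add: norm_mult)
    moreover have "cmod (cnj w' - M z) > 0" using Mz w' by (auto simp: complex_eq_iff)
    ultimately have prod: "cmod (F z) * cmod (w' - M z) \<ge> 1 * cmod (w' - M z)" and "cmod (F z) * cmod (w' - M z) > 0"
      using le by simp_all
    then have "cmod (w' - M z) > 0" by (simp add: zero_less_mult_iff)
    with prod show ?thesis by (rule mult_right_le_imp_le)
  qed
  obtain b where b: "b \<ge> 0" "\<And>z. F z = F 0 * exp (- \<i> * of_real b * z)"
    using entire_half_plane_exponential[OF F_hol F_refl F_upper] by blast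
  have Mi: "M \<i> = \<i>" "M (- \<i>) = - \<i>" by (simp_all add: M_def)
  have "b \<noteq> 0"
  proof
    assume "b = 0"
    then have "F \<i> = F (- \<i>)" using b(2)[of \<i>] b(2)[of "- \<i>"] by simp
    then have "F \<i> * (w' + \<i>) = cnj w' + \<i>" "F \<i> * (w' - \<i>) = cnj w' - \<i>"
      using F_M[of \<i>] F_M[of "- \<i>"] Mi by simp_all
    then have "F \<i> * (w' + \<i>) - F \<i> * (w' - \<i>) = 2 * \<i>" by simp
    then have "F \<i> * (2 * \<i>) = 1 * (2 * \<i>)" by (simp add: algebra_simps)
    then have "F \<i> = 1" by simp
    then have "w' = cnj w'" using \<open>F \<i> * (w' - \<i>) = cnj w' - \<i>\<close> by simp
    then show False using w' by (simp add: complex_eq_iff)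
  qed
  then have bpos: "b > 0" using b by simp
  define a where "a = b / 2"
  have a: "a > 0" using bpos by (simp add: a_def)
  define \<tau> where "\<tau> = tanh a"
  have \<tau>: "\<tau> > 0" using a by (simp add: \<tau>_def)
  have F0: "cmod (F 0) = 1"
    by (rule nonneg_mult_self_eq_one[OF norm_ge_zero]) (use arg_cong[OF F_refl[of 0], of cmod] in \<open>simp add: norm_mult\<close>)
  obtain \<alpha> where \<alpha>: "0 \<le> \<alpha>" "\<alpha> < pi"
    "F 0 * (of_real (cos \<alpha>) + \<i> * of_real (\<tau> * sin \<alpha>)) = of_real (cos \<alpha>) - \<i> * of_real (\<tau> * sin \<alpha>)"
    using phase_of_unit[OF F0 \<tau>] by blast
  define d where "d = of_real (cos \<alpha>) + \<i> * of_real (\<tau> * sin \<alpha>)"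
  have d: "d \<noteq> 0"
  proof
    assume "d = 0"
    then have "cos \<alpha> = 0" "sin \<alpha> = 0" using \<tau> by (auto simp: d_def complex_eq_iff)
    then show False using sin_cos_squared_add[of \<alpha>] by simp
  qed
  define n where "n = of_real (sin \<alpha>) + \<i> * of_real (\<tau> * cos \<alpha>)"
  define n' where "n' = of_real (sin \<alpha>) - \<i> * of_real (\<tau> * cos \<alpha>)"
  \<comment> \<open>both sides are Moebius transforms of exp(-2iaz) with the same pole and the same values at i and -i\<close>
  define X where "X = exp (2 * a)"
  have X: "X > 1" using a by (simp add: X_def)
  have \<tau>X: "\<tau> * (X + 1) = X - 1"
  proof -
    define y where "y = exp a"
    have y: "y > 0" "y * y + 1 > 0" "X = y * y" by (simp_all add: y_def X_def add_pos_pos flip: exp_add)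
    have "\<tau> = (y - 1 / y) / (y + 1 / y)"
      unfolding \<tau>_def tanh_altdef by (simp add: y_def exp_minus divide_inverse)
    also have "y - 1 / y = (y * y - 1) / y" using y by (simp add: diff_divide_distrib)
    also have "y + 1 / y = (y * y + 1) / y" using y by (simp add: add_divide_distrib)
    also have "(y * y - 1) / y / ((y * y + 1) / y) = (y * y - 1) / (y * y + 1)" using y by simp
    finally show ?thesis using y by simp
  qed
  have pole: "d * (F 0 * e - 1) = (of_real (cos \<alpha>) - \<i> * of_real (\<tau> * sin \<alpha>)) * e - (of_real (cos \<alpha>) + \<i> * of_real (\<tau> * sin \<alpha>))" for e
  proof -
    have "d * (F 0 * e - 1) = (F 0 * d) * e - d" by (simp add: algebra_simps)
    also have "F 0 * d = of_real (cos \<alpha>) - \<i> * of_real (\<tau> * sin \<alpha>)"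
      unfolding d_def by (rule \<alpha>(3))
    finally show ?thesis by (simp only: d_def)
  qed
  have expi: "exp (- 2 * \<i> * of_real a * \<i>) = of_real X" "exp (- 2 * \<i> * of_real a * (- \<i>)) = of_real (1 / X)"
  proof -
    have "- 2 * \<i> * of_real a * \<i> = of_real (2 * a)" "- 2 * \<i> * of_real a * (- \<i>) = of_real (- (2 * a))"
      by (simp_all add: complex_eq_iff)
    then show "exp (- 2 * \<i> * of_real a * \<i>) = of_real X" "exp (- 2 * \<i> * of_real a * (- \<i>)) = of_real (1 / X)"
      by (simp_all only: exp_of_real X_def exp_minus divide_inverse mult_1)
  qed
  have Fexp: "F z = F 0 * exp (- 2 * \<i> * of_real a * z)" for z
    using b(2)[of z] by (simp add: a_def)
  have v1: "d * (w' * F 0) * of_real X - d * cnj w' = n * of_real X - n'"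
  proof -
    have "F 0 * of_real X * (w' - \<i>) = cnj w' - \<i>"
      using F_M[of \<i>] Mi Fexp[of \<i>] expi by simp
    moreover have "d * (w' * F 0) * of_real X - d * cnj w' - \<i> * (d * (F 0 * of_real X - 1)) =
        d * (F 0 * of_real X * (w' - \<i>) - (cnj w' - \<i>))"
      by (simp add: algebra_simps)
    ultimately have "d * (w' * F 0) * of_real X - d * cnj w' = \<i> * (d * (F 0 * of_real X - 1))"
      by simp
    also have "\<dots> = n * of_real X - n'"
      unfolding pole n_def n'_def using arg_cong[OF \<tau>X, of "\<lambda>r. r * sin \<alpha>"] arg_cong[OF \<tau>X, of "\<lambda>r. r * cos \<alpha>"]
      by (simp add: complex_eq_iff algebra_simps)
    finally show ?thesis .
  qed
  have v2: "d * (w' * F 0) - d * cnj w' * of_real X = n - n' * of_real X"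
  proof -
    have "F 0 * of_real (1 / X) * (w' + \<i>) = cnj w' + \<i>"
      using F_M[of "- \<i>"] Mi Fexp[of "- \<i>"] expi by simp
    then have "F 0 * (w' + \<i>) = (cnj w' + \<i>) * of_real X" using X by (simp add: field_simps)
    moreover have "d * (w' * F 0) - d * cnj w' * of_real X + \<i> * ((F 0 * d) - d * of_real X) =
        d * (F 0 * (w' + \<i>) - (cnj w' + \<i>) * of_real X)"
      by (simp add: algebra_simps)
    ultimately have "d * (w' * F 0) - d * cnj w' * of_real X = - \<i> * ((F 0 * d) - d * of_real X)"
      by (simp add: eq_neg_iff_add_eq_0)
    also have "\<dots> = n - n' * of_real X"
      unfolding \<alpha>(3)[folded d_def] unfolding d_def n_def n'_def
      using arg_cong[OF \<tau>X, of "\<lambda>r. r * sin \<alpha>"] arg_cong[OF \<tau>X, of "\<lambda>r. r * cos \<alpha>"]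
      by (simp add: complex_eq_iff algebra_simps)
    finally show ?thesis .
  qed
  \<comment> \<open>p and q are the errors in the two coefficients of the numerator; agreement at i and -i gives p X
    = q and p = q X with X > 1, hence p = q = 0\<close>
  define p q where "p = d * (w' * F 0) - n" and "q = d * cnj w' - n'"
  have pq: "p * of_real X = q" "p = q * of_real X"
    using v1 v2 by (simp_all add: p_def q_def algebra_simps)
  have "q * (of_real X * of_real X - 1) = 0" using pq by (simp add: algebra_simps)
  moreover have "complex_of_real X * of_real X - 1 \<noteq> 0"
  proof -
    have "X * X > 1 * 1" using X by (intro mult_strict_mono) auto
    then have "complex_of_real (X * X - 1) \<noteq> 0" by (simp only: of_real_eq_0_iff)
    then show ?thesis by simp
  qed
  ultimately have "q = 0" by simp
  then have n_eq: "n = d * (w' * F 0)" "n' = d * cnj w'" using pq by (simp_all add: p_def q_def)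
  have "weyl_representation \<omega> a \<alpha>"
    unfolding weyl_representation_iff
  proof (intro allI impI)
    fix z assume z: "Im z \<noteq> 0"
    have F1: "F z \<noteq> 1"
    proof
      assume "F z = 1"
      then have "w' = cnj w'" using F_M[OF z] by simp
      then show False using w' by (simp add: complex_eq_iff)
    qed
    have "weyl_rhs a \<alpha> z = (n * exp (- 2 * \<i> * of_real a * z) - n') / (d * (F 0 * exp (- 2 * \<i> * of_real a * z) - 1))"
      unfolding weyl_rhs_exp[OF a z] pole n_def n'_def \<tau>_def ..
    also have "\<dots> = (d * (w' * F z - cnj w')) / (d * (F z - 1))"
      unfolding n_eq Fexp[of z] by (simp add: algebra_simps)
    also have "\<dots> = (w' * F z - cnj w') / (F z - 1)" using d by simp
    also have "\<dots> = M z" using F_M[OF z] F1 by (simp add: field_simps)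
    finally show "weyl_function \<omega> z = weyl_rhs a \<alpha> z" by (simp add: M_def)
  qed
  then show ?thesis using a \<alpha>(1,2) by (intro exI[of _ a] conjI bexI[of _ \<alpha>]) auto
qed

end

section \<open>Recovering the measure from its Weyl function\<close>

lemma phase_angle_unique:
  assumes a: "a > 0" and \<alpha>: "0 \<le> \<alpha>" "\<alpha> < pi"
  shows "\<exists>!\<beta>. phase_angle a \<alpha> \<beta>"
proof (cases "\<alpha> = 0")
  case False
  define k where "k = - (cot \<alpha> * coth a)"
  have iff: "phase_angle a \<alpha> \<beta> \<longleftrightarrow> 0 < \<beta> \<and> \<beta> < pi \<and> cot \<beta> = k" for \<beta>
    using False by (auto simp: phase_angle_def k_def)
  show ?thesis
  proof (rule ex1I)
    define x where "x = arctan k"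
    have x: "- (pi / 2) < x" "x < pi / 2" "tan x = k" unfolding x_def by (rule arctan_lbound arctan_ubound tan_arctan)+
    have "cot (pi / 2 - x) = k" using x(3) by (simp add: cot_def tan_def cos_diff sin_diff)
    then show "phase_angle a \<alpha> (pi / 2 - x)" unfolding iff using x by auto
  next
    fix \<beta> assume b: "phase_angle a \<alpha> \<beta>"
    define \<gamma> where "\<gamma> = pi / 2 - arctan k"
    have g: "0 < \<gamma>" "\<gamma> < pi" using arctan_lbound[of k] arctan_ubound[of k] by (auto simp: \<gamma>_def)
    have cg: "cot \<gamma> = k" using tan_arctan[of k] by (simp add: \<gamma>_def cot_def tan_def cos_diff sin_diff)
    have bb: "0 < \<beta>" "\<beta> < pi" "cot \<beta> = k" using b by (auto simp: iff)
    have s: "sin \<beta> > 0" "sin \<gamma> > 0" using bb g by (auto intro: sin_gt_zero)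
    have "cos \<beta> = k * sin \<beta>" "cos \<gamma> = k * sin \<gamma>" using s bb cg by (auto simp: cot_def field_simps)
    then have z: "sin (\<beta> - \<gamma>) = 0" by (simp add: sin_diff)
    have "\<beta> - \<gamma> = 0"
      by (rule sin_eq_0_pi[OF _ _ z]) (use bb g in auto)
    then show "\<beta> = pi / 2 - arctan k" by (simp add: \<gamma>_def)
  qed
qed (simp add: phase_angle_def)

text \<open>
  The equation for cot \<beta> says that (cos \<alpha>, sin \<alpha> tanh a) and (cos \<beta>, -
  sin \<beta>) are parallel. The factor l is negative for \<alpha> > 0.
\<close>
lemma phase_angle_polar:
  assumes a: "a > 0" and \<alpha>: "0 \<le> \<alpha>" "\<alpha> < pi" and \<beta>: "phase_angle a \<alpha> \<beta>"
  obtains l where "l \<noteq> 0" "cos \<alpha> = l * cos \<beta>" "sin \<alpha> * tanh a = - l * sin \<beta>"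
proof (cases "\<alpha> = 0")
  case True
  then show ?thesis using \<beta> that[of 1] by (simp add: phase_angle_def)
next
  case False
  have b: "0 < \<beta>" "\<beta> < pi" "cot \<beta> + cot \<alpha> * coth a = 0" using \<beta> False by (auto simp: phase_angle_def)
  have t: "tanh a > 0" "coth a = 1 / tanh a" using a by (simp_all add: coth_def tanh_def)
  have s: "sin \<beta> > 0" "sin \<alpha> > 0" using b False \<alpha> by (auto intro: sin_gt_zero)
  define l where "l = - (sin \<alpha> * tanh a) / sin \<beta>"
  have "cos \<beta> * (sin \<alpha> * tanh a) + cos \<alpha> * sin \<beta> = (cot \<beta> + cot \<alpha> * coth a) * (sin \<beta> * sin \<alpha> * tanh a)"
    using s t(1) unfolding t(2) cot_def by (simp add: field_simps)
  then have "cos \<alpha> * sin \<beta> = - (cos \<beta> * (sin \<alpha> * tanh a))" unfolding b(3) by simp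
  then have "cos \<alpha> = l * cos \<beta>" using s by (simp add: l_def field_simps)
  moreover have "sin \<alpha> * tanh a = - l * sin \<beta>" using s by (simp add: l_def)
  moreover have "l \<noteq> 0" using s t by (simp add: l_def)
  ultimately show ?thesis using that by blast
qed

context spectral_measure
begin

lemma kernel_square:
  "(cmod (kernel (of_real c + \<i> * of_real y) x))\<^sup>2 = 1 / ((x - c)\<^sup>2 + y\<^sup>2)"
proof -
  have "(cmod (complex_of_real x - (of_real c + \<i> * of_real y)))\<^sup>2 = (x - c)\<^sup>2 + y\<^sup>2"
    by (simp add: cmod_power2)
  then show ?thesis by (simp add: kernel_def norm_divide power_divide)
qed

text \<open>
  The function 2 y^2 / ((x - c)^2 + y^2) is at least one on the interval, and its integral is 2 y
  Im M(c + i y).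
\<close>
lemma emeasure_interval_le_weyl:
  assumes y: "y > 0"
  shows "emeasure \<omega> {c - y..c + y} \<le> ennreal (2 * y * Im (weyl_function \<omega> (of_real c + \<i> * of_real y)))"
proof -
  define z where "z = of_real c + \<i> * of_real y"
  have z: "Im z \<noteq> 0" using y by (simp add: z_def)
  have "emeasure \<omega> {c - y..c + y} = (\<integral>\<^sup>+x. indicator {c - y..c + y} x \<partial>\<omega>)" by simp
  also have "\<dots> \<le> (\<integral>\<^sup>+x. ennreal (2 * y\<^sup>2) * ennreal ((cmod (kernel z x))\<^sup>2) \<partial>\<omega>)"
  proof (rule nn_integral_mono)
    fix x :: real
    show "indicator {c - y..c + y} x \<le> ennreal (2 * y\<^sup>2) * ennreal ((cmod (kernel z x))\<^sup>2)"
    proof (cases "x \<in> {c - y..c + y}")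
      case True
      then have "\<bar>x - c\<bar> \<le> \<bar>y\<bar>" using y by auto
      then have "(x - c)\<^sup>2 \<le> y\<^sup>2" by (rule abs_le_square_iff[THEN iffD1])
      moreover have "(x - c)\<^sup>2 + y\<^sup>2 > 0" using y by (simp add: add_nonneg_pos)
      ultimately have "1 \<le> 2 * y\<^sup>2 * (1 / ((x - c)\<^sup>2 + y\<^sup>2))" by (simp add: divide_simps)
      then have "ennreal 1 \<le> ennreal (2 * y\<^sup>2 * (cmod (kernel z x))\<^sup>2)"
        unfolding z_def kernel_square by (rule ennreal_leI)
      then show ?thesis using True by (simp add: ennreal_mult)
    qed simp
  qed
  also have "\<dots> = ennreal (2 * y\<^sup>2) * ennreal ((L2_norm \<omega> (kernel z))\<^sup>2)"
    using L2_measurable[OF L2_kernel[OF z]] L2_norm_nn_integral[OF L2_kernel[OF z]]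
    by (subst nn_integral_cmult) auto
  also have "\<dots> = ennreal (2 * y * Im (weyl_function \<omega> z))"
    unfolding Im_weyl_function[OF z] by (subst ennreal_mult[symmetric]) (auto simp: z_def power2_eq_square algebra_simps)
  finally show ?thesis by (simp add: z_def)
qed

text \<open>
  Under the hypothesis an interval of half-length h has mass O(h^2). Halving it n times bounds the
  mass by 2^n pieces of size O(h^2 / 4^n).
\<close>
lemma null_interval_of_bounded_slope:
  assumes K: "\<And>x y. \<bar>x - x0\<bar> \<le> r \<Longrightarrow> 0 < y \<Longrightarrow> y \<le> r \<Longrightarrow> Im (weyl_function \<omega> (of_real x + \<i> * of_real y)) \<le> K * y"
    and r: "r > 0"
  shows "emeasure \<omega> {x0 - r..x0 + r} = 0"
proof -
  have halving: "emeasure \<omega> {c - h..c + h} \<le> ennreal (2 * \<bar>K\<bar> * h\<^sup>2 / 2 ^ n)"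
    if "h > 0" "h \<le> r" "\<bar>c - x0\<bar> \<le> r - h" for c h n
    using that
  proof (induction n arbitrary: c h)
    case 0
    have "h > 0" by fact
    from 0 have "Im (weyl_function \<omega> (of_real c + \<i> * of_real h)) \<le> K * h" by (intro K) auto
    also have "\<dots> \<le> \<bar>K\<bar> * h" using 0 by (intro mult_right_mono) auto
    finally have "2 * h * Im (weyl_function \<omega> (of_real c + \<i> * of_real h)) \<le> 2 * h * (\<bar>K\<bar> * h)"
      using 0 by (intro mult_left_mono) auto
    then have "2 * h * Im (weyl_function \<omega> (of_real c + \<i> * of_real h)) \<le> 2 * \<bar>K\<bar> * h\<^sup>2 / 2 ^ 0"
      by (simp add: power2_eq_square algebra_simps)
    from order_trans[OF emeasure_interval_le_weyl[OF \<open>h > 0\<close>, of c] ennreal_leI[OF this]] show ?case .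
  next
    case (Suc n)
    have "{c - h..c + h} \<subseteq> {(c - h / 2) - h / 2..(c - h / 2) + h / 2} \<union> {(c + h / 2) - h / 2..(c + h / 2) + h / 2}"
      by auto
    then have "emeasure \<omega> {c - h..c + h} \<le> emeasure \<omega> {(c - h / 2) - h / 2..(c - h / 2) + h / 2} + emeasure \<omega> {(c + h / 2) - h / 2..(c + h / 2) + h / 2}"
      by (intro order_trans[OF emeasure_mono emeasure_subadditive]) auto
    also have "\<dots> \<le> ennreal (2 * \<bar>K\<bar> * (h / 2)\<^sup>2 / 2 ^ n) + ennreal (2 * \<bar>K\<bar> * (h / 2)\<^sup>2 / 2 ^ n)"
      using Suc.prems by (intro add_mono Suc.IH) (auto simp: abs_le_iff)
    also have "\<dots> = ennreal (2 * \<bar>K\<bar> * h\<^sup>2 / 2 ^ Suc n)"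
      by (subst ennreal_plus[symmetric]) (auto simp: power_divide)
    finally show ?case .
  qed
  have "(\<lambda>n. 2 * \<bar>K\<bar> * r\<^sup>2 * (1 / 2) ^ n) \<longlonglongrightarrow> 2 * \<bar>K\<bar> * r\<^sup>2 * 0"
    by (intro tendsto_mult tendsto_const LIMSEQ_power_zero) simp
  moreover have "2 * \<bar>K\<bar> * r\<^sup>2 * (1 / 2) ^ n = 2 * \<bar>K\<bar> * r\<^sup>2 / 2 ^ n" for n
    by (simp only: power_one_over times_divide_eq_right mult_1_right)
  ultimately have "(\<lambda>n. 2 * \<bar>K\<bar> * r\<^sup>2 / 2 ^ n) \<longlonglongrightarrow> 0" by (simp only: mult_zero_right)
  then have "(\<lambda>n. ennreal (2 * \<bar>K\<bar> * r\<^sup>2 / 2 ^ n)) \<longlonglongrightarrow> ennreal 0" by (rule tendsto_ennrealI)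
  moreover have "emeasure \<omega> {x0 - r..x0 + r} \<le> ennreal (2 * \<bar>K\<bar> * r\<^sup>2 / 2 ^ n)" for n
    using r by (intro halving) auto
  ultimately have "emeasure \<omega> {x0 - r..x0 + r} \<le> ennreal 0"
    by (intro tendsto_lowerbound[where F = sequentially]) auto
  then show ?thesis by simp
qed

text \<open>
  y Im M(c + i y) is the integral of y^2 / ((x - c)^2 + y^2), which decreases to the indicator of
  {c} as y tends to zero.
\<close>
lemma atom_limit:
  "(\<lambda>n. (1 / real (Suc n)) * Im (weyl_function \<omega> (of_real c + \<i> * of_real (1 / real (Suc n))))) \<longlonglongrightarrow> measure \<omega> {c}"
proof -
  define y where "y n = 1 / real (Suc n)" for n
  have y: "y n > 0" "y n \<le> 1" for n by (simp_all add: y_def)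
  have y0: "y \<longlonglongrightarrow> 0" unfolding y_def by (rule LIMSEQ_Suc[OF lim_1_over_n])
  have "(\<lambda>n. \<integral>x. (y n)\<^sup>2 * (1 / ((x - c)\<^sup>2 + (y n)\<^sup>2)) \<partial>\<omega>) \<longlonglongrightarrow> (\<integral>x. indicator {c} x \<partial>\<omega>)"
  proof (rule integral_dominated_convergence[where w = "\<lambda>x. 1 / ((x - c)\<^sup>2 + 1\<^sup>2)"])
    show "integrable \<omega> (\<lambda>x. 1 / ((x - c)\<^sup>2 + 1\<^sup>2))"
      using L2_integrable_square[OF L2_kernel[of "of_real c + \<i> * of_real 1"]] unfolding kernel_square by simp
    show "AE x in \<omega>. (\<lambda>n. (y n)\<^sup>2 * (1 / ((x - c)\<^sup>2 + (y n)\<^sup>2))) \<longlonglongrightarrow> indicator {c} x"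
    proof (rule AE_I2)
      fix x
      show "(\<lambda>n. (y n)\<^sup>2 * (1 / ((x - c)\<^sup>2 + (y n)\<^sup>2))) \<longlonglongrightarrow> indicator {c} x"
      proof (cases "x = c")
        case True
        have "(y n)\<^sup>2 * (1 / ((x - c)\<^sup>2 + (y n)\<^sup>2)) = 1" for n using y(1)[of n] True by simp
        then show ?thesis using True by simp
      next
        case False
        have "(\<lambda>n. (y n)\<^sup>2 * (1 / ((x - c)\<^sup>2 + (y n)\<^sup>2))) \<longlonglongrightarrow> 0\<^sup>2 * (1 / ((x - c)\<^sup>2 + 0\<^sup>2))"
          using False by (intro tendsto_intros y0) auto
        then show ?thesis using False by simp
      qed
    qed
    show "AE x in \<omega>. norm ((y n)\<^sup>2 * (1 / ((x - c)\<^sup>2 + (y n)\<^sup>2))) \<le> 1 / ((x - c)\<^sup>2 + 1\<^sup>2)" for n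
    proof (rule AE_I2)
      fix x
      have p: "(x - c)\<^sup>2 + (y n)\<^sup>2 > 0" "(x - c)\<^sup>2 + 1\<^sup>2 > 0" using y(1)[of n] by (auto intro: add_nonneg_pos)
      have "(y n)\<^sup>2 \<le> 1\<^sup>2" using y[of n] by (intro power_mono) auto
      then have "(y n)\<^sup>2 * (x - c)\<^sup>2 \<le> 1 * (x - c)\<^sup>2" by (intro mult_right_mono) auto
      then have "(y n)\<^sup>2 * ((x - c)\<^sup>2 + 1\<^sup>2) \<le> (x - c)\<^sup>2 + (y n)\<^sup>2" by (simp add: algebra_simps)
      then have "(y n)\<^sup>2 * (1 / ((x - c)\<^sup>2 + (y n)\<^sup>2)) \<le> 1 / ((x - c)\<^sup>2 + 1\<^sup>2)"
        using p by (simp add: divide_simps)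
      then show "norm ((y n)\<^sup>2 * (1 / ((x - c)\<^sup>2 + (y n)\<^sup>2))) \<le> 1 / ((x - c)\<^sup>2 + 1\<^sup>2)"
        using p by (simp add: abs_mult)
    qed
  qed auto
  moreover have "(\<integral>x. (y n)\<^sup>2 * (1 / ((x - c)\<^sup>2 + (y n)\<^sup>2)) \<partial>\<omega>) = y n * Im (weyl_function \<omega> (of_real c + \<i> * of_real (y n)))" for n
  proof -
    have "Im (of_real c + \<i> * of_real (y n)) \<noteq> 0" using y(1)[of n] by simp
    from Im_weyl_function[OF this] show ?thesis
      unfolding L2_norm_square kernel_square Bochner_Integration.integral_mult_right_zero
      by (simp add: power2_eq_square)
  qed
  ultimately show ?thesis by (simp add: y_def)
qed

lemma emeasure_singleton: "emeasure \<omega> {c} = ennreal (measure \<omega> {c})"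
proof -
  obtain n where "\<bar>c\<bar> \<le> real n" using real_arch_simple by blast
  then have "{c} \<subseteq> {- real n..real n}" by auto
  then have "emeasure \<omega> {c} \<le> emeasure \<omega> {- real n..real n}" by (intro emeasure_mono) auto
  then have "emeasure \<omega> {c} < \<infinity>" using emeasure_interval_finite[of n] by (rule le_less_trans)
  then show ?thesis by (intro emeasure_eq_ennreal_measure) auto
qed

end

lemma infsum_int_ennreal:
  fixes f :: "int \<Rightarrow> ennreal"
  shows "infsum f UNIV = (\<integral>\<^sup>+n. f n \<partial>count_space UNIV)"
proof -
  define g where "g = (from_nat_into UNIV :: nat \<Rightarrow> int)"
  have g: "bij_betw g UNIV UNIV"
    unfolding g_def by (rule bij_betw_from_nat_into) (auto simp: infinite_UNIV_int)
  have "infsum f UNIV = infsum (\<lambda>k. f (g k)) UNIV"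
    by (rule infsum_reindex_bij_betw[OF g, symmetric])
  also have "\<dots> = (\<Sum>k. f (g k))"
  proof -
    have "((\<lambda>k. f (g k)) has_sum infsum (\<lambda>k. f (g k)) UNIV) UNIV"
      by (rule has_sum_infsum) (rule nonneg_summable_on_complete, simp)
    then have "(\<lambda>k. f (g k)) sums infsum (\<lambda>k. f (g k)) UNIV" by (rule has_sum_imp_sums)
    then show ?thesis by (rule sums_unique)
  qed
  also have "\<dots> = (\<integral>\<^sup>+k. f (g k) \<partial>count_space UNIV)" by (rule nn_integral_count_space_nat[symmetric])
  also have "\<dots> = (\<integral>\<^sup>+n. f n \<partial>count_space UNIV)"
    by (rule nn_integral_bij_count_space[OF g])
  finally show ?thesis .
qed

text \<open>
  The polar representation (cos \<alpha>, - sin \<alpha> tanh a) = l (cos \<beta>, sin \<beta>)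
  turns the denominator of the Weyl function into l sin(a z - \<beta>) and treats the case
  \<alpha> = 0 on the same footing as the others.
\<close>
locale cotangent_measure = spectral_measure +
  fixes a \<alpha> \<beta> l :: real
  assumes a: "a > 0" and \<alpha>: "0 \<le> \<alpha>" "\<alpha> < pi"
    and rep: "weyl_representation \<omega> a \<alpha>"
    and polar: "l \<noteq> 0" "cos \<alpha> = l * cos \<beta>" "sin \<alpha> * tanh a = - l * sin \<beta>"
begin

lemma tanh_pos: "tanh a > 0" using a by simp

lemma polar_square: "l\<^sup>2 = (cos \<alpha>)\<^sup>2 + (sin \<alpha> * tanh a)\<^sup>2"
proof -
  have "(cos \<alpha>)\<^sup>2 + (sin \<alpha> * tanh a)\<^sup>2 = l\<^sup>2 * ((cos \<beta>)\<^sup>2 + (sin \<beta>)\<^sup>2)"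
    unfolding polar by (simp only: power_mult_distrib power2_minus distrib_left)
  then show ?thesis by (simp only: sin_cos_squared_add2 mult_1_right)
qed

definition num :: "complex \<Rightarrow> complex" where
  "num z = of_real (sin \<alpha>) * sin (of_real a * z) - of_real (cos \<alpha> * tanh a) * cos (of_real a * z)"

definition den :: "complex \<Rightarrow> complex" where
  "den z = of_real l * sin (of_real a * z - of_real \<beta>)"

lemma weyl_quotient:
  assumes "Im z \<noteq> 0"
  shows "weyl_function \<omega> z = num z / den z"
proof -
  have "sin (of_real a * z) \<noteq> 0" using a assms by (intro sin_nonreal) simp
  then have "weyl_function \<omega> z = num z / (of_real (cos \<alpha>) * sin (of_real a * z) + of_real (sin \<alpha> * tanh a) * cos (of_real a * z))"
    using rep assms by (simp add: weyl_representation_iff weyl_rhs_sin_cos num_def)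
  also have "of_real (cos \<alpha>) * sin (of_real a * z) + of_real (sin \<alpha> * tanh a) * cos (of_real a * z) = den z"
    unfolding polar den_def sin_diff by (simp add: algebra_simps sin_of_real cos_of_real)
  finally show ?thesis .
qed

definition mass :: real where "mass = tanh a / (a * l\<^sup>2)"

lemma mass_pos: "mass > 0"
  using a tanh_pos polar by (simp add: mass_def)

text \<open>
  Where the denominator does not vanish, the quotient is Lipschitz and real on the real axis, so
  its imaginary part at x + i y is at most K y.
\<close>
lemma null_away_from_zeros:
  assumes x0: "sin (a * x0 - \<beta>) \<noteq> 0"
  shows "\<exists>r>0. emeasure \<omega> {x0 - r..x0 + r} = 0"
proof -
  have den_real: "den (of_real x) = of_real (l * sin (a * x - \<beta>))" for x
    by (simp add: den_def sin_of_real flip: of_real_mult of_real_diff)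
  have num_real: "num (of_real x) = of_real (sin \<alpha> * sin (a * x) - cos \<alpha> * tanh a * cos (a * x))" for x
    by (simp add: num_def sin_of_real cos_of_real flip: of_real_mult of_real_diff)
  have "den (of_real x0) \<noteq> 0" using x0 polar(1) unfolding den_real by (simp only: of_real_eq_0_iff mult_eq_0_iff) simp
  moreover have "open {z. den z \<noteq> 0}"
    unfolding den_def by (intro open_Collect_neq continuous_intros)
  ultimately obtain R where R: "R > 0" "cball (of_real x0) R \<subseteq> {z. den z \<noteq> 0}"
    unfolding open_contains_cball by blast
  define G where "G z = num z / den z" for z
  have hol: "G holomorphic_on {z. den z \<noteq> 0}"
    unfolding G_def num_def den_def by (intro holomorphic_intros) auto
  have op: "open {z. den z \<noteq> 0}" by fact
  have "continuous_on (cball (of_real x0) R) (deriv G)"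
    using holomorphic_on_imp_continuous_on[OF holomorphic_deriv[OF hol op]] R(2) by (rule continuous_on_subset)
  then have "compact (deriv G ` cball (of_real x0) R)" by (rule compact_continuous_image) simp
  from compact_imp_bounded[OF this] obtain K where "\<forall>w\<in>deriv G ` cball (of_real x0) R. cmod w \<le> K"
    unfolding bounded_iff by (elim exE)
  then have K: "cmod (deriv G z) \<le> K" if "z \<in> cball (of_real x0) R" for z using that by simp
  \<comment> \<open>the derivative is bounded on a compact disc around x0\<close>
  have lip: "cmod (G z - G w) \<le> K * cmod (z - w)" if "z \<in> cball (of_real x0) R" "w \<in> cball (of_real x0) R" for z w
  proof (rule field_differentiable_bound[OF convex_cball _ K that])
    fix z assume z: "z \<in> cball (complex_of_real x0) R"
    then have "G field_differentiable at z"
      using hol op R(2) by (intro holomorphic_on_imp_differentiable_at[where s = "{z. den z \<noteq> 0}"]) auto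
    then have "(G has_field_derivative deriv G z) (at z)" by (simp add: DERIV_deriv_iff_field_differentiable)
    then show "(G has_field_derivative deriv G z) (at z within cball (of_real x0) R)"
      by (rule has_field_derivative_at_within)
  qed
  define r where "r = R / 2"
  have "emeasure \<omega> {x0 - r..x0 + r} = 0"
  proof (rule null_interval_of_bounded_slope)
    show "r > 0" using R by (simp add: r_def)
    fix x y assume xy: "\<bar>x - x0\<bar> \<le> r" "0 < y" "y \<le> r"
    define z where "z = of_real x + \<i> * of_real y"
    have zx: "z - of_real x0 = of_real (x - x0) + \<i> * of_real y" "z - of_real x = \<i> * of_real y"
      by (simp_all add: z_def)
    have "cmod (z - of_real x0) \<le> cmod (of_real (x - x0)) + cmod (\<i> * of_real y)"
      unfolding zx by (rule norm_triangle_ineq)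
    then have "cmod (z - of_real x0) \<le> \<bar>x - x0\<bar> + y" using xy(2) by (simp only: norm_mult norm_of_real norm_ii mult_1 abs_of_pos)
    then have "z \<in> cball (of_real x0) R" using xy by (simp add: dist_norm norm_minus_commute r_def)
    moreover have "of_real x \<in> cball (complex_of_real x0) R"
    proof -
      have "cmod (complex_of_real x0 - of_real x) = \<bar>x0 - x\<bar>" by (simp flip: of_real_diff)
      moreover have "\<bar>x0 - x\<bar> \<le> R" using xy(1) R(1) unfolding r_def by linarith
      ultimately show ?thesis by (simp add: dist_norm)
    qed
    ultimately have "cmod (G z - G (of_real x)) \<le> K * y"
      using lip[of z "of_real x"] xy(2) unfolding zx by (simp add: norm_mult)
    moreover have "Im (G (of_real x)) = 0"
      unfolding G_def den_real num_real of_real_divide[symmetric] by (rule Im_complex_of_real)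
    ultimately have "Im (G z) \<le> K * y"
      using abs_Im_le_cmod[of "G z - G (of_real x)"] by simp
    moreover have "Im z \<noteq> 0" using xy by (simp add: z_def)
    ultimately show "Im (weyl_function \<omega> (of_real x + \<i> * of_real y)) \<le> K * y"
      using weyl_quotient[of z] by (simp add: G_def z_def)
  qed
  then show ?thesis using R by (intro exI[of _ r]) (simp add: r_def)
qed

text \<open>
  By Lindelof's theorem countably many of the null intervals cover the complement of the zeros.
\<close>
lemma supported_on_zeros: "AE x in \<omega>. sin (a * x - \<beta>) = 0"
proof -
  define U where "U = {x. sin (a * x - \<beta>) \<noteq> 0}"
  have "\<forall>x. \<exists>r. x \<in> U \<longrightarrow> r > 0 \<and> emeasure \<omega> {x - r..x + r} = 0"
    using null_away_from_zeros unfolding U_def by blast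
  from this[THEN choice] obtain r where r: "\<And>x. x \<in> U \<Longrightarrow> r x > 0 \<and> emeasure \<omega> {x - r x..x + r x} = 0" by blast
  define F where "F = (\<lambda>x. {x - r x<..<x + r x}) ` U"
  have "\<And>S. S \<in> F \<Longrightarrow> open S" by (auto simp: F_def)
  from Lindelof[OF this] obtain F' where F': "F' \<subseteq> F" "countable F'" "\<Union>F' = \<Union>F" .
  have "S \<in> null_sets \<omega>" if "S \<in> F'" for S
  proof -
    from that F' obtain x where x: "x \<in> U" "S = {x - r x<..<x + r x}" by (auto simp: F_def)
    have "{x - r x..x + r x} \<in> null_sets \<omega>" using r[OF x(1)] by auto
    then show ?thesis unfolding x(2) by (rule null_sets_subset) auto
  qed
  then have "\<Union>F' \<in> null_sets \<omega>" using F' null_sets_UN'[of F' "\<lambda>S. S" \<omega>] by auto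
  then have N: "\<Union>F \<in> null_sets \<omega>" using F' by simp
  show ?thesis
  proof (rule AE_I'[OF N])
    show "{x \<in> space \<omega>. sin (a * x - \<beta>) \<noteq> 0} \<subseteq> \<Union>F"
    proof
      fix x assume "x \<in> {x \<in> space \<omega>. sin (a * x - \<beta>) \<noteq> 0}"
      then have "x \<in> U" by (simp add: U_def)
      then have "x \<in> {x - r x<..<x + r x}" using r[of x] by auto
      moreover have "{x - r x<..<x + r x} \<in> F" using \<open>x \<in> U\<close> by (simp add: F_def)
      ultimately show "x \<in> \<Union>F" by blast
    qed
  qed
qed

text \<open>
  The mass is minus the residue of num / den. The sign \<epsilon> = cos(a x - \<beta>) =
  \<plusminus>1 of the derivative of the sine occurs in numerator and denominator and cancels, so
  every atom has the same mass.
\<close>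
lemma mass_at_zero:
  assumes x: "sin (a * x - \<beta>) = 0"
  shows "measure \<omega> {x} = mass"
proof -
  define y where "y n = 1 / real (Suc n)" for n
  have y: "y n > 0" for n by (simp add: y_def)
  have y0: "y \<longlonglongrightarrow> 0" unfolding y_def by (rule LIMSEQ_Suc[OF lim_1_over_n])
  define Y where "Y n = \<i> * complex_of_real (a * y n)" for n
  have "Y \<longlonglongrightarrow> \<i> * complex_of_real (a * 0)" unfolding Y_def by (intro tendsto_intros y0)
  then have Y0: "Y \<longlonglongrightarrow> 0" by simp
  have Ynz: "Y n \<noteq> 0" for n using a y[of n] by (simp add: Y_def)
  \<comment> \<open>sin (a z - beta) = plus or minus sin (a (z - x)), and the sign cancels in the quotient\<close>
  define \<epsilon> where "\<epsilon> = cos (a * x - \<beta>)"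
  have eps: "\<epsilon> * \<epsilon> = 1" using sin_cos_squared_add[of "a * x - \<beta>"] x by (simp add: \<epsilon>_def power2_eq_square)
  have c: "cos (a * x) = \<epsilon> * cos \<beta>" and s: "sin (a * x) = \<epsilon> * sin \<beta>"
    using cos_add[of "a * x - \<beta>" \<beta>] sin_add[of "a * x - \<beta>" \<beta>] x by (simp_all add: \<epsilon>_def)
  have den: "den (of_real x + \<i> * of_real (y n)) = of_real (l * \<epsilon>) * sin (Y n)" for n
  proof -
    have e: "of_real a * (of_real x + \<i> * of_real (y n)) - of_real \<beta> = of_real (a * x - \<beta>) + Y n"
      by (simp add: Y_def algebra_simps)
    show ?thesis unfolding den_def e sin_add using x by (simp add: \<epsilon>_def sin_of_real cos_of_real del: of_real_diff)
  qed
  define P where "P n = num (of_real x + \<i> * of_real (y n))" for n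
  have contn: "isCont num z" for z unfolding num_def by (intro continuous_intros)
  have "(\<lambda>n. of_real x + \<i> * of_real (y n)) \<longlonglongrightarrow> complex_of_real x + \<i> * of_real 0"
    by (intro tendsto_intros y0)
  then have "P \<longlonglongrightarrow> num (of_real x)"
    unfolding P_def by (intro isCont_tendsto_compose[OF contn]) simp
  moreover have "num (of_real x) = - of_real (\<epsilon> * tanh a / l)"
  proof -
    have "num (of_real x) = of_real (sin \<alpha> * sin (a * x) - cos \<alpha> * tanh a * cos (a * x))"
      by (simp add: num_def sin_of_real cos_of_real flip: of_real_mult of_real_diff)
    also have "sin \<alpha> * sin (a * x) - cos \<alpha> * tanh a * cos (a * x) = - (\<epsilon> * tanh a / l)"
    proof -
      have "l * (sin \<alpha> * sin (a * x) - cos \<alpha> * tanh a * cos (a * x)) = \<epsilon> * (sin \<alpha> * (l * sin \<beta>) - cos \<alpha> * tanh a * (l * cos \<beta>))"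
        unfolding c s by (simp add: algebra_simps)
      also have "l * sin \<beta> = - (sin \<alpha> * tanh a)" using polar(3) by simp
      also have "l * cos \<beta> = cos \<alpha>" using polar(2) by simp
      also have "\<epsilon> * (sin \<alpha> * - (sin \<alpha> * tanh a) - cos \<alpha> * tanh a * cos \<alpha>) = - (\<epsilon> * tanh a * ((sin \<alpha>)\<^sup>2 + (cos \<alpha>)\<^sup>2))"
      proof -
        have "\<epsilon> * (S * - (S * t) - C * t * C) = - (\<epsilon> * t * (S\<^sup>2 + C\<^sup>2))" for S C t
          by (simp add: power2_eq_square algebra_simps)
        then show ?thesis .
      qed
      finally have "l * (sin \<alpha> * sin (a * x) - cos \<alpha> * tanh a * cos (a * x)) = - (\<epsilon> * tanh a)" by simp
      moreover have "q = - (e / l)" if "l * q = - e" for q e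
      proof -
        have "q = l * q / l" using polar(1) by simp
        then show ?thesis unfolding that by simp
      qed
      ultimately show ?thesis by blast
    qed
    finally show ?thesis by simp
  qed
  ultimately have P: "P \<longlonglongrightarrow> - of_real (\<epsilon> * tanh a / l)" by simp
  have "((\<lambda>z. sin z / z) \<longlongrightarrow> 1) (at (0::complex))"
    using DERIV_sin[of "0::complex"] by (simp add: has_field_derivative_iff)
  then have "(\<lambda>n. sin (Y n) / Y n) \<longlonglongrightarrow> 1"
    by (rule filterlim_compose) (use Y0 Ynz in \<open>auto simp: filterlim_at\<close>)
  then have "(\<lambda>n. (1 / (\<i> * of_real a)) * (P n / of_real (l * \<epsilon>)) * (1 / (sin (Y n) / Y n)))
      \<longlonglongrightarrow> (1 / (\<i> * of_real a)) * (- of_real (\<epsilon> * tanh a / l) / of_real (l * \<epsilon>)) * (1 / 1)"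
    using polar(1) eps by (intro tendsto_intros P) auto
  moreover have "(1 / (\<i> * of_real a)) * (- of_real (\<epsilon> * tanh a / l) / of_real (l * \<epsilon>)) * (1 / 1) = \<i> * of_real mass"
  proof -
    have e0: "\<epsilon> \<noteq> 0" using eps by auto
    have "\<epsilon> * tanh a / l / (l * \<epsilon>) / a = mass" using e0 polar(1) a by (simp add: mass_def power2_eq_square)
    then have "complex_of_real (\<epsilon> * tanh a / l) / of_real (l * \<epsilon>) / of_real a = of_real mass"
      by (simp only: flip: of_real_divide)
    moreover have "(1 / (\<i> * A)) * (- B / C) * (1 / 1) = \<i> * (B / C / A)" for A B C :: complex
      by (simp add: divide_inverse)
    ultimately show ?thesis by metis
  qed
  moreover have "(1 / (\<i> * of_real a)) * (P n / of_real (l * \<epsilon>)) * (1 / (sin (Y n) / Y n)) =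
      of_real (y n) * weyl_function \<omega> (of_real x + \<i> * of_real (y n))" for n
  proof -
    have "Im (of_real x + \<i> * of_real (y n)) \<noteq> 0" using y[of n] by simp
    note w = weyl_quotient[OF this]
    show ?thesis unfolding w den P_def[symmetric] using a by (simp add: Y_def)
  qed
  ultimately have "(\<lambda>n. of_real (y n) * weyl_function \<omega> (of_real x + \<i> * of_real (y n))) \<longlonglongrightarrow> \<i> * of_real mass"
    by simp
  from tendsto_Im[OF this] have "(\<lambda>n. y n * Im (weyl_function \<omega> (of_real x + \<i> * of_real (y n)))) \<longlonglongrightarrow> mass" by simp
  then show ?thesis using atom_limit[of x] LIMSEQ_unique unfolding y_def by blast
qed

definition node :: "int \<Rightarrow> real" where "node n = (\<beta> + pi * of_int n) / a"

lemma sin_node: "sin (a * node n - \<beta>) = 0"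
proof -
  have "a * node n - \<beta> = of_int n * pi" using a by (simp add: node_def)
  then show ?thesis by (simp add: sin_zero_iff_int2)
qed

lemma zero_is_node: "sin (a * x - \<beta>) = 0 \<longleftrightarrow> x \<in> range node"
proof
  assume "sin (a * x - \<beta>) = 0"
  then obtain n :: int where "a * x - \<beta> = of_int n * pi" by (auto simp: sin_zero_iff_int2)
  then have "x = node n" using a by (simp add: node_def field_simps)
  then show "x \<in> range node" by simp
qed (auto simp: sin_node)

lemma inj_node: "inj node"
  using a by (auto simp: inj_def node_def)

lemma emeasure_nodes:
  assumes A: "A \<in> sets borel"
  shows "emeasure \<omega> A = (\<integral>\<^sup>+n. ennreal mass * indicator A (node n) \<partial>count_space UNIV)"
proof -
  have ae: "AE x in \<omega>. x \<in> range node" using supported_on_zeros by (simp add: zero_is_node)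
  have "emeasure \<omega> A = emeasure \<omega> (\<Union>n. {node n} \<inter> A)"
    by (rule emeasure_eq_AE) (use ae A in \<open>auto elim!: eventually_mono\<close>)
  also have "\<dots> = (\<integral>\<^sup>+n. emeasure \<omega> ({node n} \<inter> A) \<partial>count_space UNIV)"
    using A inj_node by (intro emeasure_UN_countable) (auto simp: disjoint_family_on_def inj_def)
  also have "\<dots> = (\<integral>\<^sup>+n. ennreal mass * indicator A (node n) \<partial>count_space UNIV)"
  proof (rule nn_integral_cong)
    fix n
    show "emeasure \<omega> ({node n} \<inter> A) = ennreal mass * indicator A (node n)"
      using mass_at_zero[OF sin_node[of n]] by (cases "node n \<in> A") (auto simp: emeasure_singleton)
  qed
  finally show ?thesis .
qed

lemma point_mass_eq: "point_mass a \<alpha> = mass"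
proof (cases "\<alpha> = 0")
  case True
  then show ?thesis using polar_square by (simp add: point_mass_def mass_def)
next
  case False
  then have s: "sin \<alpha> > 0" using \<alpha> by (intro sin_gt_zero) auto
  define t S C where "t = tanh a" and "S = sin \<alpha>" and "C = cos \<alpha>"
  have t: "t > 0" "coth a = 1 / t" using tanh_pos by (simp_all add: t_def coth_def tanh_def)
  have SC: "S\<^sup>2 + C\<^sup>2 = 1" "S > 0" using s by (simp_all add: S_def C_def)
  have "1 + (C / S)\<^sup>2 = 1 / S\<^sup>2" using SC by (simp add: field_simps)
  moreover have "1 + (C / S)\<^sup>2 * (1 / t)\<^sup>2 = (C\<^sup>2 + (S * t)\<^sup>2) / (S * t)\<^sup>2"
    using SC t by (simp add: field_simps)
  ultimately have "(1 / t) * (1 + (C / S)\<^sup>2) / (a * (1 + (C / S)\<^sup>2 * (1 / t)\<^sup>2)) =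
     (1 / t) * (1 / S\<^sup>2) / (a * ((C\<^sup>2 + (S * t)\<^sup>2) / (S * t)\<^sup>2))" by simp
  also have "\<dots> = t / (a * (C\<^sup>2 + (S * t)\<^sup>2))"
    using SC t by (simp add: power_mult_distrib) (simp add: power2_eq_square)
  finally show ?thesis
    using False polar_square by (simp add: point_mass_def mass_def cot_def t(2) S_def C_def t_def)
qed

theorem emeasure_point_masses:
  assumes A: "A \<in> sets borel"
  shows "emeasure \<omega> A = ennreal (point_mass a \<alpha>) *
    (\<Sum>\<^sub>\<infinity>n::int. emeasure (return borel ((\<beta> + pi * of_int n) / a)) A)"
proof -
  have "(\<Sum>\<^sub>\<infinity>n::int. emeasure (return borel ((\<beta> + pi * of_int n) / a)) A) =
      (\<integral>\<^sup>+n. indicator A (node n) \<partial>count_space UNIV)"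
    unfolding infsum_int_ennreal using A by (simp add: node_def)
  then show ?thesis
    unfolding emeasure_nodes[OF A] point_mass_eq by (simp add: nn_integral_cmult)
qed

end

section \<open>The extension with empty spectrum\<close>

context spectral_measure
begin

text \<open>
  The hypothesis allows an atom at z itself: there the kernel has the value 1 / 0 = 0, so it is
  the kernel of the reduced resolvent.
\<close>
lemma kernel_gap_L2:
  assumes "\<delta> > 0" and gap: "AE x in \<omega>. of_real x \<noteq> z \<longrightarrow> \<delta> \<le> cmod (of_real x - z)"
  shows "kernel z \<in> L2_space \<omega>"
proof (rule L2_of_decay[where C = "2 + (1 + 2 * (cmod z)\<^sup>2) / \<delta>\<^sup>2"])
  show "kernel z \<in> borel_measurable borel" unfolding kernel_def by measurable
  have p: "1 + x\<^sup>2 > 0" for x :: real by (simp add: add_pos_nonneg)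
  show "AE x in \<omega>. (cmod (kernel z x))\<^sup>2 \<le> (2 + (1 + 2 * (cmod z)\<^sup>2) / \<delta>\<^sup>2) / (1 + x\<^sup>2)"
    using gap
  proof eventually_elim
    case (elim x)
    show ?case
    proof (cases "of_real x = z")
      case True
      have "0 \<le> (2 + (1 + 2 * (cmod z)\<^sup>2) / \<delta>\<^sup>2) / (1 + x\<^sup>2)"
        using p[of x] assms(1) by (intro divide_nonneg_pos add_nonneg_nonneg) auto
      then show ?thesis using True by (simp add: kernel_def)
    next
      case False
      then show ?thesis unfolding kernel_def using elim by (intro resolvent_kernel_decay assms(1)) auto
    qed
  qed
qed

lemma kernel_gap_mult:
  assumes "\<delta> > 0" and gap: "AE x in \<omega>. of_real x \<noteq> z \<longrightarrow> \<delta> \<le> cmod (of_real x - z)"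
    and h: "h \<in> L2_space \<omega>"
  shows "(\<lambda>x. h x * kernel z x) \<in> L2_space \<omega>" "L2_norm \<omega> (\<lambda>x. h x * kernel z x) \<le> (1 / \<delta>) * L2_norm \<omega> h"
proof -
  have [measurable]: "h \<in> borel_measurable borel" using L2_measurable[OF h] by simp
  have m: "(\<lambda>x. h x * kernel z x) \<in> borel_measurable \<omega>" unfolding kernel_def by measurable
  have b: "AE x in \<omega>. cmod (h x * kernel z x) \<le> cmod (of_real (1 / \<delta>) * h x)"
    using gap
  proof eventually_elim
    case (elim x)
    have "cmod (kernel z x) \<le> 1 / \<delta>"
    proof (cases "of_real x = z")
      case False
      then show ?thesis unfolding kernel_def norm_divide norm_one using elim assms(1) by (intro divide_left_mono mult_pos_pos) auto
    qed (use assms(1) in \<open>simp add: kernel_def\<close>)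
    then have "cmod (h x) * cmod (kernel z x) \<le> cmod (h x) * (1 / \<delta>)" by (intro mult_left_mono) auto
    then show ?case using assms(1) by (simp only: norm_mult norm_of_real mult.commute) simp
  qed
  show "(\<lambda>x. h x * kernel z x) \<in> L2_space \<omega>" by (rule L2_dominated[OF L2_scale[OF h] m b])
  show "L2_norm \<omega> (\<lambda>x. h x * kernel z x) \<le> (1 / \<delta>) * L2_norm \<omega> h"
    using L2_norm_mono[OF L2_scale[OF h] m b] assms(1) unfolding L2_norm_scale by (simp only: norm_of_real) simp
qed

lemma resolvent_setI:
  assumes bound: "\<And>u v. (u, v) \<in> ext w \<Longrightarrow> L2_norm \<omega> u \<le> C * L2_norm \<omega> (\<lambda>x. v x - z * u x)"
    and surj: "\<And>h. h \<in> L2_space \<omega> \<Longrightarrow> \<exists>u v. (u, v) \<in> ext w \<and> (AE x in \<omega>. v x - z * u x = h x)"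
  shows "z \<in> resolvent_set \<omega> (ext w)"
proof -
  have "ae_eq \<omega> u (\<lambda>x. 0)" if uv: "(u, v) \<in> ext w" and e: "ae_eq \<omega> (\<lambda>x. v x - z * u x) (\<lambda>x. 0)" for u v
  proof -
    have L: "u \<in> L2_space \<omega>" "v \<in> L2_space \<omega>" using uv max_opD by (auto simp: ext_def)
    have "L2_norm \<omega> (\<lambda>x. v x - z * u x) = 0"
      using e L by (subst L2_norm_zero_iff) (auto simp: ae_eq_def)
    then have "L2_norm \<omega> u = 0" using bound[OF uv] L2_norm_nonneg[of \<omega> u] by simp
    then show ?thesis using L2_norm_zero_iff[OF L(1)] by (simp add: ae_eq_def)
  qed
  moreover have "\<exists>(f, g)\<in>ext w. ae_eq \<omega> (\<lambda>x. g x - z * f x) h" if "h \<in> L2_space \<omega>" for h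
    using surj[OF that] unfolding ae_eq_def by blast
  moreover have "\<exists>C. \<forall>(f, g)\<in>ext w. L2_norm \<omega> f \<le> C * L2_norm \<omega> (\<lambda>x. g x - z * f x)"
    using bound by (intro exI[of _ C]) auto
  ultimately show ?thesis unfolding resolvent_set_def by blast
qed

text \<open>
  The equation (S - z) u = h forces u = (h + c) / (x - z) with c = jump. The boundary condition
  reads c (w - M(z)) = \<integral> h / (x - z) d\<omega> and determines c when w \<noteq> M(z).
\<close>
lemma resolvent_regular_point:
  assumes \<delta>: "\<delta> > 0" and gap: "AE x in \<omega>. \<delta> \<le> cmod (of_real x - z)"
    and ne: "weyl_function \<omega> z \<noteq> w"
  shows "z \<in> resolvent_set \<omega> (ext w)"
proof -
  have gap': "AE x in \<omega>. of_real x \<noteq> z \<longrightarrow> \<delta> \<le> cmod (of_real x - z)" using gap by eventually_elim simp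
  have nez: "AE x in \<omega>. of_real x \<noteq> z" using gap by eventually_elim (use \<delta> in auto)
  note kL = kernel_gap_L2[OF \<delta> gap']
  define M where "M = weyl_function \<omega> z"
  have wM: "w - M \<noteq> 0" using ne by (simp add: M_def)
  define C where "C = 1 / \<delta> + L2_norm \<omega> (kernel z) * L2_norm \<omega> (kernel z) / cmod (w - M)"
  show ?thesis
  proof (rule resolvent_setI[where C = C])
    fix u v assume uv: "(u, v) \<in> ext w"
    define h where "h x = v x - z * u x" for x
    have m: "(u, v) \<in> max_op" "trace u v = w * jump u v" using uv by (auto simp: ext_def)
    note D = max_opD[OF m(1)]
    have hL: "h \<in> L2_space \<omega>" unfolding h_def using D by simp
    have "jump u v * (w - M) = (\<integral>x. h x * kernel z x \<partial>\<omega>)"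
      using trace_resolvent[OF kL nez m(1) hL] m(2) by (simp add: h_def M_def algebra_simps)
    then have "cmod (jump u v) * cmod (w - M) \<le> L2_norm \<omega> h * L2_norm \<omega> (kernel z)"
      using L2_Cauchy_Schwarz[OF hL kL] by (simp flip: norm_mult)
    then have c: "cmod (jump u v) \<le> L2_norm \<omega> h * L2_norm \<omega> (kernel z) / cmod (w - M)"
      using wM by (simp add: pos_le_divide_eq)
    have "AE x in \<omega>. u x = h x * kernel z x + jump u v * kernel z x"
      using nez D(3)
    proof eventually_elim
      case (elim x)
      have "of_real x - z \<noteq> 0" using elim by simp
      moreover have "(of_real x - z) * u x = h x + jump u v" using elim by (simp add: h_def algebra_simps)
      ultimately have "u x = (h x + jump u v) / (of_real x - z)" by (simp add: eq_divide_eq mult.commute)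
      then show ?case by (simp add: kernel_def add_divide_distrib)
    qed
    then have "L2_norm \<omega> u = L2_norm \<omega> (\<lambda>x. h x * kernel z x + jump u v * kernel z x)"
      using D kL kernel_gap_mult(1)[OF \<delta> gap' hL] by (intro L2_norm_cong_AE L2_measurable[OF D(1)] L2_measurable[OF L2_add]) auto
    also have "\<dots> \<le> L2_norm \<omega> (\<lambda>x. h x * kernel z x) + cmod (jump u v) * L2_norm \<omega> (kernel z)"
      using L2_norm_triangle[OF kernel_gap_mult(1)[OF \<delta> gap' hL] L2_scale[OF kL]] by (simp add: L2_norm_scale)
    also have "\<dots> \<le> (1 / \<delta>) * L2_norm \<omega> h + (L2_norm \<omega> h * L2_norm \<omega> (kernel z) / cmod (w - M)) * L2_norm \<omega> (kernel z)"
      by (intro add_mono mult_right_mono kernel_gap_mult(2)[OF \<delta> gap' hL] c) simp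
    also have "\<dots> = C * L2_norm \<omega> h" by (simp add: C_def algebra_simps)
    finally show "L2_norm \<omega> u \<le> C * L2_norm \<omega> (\<lambda>x. v x - z * u x)" unfolding h_def .
  next
    fix h assume h: "h \<in> L2_space \<omega>"
    define c where "c = (\<integral>x. h x * kernel z x \<partial>\<omega>) / (w - M)"
    define u where "u x = h x * kernel z x + c * kernel z x" for x
    define v where "v x = z * u x + h x" for x
    have uL: "u \<in> L2_space \<omega>" unfolding u_def using kernel_gap_mult(1)[OF \<delta> gap' h] kL by (intro L2_add L2_scale)
    have vL: "v \<in> L2_space \<omega>" unfolding v_def using uL h by simp
    have "AE x in \<omega>. v x = of_real x * u x - c"
      using nez
    proof eventually_elim
      case (elim x)
      have "(of_real x - z) * kernel z x = 1" using elim by (simp add: kernel_def)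
      then have "(of_real x - z) * u x = h x + c" unfolding u_def by (metis mult.left_commute distrib_left mult_1_right)
      then show ?case by (simp add: v_def algebra_simps)
    qed
    from max_opI[OF uL vL this] have m: "(u, v) \<in> max_op" "jump u v = c" .
    have "trace u v - c * M = (\<integral>x. h x * kernel z x \<partial>\<omega>)"
      using trace_resolvent[OF kL nez m(1) h] m(2) by (simp add: v_def M_def)
    also have "\<dots> = c * (w - M)" using wM by (simp add: c_def)
    finally have "trace u v = w * jump u v" by (simp add: m(2) algebra_simps)
    then show "\<exists>u v. (u, v) \<in> ext w \<and> (AE x in \<omega>. v x - z * u x = h x)"
      using m(1) by (intro exI[of _ u] exI[of _ v]) (simp add: ext_def v_def)
  qed
qed

text \<open>
  At an isolated atom t the Weyl function has a pole, but the boundary value problem is still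
  uniquely solvable: evaluating v - t u = h at t gives jump = - h(t), and the boundary condition
  determines u(t), whose coefficient in the trace is the mass of the atom.
\<close>
lemma resolvent_atom:
  fixes t :: real
  assumes \<delta>: "\<delta> > 0" and gap: "AE x in \<omega>. x \<noteq> t \<longrightarrow> \<delta> \<le> \<bar>x - t\<bar>"
    and \<mu>: "measure \<omega> {t} > 0"
  shows "of_real t \<in> resolvent_set \<omega> (ext w)"
proof -
  define z \<mu> where "z = complex_of_real t" and "\<mu> = measure \<omega> {t}"
  have \<mu>0: "\<mu> > 0" using \<mu> by (simp add: \<mu>_def)
  have gap': "AE x in \<omega>. of_real x \<noteq> z \<longrightarrow> \<delta> \<le> cmod (of_real x - z)"
    using gap by eventually_elim (simp add: z_def flip: of_real_diff)
  note kL = kernel_gap_L2[OF \<delta> gap']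
  define e :: "real \<Rightarrow> complex" where "e = indicator {t}"
  have e_sq: "(cmod (e x))\<^sup>2 = indicator {t} x" for x by (simp add: e_def indicator_def)
  have fin: "emeasure \<omega> {t} < \<infinity>" by (simp add: emeasure_singleton)
  have eL: "e \<in> L2_space \<omega>"
  proof (rule L2_spaceI)
    show "e \<in> borel_measurable \<omega>" unfolding e_def by measurable
    show "integrable \<omega> (\<lambda>x. (cmod (e x))\<^sup>2)" unfolding e_sq using fin by simp
  qed
  have int_e: "(\<integral>x. c * e x \<partial>\<omega>) = c * of_real \<mu>" for c
  proof -
    have "(\<integral>x. e x \<partial>\<omega>) = of_real (\<integral>x. indicator {t} x \<partial>\<omega>)"
      by (subst integral_complex_of_real[symmetric]) (simp add: e_def of_real_indicator)
    then show ?thesis by (simp add: \<mu>_def)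
  qed
  have at_t: "f x * e x = f t * e x" for f :: "real \<Rightarrow> complex" and x by (simp add: e_def indicator_def)
  have cnjs: "cnj (e x) = e x" "cnj (kernel z x) = kernel z x" "cnj z = z" for x
    by (simp_all add: e_def indicator_def cnj_kernel z_def)
  have me: "(e, \<lambda>x. z * e x) \<in> max_op" "jump e (\<lambda>x. z * e x) = 0"
    using max_opI[OF eL L2_scale[OF eL], of z 0] by (auto simp: e_def z_def indicator_def)
  have te: "trace e (\<lambda>x. z * e x) = of_real \<mu>"
    using trace_regular[OF me(2)] int_e[of 1] by simp
  have kv: "(\<lambda>x. z * kernel z x - e x) \<in> L2_space \<omega>" using kL eL by simp
  have "AE x in \<omega>. z * kernel z x - e x = of_real x * kernel z x - 1"
  proof (rule AE_I2)
    fix x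
    show "z * kernel z x - e x = of_real x * kernel z x - 1"
    proof (cases "x = t")
      case False
      then have "complex_of_real x - of_real t \<noteq> 0" by simp
      then show ?thesis using False by (simp add: kernel_def e_def z_def divide_simps)
    qed (simp add: kernel_def e_def z_def)
  qed
  note mk = max_opI[OF kL kv this]
  define T where "T = cnj (trace (kernel z) (\<lambda>x. z * kernel z x - e x))"
  \<comment> \<open>Green's identity against the eigenfunction at t and against the truncated kernel\<close>
  have id1: "(\<integral>x. h x * e x \<partial>\<omega>) = - (jump u v * of_real \<mu>)"
    and id2: "(\<integral>x. h x * kernel z x \<partial>\<omega>) + (\<integral>x. u x * e x \<partial>\<omega>) = trace u v - jump u v * T"
    if m: "(u, v) \<in> max_op" and h: "h = (\<lambda>x. v x - z * u x)" for u v h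
  proof -
    note D = max_opD[OF m]
    have i: "integrable \<omega> (\<lambda>x. v x * f x)" "integrable \<omega> (\<lambda>x. u x * f x)" if "f \<in> L2_space \<omega>" for f
      using D that by auto
    have "L2_inner \<omega> v e - L2_inner \<omega> u (\<lambda>x. z * e x) = (\<integral>x. v x * e x \<partial>\<omega>) - z * (\<integral>x. u x * e x \<partial>\<omega>)"
      unfolding L2_inner_def complex_cnj_mult cnjs by (simp add: mult.left_commute)
    also have "\<dots> = (\<integral>x. h x * e x \<partial>\<omega>)"
      unfolding h left_diff_distrib mult.assoc using i[OF eL]
      by (subst Bochner_Integration.integral_diff) auto
    finally show "(\<integral>x. h x * e x \<partial>\<omega>) = - (jump u v * of_real \<mu>)"
      using Green_identity[OF m me(1)] by (simp add: me(2) te)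
    have "L2_inner \<omega> v (kernel z) - L2_inner \<omega> u (\<lambda>x. z * kernel z x - e x) =
       (\<integral>x. v x * kernel z x \<partial>\<omega>) - (\<integral>x. z * (u x * kernel z x) - u x * e x \<partial>\<omega>)"
      unfolding L2_inner_def complex_cnj_diff complex_cnj_mult cnjs by (simp add: algebra_simps)
    also have "(\<integral>x. z * (u x * kernel z x) - u x * e x \<partial>\<omega>) = z * (\<integral>x. u x * kernel z x \<partial>\<omega>) - (\<integral>x. u x * e x \<partial>\<omega>)"
      using i[OF eL] i[OF kL] by (subst Bochner_Integration.integral_diff) auto
    also have "(\<integral>x. v x * kernel z x \<partial>\<omega>) - (z * (\<integral>x. u x * kernel z x \<partial>\<omega>) - (\<integral>x. u x * e x \<partial>\<omega>)) =
       (\<integral>x. h x * kernel z x \<partial>\<omega>) + (\<integral>x. u x * e x \<partial>\<omega>)"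
      unfolding h left_diff_distrib mult.assoc using i[OF kL]
      by (subst Bochner_Integration.integral_diff) auto
    finally show "(\<integral>x. h x * kernel z x \<partial>\<omega>) + (\<integral>x. u x * e x \<partial>\<omega>) = trace u v - jump u v * T"
      using Green_identity[OF m mk(1)] by (simp add: mk(2) T_def)
  qed
  have int_ue: "(\<integral>x. f x * e x \<partial>\<omega>) = f t * of_real \<mu>" for f
    unfolding at_t by (rule int_e)
  define k n where "k = L2_norm \<omega> (kernel z)" and "n = L2_norm \<omega> e"
  \<comment> \<open>from jump = - \<integral> h e / \<mu> and the formula for u(t), each estimated by Cauchy-Schwarz\<close>
  define C where "C = 1 / \<delta> + n / \<mu> * k + (n / \<mu> * cmod (w - T) + k) / \<mu> * n"
  have "z \<in> resolvent_set \<omega> (ext w)"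
  proof (rule resolvent_setI[where C = C])
    fix u v assume uv: "(u, v) \<in> ext w"
    define h where "h = (\<lambda>x. v x - z * u x)"
    have m: "(u, v) \<in> max_op" "trace u v = w * jump u v" using uv by (auto simp: ext_def)
    note D = max_opD[OF m(1)]
    have hL: "h \<in> L2_space \<omega>" unfolding h_def using D by simp
    define H where "H = L2_norm \<omega> h"
    have H0: "H \<ge> 0" "k \<ge> 0" "n \<ge> 0" by (simp_all add: H_def k_def n_def)
    note id = id1[OF m(1) h_def] id2[OF m(1) h_def]
    have "cmod (jump u v) * \<mu> = cmod (\<integral>x. h x * e x \<partial>\<omega>)" using \<mu>0 unfolding id by (simp add: norm_mult)
    also have "\<dots> \<le> H * n" using L2_Cauchy_Schwarz[OF hL eL] by (simp add: H_def n_def)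
    finally have c: "cmod (jump u v) \<le> H * (n / \<mu>)" using \<mu>0 by (simp add: pos_le_divide_eq)
    have "u t * of_real \<mu> = jump u v * (w - T) - (\<integral>x. h x * kernel z x \<partial>\<omega>)"
      using id(2) m(2) unfolding int_ue by (simp add: algebra_simps)
    then have "cmod (u t) * \<mu> \<le> cmod (jump u v * (w - T)) + cmod (\<integral>x. h x * kernel z x \<partial>\<omega>)"
      using norm_triangle_ineq4[of "jump u v * (w - T)" "\<integral>x. h x * kernel z x \<partial>\<omega>"] \<mu>0
      by (metis abs_of_pos norm_mult norm_of_real)
    also have "\<dots> \<le> H * (n / \<mu>) * cmod (w - T) + H * k"
      unfolding norm_mult using L2_Cauchy_Schwarz[OF hL kL] by (intro add_mono mult_right_mono c) (auto simp: H_def k_def)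
    finally have ut: "cmod (u t) \<le> H * ((n / \<mu> * cmod (w - T) + k) / \<mu>)" using \<mu>0 by (simp add: pos_le_divide_eq algebra_simps)
    have "AE x in \<omega>. u x = (h x * kernel z x + jump u v * kernel z x) + u t * e x"
      using D(3)
    proof eventually_elim
      case (elim x)
      show ?case
      proof (cases "x = t")
        case True then show ?thesis by (simp add: kernel_def e_def z_def)
      next
        case False
        then have "of_real x - z \<noteq> 0" by (simp add: z_def)
        moreover have "(of_real x - z) * u x = h x + jump u v" using elim by (simp add: h_def algebra_simps)
        ultimately have "u x = (h x + jump u v) / (of_real x - z)" by (simp add: eq_divide_eq mult.commute)
        then show ?thesis using False by (simp add: kernel_def e_def add_divide_distrib)
      qed
    qed
    moreover have L3: "(\<lambda>x. h x * kernel z x) \<in> L2_space \<omega>" "(\<lambda>x. jump u v * kernel z x) \<in> L2_space \<omega>" "(\<lambda>x. u t * e x) \<in> L2_space \<omega>"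
      using kernel_gap_mult(1)[OF \<delta> gap' hL] kL eL by (simp_all del: times_divide_eq_right)
    ultimately have "L2_norm \<omega> u = L2_norm \<omega> (\<lambda>x. (h x * kernel z x + jump u v * kernel z x) + u t * e x)"
      by (intro L2_norm_cong_AE L2_measurable[OF D(1)] L2_measurable[OF L2_add[OF L2_add]]) auto
    also have "\<dots> \<le> L2_norm \<omega> (\<lambda>x. h x * kernel z x + jump u v * kernel z x) + cmod (u t) * n"
      using L2_norm_triangle[OF L2_add[OF L3(1,2)] L3(3)] unfolding L2_norm_scale n_def .
    also have "L2_norm \<omega> (\<lambda>x. h x * kernel z x + jump u v * kernel z x) \<le> (1 / \<delta>) * H + cmod (jump u v) * k"
      using L2_norm_triangle[OF L3(1,2)] kernel_gap_mult(2)[OF \<delta> gap' hL] unfolding L2_norm_scale k_def H_def by linarith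
    also have "(1 / \<delta>) * H + cmod (jump u v) * k + cmod (u t) * n \<le> (1 / \<delta>) * H + H * (n / \<mu>) * k + H * ((n / \<mu> * cmod (w - T) + k) / \<mu>) * n"
      using c ut H0 by (intro add_mono mult_right_mono order_refl) auto
    also have "\<dots> = C * H" by (simp add: C_def algebra_simps)
    finally show "L2_norm \<omega> u \<le> C * L2_norm \<omega> (\<lambda>x. v x - z * u x)" by (simp add: H_def h_def)
  next
    fix h assume h: "h \<in> L2_space \<omega>"
    define c where "c = - h t"
    \<comment> \<open>the value u(t) forced by the boundary condition\<close>
    define \<kappa> where "\<kappa> = (c * (w - T) - (\<integral>x. h x * kernel z x \<partial>\<omega>)) / of_real \<mu>"
    define u where "u x = (h x * kernel z x + c * kernel z x) + \<kappa> * e x" for x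
    define v where "v x = z * u x + h x" for x
    have uL: "u \<in> L2_space \<omega>" unfolding u_def using kernel_gap_mult(1)[OF \<delta> gap' h] kL eL by (intro L2_add L2_scale)
    have vL: "v \<in> L2_space \<omega>" unfolding v_def using uL h by simp
    have "v x = of_real x * u x - c" for x
    proof (cases "x = t")
      case True then show ?thesis by (simp add: v_def c_def z_def)
    next
      case False
      then have "(of_real x - z) * kernel z x = 1" by (simp add: kernel_def z_def)
      then have "(of_real x - z) * (h x * kernel z x + c * kernel z x) = h x + c"
        by (metis mult.left_commute distrib_left mult_1_right)
      then have "(of_real x - z) * u x = h x + c" using False by (simp add: u_def e_def)
      then show ?thesis by (simp add: v_def algebra_simps)
    qed
    then have "AE x in \<omega>. v x = of_real x * u x - c" by simp
    from max_opI[OF uL vL this] have m: "(u, v) \<in> max_op" "jump u v = c" .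
    have "h = (\<lambda>x. v x - z * u x)" by (simp add: v_def)
    from id2[OF m(1) this] have "(\<integral>x. h x * kernel z x \<partial>\<omega>) + u t * of_real \<mu> = trace u v - c * T"
      unfolding int_ue m(2) .
    moreover have "u t = \<kappa>" by (simp add: u_def e_def kernel_def z_def)
    moreover have "\<kappa> * of_real \<mu> = c * (w - T) - (\<integral>x. h x * kernel z x \<partial>\<omega>)" using \<mu>0 by (simp add: \<kappa>_def)
    ultimately have "trace u v = w * jump u v" by (simp add: m(2) algebra_simps)
    then show "\<exists>u v. (u, v) \<in> ext w \<and> (AE x in \<omega>. v x - z * u x = h x)"
      using m(1) by (intro exI[of _ u] exI[of _ v]) (simp add: ext_def v_def)
  qed
  then show ?thesis by (simp add: z_def)
qed

end

lemma abs_sin_diff_le: "\<bar>sin p - sin q\<bar> \<le> \<bar>p - q\<bar>" for p q :: real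
proof -
  have "\<bar>sin p - sin q\<bar> = 2 * \<bar>sin ((p - q) / 2)\<bar> * \<bar>cos ((p + q) / 2)\<bar>"
    by (simp add: sin_diff_sin abs_mult)
  also have "\<dots> \<le> 2 * \<bar>(p - q) / 2\<bar> * 1"
    by (intro mult_mono abs_sin_x_le_abs_x abs_cos_le_one) auto
  finally show ?thesis by simp
qed

context cotangent_measure
begin

text \<open>
  The limit of M(z) as Im z tends to +\<infinity>: in the Moebius form \<open>weyl_rhs_exp\<close>
  the quotient of the coefficients of exp(-2 i a z).
\<close>
definition asymptotic_value :: complex where
  "asymptotic_value = (of_real (sin \<alpha>) + \<i> * of_real (tanh a * cos \<alpha>)) / (of_real (cos \<alpha>) - \<i> * of_real (tanh a * sin \<alpha>))"

lemma asymptotic_den_nonzero: "of_real (cos \<alpha>) - \<i> * of_real (tanh a * sin \<alpha>) \<noteq> 0"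
proof
  assume "of_real (cos \<alpha>) - \<i> * of_real (tanh a * sin \<alpha>) = 0"
  then have "cos \<alpha> = 0" "sin \<alpha> = 0" using tanh_pos by (auto simp: complex_eq_iff)
  then show False using sin_cos_squared_add[of \<alpha>] by simp
qed

lemma Im_asymptotic_value: "Im asymptotic_value > 0"
proof -
  define N where "N = (cos \<alpha>)\<^sup>2 + (tanh a * sin \<alpha>)\<^sup>2"
  have N: "N > 0" using polar_square polar(1) by (simp add: N_def mult.commute flip: polar_square)
  have "Im asymptotic_value = (tanh a * cos \<alpha> * cos \<alpha> + sin \<alpha> * (tanh a * sin \<alpha>)) / N"
    unfolding asymptotic_value_def by (simp add: Im_divide N_def)
  also have "tanh a * cos \<alpha> * cos \<alpha> + sin \<alpha> * (tanh a * sin \<alpha>) = tanh a * ((sin \<alpha>)\<^sup>2 + (cos \<alpha>)\<^sup>2)"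
    by (simp only: power2_eq_square distrib_left mult_ac add_ac)
  finally have "Im asymptotic_value = tanh a / N" by simp
  then show ?thesis using N tanh_pos by simp
qed

text \<open>
  After clearing denominators, M(z) = w becomes tanh a (cos(a z) + i sin(a z)) = 0, and the
  bracket is exp(i a z).
\<close>
lemma weyl_function_ne_asymptotic_value:
  assumes z: "Im z \<noteq> 0"
  shows "weyl_function \<omega> z \<noteq> asymptotic_value"
proof
  assume eq: "weyl_function \<omega> z = asymptotic_value"
  define S C where "S = sin (of_real a * z)" and "C = cos (of_real a * z)"
  define s c \<tau> where "s = complex_of_real (sin \<alpha>)" and "c = complex_of_real (cos \<alpha>)" and "\<tau> = complex_of_real (tanh a)"
  have num: "num z = s * S - c * \<tau> * C" by (simp add: num_def S_def C_def s_def c_def \<tau>_def)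
  have den: "den z = c * S + s * \<tau> * C"
  proof -
    have "c = of_real l * of_real (cos \<beta>)" "s * \<tau> = - of_real l * of_real (sin \<beta>)"
      using arg_cong[OF polar(2), of complex_of_real] arg_cong[OF polar(3), of complex_of_real] by (simp_all add: s_def c_def \<tau>_def)
    then show ?thesis by (simp add: den_def sin_diff S_def C_def sin_of_real cos_of_real algebra_simps)
  qed
  have "den z \<noteq> 0" unfolding den_def using polar(1) sin_nonreal[of "of_real a * z - of_real \<beta>"] a z by simp
  moreover have "num z / den z = (s + \<i> * (\<tau> * c)) / (c - \<i> * (\<tau> * s))" using eq weyl_quotient[OF z] by (simp add: asymptotic_value_def s_def c_def \<tau>_def)
  moreover have "c - \<i> * (\<tau> * s) \<noteq> 0" using asymptotic_den_nonzero by (simp add: s_def c_def \<tau>_def)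
  ultimately have "num z * (c - \<i> * (\<tau> * s)) - (s + \<i> * (\<tau> * c)) * den z = 0" by (simp add: frac_eq_eq)
  also have "num z * (c - \<i> * (\<tau> * s)) - (s + \<i> * (\<tau> * c)) * den z = - (\<tau> * (s * s + c * c) * (C + \<i> * S))"
    unfolding num den by (simp add: algebra_simps)
  finally have "\<tau> * (s * s + c * c) * (C + \<i> * S) = 0" by simp
  moreover have "s * s + c * c = 1"
  proof -
    have "sin \<alpha> * sin \<alpha> + cos \<alpha> * cos \<alpha> = 1" using sin_cos_squared_add[of \<alpha>] by (simp add: power2_eq_square)
    then have "complex_of_real (sin \<alpha> * sin \<alpha> + cos \<alpha> * cos \<alpha>) = 1" by simp
    then show ?thesis by (simp add: s_def c_def)
  qed
  moreover have "\<tau> \<noteq> 0" using tanh_pos by (simp add: \<tau>_def)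
  ultimately have "C + \<i> * S = 0" by simp
  then have "exp (\<i> * (of_real a * z)) = 0" by (simp only: exp_Euler S_def C_def)
  then show False by simp
qed

text \<open>
  Nonreal points and real points off the nodes are covered by
  \<open>resolvent_regular_point\<close>, because M is real on the real axis while w is not; the
  nodes are covered by \<open>resolvent_atom\<close>, because they are \<pi> / a apart.
\<close>
theorem empty_spectrum_asymptotic_extension: "spectrum \<omega> (ext asymptotic_value) = {}"
proof -
  have "z \<in> resolvent_set \<omega> (ext asymptotic_value)" for z
  proof (cases "Im z = 0")
    case False
    have "AE x in \<omega>. \<bar>Im z\<bar> \<le> cmod (of_real x - z)" using Im_le_distance by simp
    then show ?thesis
      using False by (intro resolvent_regular_point[of "\<bar>Im z\<bar>"] weyl_function_ne_asymptotic_value) auto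
  next
    case True
    define t where "t = Re z"
    have zt: "z = of_real t" using True by (simp add: t_def complex_eq_iff)
    show ?thesis
    proof (cases "sin (a * t - \<beta>) = 0")
      case False
      define \<delta> where "\<delta> = \<bar>sin (a * t - \<beta>)\<bar> / a"
      have \<delta>: "\<delta> > 0" using False a by (simp add: \<delta>_def)
      have gap: "AE x in \<omega>. \<delta> \<le> cmod (of_real x - z)"
        using supported_on_zeros
      proof eventually_elim
        case (elim x)
        have "\<bar>sin (a * t - \<beta>)\<bar> \<le> \<bar>(a * t - \<beta>) - (a * x - \<beta>)\<bar>"
          using abs_sin_diff_le[of "a * t - \<beta>" "a * x - \<beta>"] elim by simp
        also have "(a * t - \<beta>) - (a * x - \<beta>) = a * (t - x)" by (simp add: algebra_simps)
        finally have "\<bar>sin (a * t - \<beta>)\<bar> \<le> a * \<bar>x - t\<bar>" using a by (simp add: abs_mult abs_minus_commute)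
        then have "\<delta> \<le> \<bar>x - t\<bar>" using a by (simp add: \<delta>_def pos_divide_le_eq mult.commute)
        then show ?case by (simp add: zt flip: of_real_diff)
      qed
      have "cnj (weyl_function \<omega> z) = weyl_function \<omega> z"
        using weyl_function_cnj[of z] by (simp add: zt)
      then have "Im (weyl_function \<omega> z) = 0" by (simp add: complex_eq_iff)
      then have "weyl_function \<omega> z \<noteq> asymptotic_value" using Im_asymptotic_value by auto
      then show ?thesis by (rule resolvent_regular_point[OF \<delta> gap])
    next
      case True
      have "AE x in \<omega>. x \<noteq> t \<longrightarrow> pi / a \<le> \<bar>x - t\<bar>"
        using supported_on_zeros
      proof eventually_elim
        case (elim x)
        show ?case
        proof (rule impI, rule ccontr)
          assume ne: "x \<noteq> t" and lt: "\<not> pi / a \<le> \<bar>x - t\<bar>"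
          have "sin (a * (x - t)) = sin ((a * x - \<beta>) - (a * t - \<beta>))" by (simp add: algebra_simps)
          also have "\<dots> = 0" unfolding sin_diff[of "a * x - \<beta>" "a * t - \<beta>"] elim True by simp
          finally have s0: "sin (a * (x - t)) = 0" .
          have "\<bar>x - t\<bar> * a < pi" using lt a by (simp add: not_le pos_less_divide_eq)
          then have lt': "\<bar>a * (x - t)\<bar> < pi" unfolding abs_mult using a by (simp add: mult.commute)
          have "a * (x - t) = 0" by (rule sin_eq_0_pi[OF _ _ s0]) (use lt' in auto)
          then show False using ne a by simp
        qed
      qed
      then show ?thesis unfolding zt
        using a mass_pos mass_at_zero[OF True] by (intro resolvent_atom[of "pi / a"]) auto
    qed
  qed
  then show ?thesis by (auto simp: spectrum_def)
qed

end

section \<open>Absolutely continuous functions and Lebesgue differentiation\<close>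

lemma abs_continuous_onE:
  assumes "abs_continuous_on c d g" "\<epsilon> > 0"
  obtains \<delta> where "\<delta> > 0"
    "\<And>D. finite D \<Longrightarrow> (\<And>s t. (s, t) \<in> D \<Longrightarrow> c \<le> s \<and> s \<le> t \<and> t \<le> d) \<Longrightarrow>
        pairwise (\<lambda>(s, t) (s', t'). {s<..<t} \<inter> {s'<..<t'} = {}) D \<Longrightarrow>
        (\<Sum>(s, t)\<in>D. t - s) < \<delta> \<Longrightarrow> (\<Sum>(s, t)\<in>D. cmod (g t - g s)) < \<epsilon>"
proof -
  have "\<exists>\<delta>>0. \<forall>D. finite D \<longrightarrow>
        (\<forall>(s, t)\<in>D. c \<le> s \<and> s \<le> t \<and> t \<le> d) \<longrightarrow>
        pairwise (\<lambda>(s, t) (s', t'). {s<..<t} \<inter> {s'<..<t'} = {}) D \<longrightarrow>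
        (\<Sum>(s, t)\<in>D. t - s) < \<delta> \<longrightarrow> (\<Sum>(s, t)\<in>D. cmod (g t - g s)) < \<epsilon>"
    using assms unfolding abs_continuous_on_def by blast
  then obtain \<delta> where "\<delta> > 0" and d: "\<forall>D. finite D \<longrightarrow>
        (\<forall>(s, t)\<in>D. c \<le> s \<and> s \<le> t \<and> t \<le> d) \<longrightarrow>
        pairwise (\<lambda>(s, t) (s', t'). {s<..<t} \<inter> {s'<..<t'} = {}) D \<longrightarrow>
        (\<Sum>(s, t)\<in>D. t - s) < \<delta> \<longrightarrow> (\<Sum>(s, t)\<in>D. cmod (g t - g s)) < \<epsilon>"
    by (elim exE conjE)
  show ?thesis
  proof (rule that[OF \<open>\<delta> > 0\<close>])
    fix D assume D: "finite D" "\<And>s t. (s, t) \<in> D \<Longrightarrow> c \<le> s \<and> s \<le> t \<and> t \<le> d"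
        "pairwise (\<lambda>(s, t) (s', t'). {s<..<t} \<inter> {s'<..<t'} = {}) D" "(\<Sum>(s, t)\<in>D. t - s) < \<delta>"
    have "\<forall>(s, t)\<in>D. c \<le> s \<and> s \<le> t \<and> t \<le> d" using D(2) by auto
    from d[THEN spec, THEN mp, OF D(1), THEN mp, OF this, THEN mp, OF D(3), THEN mp, OF D(4)]
    show "(\<Sum>(s, t)\<in>D. cmod (g t - g s)) < \<epsilon>" .
  qed
qed

lemma abs_continuous_on_imp_continuous:
  assumes "abs_continuous_on c d g"
  shows "continuous_on {c..d} g"
  unfolding continuous_on_iff
proof (intro ballI allI impI)
  fix x and e :: real assume x: "x \<in> {c..d}" and e: "e > 0"
  obtain \<delta> where \<delta>: "\<delta> > 0" "\<And>D. finite D \<Longrightarrow> (\<And>s t. (s, t) \<in> D \<Longrightarrow> c \<le> s \<and> s \<le> t \<and> t \<le> d) \<Longrightarrow>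
        pairwise (\<lambda>(s, t) (s', t'). {s<..<t} \<inter> {s'<..<t'} = {}) D \<Longrightarrow>
        (\<Sum>(s, t)\<in>D. t - s) < \<delta> \<Longrightarrow> (\<Sum>(s, t)\<in>D. cmod (g t - g s)) < e"
    by (rule abs_continuous_onE[OF assms e]) blast
  show "\<exists>\<delta>>0. \<forall>x'\<in>{c..d}. dist x' x < \<delta> \<longrightarrow> dist (g x') (g x) < e"
  proof (intro exI[of _ \<delta>] conjI ballI impI \<delta>(1))
    fix y assume y: "y \<in> {c..d}" and d: "dist y x < \<delta>"
    have "(\<Sum>(s, t)\<in>{(min x y, max x y)}. cmod (g t - g s)) < e"
      by (rule \<delta>(2)) (use x y d in \<open>auto simp: dist_real_def pairwise_def min_def max_def split: if_splits\<close>)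
    then show "dist (g y) (g x) < e"
      by (auto simp: dist_norm min_def max_def norm_minus_commute split: if_splits)
  qed
qed

text \<open>
  The integral is computed with a gauge. At points where g is differentiable the gauge makes the
  increments of g comparable with the derivative; at the exceptional points it keeps the tagged
  intervals inside an open set of small measure, where absolute continuity makes the sum of the
  increments small.
\<close>
theorem abs_continuous_on_has_integral:
  fixes g g' :: "real \<Rightarrow> complex"
  assumes cd: "c \<le> d" and ac: "abs_continuous_on c d g"
    and N: "negligible N" "\<And>x. x \<in> {c..d} - N \<Longrightarrow> (g has_vector_derivative g' x) (at x)"
  shows "(g' has_integral (g d - g c)) {c..d}"
proof -
  \<comment> \<open>redefining the derivative as zero on N removes the exceptional tags from the Riemann sum\<close>
  define f where "f x = (if x \<in> N then 0 else g' x)" for x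
  have "(f has_integral (g d - g c)) (cbox c d)"
    unfolding has_integral
  proof (intro allI impI)
    fix e :: real assume e: "e > 0"
    define \<eta> where "\<eta> = e / (2 * (d - c + 1))"
    have \<eta>: "\<eta> > 0" using e cd by (simp add: \<eta>_def)
    obtain \<delta> where \<delta>: "\<delta> > 0" "\<And>D. finite D \<Longrightarrow> (\<And>s t. (s, t) \<in> D \<Longrightarrow> c \<le> s \<and> s \<le> t \<and> t \<le> d) \<Longrightarrow>
        pairwise (\<lambda>(s, t) (s', t'). {s<..<t} \<inter> {s'<..<t'} = {}) D \<Longrightarrow>
        (\<Sum>(s, t)\<in>D. t - s) < \<delta> \<Longrightarrow> (\<Sum>(s, t)\<in>D. cmod (g t - g s)) < e / 2"
      by (rule abs_continuous_onE[OF ac half_gt_zero[OF e]]) blast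
    obtain U where U: "open U" "N \<subseteq> U" "emeasure lborel U < ennreal \<delta>"
    proof -
      have Nn: "N \<in> null_sets lebesgue" using N(1) by (simp add: negligible_iff_null_sets)
      then have Ns: "N \<in> sets lebesgue" by auto
      obtain T where T: "open T" "N \<subseteq> T" "(T - N) \<in> lmeasurable" "emeasure lebesgue (T - N) < ennreal \<delta>"
        by (rule sets_lebesgue_outer_open[OF Ns \<delta>(1)])
      have "emeasure lebesgue T = emeasure lebesgue (T - N)"
        using Nn T(1) by (intro emeasure_Diff_null_set[symmetric]) auto
      moreover have "emeasure lebesgue T = emeasure lborel T" using T(1) by simp
      ultimately show ?thesis using that[of T] T by simp
    qed
    have "\<exists>r>0. x \<notin> N \<longrightarrow> x \<in> {c..d} \<longrightarrow> (\<forall>y. \<bar>y - x\<bar> < r \<longrightarrow> cmod (g y - g x - (y - x) *\<^sub>R g' x) \<le> \<eta> * \<bar>y - x\<bar>)" for x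
    proof (cases "x \<notin> N \<and> x \<in> {c..d}")
      case True
      then have "(g has_vector_derivative g' x) (at x)" using N(2) by blast
      then have "\<exists>r>0. \<forall>y. norm (y - x) < r \<longrightarrow> norm (g y - g x - (y - x) *\<^sub>R g' x) \<le> \<eta> * norm (y - x)"
        using \<eta> unfolding has_vector_derivative_def has_derivative_at_alt by blast
      then show ?thesis by (auto simp: real_norm_def)
    qed (use zero_less_one in blast)
    then have "\<forall>x. \<exists>r. r > 0 \<and> (x \<notin> N \<longrightarrow> x \<in> {c..d} \<longrightarrow> (\<forall>y. \<bar>y - x\<bar> < r \<longrightarrow> cmod (g y - g x - (y - x) *\<^sub>R g' x) \<le> \<eta> * \<bar>y - x\<bar>))"
      by blast
    from this[THEN choice] obtain r where r0: "\<forall>x. r x > 0 \<and> (x \<notin> N \<longrightarrow> x \<in> {c..d} \<longrightarrow>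
        (\<forall>y. \<bar>y - x\<bar> < r x \<longrightarrow> cmod (g y - g x - (y - x) *\<^sub>R g' x) \<le> \<eta> * \<bar>y - x\<bar>))" ..
    have r: "r x > 0" "x \<notin> N \<Longrightarrow> x \<in> {c..d} \<Longrightarrow> \<bar>y - x\<bar> < r x \<Longrightarrow> cmod (g y - g x - (y - x) *\<^sub>R g' x) \<le> \<eta> * \<bar>y - x\<bar>" for x y
      using r0 by auto
    define \<gamma> where "\<gamma> x = (if x \<in> N then U else ball x (r x))" for x
    have g1: "gauge \<gamma>" using U r(1) by (auto simp: gauge_def \<gamma>_def)
    have g2: "norm ((\<Sum>(x, K)\<in>p. measure lborel K *\<^sub>R f x) - (g d - g c)) < e"
      if p: "p tagged_division_of cbox c d" "\<gamma> fine p" for p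
    proof -
      note pD = tagged_division_ofD[OF p(1)]
      have K: "K = {Inf K..Sup K}" "Inf K \<le> x" "x \<le> Sup K" "c \<le> Inf K" "Sup K \<le> d" "measure lborel K = Sup K - Inf K"
        "K \<subseteq> \<gamma> x" if "(x, K) \<in> p" for x K
      proof -
        obtain s t where st: "K = cbox s t" using pD(4)[OF \<open>(x, K) \<in> p\<close>] by blast
        have x: "x \<in> K" "K \<subseteq> {c..d}" using pD(2,3)[OF \<open>(x, K) \<in> p\<close>] by auto
        then have "s \<le> t" using st by auto
        then show "K = {Inf K..Sup K}" "Inf K \<le> x" "x \<le> Sup K" "c \<le> Inf K" "Sup K \<le> d" "measure lborel K = Sup K - Inf K"
          using x unfolding st by auto
        show "K \<subseteq> \<gamma> x" using p(2) \<open>(x, K) \<in> p\<close> by (rule fineD)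
      qed
      define P where "P = {q \<in> p. fst q \<in> N}"
      have finp: "finite p" "finite P" using pD(1) by (auto simp: P_def)
      define \<Delta> where "\<Delta> K = g (Sup K) - g (Inf K)" for K
      have tele: "(\<Sum>(x, K)\<in>p. \<Delta> K) = g d - g c"
        unfolding \<Delta>_def using additive_tagged_division_1[OF cd, of p g] p(1) by simp
      have good: "cmod (measure lborel K *\<^sub>R f x - \<Delta> K) \<le> \<eta> * measure lborel K" if xK: "(x, K) \<in> p" "x \<notin> N" for x K
      proof -
        note k = K[OF xK(1)]
        have xcd: "x \<in> {c..d}" using k by auto
        have "Inf K \<in> K" "Sup K \<in> K" using k by auto
        then have "Inf K \<in> ball x (r x)" "Sup K \<in> ball x (r x)" using k(7) xK(2) by (auto simp: \<gamma>_def)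
        then have "\<bar>Inf K - x\<bar> < r x" "\<bar>Sup K - x\<bar> < r x" by (auto simp: dist_real_def)
        note a1 = r(2)[OF xK(2) xcd this(1)] and a2 = r(2)[OF xK(2) xcd this(2)]
        have "measure lborel K *\<^sub>R f x - \<Delta> K = (g (Inf K) - g x - (Inf K - x) *\<^sub>R g' x) - (g (Sup K) - g x - (Sup K - x) *\<^sub>R g' x)"
          unfolding k(6) \<Delta>_def f_def using xK(2) by (simp add: algebra_simps)
        also have "cmod \<dots> \<le> \<eta> * \<bar>Inf K - x\<bar> + \<eta> * \<bar>Sup K - x\<bar>"
          by (rule order_trans[OF norm_triangle_ineq4 add_mono[OF a1 a2]])
        also have "\<dots> = \<eta> * (\<bar>Inf K - x\<bar> + \<bar>Sup K - x\<bar>)" by (simp only: distrib_left)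
        also have "\<bar>Inf K - x\<bar> + \<bar>Sup K - x\<bar> = measure lborel K" using k(2,3,6) by linarith
        finally show ?thesis .
      qed
      have bad: "(\<Sum>(x, K)\<in>P. cmod (\<Delta> K)) < e / 2"
      proof -
        \<comment> \<open>the intervals tagged in N as pairs of end points; a degenerate interval contains only one tag,
          so the pairs are distinct\<close>
        define \<phi> where "\<phi> q = (Inf (snd q), Sup (snd q))" for q :: "real \<times> real set"
        have disj: "{Inf K1<..<Sup K1} \<inter> {Inf K2<..<Sup K2} = {}"
          if "(x1, K1) \<in> p" "(x2, K2) \<in> p" "(x1, K1) \<noteq> (x2, K2)" for x1 K1 x2 K2
        proof -
          have "interior K1 \<inter> interior K2 = {}" using pD(5)[OF that] .
          moreover have "interior K1 = {Inf K1<..<Sup K1}" "interior K2 = {Inf K2<..<Sup K2}"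
            using K(1)[OF that(1)] K(1)[OF that(2)] interior_atLeastAtMost_real by metis+
          ultimately show ?thesis by simp
        qed
        have inj: "inj_on \<phi> P"
        proof (rule inj_onI, rule ccontr)
          fix q1 q2 assume q: "q1 \<in> P" "q2 \<in> P" "\<phi> q1 = \<phi> q2" "q1 \<noteq> q2"
          obtain x1 K1 x2 K2 where e: "q1 = (x1, K1)" "q2 = (x2, K2)" by (cases q1, cases q2)
          have m: "(x1, K1) \<in> p" "(x2, K2) \<in> p" using q e by (auto simp: P_def)
          have IS: "Inf K1 = Inf K2" "Sup K1 = Sup K2" using q(3) e by (auto simp: \<phi>_def)
          then have KK: "K1 = K2" using K(1)[OF m(1)] K(1)[OF m(2)] by metis
          have "{Inf K1<..<Sup K1} = {}" using disj[OF m] q(4) e IS by auto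
          then have "Sup K1 \<le> Inf K1" by simp
          then have "x1 = x2" using K(2,3)[OF m(1)] K(2,3)[OF m(2)] IS by linarith
          then show False using KK q(4) e by simp
        qed
        have D: "finite (\<phi> ` P)" using finp by simp
        have D1: "c \<le> s \<and> s \<le> t \<and> t \<le> d" if "(s, t) \<in> \<phi> ` P" for s t
        proof -
          from that obtain x k where "(x, k) \<in> p" "s = Inf k" "t = Sup k" by (auto simp: \<phi>_def P_def)
          then show ?thesis using K[of x k] by auto
        qed
        have D2: "pairwise (\<lambda>(s, t) (s', t'). {s<..<t} \<inter> {s'<..<t'} = {}) (\<phi> ` P)"
        proof (rule pairwiseI)
          fix u v assume uv: "u \<in> \<phi> ` P" "v \<in> \<phi> ` P" "u \<noteq> v"
          from uv(1) obtain x1 K1 where e1: "(x1, K1) \<in> p" "u = (Inf K1, Sup K1)"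
            by (auto simp: \<phi>_def P_def)
          from uv(2) obtain x2 K2 where e2: "(x2, K2) \<in> p" "v = (Inf K2, Sup K2)"
            by (auto simp: \<phi>_def P_def)
          note e = e1 e2
          then have "(x1, K1) \<noteq> (x2, K2)" using uv by auto
          from disj[OF e(1) e(3) this] show "(\<lambda>(s, t) (s', t'). {s<..<t} \<inter> {s'<..<t'} = {}) u v"
            by (simp add: e)
        qed
        have D3: "(\<Sum>(s, t)\<in>\<phi> ` P. t - s) < \<delta>"
        proof -
          have "ennreal (\<Sum>(s, t)\<in>\<phi> ` P. t - s) = (\<Sum>(s, t)\<in>\<phi> ` P. ennreal (t - s))"
            using D1 by (subst sum_ennreal[symmetric]) (auto simp: split_beta)
          also have "\<dots> = (\<Sum>q\<in>\<phi> ` P. emeasure lborel {fst q<..<snd q})"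
            using D1 by (intro sum.cong) (auto simp: split_beta)
          also have "\<dots> = emeasure lborel (\<Union>q\<in>\<phi> ` P. {fst q<..<snd q})"
            using D2 D by (intro sum_emeasure) (auto simp: disjoint_family_on_def pairwise_def split_beta)
          also have "\<dots> \<le> emeasure lborel U"
          proof (rule emeasure_mono)
            show "(\<Union>q\<in>\<phi> ` P. {fst q<..<snd q}) \<subseteq> U"
            proof (rule UN_least)
              fix q assume "q \<in> \<phi> ` P"
              then obtain x k where xk: "(x, k) \<in> p" "x \<in> N" "q = (Inf k, Sup k)" by (auto simp: \<phi>_def P_def)
              have "{Inf k<..<Sup k} \<subseteq> {Inf k..Sup k}" by auto
              also have "\<dots> = k" using K(1)[OF xk(1)] ..
              also have "k \<subseteq> U" using K(7)[OF xk(1)] xk(2) by (simp add: \<gamma>_def)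
              finally show "{fst q<..<snd q} \<subseteq> U" by (simp add: xk)
            qed
          qed (use U in simp)
          also have "\<dots> < ennreal \<delta>" by (rule U(3))
          finally have "ennreal (\<Sum>(s, t)\<in>\<phi> ` P. t - s) < ennreal \<delta>" .
          then show ?thesis by (meson ennreal_leI leD not_le)
        qed
        have "(\<Sum>(s, t)\<in>\<phi> ` P. cmod (g t - g s)) < e / 2"
          by (rule \<delta>(2)[OF D D1 D2 D3])
        then show ?thesis unfolding split_beta sum.reindex[OF inj] o_def by (simp add: \<phi>_def \<Delta>_def)
      qed
      have "(\<Sum>(x, K)\<in>p. measure lborel K *\<^sub>R f x) - (g d - g c) = (\<Sum>(x, K)\<in>p. measure lborel K *\<^sub>R f x - \<Delta> K)"
        unfolding tele[symmetric] by (simp add: split_beta sum_subtractf)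
      also have "cmod \<dots> \<le> (\<Sum>(x, K)\<in>p. cmod (measure lborel K *\<^sub>R f x - \<Delta> K))"
        unfolding split_beta by (rule norm_sum)
      also have "\<dots> \<le> (\<Sum>(x, K)\<in>p. \<eta> * measure lborel K + (if x \<in> N then cmod (\<Delta> K) else 0))"
      proof (rule sum_mono, clarify)
        fix x K assume xK: "(x, K) \<in> p"
        show "cmod (measure lborel K *\<^sub>R f x - \<Delta> K) \<le> \<eta> * measure lborel K + (if x \<in> N then cmod (\<Delta> K) else 0)"
        proof (cases "x \<in> N")
          case True
          then show ?thesis using \<eta> by (simp add: f_def)
        qed (use good[OF xK] in simp)
      qed
      also have "\<dots> = \<eta> * (\<Sum>(x, K)\<in>p. measure lborel K) + (\<Sum>(x, K)\<in>P. cmod (\<Delta> K))"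
      proof -
        have "(\<Sum>q\<in>p. if fst q \<in> N then cmod (\<Delta> (snd q)) else 0) = (\<Sum>q\<in>P. cmod (\<Delta> (snd q)))"
          unfolding P_def using finp(1) by (simp add: sum.inter_filter)
        then show ?thesis by (simp add: split_beta sum.distrib sum_distrib_left)
      qed
      also have "(\<Sum>(x, K)\<in>p. measure lborel K) = d - c"
        using additive_content_tagged_division[of p c d] p(1) cd by simp
      also have "\<eta> * (d - c) + (\<Sum>(x, K)\<in>P. cmod (\<Delta> K)) < e"
      proof -
        have "\<eta> * (d - c) \<le> \<eta> * (d - c + 1)" using \<eta> by (intro mult_left_mono) auto
        also have "\<dots> = e / 2"
        proof -
          have "e / (2 * X) * X = e / 2" if "X \<noteq> 0" for X using that by simp
          from this[of "d - c + 1"] show ?thesis using cd unfolding \<eta>_def by simp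
        qed
        finally show ?thesis using bad by simp
      qed
      finally show ?thesis .
    qed
    show "\<exists>\<gamma>. gauge \<gamma> \<and> (\<forall>\<D>. \<D> tagged_division_of cbox c d \<and> \<gamma> fine \<D> \<longrightarrow>
        norm ((\<Sum>(x, k)\<in>\<D>. measure lborel k *\<^sub>R f x) - (g d - g c)) < e)"
      by (intro exI[of _ \<gamma>] conjI allI impI g1) (elim conjE, rule g2; assumption)
  qed
  then show ?thesis
    by (intro has_integral_spike[OF N(1), of "{c..d}" g' f]) (auto simp: f_def)
qed

text \<open>
  Let E k be the set of points where the difference quotient deviates from h by more than 1 / (k +
  1) at arbitrarily small scales. Vitali's covering lemma selects disjoint witnessing intervals
  whose fivefold enlargements cover E k, and the Henstock lemma bounds the total deviation over
  disjoint gauge-fine intervals, hence their total length.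
\<close>
theorem lebesgue_differentiation_indefinite_integral:
  fixes h :: "real \<Rightarrow> 'a::euclidean_space"
  assumes h: "h integrable_on {c..d}"
  shows "negligible {x \<in> {c<..<d}. \<not> ((\<lambda>x. integral {c..x} h) has_vector_derivative h x) (at x)}"
proof -
  define F where "F x = integral {c..x} h" for x
  have Fdiff: "F y - F x = integral {x..y} h" if "c \<le> x" "x \<le> y" "y \<le> d" for x y
  proof -
    have "h integrable_on {c..y}" using h that by (rule_tac integrable_on_subinterval[OF h]) auto
    then show ?thesis using Henstock_Kurzweil_Integration.integral_combine[of c x y h] that by (simp add: F_def diff_eq_eq add.commute)
  qed
  define E where "E k = {x \<in> {c<..<d}. \<forall>r>0. \<exists>y\<in>{c..d}. y \<noteq> x \<and> \<bar>y - x\<bar> < r \<and>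
     \<bar>y - x\<bar> / real (Suc k) < norm (F y - F x - (y - x) *\<^sub>R h x)}" for k
  have neg: "negligible (E k)" for k
    unfolding negligible_outer_le
  proof (intro allI impI)
    fix e :: real assume e: "e > 0"
    define \<epsilon> where "\<epsilon> = e / (5 * real (Suc k))"
    have \<epsilon>: "\<epsilon> > 0" using e by (simp add: \<epsilon>_def)
    have hc: "h integrable_on cbox c d" using h by simp
    obtain \<gamma> where \<gamma>: "gauge \<gamma>" "\<And>p. p tagged_partial_division_of (cbox c d) \<Longrightarrow> \<gamma> fine p \<Longrightarrow>
             sum (\<lambda>(x,K). norm (measure lborel K *\<^sub>R h x - integral K h)) p < \<epsilon>"
    proof (rule Henstock_lemma[OF hc \<epsilon>])
      fix \<gamma>' :: "real \<Rightarrow> real set"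
      assume g1: "gauge \<gamma>'" and g2: "\<And>p. p tagged_partial_division_of (cbox c d) \<Longrightarrow> \<gamma>' fine p \<Longrightarrow>
             sum (\<lambda>(x,K). norm (measure lborel K *\<^sub>R h x - integral K h)) p < \<epsilon>"
      show thesis by (rule that[OF g1 g2])
    qed
    have "\<exists>y. x \<in> E k \<longrightarrow> y \<in> {c..d} \<and> y \<noteq> x \<and> {min x y..max x y} \<subseteq> \<gamma> x \<and>
     \<bar>y - x\<bar> / real (Suc k) < norm (F y - F x - (y - x) *\<^sub>R h x)" for x
    proof (cases "x \<in> E k")
      case True
      obtain r where r: "r > 0" "ball x r \<subseteq> \<gamma> x"
        using \<gamma>(1) unfolding gauge_def open_contains_ball by blast
      obtain y where y: "y \<in> {c..d}" "y \<noteq> x" "\<bar>y - x\<bar> < r" "\<bar>y - x\<bar> / real (Suc k) < norm (F y - F x - (y - x) *\<^sub>R h x)"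
        using True r(1) unfolding E_def by blast
      have "{min x y..max x y} \<subseteq> ball x r" using y(3) by (auto simp: dist_real_def)
      then show ?thesis using y r(2) by blast
    qed simp
    then have "\<forall>x. \<exists>y. x \<in> E k \<longrightarrow> y \<in> {c..d} \<and> y \<noteq> x \<and> {min x y..max x y} \<subseteq> \<gamma> x \<and>
     \<bar>y - x\<bar> / real (Suc k) < norm (F y - F x - (y - x) *\<^sub>R h x)" by blast
    from this[THEN choice] obtain y where "\<forall>x. x \<in> E k \<longrightarrow> y x \<in> {c..d} \<and> y x \<noteq> x \<and> {min x (y x)..max x (y x)} \<subseteq> \<gamma> x \<and>
     \<bar>y x - x\<bar> / real (Suc k) < norm (F (y x) - F x - (y x - x) *\<^sub>R h x)" ..
    then have y: "y x \<in> {c..d}" "y x \<noteq> x" "{min x (y x)..max x (y x)} \<subseteq> \<gamma> x"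
      "\<bar>y x - x\<bar> / real (Suc k) < norm (F (y x) - F x - (y x - x) *\<^sub>R h x)" if "x \<in> E k" for x
      using that by auto
    have Ecd: "c < x \<and> x < d" if "x \<in> E k" for x using that by (simp add: E_def)
    define I where "I x = {min x (y x)..max x (y x)}" for x
    define m \<rho> where "m x = (x + y x) / 2" and "\<rho> x = \<bar>y x - x\<bar> / 2" for x
    have Icb: "cball (m x) (\<rho> x) = I x" for x
      by (auto simp: cball_eq_atLeastAtMost m_def \<rho>_def I_def min_def max_def field_simps abs_if)
    have xI: "x \<in> I x" for x by (auto simp: I_def)
    have Icd: "I x \<subseteq> {c..d}" if "x \<in> E k" for x using y(1)[OF that] Ecd[OF that] by (auto simp: I_def)
    have "E k \<subseteq> (\<Union>x\<in>E k. cball (m x) (\<rho> x))" unfolding Icb using xI by blast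
    moreover have "0 < \<rho> x \<and> \<rho> x \<le> (d - c) / 2" if "x \<in> E k" for x
      using y(1,2)[OF that] Ecd[OF that] by (auto simp: \<rho>_def)
    ultimately have VC: "E k \<subseteq> (\<Union>x\<in>E k. cball (m x) (\<rho> x))"
      "\<And>x. x \<in> E k \<Longrightarrow> 0 < \<rho> x \<and> \<rho> x \<le> (d - c) / 2" by auto
    obtain C where C: "countable C" "C \<subseteq> E k"
      "pairwise (\<lambda>i j. disjnt (cball (m i) (\<rho> i)) (cball (m j) (\<rho> j))) C"
      "E k \<subseteq> (\<Union>i\<in>C. cball (m i) (5 * \<rho> i))"
      by (rule Vitali_covering_lemma_cballs[OF VC])
    have sum_small: "(\<Sum>x\<in>C'. 2 * \<rho> x) \<le> real (Suc k) * \<epsilon>" if C': "C' \<subseteq> C" "finite C'" for C'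
    proof -
      define p where "p = (\<lambda>x. (x, I x)) ` C'"
      have inE: "x \<in> E k" if "x \<in> C'" for x using that C' C(2) by blast
      have "p tagged_partial_division_of (cbox c d)"
        unfolding tagged_partial_division_of_def
      proof (intro conjI allI impI)
        show "finite p" using C' by (simp add: p_def)
        fix x K assume "(x, K) \<in> p"
        then have x: "x \<in> C'" "K = I x" by (auto simp: p_def)
        then show "x \<in> K" "K \<subseteq> cbox c d" "\<exists>a b. K = cbox a b"
          using xI Icd[OF inE[OF x(1)]] by (auto simp: I_def)
      next
        fix x1 K1 x2 K2 assume "(x1, K1) \<in> p \<and> (x2, K2) \<in> p \<and> (x1, K1) \<noteq> (x2, K2)"
        then have x: "x1 \<in> C" "x2 \<in> C" "K1 = I x1" "K2 = I x2" "x1 \<noteq> x2" using C' by (auto simp: p_def)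
        then have "disjnt K1 K2" using C(3) unfolding pairwise_def Icb by blast
        then show "interior K1 \<inter> interior K2 = {}" using interior_subset unfolding disjnt_def by blast
      qed
      moreover have "\<gamma> fine p"
      proof (rule fineI)
        fix x K assume "(x, K) \<in> p"
        then have "x \<in> C'" "K = I x" by (auto simp: p_def)
        then show "K \<subseteq> \<gamma> x" using y(3)[OF inE] by (simp add: I_def)
      qed
      ultimately have "sum (\<lambda>(x,K). norm (measure lborel K *\<^sub>R h x - integral K h)) p < \<epsilon>" by (rule \<gamma>(2))
      then have lt: "(\<Sum>x\<in>C'. norm (measure lborel (I x) *\<^sub>R h x - integral (I x) h)) < \<epsilon>"
        unfolding p_def by (subst (asm) sum.reindex) (auto simp: inj_on_def)
      have "(\<Sum>x\<in>C'. 2 * \<rho> x) \<le> (\<Sum>x\<in>C'. real (Suc k) * norm (measure lborel (I x) *\<^sub>R h x - integral (I x) h))"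
      proof (rule sum_mono)
        fix x assume x: "x \<in> C'"
        note yx = y[OF inE[OF x]]
        have cI: "measure lborel (I x) = \<bar>y x - x\<bar>" by (simp add: I_def min_def max_def)
        have "norm (measure lborel (I x) *\<^sub>R h x - integral (I x) h) = norm (F (y x) - F x - (y x - x) *\<^sub>R h x)"
        proof (cases "x \<le> y x")
          case True
          then show ?thesis unfolding cI using Fdiff[of x "y x"] Ecd[OF inE[OF x]] yx(1)
            by (simp add: I_def norm_minus_commute)
        next
          case False
          have "F (y x) - F x - (y x - x) *\<^sub>R h x = (x - y x) *\<^sub>R h x - integral {y x..x} h"
            using Fdiff[of "y x" x] Ecd[OF inE[OF x]] yx(1) False by (simp add: algebra_simps)
          then show ?thesis unfolding cI using False by (simp add: I_def)
        qed
        then have "2 * \<rho> x / real (Suc k) < norm (measure lborel (I x) *\<^sub>R h x - integral (I x) h)"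
          using yx(4) by (simp add: \<rho>_def)
        then have "2 * \<rho> x < norm (measure lborel (I x) *\<^sub>R h x - integral (I x) h) * real (Suc k)"
          by (subst (asm) pos_divide_less_eq) auto
        then show "2 * \<rho> x \<le> real (Suc k) * norm (measure lborel (I x) *\<^sub>R h x - integral (I x) h)"
          by (simp only: mult.commute less_imp_le)
      qed
      also have "\<dots> = real (Suc k) * (\<Sum>x\<in>C'. norm (measure lborel (I x) *\<^sub>R h x - integral (I x) h))"
        by (simp only: sum_distrib_left)
      also have "\<dots> \<le> real (Suc k) * \<epsilon>" using lt by (intro mult_left_mono) auto
      finally show ?thesis .
    qed
    have \<rho>0: "\<rho> x \<ge> 0" for x by (simp add: \<rho>_def)
    have bound: "measure lebesgue (\<Union>i\<in>C'. cball (m i) (5 * \<rho> i)) \<le> e" if C': "C' \<subseteq> C" "finite C'" for C'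
    proof -
      have "measure lebesgue (\<Union>i\<in>C'. cball (m i) (5 * \<rho> i)) \<le> (\<Sum>i\<in>C'. measure lebesgue (cball (m i) (5 * \<rho> i)))"
        using C' by (intro measure_UNION_le) auto
      also have "\<dots> = (\<Sum>i\<in>C'. 5 * (2 * \<rho> i))"
        using \<rho>0 by (intro sum.cong) (auto simp: cball_eq_atLeastAtMost)
      also have "\<dots> = 5 * (\<Sum>i\<in>C'. 2 * \<rho> i)" by (simp only: sum_distrib_left)
      also have "\<dots> \<le> 5 * (real (Suc k) * \<epsilon>)" using sum_small[OF C'] by simp
      also have "\<dots> = e" by (simp add: \<epsilon>_def del: of_nat_Suc)
      finally show ?thesis .
    qed
    show "\<exists>T. E k \<subseteq> T \<and> T \<in> lmeasurable \<and> measure lebesgue T \<le> e"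
    proof (intro exI[of _ "\<Union>i\<in>C. cball (m i) (5 * \<rho> i)"] conjI C(4))
      show "(\<Union>i\<in>C. cball (m i) (5 * \<rho> i)) \<in> lmeasurable"
        by (rule fmeasurable_UN_bound[OF C(1) _ bound]) auto
      show "measure lebesgue (\<Union>i\<in>C. cball (m i) (5 * \<rho> i)) \<le> e"
        by (rule measure_UN_bound[OF C(1) _ bound]) auto
    qed
  qed
  have "{x \<in> {c<..<d}. \<not> (F has_vector_derivative h x) (at x)} \<subseteq> (\<Union>k. E k)"
  proof (rule subsetI, rule ccontr)
    fix x assume x: "x \<in> {x \<in> {c<..<d}. \<not> (F has_vector_derivative h x) (at x)}" and nE: "x \<notin> (\<Union>k. E k)"
    have "(F has_vector_derivative h x) (at x)"
      unfolding has_vector_derivative_def has_derivative_at_alt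
    proof (intro conjI allI impI)
      show "bounded_linear (\<lambda>t. t *\<^sub>R h x)" by (rule bounded_linear_scaleR_left)
      fix e :: real assume "e > 0"
      then obtain k where k: "inverse (real (Suc k)) < e" using reals_Archimedean by blast
      have "x \<notin> E k" using nE by blast
      then have "\<exists>r>0. \<forall>y\<in>{c..d}. \<not> (y \<noteq> x \<and> \<bar>y - x\<bar> < r \<and>
         \<bar>y - x\<bar> / real (Suc k) < norm (F y - F x - (y - x) *\<^sub>R h x))"
        using x unfolding E_def by blast
      then obtain r where r1: "r > 0" and r2: "\<forall>y\<in>{c..d}. \<not> (y \<noteq> x \<and> \<bar>y - x\<bar> < r \<and>
         \<bar>y - x\<bar> / real (Suc k) < norm (F y - F x - (y - x) *\<^sub>R h x))" by (elim exE conjE)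
      have r: "r > 0" "norm (F y - F x - (y - x) *\<^sub>R h x) \<le> \<bar>y - x\<bar> / real (Suc k)"
        if "y \<in> {c..d}" "y \<noteq> x" "\<bar>y - x\<bar> < r" for y
        using r1 r2[THEN bspec, OF that(1)] that by (auto simp: not_less)
      define R where "R = min r (min (x - c) (d - x))"
      have "R > 0" using r1 x by (simp add: R_def)
      moreover have "norm (F y - F x - (y - x) *\<^sub>R h x) \<le> e * norm (y - x)" if "norm (y - x) < R" for y
      proof (cases "y = x")
        case False
        have "norm (F y - F x - (y - x) *\<^sub>R h x) \<le> \<bar>y - x\<bar> / real (Suc k)"
          using that False by (intro r(2)) (auto simp: R_def)
        also have "\<dots> = inverse (real (Suc k)) * \<bar>y - x\<bar>" by (simp only: divide_inverse mult.commute)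
        also have "\<dots> \<le> e * \<bar>y - x\<bar>" using k by (intro mult_right_mono) auto
        finally show ?thesis by simp
      qed simp
      ultimately show "\<exists>d>0. \<forall>y. norm (y - x) < d \<longrightarrow> norm (F y - F x - (y - x) *\<^sub>R h x) \<le> e * norm (y - x)"
        by blast
    qed
    then show False using x by simp
  qed
  moreover have "negligible (\<Union>k. E k)" using neg by (rule negligible_Union_nat)
  ultimately show ?thesis unfolding F_def by (rule negligible_subset[rotated])
qed

section \<open>Unitary maps between spans with equal Gram matrices\<close>

lemma L2_inner_sum_left:
  assumes "\<And>i. i \<in> S \<Longrightarrow> d i \<in> L2_space M" "g \<in> L2_space M"
  shows "L2_inner M (\<lambda>x. \<Sum>i\<in>S. c i * d i x) g = (\<Sum>i\<in>S. c i * L2_inner M (d i) g)"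
  using assms
proof (induction S rule: infinite_finite_induct)
  case (insert i S)
  have "L2_inner M (\<lambda>x. c i * d i x + (\<Sum>i\<in>S. c i * d i x)) g = c i * L2_inner M (d i) g + L2_inner M (\<lambda>x. \<Sum>i\<in>S. c i * d i x) g"
    using insert by (intro L2_inner_linear_left L2_sum L2_scale) auto
  then show ?case using insert by simp
qed auto

lemma L2_inner_sum_right:
  assumes "\<And>i. i \<in> S \<Longrightarrow> d i \<in> L2_space M" "g \<in> L2_space M"
  shows "L2_inner M g (\<lambda>x. \<Sum>i\<in>S. c i * d i x) = (\<Sum>i\<in>S. cnj (c i) * L2_inner M g (d i))"
proof -
  have "cnj (L2_inner M g (\<lambda>x. \<Sum>i\<in>S. c i * d i x)) = cnj (\<Sum>i\<in>S. cnj (c i) * L2_inner M g (d i))"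
    unfolding L2_inner_cnj using L2_inner_sum_left[OF assms] by (simp add: L2_inner_cnj)
  then show ?thesis by (simp only: complex_cnj_cancel_iff)
qed

lemma lin_span_range:
  assumes "g \<in> lin_span (range d)"
  shows "\<exists>S c. finite S \<and> g = (\<lambda>x. \<Sum>i\<in>S. c i * d i x)"
proof -
  obtain F a where g: "g = (\<lambda>x. \<Sum>h\<in>F. a h * h x)" "finite F" "F \<subseteq> range d"
    using assms by (rule lin_spanE)
  define S where "S = inv d ` F"
  have inj: "inj_on (inv d) F" using g(3) by (rule inj_on_inv_into)
  have "(\<Sum>i\<in>S. a (d i) * d i x) = (\<Sum>h\<in>F. a h * h x)" for x
    unfolding S_def sum.reindex[OF inj] using g(3) by (intro sum.cong) (auto simp: f_inv_into_f subset_iff)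
  then have e: "g = (\<lambda>x. \<Sum>i\<in>S. a (d i) * d i x)" unfolding g(1) by simp
  have "finite S" unfolding S_def using g(2) by simp
  with e show ?thesis by (intro exI[of _ S] exI[of _ "\<lambda>i. a (d i)"] conjI)
qed

text \<open>
  Two total families with the same matrix of inner products; matching them extends to a unitary
  map.
\<close>
locale gram_equal =
  fixes M :: "'a measure" and N :: "'b measure" and d :: "'i \<Rightarrow> 'a \<Rightarrow> complex" and e :: "'i \<Rightarrow> 'b \<Rightarrow> complex"
  assumes dL: "d i \<in> L2_space M" and eL: "e i \<in> L2_space N"
    and gram: "L2_inner N (e i) (e j) = L2_inner M (d i) (d j)"
    and dense_d: "L2_dense M (lin_span (range d))" and dense_e: "L2_dense N (lin_span (range e))"
begin

lemma unique:
  assumes "F \<in> L2_space N" "G \<in> L2_space N" "\<And>i. L2_inner N F (e i) = L2_inner N G (e i)"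
  shows "ae_eq N F G"
proof -
  have "ae_eq N (\<lambda>x. F x - G x) (\<lambda>x. 0)"
  proof (rule orthogonal_to_dense_zero[OF dense_e])
    show "lin_span (range e) \<subseteq> L2_space N" using eL by (intro lin_span_L2) auto
    show "(\<lambda>x. F x - G x) \<in> L2_space N" using assms by simp
    fix f assume "f \<in> lin_span (range e)"
    from lin_span_range[OF this] obtain S c where f: "finite S" "f = (\<lambda>x. \<Sum>i\<in>S. c i * e i x)" by (elim exE conjE)
    have "L2_inner N (e i) (\<lambda>x. F x - G x) = 0" for i
    proof -
      have "L2_inner N (\<lambda>x. F x - G x) (e i) = 0"
        using assms eL by (simp add: L2_inner_diff_left)
      then have "cnj (L2_inner N (\<lambda>x. F x - G x) (e i)) = 0" by simp
      then show ?thesis unfolding L2_inner_cnj .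
    qed
    then show "L2_inner N f (\<lambda>x. F x - G x) = 0"
      unfolding f(2) using assms eL by (subst L2_inner_sum_left) auto
  qed
  then show ?thesis by (simp add: ae_eq_def)
qed

lemma norm_sum: "L2_norm N (\<lambda>x. \<Sum>i\<in>S. c i * e i x) = L2_norm M (\<lambda>x. \<Sum>i\<in>S. c i * d i x)"
proof -
  have "L2_inner N (\<lambda>x. \<Sum>i\<in>S. c i * e i x) (\<lambda>x. \<Sum>i\<in>S. c i * e i x) =
        L2_inner M (\<lambda>x. \<Sum>i\<in>S. c i * d i x) (\<lambda>x. \<Sum>i\<in>S. c i * d i x)"
    using dL eL by (simp add: L2_inner_sum_left L2_inner_sum_right L2_sum gram)
  then have "(L2_norm N (\<lambda>x. \<Sum>i\<in>S. c i * e i x))\<^sup>2 = (L2_norm M (\<lambda>x. \<Sum>i\<in>S. c i * d i x))\<^sup>2"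
    unfolding L2_inner_self by (simp only: of_real_eq_iff)
  then show ?thesis by (simp add: power2_eq_iff_nonneg)
qed

text \<open>
  Replacing d by e in finite linear combinations is isometric, so combinations converging to f are
  sent to a Cauchy sequence. The approximating sequences are part of the conclusion because
  \<open>inner_preserved\<close> passes to the limit along them.
\<close>
lemma transfer_approximation:
  assumes f: "f \<in> L2_space M"
  shows "\<exists>F fs Fs. F \<in> L2_space N \<and> (\<forall>i. L2_inner N F (e i) = L2_inner M f (d i)) \<and>
    (\<forall>k::nat. \<exists>S c. finite S \<and> fs k = (\<lambda>x. \<Sum>i\<in>S. c i * d i x) \<and> Fs k = (\<lambda>x. \<Sum>i\<in>S. c i * e i x)) \<and>
    (\<lambda>k. L2_norm M (\<lambda>x. fs k x - f x)) \<longlonglongrightarrow> 0 \<and> (\<lambda>k. L2_norm N (\<lambda>x. Fs k x - F x)) \<longlonglongrightarrow> 0"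
proof -
  have "\<forall>k::nat. \<exists>S c. finite S \<and> L2_norm M (\<lambda>x. f x - (\<Sum>i\<in>S. c i * d i x)) < inverse (real (Suc k))"
  proof
    fix k :: nat
    have "inverse (real (Suc k)) > 0" by simp
    then obtain g where g: "g \<in> lin_span (range d)" "L2_norm M (\<lambda>x. f x - g x) < inverse (real (Suc k))"
      using dense_d f unfolding L2_dense_def by blast
    from lin_span_range[OF g(1)] obtain S c where "finite S" "g = (\<lambda>x. \<Sum>i\<in>S. c i * d i x)" by (elim exE conjE)
    then show "\<exists>S c. finite S \<and> L2_norm M (\<lambda>x. f x - (\<Sum>i\<in>S. c i * d i x)) < inverse (real (Suc k))"
      using g(2) by (intro exI[of _ S] exI[of _ c]) simp
  qed
  from this[THEN choice] obtain S where "\<forall>k::nat. \<exists>c. finite (S k) \<and> L2_norm M (\<lambda>x. f x - (\<Sum>i\<in>S k. c i * d i x)) < inverse (real (Suc k))" ..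
  from this[THEN choice] obtain c where "\<forall>k::nat. finite (S k) \<and> L2_norm M (\<lambda>x. f x - (\<Sum>i\<in>S k. c k i * d i x)) < inverse (real (Suc k))" ..
  then have fin: "finite (S k)" and sm: "L2_norm M (\<lambda>x. f x - (\<Sum>i\<in>S k. c k i * d i x)) < inverse (real (Suc k))" for k by auto
  define fs where "fs k = (\<lambda>x. \<Sum>i\<in>S k. c k i * d i x)" for k
  define Fs where "Fs k = (\<lambda>x. \<Sum>i\<in>S k. c k i * e i x)" for k
  have fsL: "fs k \<in> L2_space M" and FsL: "Fs k \<in> L2_space N" for k
    unfolding fs_def Fs_def using dL eL by (auto intro!: L2_sum)
  have near: "L2_norm M (\<lambda>x. fs k x - f x) < inverse (real (Suc k))" for k
    using sm[of k] by (simp add: fs_def L2_norm_minus_commute[of M f])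
  have lim: "(\<lambda>k. L2_norm M (\<lambda>x. fs k x - f x)) \<longlonglongrightarrow> 0"
  proof (rule Lim_null_comparison[OF _ LIMSEQ_inverse_real_of_nat])
    show "\<forall>\<^sub>F k in sequentially. norm (L2_norm M (\<lambda>x. fs k x - f x)) \<le> inverse (real (Suc k))"
      by (intro always_eventually allI) (simp only: real_norm_def abs_of_nonneg[OF L2_norm_nonneg] near less_imp_le)
  qed
  \<comment> \<open>two finite combinations can be written over a common index set, where the Gram matrices agree\<close>
  have iso: "L2_norm N (\<lambda>x. Fs k x - Fs l x) = L2_norm M (\<lambda>x. fs k x - fs l x)" for k l
  proof -
    define b where "b i = (if i \<in> S k then c k i else 0) - (if i \<in> S l then c l i else 0)" for i
    have ext: "(\<Sum>i\<in>S k. c k i * g i) - (\<Sum>i\<in>S l. c l i * g i) = (\<Sum>i\<in>S k \<union> S l. b i * g i)" for g :: "'i \<Rightarrow> complex"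
    proof -
      have "(\<Sum>i\<in>S k. c k i * g i) = (\<Sum>i\<in>S k \<union> S l. (if i \<in> S k then c k i else 0) * g i)"
        using fin by (intro sum.mono_neutral_cong_left) auto
      moreover have "(\<Sum>i\<in>S l. c l i * g i) = (\<Sum>i\<in>S k \<union> S l. (if i \<in> S l then c l i else 0) * g i)"
        using fin by (intro sum.mono_neutral_cong_left) auto
      ultimately show ?thesis by (simp only: b_def left_diff_distrib sum_subtractf)
    qed
    show ?thesis unfolding Fs_def fs_def ext by (rule norm_sum)
  qed
  have "\<exists>F\<in>L2_space N. (\<lambda>k. L2_norm N (\<lambda>x. Fs k x - F x)) \<longlonglongrightarrow> 0"
  proof (rule L2_complete[OF FsL])
    fix \<epsilon> :: real assume "\<epsilon> > 0"
    then obtain K where K: "\<And>k. k \<ge> K \<Longrightarrow> L2_norm M (\<lambda>x. fs k x - f x) < \<epsilon> / 2"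
      using order_tendstoD(2)[OF lim, of "\<epsilon> / 2"] by (auto simp: eventually_sequentially)
    show "\<exists>K. \<forall>m\<ge>K. \<forall>n\<ge>K. L2_norm N (\<lambda>x. Fs m x - Fs n x) < \<epsilon>"
    proof (intro exI[of _ K] allI impI)
      fix m n assume mn: "m \<ge> K" "n \<ge> K"
      have "L2_norm M (\<lambda>x. fs m x - fs n x) \<le> L2_norm M (\<lambda>x. fs m x - f x) + L2_norm M (\<lambda>x. f x - fs n x)"
        by (rule L2_norm_triangle_diff[OF fsL f fsL])
      also have "\<dots> < \<epsilon>" using K[OF mn(1)] K[OF mn(2)] by (simp add: L2_norm_minus_commute[of M f])
      finally show "L2_norm N (\<lambda>x. Fs m x - Fs n x) < \<epsilon>" unfolding iso .
    qed
  qed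
  then obtain F where F: "F \<in> L2_space N" "(\<lambda>k. L2_norm N (\<lambda>x. Fs k x - F x)) \<longlonglongrightarrow> 0" by blast
  have i1: "L2_inner N F (e i) = L2_inner M f (d i)" for i
  proof -
    have "(\<lambda>k. L2_inner N (Fs k) (e i)) \<longlonglongrightarrow> L2_inner N F (e i)" by (rule L2_inner_tendsto[OF FsL F(1) eL F(2)])
    moreover have "(\<lambda>k. L2_inner M (fs k) (d i)) \<longlonglongrightarrow> L2_inner M f (d i)" by (rule L2_inner_tendsto[OF fsL f dL lim])
    moreover have "L2_inner N (Fs k) (e i) = L2_inner M (fs k) (d i)" for k
      unfolding Fs_def fs_def using dL eL by (simp add: L2_inner_sum_left gram)
    ultimately show ?thesis by (simp add: LIMSEQ_unique)
  qed
  have i2: "\<exists>S c. finite S \<and> fs k = (\<lambda>x. \<Sum>i\<in>S. c i * d i x) \<and> Fs k = (\<lambda>x. \<Sum>i\<in>S. c i * e i x)" for k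
    by (intro exI[of _ "S k"] exI[of _ "c k"]) (simp add: fin fs_def Fs_def)
  show ?thesis
    by (intro exI[of _ F] exI[of _ fs] exI[of _ Fs] conjI allI F(1) i1 i2 lim F(2))
qed

lemma inner_preserved:
  assumes f: "f \<in> L2_space M" and g: "g \<in> L2_space M" and F: "F \<in> L2_space N" and G: "G \<in> L2_space N"
    and fF: "\<And>i. L2_inner N F (e i) = L2_inner M f (d i)" and gG: "\<And>i. L2_inner N G (e i) = L2_inner M g (d i)"
  shows "L2_inner N F G = L2_inner M f g"
proof -
  from transfer_approximation[OF g] obtain G' gs Gs where "G' \<in> L2_space N \<and> (\<forall>i. L2_inner N G' (e i) = L2_inner M g (d i)) \<and>
    (\<forall>k::nat. \<exists>S c. finite S \<and> gs k = (\<lambda>x. \<Sum>i\<in>S. c i * d i x) \<and> Gs k = (\<lambda>x. \<Sum>i\<in>S. c i * e i x)) \<and>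
    (\<lambda>k. L2_norm M (\<lambda>x. gs k x - g x)) \<longlonglongrightarrow> 0 \<and> (\<lambda>k. L2_norm N (\<lambda>x. Gs k x - G' x)) \<longlonglongrightarrow> 0"
    by (elim exE)
  then have G': "G' \<in> L2_space N" "\<And>i. L2_inner N G' (e i) = L2_inner M g (d i)"
    "\<And>k::nat. \<exists>S c. finite S \<and> gs k = (\<lambda>x. \<Sum>i\<in>S. c i * d i x) \<and> Gs k = (\<lambda>x. \<Sum>i\<in>S. c i * e i x)"
    "(\<lambda>k. L2_norm M (\<lambda>x. gs k x - g x)) \<longlonglongrightarrow> 0" "(\<lambda>k. L2_norm N (\<lambda>x. Gs k x - G' x)) \<longlonglongrightarrow> 0"
    by simp_all
  have L: "gs k \<in> L2_space M" "Gs k \<in> L2_space N" "L2_inner N (Gs k) F = L2_inner M (gs k) f" for k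
  proof -
    from G'(3)[of k] obtain S c where "finite S" and s: "gs k = (\<lambda>x. \<Sum>i\<in>S. c i * d i x)" "Gs k = (\<lambda>x. \<Sum>i\<in>S. c i * e i x)"
      by (elim exE conjE)
    show "gs k \<in> L2_space M" "Gs k \<in> L2_space N" unfolding s using dL eL by (auto intro!: L2_sum)
    have "L2_inner N (e i) F = L2_inner M (d i) f" for i
      using arg_cong[OF fF[of i], of cnj] unfolding L2_inner_cnj .
    then show "L2_inner N (Gs k) F = L2_inner M (gs k) f" unfolding s using dL eL F f by (simp add: L2_inner_sum_left)
  qed
  have "(\<lambda>k. L2_inner N (Gs k) F) \<longlonglongrightarrow> L2_inner N G' F" by (rule L2_inner_tendsto[OF L(2) G'(1) F G'(5)])
  moreover have "(\<lambda>k. L2_inner N (Gs k) F) \<longlonglongrightarrow> L2_inner M g f" unfolding L(3) by (rule L2_inner_tendsto[OF L(1) g f G'(4)])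
  ultimately have "L2_inner N G' F = L2_inner M g f" by (rule LIMSEQ_unique)
  moreover have "ae_eq N G' G" using G' G gG by (intro unique) auto
  then have "L2_inner N G' F = L2_inner N G F" using G' G F by (intro L2_inner_cong_AE) (auto simp: ae_eq_def)
  ultimately have "cnj (L2_inner N G F) = cnj (L2_inner M g f)" by simp
  then show ?thesis unfolding L2_inner_cnj .
qed

end

text \<open>
  The image of f is characterised by its inner products with the family, so linearity follows from
  uniqueness and surjectivity from exchanging the roles of the two families.
\<close>
theorem (in gram_equal) unitary_exists:
  obtains U where "unitary_map M N U" "\<And>f. f \<in> L2_space M \<Longrightarrow> U f \<in> L2_space N"
    "\<And>f i. f \<in> L2_space M \<Longrightarrow> L2_inner N (U f) (e i) = L2_inner M f (d i)"
proof -
  interpret swap: gram_equal N M e d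
    by unfold_locales (use dL eL gram dense_d dense_e in auto)
  have "\<forall>f. \<exists>F. f \<in> L2_space M \<longrightarrow> F \<in> L2_space N \<and> (\<forall>i. L2_inner N F (e i) = L2_inner M f (d i))"
  proof
    fix f
    show "\<exists>F. f \<in> L2_space M \<longrightarrow> F \<in> L2_space N \<and> (\<forall>i. L2_inner N F (e i) = L2_inner M f (d i))"
    proof (cases "f \<in> L2_space M")
      case True
      then show ?thesis using transfer_approximation[OF True] by (elim exE conjE) (intro exI impI conjI, assumption+)
    qed simp
  qed
  from this[THEN choice] obtain U where "\<forall>f. f \<in> L2_space M \<longrightarrow> U f \<in> L2_space N \<and> (\<forall>i. L2_inner N (U f) (e i) = L2_inner M f (d i))" ..
  then have U: "U f \<in> L2_space N" "L2_inner N (U f) (e i) = L2_inner M f (d i)" if "f \<in> L2_space M" for f i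
    using that by auto
  have "unitary_map M N U"
    unfolding unitary_map_def
  proof (intro conjI ballI allI)
    fix c f g assume f: "f \<in> L2_space M" and g: "g \<in> L2_space M"
    have fg: "(\<lambda>x. c * f x + g x) \<in> L2_space M" using f g by simp
    show "ae_eq N (U (\<lambda>x. c * f x + g x)) (\<lambda>x. c * U f x + U g x)"
      using U[OF fg] U[OF f] U[OF g] f g dL eL by (intro unique) (simp_all add: L2_inner_linear_left)
  next
    fix f g assume f: "f \<in> L2_space M" and g: "g \<in> L2_space M"
    show "L2_inner N (U f) (U g) = L2_inner M f g"
      by (rule inner_preserved[OF f g U(1)[OF f] U(1)[OF g] U(2)[OF f] U(2)[OF g]])
  next
    fix h assume h: "h \<in> L2_space N"
    have "\<exists>f. f \<in> L2_space M \<and> (\<forall>i. L2_inner M f (d i) = L2_inner N h (e i))"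
      using swap.transfer_approximation[OF h] by (elim exE conjE) (intro exI conjI, assumption+)
    then obtain f where f: "f \<in> L2_space M" "\<And>i. L2_inner M f (d i) = L2_inner N h (e i)" by auto
    have "ae_eq N (U f) h" using U[OF f(1)] f(2) h by (intro unique) auto
    then show "\<exists>f\<in>L2_space M. ae_eq N (U f) h" using f(1) by blast
  qed (use U in auto)
  then show ?thesis by (rule that[OF _ U])
qed

lemma AE_lebesgue_onI:
  assumes "negligible N" "S \<in> sets lebesgue" "\<And>x. x \<in> S \<Longrightarrow> x \<notin> N \<Longrightarrow> P x"
  shows "AE x in lebesgue_on S. P x"
proof -
  have "N \<in> null_sets lebesgue" using assms(1) by (simp add: negligible_iff_null_sets)
  then have "AE x in lebesgue. x \<notin> N" by (rule AE_not_in)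
  then show ?thesis using assms(2,3) by (subst AE_restrict_space_iff) (auto elim!: eventually_mono)
qed

lemma AE_lebesgue_onE:
  assumes "AE x in lebesgue_on S. P x" "S \<in> sets lebesgue"
  obtains N where "negligible N" "\<And>x. x \<in> S \<Longrightarrow> x \<notin> N \<Longrightarrow> P x"
proof -
  have "AE x in lebesgue. x \<in> S \<longrightarrow> P x"
    using assms by (subst (asm) AE_restrict_space_iff) auto
  then obtain N where N: "N \<in> null_sets lebesgue" "{x \<in> space lebesgue. \<not> (x \<in> S \<longrightarrow> P x)} \<subseteq> N"
    unfolding eventually_ae_filter by auto
  show ?thesis by (rule that[of N]) (use N in \<open>auto simp: negligible_iff_null_sets\<close>)
qed

lemma borel_measurable_lebesgue_on: "f \<in> borel_measurable borel \<Longrightarrow> f \<in> borel_measurable (lebesgue_on S)"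
  by (intro measurable_restrict_space1 measurable_completion) simp

lemma L2_bounded_lebesgue_on:
  fixes f :: "real \<Rightarrow> complex"
  assumes "f \<in> borel_measurable (lebesgue_on {c..d})" "\<And>x. x \<in> {c..d} \<Longrightarrow> cmod (f x) \<le> B"
  shows "f \<in> L2_space (lebesgue_on {c..d})"
proof (rule L2_dominated)
  interpret finite_measure "lebesgue_on {c..d}"
    by (rule finite_measure_lebesgue_on) simp
  show "(\<lambda>x. of_real B) \<in> L2_space (lebesgue_on {c..d})"
    by (rule L2_spaceI) auto
  show "AE x in lebesgue_on {c..d}. cmod (f x) \<le> cmod (of_real B)"
    by (rule AE_I2) (use assms(2) abs_ge_self order_trans in fastforce)
qed (use assms in auto)

lemma L2_continuous_lebesgue_on:
  fixes f :: "real \<Rightarrow> complex"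
  assumes "continuous_on {c..d} f"
  shows "f \<in> L2_space (lebesgue_on {c..d})"
proof -
  obtain B where "\<forall>y\<in>f ` {c..d}. cmod y \<le> B"
    using compact_imp_bounded[OF compact_continuous_image[OF assms compact_Icc]] unfolding bounded_iff by (elim exE)
  then show ?thesis
    using continuous_imp_measurable_on_sets_lebesgue[OF assms] by (intro L2_bounded_lebesgue_on) auto
qed

lemma L2_imp_integrable_lebesgue_on:
  fixes f :: "real \<Rightarrow> complex"
  assumes "f \<in> L2_space (lebesgue_on {c..d})"
  shows "integrable (lebesgue_on {c..d}) f" "f integrable_on {c..d}"
proof -
  have "(\<lambda>x. 1) \<in> L2_space (lebesgue_on {c..d})" by (rule L2_continuous_lebesgue_on) simp
  from L2_mult_integrable[OF assms this] show i: "integrable (lebesgue_on {c..d}) f" by simp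
  then show "f integrable_on {c..d}" using has_integral_integral_lebesgue_on[OF i] by auto
qed

text \<open>
  The inequality |h| \<le> \<eta> |h|^2 / 2 + 1 / (2 \<eta>) splits the increment over a family of
  intervals into a part controlled by the total integral of |h|^2 and a part controlled by the
  total length.
\<close>
theorem indefinite_integral_abs_continuous:
  fixes h :: "real \<Rightarrow> complex"
  assumes h: "h \<in> L2_space (lebesgue_on {c..d})"
  shows "abs_continuous_on c d (\<lambda>x. integral {c..x} h)"
  unfolding abs_continuous_on_def
proof (intro allI impI)
  fix \<epsilon> :: real assume \<epsilon>: "\<epsilon> > 0"
  define k where "k x = (cmod (h x))\<^sup>2" for x
  have ki: "k integrable_on {c..d}"
    using has_integral_integral_lebesgue_on[OF L2_integrable_square[OF h]] unfolding k_def by auto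
  have k0: "k x \<ge> 0" for x by (simp add: k_def)
  define H where "H = integral {c..d} k"
  have H0: "H \<ge> 0" unfolding H_def by (rule integral_nonneg[OF ki]) (simp add: k0)
  define \<eta> where "\<eta> = \<epsilon> / (H + 1)"
  have \<eta>: "\<eta> > 0" "\<eta> * H \<le> \<epsilon>" using \<epsilon> H0 by (auto simp: \<eta>_def field_simps intro!: divide_pos_pos)
  show "\<exists>\<delta>>0. \<forall>D. finite D \<longrightarrow> (\<forall>(s, t)\<in>D. c \<le> s \<and> s \<le> t \<and> t \<le> d) \<longrightarrow>
        pairwise (\<lambda>(s, t) (s', t'). {s<..<t} \<inter> {s'<..<t'} = {}) D \<longrightarrow>
        (\<Sum>(s, t)\<in>D. t - s) < \<delta> \<longrightarrow> (\<Sum>(s, t)\<in>D. cmod (integral {c..t} h - integral {c..s} h)) < \<epsilon>"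
  proof (intro exI[of _ "\<eta> * \<epsilon>"] conjI allI impI)
    show "0 < \<eta> * \<epsilon>" using \<eta> \<epsilon> by simp
    fix D assume fin: "finite D" and cd: "\<forall>(s, t)\<in>D. c \<le> s \<and> s \<le> t \<and> t \<le> d"
      and disj: "pairwise (\<lambda>(s, t) (s', t'). {s<..<t} \<inter> {s'<..<t'} = {}) D"
      and small: "(\<Sum>(s, t)\<in>D. t - s) < \<eta> * \<epsilon>"
    have D: "c \<le> fst q" "fst q \<le> snd q" "snd q \<le> d" if "q \<in> D" for q using cd that by (auto simp: split_beta)
    have each: "cmod (integral {c..snd q} h - integral {c..fst q} h) \<le>
        \<eta> / 2 * integral {fst q..snd q} k + (snd q - fst q) * (1 / (2 * \<eta>))" if q: "q \<in> D" for q
    proof -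
      have hi: "h integrable_on {c..snd q}" "h integrable_on {fst q..snd q}"
        using D[OF q] L2_imp_integrable_lebesgue_on(2)[OF h] by (auto elim!: integrable_on_subinterval)
      have kq: "k integrable_on {fst q..snd q}" using D[OF q] ki by (auto elim!: integrable_on_subinterval)
      have "integral {c..snd q} h - integral {c..fst q} h = integral {fst q..snd q} h"
        using Henstock_Kurzweil_Integration.integral_combine[OF D(1)[OF q] D(2)[OF q] hi(1)] by (simp add: diff_eq_eq add.commute)
      also have "cmod \<dots> \<le> integral {fst q..snd q} (\<lambda>x. \<eta> / 2 * k x + 1 / (2 * \<eta>))"
      proof (rule integral_norm_bound_integral[OF hi(2)])
        show "(\<lambda>x. \<eta> / 2 * k x + 1 / (2 * \<eta>)) integrable_on {fst q..snd q}"
          using kq by (intro integrable_add integrable_on_mult_right integrable_const_ivl)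
        fix x
        have "0 \<le> (\<eta> * cmod (h x) - 1)\<^sup>2" by simp
        then have "2 * \<eta> * cmod (h x) \<le> \<eta> * \<eta> * k x + 1" by (simp add: power2_diff k_def power2_eq_square algebra_simps)
        then have "2 * \<eta> * cmod (h x) / (2 * \<eta>) \<le> (\<eta> * \<eta> * k x + 1) / (2 * \<eta>)" using \<eta>(1) by (intro divide_right_mono) auto
        then show "cmod (h x) \<le> \<eta> / 2 * k x + 1 / (2 * \<eta>)" using \<eta>(1) by (simp add: add_divide_distrib)
      qed
      also have "\<dots> = \<eta> / 2 * integral {fst q..snd q} k + (snd q - fst q) * (1 / (2 * \<eta>))"
        using kq D(2)[OF q] by (subst Henstock_Kurzweil_Integration.integral_add) (auto intro: integrable_on_mult_right)
      finally show ?thesis .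
    qed
    define J where "J q = {fst q..snd q}" for q :: "real \<times> real"
    have inj: "inj_on J D"
    proof (rule inj_onI)
      fix p q assume "p \<in> D" "q \<in> D" "J p = J q"
      then show "p = q" using D(2)[of p] D(2)[of q] unfolding J_def by (auto simp: Icc_eq_Icc prod_eq_iff)
    qed
    have "(\<Sum>q\<in>D. integral (J q) k) \<le> H"
    proof -
      have "(k has_integral (sum (\<lambda>S. integral S k) (J ` D))) (\<Union>(J ` D))"
      proof (rule has_integral_Union)
        show "finite (J ` D)" using fin by simp
        fix S assume "S \<in> J ` D"
        then obtain q where q: "q \<in> D" "S = {fst q..snd q}" by (auto simp: J_def)
        have "k integrable_on {fst q..snd q}" using D[OF q(1)] ki by (auto elim!: integrable_on_subinterval)
        then show "(k has_integral integral S k) S" unfolding q(2) by (rule integrable_integral)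
      next
        show "pairwise (\<lambda>S S'. negligible (S \<inter> S')) (J ` D)"
        proof (rule pairwiseI)
          fix A B assume "A \<in> J ` D" "B \<in> J ` D" "A \<noteq> B"
          then obtain p q where pq: "p \<in> D" "q \<in> D" "A = J p" "B = J q" "p \<noteq> q" by auto
          have e: "{fst p<..<snd p} \<inter> {fst q<..<snd q} = {}"
            using disj pq(1,2,5) unfolding pairwise_def by (auto simp: split_beta)
          have "A \<inter> B \<subseteq> {max (fst p) (fst q)}"
          proof
            fix x assume x: "x \<in> A \<inter> B"
            have "{fst p<..<snd p} \<inter> {fst q<..<snd q} = {max (fst p) (fst q)<..<min (snd p) (snd q)}" by auto
            then have "min (snd p) (snd q) \<le> max (fst p) (fst q)" using e by auto
            moreover have "max (fst p) (fst q) \<le> x" "x \<le> min (snd p) (snd q)" using x pq by (auto simp: J_def)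
            ultimately show "x \<in> {max (fst p) (fst q)}" by auto
          qed
          then show "negligible (A \<inter> B)" by (rule negligible_subset[OF negligible_sing])
        qed
      qed
      then have U: "k integrable_on \<Union>(J ` D)" "integral (\<Union>(J ` D)) k = (\<Sum>q\<in>D. integral (J q) k)"
        by (auto simp: integral_unique sum.reindex[OF inj] o_def)
      have "integral (\<Union>(J ` D)) k \<le> integral {c..d} k"
        by (rule integral_subset_le[OF _ U(1) ki]) (use D k0 in \<open>fastforce simp: J_def\<close>)+
      then show ?thesis unfolding U(2) H_def .
    qed
    then have a: "\<eta> / 2 * (\<Sum>q\<in>D. integral {fst q..snd q} k) \<le> \<epsilon> / 2"
      unfolding J_def
    proof -
      assume "(\<Sum>q\<in>D. integral {fst q..snd q} k) \<le> H"
      then have "\<eta> * (\<Sum>q\<in>D. integral {fst q..snd q} k) \<le> \<eta> * H" using \<eta>(1) by (intro mult_left_mono) auto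
      also have "\<dots> \<le> \<epsilon>" by (rule \<eta>(2))
      finally show ?thesis by simp
    qed
    have b: "(\<Sum>q\<in>D. snd q - fst q) * (1 / (2 * \<eta>)) < \<epsilon> / 2"
    proof -
      have "(\<Sum>q\<in>D. snd q - fst q) * (1 / (2 * \<eta>)) < \<eta> * \<epsilon> * (1 / (2 * \<eta>))"
        using small \<eta>(1) by (intro mult_strict_right_mono) (auto simp: split_beta)
      then show ?thesis using \<eta>(1) by simp
    qed
    have "(\<Sum>(s, t)\<in>D. cmod (integral {c..t} h - integral {c..s} h)) \<le>
        (\<Sum>q\<in>D. \<eta> / 2 * integral {fst q..snd q} k + (snd q - fst q) * (1 / (2 * \<eta>)))"
      unfolding split_beta by (intro sum_mono each)
    also have "\<dots> = \<eta> / 2 * (\<Sum>q\<in>D. integral {fst q..snd q} k) + (\<Sum>q\<in>D. snd q - fst q) * (1 / (2 * \<eta>))"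
      by (simp only: sum.distrib sum_distrib_left sum_distrib_right)
    also have "\<dots> < \<epsilon>" using a b by linarith
    finally show "(\<Sum>(s, t)\<in>D. cmod (integral {c..t} h - integral {c..s} h)) < \<epsilon>" .
  qed
qed

lemma abs_continuous_on_unimodular_affine:
  "abs_continuous_on c d g \<Longrightarrow> abs_continuous_on c d (\<lambda>x. z * g x + w)" if "cmod z = 1"
proof -
  have "cmod ((z * g t + w) - (z * g s + w)) = cmod (g t - g s)" for s t
    using that by (simp add: norm_mult flip: right_diff_distrib)
  then show "abs_continuous_on c d g \<Longrightarrow> abs_continuous_on c d (\<lambda>x. z * g x + w)"
    unfolding abs_continuous_on_def by simp
qed

lemma abs_continuous_on_mult_lipschitz:
  assumes g: "abs_continuous_on c d g" and k1: "\<And>x. cmod (k x) \<le> 1"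
    and kL: "\<And>s t. cmod (k t - k s) \<le> L * \<bar>t - s\<bar>" and L: "L \<ge> 0"
  shows "abs_continuous_on c d (\<lambda>x. g x * k x)"
  unfolding abs_continuous_on_def
proof (intro allI impI)
  fix \<epsilon> :: real assume \<epsilon>: "\<epsilon> > 0"
  obtain B0 where "\<forall>y\<in>g ` {c..d}. cmod y \<le> B0"
    using compact_imp_bounded[OF compact_continuous_image[OF abs_continuous_on_imp_continuous[OF g] compact_Icc]]
    unfolding bounded_iff by (elim exE)
  then have B: "cmod (g x) \<le> \<bar>B0\<bar>" if "x \<in> {c..d}" for x
    using that abs_ge_self[of B0] by (auto intro: order_trans)
  obtain \<delta> where \<delta>: "\<delta> > 0" "\<And>D. finite D \<Longrightarrow> (\<And>s t. (s, t) \<in> D \<Longrightarrow> c \<le> s \<and> s \<le> t \<and> t \<le> d) \<Longrightarrow>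
        pairwise (\<lambda>(s, t) (s', t'). {s<..<t} \<inter> {s'<..<t'} = {}) D \<Longrightarrow>
        (\<Sum>(s, t)\<in>D. t - s) < \<delta> \<Longrightarrow> (\<Sum>(s, t)\<in>D. cmod (g t - g s)) < \<epsilon> / 2"
    by (rule abs_continuous_onE[OF g half_gt_zero[OF \<epsilon>]]) blast
  define C where "C = \<bar>B0\<bar> * L + 1"
  have C: "C > 0" using L by (simp add: C_def add_nonneg_pos)
  show "\<exists>\<delta>>0. \<forall>D. finite D \<longrightarrow> (\<forall>(s, t)\<in>D. c \<le> s \<and> s \<le> t \<and> t \<le> d) \<longrightarrow>
        pairwise (\<lambda>(s, t) (s', t'). {s<..<t} \<inter> {s'<..<t'} = {}) D \<longrightarrow>
        (\<Sum>(s, t)\<in>D. t - s) < \<delta> \<longrightarrow> (\<Sum>(s, t)\<in>D. cmod (g t * k t - g s * k s)) < \<epsilon>"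
  proof (intro exI[of _ "min \<delta> (\<epsilon> / (2 * C))"] conjI allI impI)
    show "0 < min \<delta> (\<epsilon> / (2 * C))" using \<delta>(1) \<epsilon> C by simp
    fix D assume fin: "finite D" and cd: "\<forall>(s, t)\<in>D. c \<le> s \<and> s \<le> t \<and> t \<le> d"
      and disj: "pairwise (\<lambda>(s, t) (s', t'). {s<..<t} \<inter> {s'<..<t'} = {}) D"
      and small: "(\<Sum>(s, t)\<in>D. t - s) < min \<delta> (\<epsilon> / (2 * C))"
    have D: "c \<le> fst q" "fst q \<le> snd q" "snd q \<le> d" if "q \<in> D" for q using cd that by (auto simp: split_beta)
    have a: "(\<Sum>q\<in>D. cmod (g (snd q) - g (fst q))) < \<epsilon> / 2"
    proof -
      have "c \<le> s \<and> s \<le> t \<and> t \<le> d" if "(s, t) \<in> D" for s t using D[OF that] by simp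
      moreover have "(\<Sum>(s, t)\<in>D. t - s) < \<delta>" using small by simp
      ultimately have "(\<Sum>(s, t)\<in>D. cmod (g t - g s)) < \<epsilon> / 2" by (rule \<delta>(2)[OF fin _ disj])
      then show ?thesis by (simp add: case_prod_unfold)
    qed
    have "(\<Sum>q\<in>D. snd q - fst q) < \<epsilon> / (2 * C)" using small by (simp add: split_beta)
    then have "C * (\<Sum>q\<in>D. snd q - fst q) < C * (\<epsilon> / (2 * C))" using C by (rule mult_strict_left_mono)
    then have b: "C * (\<Sum>q\<in>D. snd q - fst q) < \<epsilon> / 2" using C by simp
    have "cmod (g (snd q) * k (snd q) - g (fst q) * k (fst q)) \<le> cmod (g (snd q) - g (fst q)) + C * (snd q - fst q)" if q: "q \<in> D" for q
    proof -
      have "g (snd q) * k (snd q) - g (fst q) * k (fst q) = (g (snd q) - g (fst q)) * k (snd q) + g (fst q) * (k (snd q) - k (fst q))"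
        by (simp add: algebra_simps)
      also have "cmod \<dots> \<le> cmod (g (snd q) - g (fst q)) * cmod (k (snd q)) + cmod (g (fst q)) * cmod (k (snd q) - k (fst q))"
        by (rule order_trans[OF norm_triangle_ineq]) (simp add: norm_mult)
      also have "\<dots> \<le> cmod (g (snd q) - g (fst q)) * 1 + \<bar>B0\<bar> * (L * \<bar>snd q - fst q\<bar>)"
        using D[OF q] by (intro add_mono mult_mono k1 kL B) auto
      also have "\<bar>B0\<bar> * (L * \<bar>snd q - fst q\<bar>) \<le> C * (snd q - fst q)"
        using D(2)[OF q] by (simp add: C_def algebra_simps)
      finally show ?thesis by simp
    qed
    then have "(\<Sum>(s, t)\<in>D. cmod (g t * k t - g s * k s)) \<le> (\<Sum>q\<in>D. cmod (g (snd q) - g (fst q)) + C * (snd q - fst q))"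
      unfolding split_beta by (rule sum_mono)
    also have "\<dots> = (\<Sum>q\<in>D. cmod (g (snd q) - g (fst q))) + C * (\<Sum>q\<in>D. snd q - fst q)"
      by (simp only: sum.distrib sum_distrib_left)
    also have "\<dots> < \<epsilon>" using a b by linarith
    finally show "(\<Sum>(s, t)\<in>D. cmod (g t * k t - g s * k s)) < \<epsilon>" .
  qed
qed

section \<open>Fourier series and the differentiation operator\<close>

lemma lin_span_sum: "finite S \<Longrightarrow> (\<lambda>x. \<Sum>i\<in>S. c i * d i x) \<in> lin_span (range d)"
proof (induction S rule: finite_induct)
  case (insert i S)
  have "d i \<in> lin_span (range d)" by (rule subsetD[OF lin_span_superset]) simp
  from lin_span_linear[OF this insert.IH] show ?case using insert by simp
qed (simp add: lin_span_zero)

lemma exp_imaginary_lipschitz: "cmod (exp (\<i> * of_real (l * t)) - exp (\<i> * of_real (l * s))) \<le> \<bar>l\<bar> * \<bar>t - s\<bar>"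
proof -
  have "cmod (exp (\<i> * of_real l * of_real t) - exp (\<i> * of_real l * of_real s)) \<le> \<bar>l\<bar> * cmod (complex_of_real t - of_real s)"
  proof (rule field_differentiable_bound[where S = "closed_segment (complex_of_real s) (of_real t)" and f = "\<lambda>z. exp (\<i> * of_real l * z)" and f' = "\<lambda>z. \<i> * of_real l * exp (\<i> * of_real l * z)"])
    fix z assume z: "z \<in> closed_segment (complex_of_real s) (of_real t)"
    show "((\<lambda>z. exp (\<i> * of_real l * z)) has_field_derivative \<i> * of_real l * exp (\<i> * of_real l * z)) (at z within closed_segment (complex_of_real s) (of_real t))"
      by (auto intro!: derivative_eq_intros)
    obtain y where "z = of_real y" using z by (auto simp: closed_segment_of_real)
    then have "\<i> * of_real l * z = \<i> * of_real (l * y)" by simp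
    then show "cmod (\<i> * of_real l * exp (\<i> * of_real l * z)) \<le> \<bar>l\<bar>" by (simp only: norm_mult norm_exp_i_times) simp
  qed auto
  then show ?thesis by (simp add: mult.assoc flip: of_real_diff)
qed

text \<open>
  The range of \<beta> ensures that a node can vanish only for n = 0 and \<beta> = 0.
\<close>
locale phase_measure = cotangent_measure +
  assumes \<beta>: "0 \<le> \<beta>" "\<beta> < pi"
begin

abbreviation I :: "real measure" where "I \<equiv> lebesgue_on {0..2 * a}"

definition wave :: "int \<Rightarrow> real \<Rightarrow> complex" where
  "wave n x = exp (\<i> * of_real (node n * x))"

text \<open>
  The factor that gives the exponentials on [0, 2a] the same norm as the indicators of the nodes.
\<close>
definition amplitude :: complex where "amplitude = of_real (sqrt (mass / (2 * a)))"

definition spike :: "int \<Rightarrow> real \<Rightarrow> complex" where "spike n = indicator {node n}"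

lemma amplitude: "amplitude \<noteq> 0" "cnj amplitude = amplitude" "amplitude * amplitude = of_real (mass / (2 * a))"
proof -
  have p: "mass / (2 * a) > 0" using mass_pos a by simp
  then have "sqrt (mass / (2 * a)) > 0" by (rule real_sqrt_gt_zero)
  then show "amplitude \<noteq> 0" unfolding amplitude_def by (metis less_irrefl of_real_eq_0_iff)
  show "cnj amplitude = amplitude" by (simp add: amplitude_def)
  have "sqrt (mass / (2 * a)) * sqrt (mass / (2 * a)) = mass / (2 * a)" by (simp only: real_sqrt_mult_self abs_of_pos[OF p])
  then show "amplitude * amplitude = of_real (mass / (2 * a))" unfolding amplitude_def by (simp only: flip: of_real_mult)
qed

lemma norm_wave [simp]: "cmod (wave n x) = 1"
  by (simp add: wave_def)

lemma continuous_wave: "continuous_on S (wave n)"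
  unfolding wave_def by (intro continuous_intros)

lemma wave_L2: "wave n \<in> L2_space I"
  by (rule L2_continuous_lebesgue_on[OF continuous_wave])

lemma cnj_wave: "cnj (wave n x) = exp (\<i> * of_real (- node n * x))"
  by (simp add: wave_def exp_cnj)

text \<open>
  Differences of nodes are multiples of \<pi> / a, so the product of two distinct waves has period
  2a and mean zero.
\<close>
lemma wave_gram: "L2_inner I (wave n) (wave m) = (if n = m then of_real (2 * a) else 0)"
proof -
  define k where "k = node n - node m"
  have prod: "wave n x * cnj (wave m x) = exp (\<i> * of_real k * of_real x)" for x
    unfolding cnj_wave unfolding wave_def k_def by (simp add: algebra_simps flip: exp_add)
  have "integrable I (\<lambda>x. wave n x * cnj (wave m x))" using wave_L2 by (intro L2_inner_integrable)
  then have hi: "((\<lambda>x. exp (\<i> * of_real k * of_real x)) has_integral L2_inner I (wave n) (wave m)) {0..2 * a}"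
    unfolding L2_inner_def prod by (rule has_integral_integral_lebesgue_on) simp
  show ?thesis
  proof (cases "n = m")
    case True
    then have "((\<lambda>x. exp (\<i> * of_real k * of_real x)) has_integral of_real (2 * a)) {0..2 * a}"
      using has_integral_const_real[of "1::complex" 0 "2 * a"] a by (simp add: k_def scaleR_conv_of_real)
    then show ?thesis using has_integral_unique[OF hi] True by simp
  next
    case False
    then have k: "k \<noteq> 0" using inj_node by (auto simp: k_def inj_def)
    define Q where "Q z = exp (\<i> * of_real k * z) / (\<i> * of_real k)" for z
    have "((\<lambda>x. exp (\<i> * of_real k * of_real x)) has_integral (Q (of_real (2 * a)) - Q (of_real 0))) {0..2 * a}"
    proof (rule fundamental_theorem_of_calculus)
      fix x
      have "(Q has_field_derivative exp (\<i> * of_real k * of_real x)) (at (of_real x))"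
        unfolding Q_def using k by (auto intro!: derivative_eq_intros)
      then show "((\<lambda>x. Q (of_real x)) has_vector_derivative exp (\<i> * of_real k * of_real x)) (at x within {0..2 * a})"
        by (rule has_vector_derivative_real_field)
    qed (use a in simp)
    moreover have "Q (of_real (2 * a)) = Q (of_real 0)"
    proof -
      have A: "\<i> * of_real k * of_real (2 * a) = 2 * of_int (n - m) * of_real pi * \<i>"
      proof -
        have "k * (2 * a) = 2 * of_int (n - m) * pi" using a by (simp add: k_def node_def field_simps)
        then have "\<i> * complex_of_real (k * (2 * a)) = \<i> * complex_of_real (2 * of_int (n - m) * pi)" by (simp only:)
        then show ?thesis by (simp add: mult_ac)
      qed
      have B: "exp (2 * of_int (n - m) * of_real pi * \<i>) = (1 :: complex)"
        unfolding exp_eq_1 by (intro conjI exI[of _ "n - m"]) simp_all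
      show ?thesis unfolding Q_def A B by simp
    qed
    ultimately show ?thesis using has_integral_unique[OF hi] False by simp
  qed
qed

text \<open>
  Multiplication by exp(i \<pi> x / a) shifts the index of a wave, so the closed span is
  invariant. This function is injective on the open interval (0, 2a) and therefore generates its
  measurable sets up to null sets.
\<close>
lemma dense_waves: "L2_dense I (lin_span (range (\<lambda>n x. amplitude * wave n x)))"
proof -
  define S where "S = range (\<lambda>n x. amplitude * wave n x)"
  define V where "V = closed_span I S"
  define \<zeta> where "\<zeta> x = exp (\<i> * of_real (pi / a * x))" for x
  have SL: "S \<subseteq> L2_space I" using wave_L2 by (auto simp: S_def)
  note V = closed_subspace_closed_span[OF SL, folded V_def]
  have SV: "f \<in> V" if "f \<in> S" for f using closed_span_superset[OF SL] that by (auto simp: V_def)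
  have z1: "cmod (\<zeta> x) = 1" for x by (simp add: \<zeta>_def)
  have cz: "cnj (\<zeta> x) = exp (\<i> * of_real (- (pi / a * x)))" for x by (simp add: \<zeta>_def exp_cnj)
  have zm: "\<zeta> \<in> borel_measurable I" "(\<lambda>x. cnj (\<zeta> x)) \<in> borel_measurable I"
    unfolding cz unfolding \<zeta>_def by (intro borel_measurable_lebesgue_on borel_measurable_continuous_onI continuous_intros)+
  have nodes: "node (n + 1) = node n + pi / a" "node (n - 1) = node n - pi / a" for n
    by (simp_all add: node_def algebra_simps add_divide_distrib diff_divide_distrib)
  have shift: "\<zeta> x * wave n x = wave (n + 1) x" "cnj (\<zeta> x) * wave n x = wave (n - 1) x" for n x
  proof -
    show "\<zeta> x * wave n x = wave (n + 1) x" unfolding wave_def \<zeta>_def nodes by (simp add: algebra_simps flip: exp_add)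
    show "cnj (\<zeta> x) * wave n x = wave (n - 1) x" unfolding wave_def cz nodes by (simp add: algebra_simps flip: exp_add)
  qed
  have "V = L2_space I"
  proof (rule cyclic_vector_dense[OF V zm(1) z1])
    have inv: "(\<lambda>x. r x * f x) \<in> V"
      if "r = \<zeta> \<or> r = (\<lambda>x. cnj (\<zeta> x))" "f \<in> V" for r f
    proof (rule mult_closed_span[OF SL _ _ _ V])
      show "r \<in> borel_measurable I" using that(1) zm by auto
      show "cmod (r x) \<le> 1" for x using that(1) z1 by auto
      show "f \<in> L2_space I" "\<And>\<epsilon>. \<epsilon> > 0 \<Longrightarrow> \<exists>g\<in>lin_span S. L2_norm I (\<lambda>x. f x - g x) < \<epsilon>"
        using that(2) unfolding V_def closed_span_def by auto
      fix g assume "g \<in> S"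
      then obtain n where g: "g = (\<lambda>x. amplitude * wave n x)" by (auto simp: S_def)
      have "(\<lambda>x. r x * g x) = (\<lambda>x. amplitude * wave (n + 1) x) \<or> (\<lambda>x. r x * g x) = (\<lambda>x. amplitude * wave (n - 1) x)"
        using that(1) unfolding g by (auto simp: mult.left_commute shift)
      then show "(\<lambda>x. r x * g x) \<in> V" by (intro SV) (auto simp: S_def)
    qed
    show "(\<lambda>x. \<zeta> x * f x) \<in> V" "(\<lambda>x. cnj (\<zeta> x) * f x) \<in> V" if "f \<in> V" for f
      using inv that by blast+
    show "(\<lambda>x. amplitude * wave 0 x) \<in> V" by (intro SV) (auto simp: S_def)
    show "AE x in I. amplitude * wave 0 x \<noteq> 0" using amplitude by (simp add: wave_def)
    fix A assume "A \<in> sets I"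
    then have "A \<in> sets lebesgue" by (auto simp: sets_restrict_space)
    then obtain B N N' where B: "A = B \<union> N" "N \<subseteq> N'" "N' \<in> null_sets lborel" "B \<in> sets lborel"
      by (rule sets_completionE)
    \<comment> \<open>the inverse of \<zeta> on (0, 2a), by the half-angle formula sin \<theta> / (1 - cos \<theta>) =
      cot (\<theta> / 2)\<close>
    define \<xi> where "\<xi> z = a / pi * (pi - 2 * arctan (Im z / (1 - Re z)))" for z
    have inv: "\<xi> (\<zeta> x) = x" if x: "0 < x" "x < 2 * a" for x
    proof -
      define h where "h = pi / a * x / 2"
      have h: "0 < h" "h < pi" using x a by (auto simp: h_def field_simps)
      have sh: "sin h > 0" using h by (rule sin_gt_zero)
      have "\<zeta> x = cis (2 * h)" by (simp add: \<zeta>_def h_def cis_conv_exp)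
      then have "Im (\<zeta> x) / (1 - Re (\<zeta> x)) = (2 * sin h * cos h) / (2 * (sin h)\<^sup>2)"
        by (simp add: sin_double cos_double_sin)
      also have "\<dots> = cos h / sin h" using sh by (simp add: power2_eq_square)
      also have "\<dots> = tan (pi / 2 - h)" by (simp add: tan_def sin_diff cos_diff)
      finally have "arctan (Im (\<zeta> x) / (1 - Re (\<zeta> x))) = pi / 2 - h"
        using h by (simp add: arctan_tan)
      then have "\<xi> (\<zeta> x) = a / pi * (2 * h)" by (simp add: \<xi>_def)
      then show ?thesis using a by (simp add: h_def)
    qed
    have xm: "\<xi> \<in> borel_measurable borel" unfolding \<xi>_def by measurable
    have C: "\<xi> -` B \<in> sets borel" using measurable_sets[OF xm, of B] B(4) by simp
    have neg: "negligible ({0, 2 * a} \<union> N')"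
    proof (rule negligible_Un)
      have "N' \<in> null_sets lebesgue" using B(3) by (rule null_sets_completionI)
      then show "negligible N'" by (simp add: negligible_iff_null_sets)
    qed simp
    have "AE x in I. (x \<in> A) = (\<zeta> x \<in> \<xi> -` B)"
    proof (rule AE_lebesgue_onI[OF neg])
      fix x assume "x \<in> {0..2 * a}" "x \<notin> {0, 2 * a} \<union> N'"
      then have "0 < x" "x < 2 * a" "x \<notin> N" using B(2) by auto
      then show "(x \<in> A) = (\<zeta> x \<in> \<xi> -` B)" using inv[of x] B(1) by auto
    qed simp
    then show "\<exists>C\<in>sets borel. AE x in I. (x \<in> A) = (\<zeta> x \<in> C)" using C by blast
  qed
  then show ?thesis unfolding L2_dense_def V_def closed_span_def S_def by blast
qed

lemma spike_L2: "spike n \<in> L2_space \<omega>"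
proof (rule L2_spaceI)
  have sq: "(cmod (spike n x))\<^sup>2 = indicator {node n} x" for x by (simp add: spike_def indicator_def)
  show "integrable \<omega> (\<lambda>x. (cmod (spike n x))\<^sup>2)" unfolding sq by (simp add: emeasure_singleton)
  show "spike n \<in> borel_measurable \<omega>" unfolding spike_def by measurable
qed

lemma inner_spike: "L2_inner \<omega> f (spike n) = of_real mass * f (node n)"
proof -
  have "f x * cnj (spike n x) = f (node n) * spike n x" for x by (simp add: spike_def indicator_def)
  moreover have "(\<integral>x. spike n x \<partial>\<omega>) = of_real (\<integral>x. indicator {node n} x \<partial>\<omega>)"
    by (subst integral_complex_of_real[symmetric]) (simp add: spike_def of_real_indicator)
  ultimately show ?thesis
    unfolding L2_inner_def using mass_at_zero[OF sin_node] by (simp add: mult.commute)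
qed

lemma AE_node: "AE x in \<omega>. x \<in> range node"
  using supported_on_zeros by (simp add: zero_is_node)

text \<open>
  \<omega> is concentrated on the nodes, so truncating a function to finitely many nodes
  approximates it.
\<close>
lemma dense_spikes: "L2_dense \<omega> (lin_span (range spike))"
  unfolding L2_dense_def
proof (intro ballI allI impI)
  fix f and e :: real assume f: "f \<in> L2_space \<omega>" and e: "e > 0"
  define F where "F k x = (\<Sum>n\<in>{- int k..int k}. f (node n) * spike n x)" for k x
  have F_eq: "F k x = (if x \<in> node ` {- int k..int k} then f x else 0)" for k x
  proof (cases "x \<in> node ` {- int k..int k}")
    case True
    then obtain m where m: "m \<in> {- int k..int k}" "x = node m" by blast
    have "F k x = (\<Sum>n\<in>{- int k..int k}. if n = m then f (node m) else 0)"
      unfolding F_def using inj_node by (intro sum.cong) (auto simp: spike_def indicator_def m(2) inj_def)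
    then show ?thesis using m by simp
  next
    case False
    then show ?thesis unfolding F_def by (auto simp: spike_def indicator_def intro!: sum.neutral)
  qed
  have m: "F k \<in> borel_measurable \<omega>" for k unfolding F_def spike_def by measurable
  have fm: "f \<in> borel_measurable \<omega>" using f by (rule L2_measurable)
  have b: "AE x in \<omega>. cmod (F k x) \<le> cmod (f x)" for k by (auto simp: F_eq)
  have l: "AE x in \<omega>. (\<lambda>k. F k x) \<longlonglongrightarrow> f x"
    using AE_node
  proof eventually_elim
    case (elim x)
    then obtain n where n: "x = node n" by blast
    have "F k x = f x" if "k \<ge> nat \<bar>n\<bar>" for k
    proof -
      have "n \<in> {- int k..int k}" using that by auto
      then show ?thesis unfolding F_eq n by simp
    qed
    then show ?case by (intro tendsto_eventually) (auto simp: eventually_sequentially)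
  qed
  have "\<forall>\<^sub>F k in sequentially. L2_norm \<omega> (\<lambda>x. F k x - f x) < e"
    using L2_dominated_convergence(2)[OF f m fm b l] e by (rule order_tendstoD)
  then obtain k where "L2_norm \<omega> (\<lambda>x. F k x - f x) < e" by (auto dest: eventually_happens)
  moreover have "F k \<in> lin_span (range spike)" unfolding F_def by (rule lin_span_sum) simp
  ultimately show "\<exists>g\<in>lin_span (range spike). L2_norm \<omega> (\<lambda>x. f x - g x) < e"
    by (auto simp: L2_norm_minus_commute[of \<omega> f])
qed

lemma inner_amplitude:
  "F \<in> L2_space I \<Longrightarrow> L2_inner I F (\<lambda>x. amplitude * wave n x) = amplitude * L2_inner I F (wave n)"
  using L2_inner_linear_right[of "wave n" I "\<lambda>x. 0" F amplitude] wave_L2 amplitude(2) by simp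

sublocale fourier: gram_equal \<omega> I spike "\<lambda>n x. amplitude * wave n x"
proof unfold_locales
  show "spike n \<in> L2_space \<omega>" for n by (rule spike_L2)
  show "(\<lambda>x. amplitude * wave n x) \<in> L2_space I" for n using wave_L2 by simp
  show "L2_dense \<omega> (lin_span (range spike))" by (rule dense_spikes)
  show "L2_dense I (lin_span (range (\<lambda>n x. amplitude * wave n x)))" by (rule dense_waves)
  show "L2_inner I (\<lambda>x. amplitude * wave i x) (\<lambda>x. amplitude * wave j x) = L2_inner \<omega> (spike i) (spike j)" for i j
  proof -
    have "L2_inner I (\<lambda>x. amplitude * wave i x) (\<lambda>x. amplitude * wave j x) = amplitude * L2_inner I (\<lambda>x. amplitude * wave i x) (wave j)"
      using wave_L2 by (intro inner_amplitude) simp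
    also have "L2_inner I (\<lambda>x. amplitude * wave i x) (wave j) = amplitude * L2_inner I (wave i) (wave j)"
      using L2_inner_linear_left[of "wave i" I "\<lambda>x. 0" "wave j" amplitude] wave_L2 by simp
    also have "amplitude * (amplitude * L2_inner I (wave i) (wave j)) = (if i = j then of_real mass else 0)"
      using a by (simp add: wave_gram amplitude(3) flip: mult.assoc)
    also have "\<dots> = L2_inner \<omega> (spike i) (spike j)"
      unfolding inner_spike using inj_node by (auto simp: spike_def indicator_def inj_def)
    finally show ?thesis .
  qed
qed

text \<open>
  Integrate the derivative of g(x) exp(-i x node n). The value exp(-2 i a node n) = exp(-2 i
  \<beta>) is the same for all n, so the boundary term vanishes for every wave at once precisely
  when g(0) = exp(-2 i \<beta>) g(2a).
\<close>
lemma integration_by_parts: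
  assumes ac: "abs_continuous_on 0 (2 * a) g" and h: "h \<in> L2_space I"
    and ae: "AE x in I. \<exists>g'. (g has_vector_derivative g') (at x) \<and> h x = - \<i> * g'"
  shows "L2_inner I h (wave n) = of_real (node n) * L2_inner I g (wave n) - \<i> * (exp (- 2 * \<i> * of_real \<beta>) * g (2 * a) - g 0)"
proof -
  define l where "l = node n"
  define k where "k x = exp (\<i> * of_real (- l * x))" for x
  have gL: "g \<in> L2_space I" by (rule L2_continuous_lebesgue_on[OF abs_continuous_on_imp_continuous[OF ac]])
  have kc: "cnj (wave n x) = k x" for x unfolding cnj_wave k_def l_def ..
  obtain N where N: "negligible N" "\<And>x. x \<in> {0..2 * a} \<Longrightarrow> x \<notin> N \<Longrightarrow> \<exists>g'. (g has_vector_derivative g') (at x) \<and> h x = - \<i> * g'"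
    using AE_lebesgue_onE[OF ae] by auto
  have kd: "(k has_vector_derivative (- \<i> * of_real l) * k x) (at x)" for x
  proof -
    have "((\<lambda>z. exp ((- \<i> * of_real l) * z)) has_field_derivative (- \<i> * of_real l) * exp ((- \<i> * of_real l) * of_real x)) (at (of_real x))"
      by (auto intro!: derivative_eq_intros)
    from has_vector_derivative_real_field[OF this] show ?thesis by (simp add: k_def[abs_def] mult.assoc)
  qed
  have hi: "((\<lambda>x. \<i> * (h x * k x) - \<i> * of_real l * (g x * k x)) has_integral (g (2 * a) * k (2 * a) - g 0 * k 0)) {0..2 * a}"
  proof (rule abs_continuous_on_has_integral[OF _ _ N(1)])
    show "abs_continuous_on 0 (2 * a) (\<lambda>x. g x * k x)"
    proof (rule abs_continuous_on_mult_lipschitz[OF ac, where L = "\<bar>l\<bar>"])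
      show "cmod (k x) \<le> 1" for x by (simp only: k_def norm_exp_i_times)
      show "cmod (k t - k s) \<le> \<bar>l\<bar> * \<bar>t - s\<bar>" for s t
        using exp_imaginary_lipschitz[of "- l" t s] by (simp add: k_def)
    qed simp
    fix x assume "x \<in> {0..2 * a} - N"
    then obtain g' where g': "(g has_vector_derivative g') (at x)" "h x = - \<i> * g'" using N(2) by blast
    have "((\<lambda>x. g x * k x) has_vector_derivative (g x * ((- \<i> * of_real l) * k x) + g' * k x)) (at x)"
      by (rule has_vector_derivative_mult[OF g'(1) kd])
    moreover have "g x * ((- \<i> * of_real l) * k x) + g' * k x = \<i> * (h x * k x) - \<i> * of_real l * (g x * k x)"
      unfolding g'(2) by (simp add: algebra_simps)
    ultimately show "((\<lambda>x. g x * k x) has_vector_derivative (\<i> * (h x * k x) - \<i> * of_real l * (g x * k x))) (at x)" by (simp only:)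
  qed (use a in simp)
  have i: "integrable I (\<lambda>x. h x * k x)" "integrable I (\<lambda>x. g x * k x)"
    using L2_inner_integrable[OF h wave_L2[of n]] L2_inner_integrable[OF gL wave_L2[of n]] unfolding kc .
  then have "integrable I (\<lambda>x. \<i> * (h x * k x) - \<i> * of_real l * (g x * k x))"
    by (intro Bochner_Integration.integrable_diff integrable_mult_right)
  from has_integral_unique[OF hi has_integral_integral_lebesgue_on[OF this]]
  have "g (2 * a) * k (2 * a) - g 0 * k 0 = (\<integral>x. \<i> * (h x * k x) - \<i> * of_real l * (g x * k x) \<partial>I)" by simp
  also have "\<dots> = \<i> * L2_inner I h (wave n) - \<i> * of_real l * L2_inner I g (wave n)"
    unfolding L2_inner_def kc
    by (subst Bochner_Integration.integral_diff[OF integrable_mult_right[OF i(1)] integrable_mult_right[OF i(2)]])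
       (simp only: Bochner_Integration.integral_mult_right_zero)
  also have "k (2 * a) = exp (- 2 * \<i> * of_real \<beta>)"
  proof -
    have "l * (2 * a) = 2 * \<beta> + 2 * (pi * of_int n)" using a by (simp add: l_def node_def field_simps)
    then have A: "\<i> * complex_of_real (- l * (2 * a)) = - 2 * \<i> * of_real \<beta> + 2 * of_int (- n) * of_real pi * \<i>"
      by (simp add: algebra_simps)
    have B: "exp (2 * of_int (- n) * of_real pi * \<i>) = (1 :: complex)"
      unfolding exp_eq_1 by (intro conjI exI[of _ "- n"]) simp_all
    show ?thesis unfolding k_def A exp_add B by simp
  qed
  also have "k 0 = 1" by (simp add: k_def)
  finally have "\<i> * L2_inner I h (wave n) = \<i> * of_real l * L2_inner I g (wave n) + (exp (- 2 * \<i> * of_real \<beta>) * g (2 * a) - g 0)"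
    by (simp add: algebra_simps)
  then have "- \<i> * (\<i> * L2_inner I h (wave n)) = - \<i> * (\<i> * of_real l * L2_inner I g (wave n) + (exp (- 2 * \<i> * of_real \<beta>) * g (2 * a) - g 0))"
    by (rule arg_cong)
  then show ?thesis by (simp add: l_def algebra_simps)
qed

lemma boundary_limits:
  assumes "abs_continuous_on 0 (2 * a) g"
  shows "Lim (at_right 0) g = g 0" "Lim (at_left (2 * a)) g = g (2 * a)"
proof -
  have c: "continuous_on {0..2 * a} g" by (rule abs_continuous_on_imp_continuous[OF assms])
  have "0 < 2 * a" using a by simp
  then have "(g \<longlongrightarrow> g 0) (at_right 0)" "(g \<longlongrightarrow> g (2 * a)) (at_left (2 * a))"
    using continuous_on_Icc_at_rightD[OF c] continuous_on_Icc_at_leftD[OF c] by auto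
  then show "Lim (at_right 0) g = g 0" "Lim (at_left (2 * a)) g = g (2 * a)"
    by (auto intro!: tendsto_Lim)
qed

abbreviation \<rho> :: complex where "\<rho> \<equiv> exp (- 2 * \<i> * of_real \<beta>)"

lemma multiple_of_pi_zero:
  assumes e: "\<beta> = of_int k * pi"
  shows "\<beta> = 0"
proof -
  have "\<not> k < 0"
  proof
    assume "k < 0"
    then have "of_int k * pi < 0" by (intro mult_neg_pos) auto
    then show False using \<beta>(1) e by simp
  qed
  moreover have "\<not> k \<ge> 1"
  proof
    assume "k \<ge> 1"
    then have "1 * pi \<le> of_int k * pi" by (intro mult_right_mono) auto
    then show False using \<beta>(2) e by simp
  qed
  ultimately show ?thesis using e by simp
qed

lemma phase_one: "\<rho> = 1 \<Longrightarrow> \<beta> = 0"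
proof -
  assume "\<rho> = 1"
  then obtain n :: int where "Im (- 2 * \<i> * of_real \<beta>) = of_int (2 * n) * pi"
    unfolding exp_eq_1 by (elim conjE exE)
  then have "- \<beta> = of_int n * pi" by simp
  then have "\<beta> = - (of_int n * pi)" by linarith
  then have "\<beta> = of_int (- n) * pi" by simp
  then show ?thesis by (rule multiple_of_pi_zero)
qed

lemma node_nonzero: "node n = 0 \<Longrightarrow> n = 0 \<and> \<beta> = 0"
proof -
  assume "node n = 0"
  then have e: "\<beta> = of_int (- n) * pi" using a by (simp add: node_def add_eq_0_iff mult.commute)
  have "\<beta> = 0" by (rule multiple_of_pi_zero[OF e])
  with e show ?thesis by simp
qed

text \<open>
  In one direction the boundary condition removes the boundary term of
  \<open>integration_by_parts\<close>. In the other, the candidate for F is an antiderivative of i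
  G with a free additive constant c. If \<rho> \<noteq> 1, the boundary condition determines c. If
  \<rho> = 1, then node 0 = 0, so the hypothesis at n = 0 makes the integral of G vanish and the
  boundary condition holds for all c; then c is used to match the coefficient of F at that node.
\<close>
theorem diff_op_iff:
  "(F, G) \<in> diff_op a \<rho> \<longleftrightarrow> F \<in> L2_space I \<and> G \<in> L2_space I \<and>
     (\<forall>n. L2_inner I G (wave n) = of_real (node n) * L2_inner I F (wave n))"
proof
  assume "(F, G) \<in> diff_op a \<rho>"
  then have FG: "F \<in> L2_space I" "G \<in> L2_space I"
    and ex: "\<exists>g. ae_eq I F g \<and> abs_continuous_on 0 (2 * a) g \<and> Lim (at_right 0) g = \<rho> * Lim (at_left (2 * a)) g \<and>
      (AE x in I. \<exists>g'. (g has_vector_derivative g') (at x) \<and> G x = - \<i> * g')"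
    unfolding diff_op_def Let_def by simp_all
  from ex obtain g where g: "ae_eq I F g" "abs_continuous_on 0 (2 * a) g"
      "Lim (at_right 0) g = \<rho> * Lim (at_left (2 * a)) g"
      "AE x in I. \<exists>g'. (g has_vector_derivative g') (at x) \<and> G x = - \<i> * g'"
    by (elim exE conjE)
  have gL: "g \<in> L2_space I" by (rule L2_continuous_lebesgue_on[OF abs_continuous_on_imp_continuous[OF g(2)]])
  have "g 0 = \<rho> * g (2 * a)" using g(3) boundary_limits[OF g(2)] by simp
  then have "L2_inner I G (wave n) = of_real (node n) * L2_inner I g (wave n)" for n
    using integration_by_parts[OF g(2) FG(2) g(4), of n] by simp
  moreover have "L2_inner I g (wave n) = L2_inner I F (wave n)" for n
    using g(1) FG(1) gL wave_L2 by (intro L2_inner_cong_AE) (auto simp: ae_eq_def elim!: eventually_mono)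
  ultimately show "F \<in> L2_space I \<and> G \<in> L2_space I \<and> (\<forall>n. L2_inner I G (wave n) = of_real (node n) * L2_inner I F (wave n))"
    using FG by simp
next
  assume FG: "F \<in> L2_space I \<and> G \<in> L2_space I \<and> (\<forall>n. L2_inner I G (wave n) = of_real (node n) * L2_inner I F (wave n))"
  then have F: "F \<in> L2_space I" and G: "G \<in> L2_space I" by auto
  define g1 where "g1 x = integral {0..x} G" for x
  define g where "g c x = \<i> * g1 x + c" for c x
  have ac: "abs_continuous_on 0 (2 * a) (g c)" for c
    unfolding g_def g1_def by (intro abs_continuous_on_unimodular_affine indefinite_integral_abs_continuous G) simp
  have gL: "g c \<in> L2_space I" for c by (rule L2_continuous_lebesgue_on[OF abs_continuous_on_imp_continuous[OF ac]])
  have ae: "AE x in I. \<exists>g'. (g c has_vector_derivative g') (at x) \<and> G x = - \<i> * g'" for c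
  proof (rule AE_lebesgue_onI)
    show "negligible ({0, 2 * a} \<union> {x \<in> {0<..<2 * a}. \<not> (g1 has_vector_derivative G x) (at x)})"
      unfolding g1_def
      by (intro negligible_Un lebesgue_differentiation_indefinite_integral L2_imp_integrable_lebesgue_on(2)[OF G]) simp
    fix x assume "x \<in> {0..2 * a}" "x \<notin> {0, 2 * a} \<union> {x \<in> {0<..<2 * a}. \<not> (g1 has_vector_derivative G x) (at x)}"
    then have "(g1 has_vector_derivative G x) (at x)" by auto
    then have "(g c has_vector_derivative \<i> * G x) (at x)"
      unfolding g_def by (auto intro!: derivative_eq_intros)
    then show "\<exists>g'. (g c has_vector_derivative g') (at x) \<and> G x = - \<i> * g'"
      by (intro exI[of _ "\<i> * G x"]) simp
  qed simp
  define S where "S = integral {0..2 * a} G"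
  have g_ends: "g c 0 = c" "g c (2 * a) = \<i> * S + c" for c by (simp_all add: g_def g1_def S_def)
  have coef: "of_real (node n) * L2_inner I F (wave n) = of_real (node n) * L2_inner I (g c) (wave n) - \<i> * (\<rho> * (\<i> * S + c) - c)" for n c
    using integration_by_parts[OF ac[of c] G ae[of c], of n] FG unfolding g_ends by simp
  have "\<exists>c. \<rho> * (\<i> * S + c) = c \<and> (\<forall>n. L2_inner I (g c) (wave n) = L2_inner I F (wave n))"
  proof (cases "\<beta> = 0")
    case False
    then have r: "1 - \<rho> \<noteq> 0" using phase_one by auto
    define c where "c = \<i> * \<rho> * S / (1 - \<rho>)"
    have "c * (1 - \<rho>) = \<i> * \<rho> * S" using r by (simp add: c_def)
    then have c: "\<rho> * (\<i> * S + c) = c" by (simp add: algebra_simps)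
    moreover have "L2_inner I (g c) (wave n) = L2_inner I F (wave n)" for n
      using coef[of n c] c node_nonzero[of n] False by auto
    ultimately show ?thesis by blast
  next
    case True
    then have r1: "\<rho> = 1" by simp
    have n0: "node 0 = 0" unfolding node_def using True by simp
    have w0: "wave 0 x = 1" for x by (simp add: wave_def n0)
    have "L2_inner I G (wave 0) = 0" using FG n0 by simp
    then have "(\<integral>x. G x \<partial>I) = 0" by (simp add: L2_inner_def w0)
    moreover have "(G has_integral (\<integral>x. G x \<partial>I)) {0..2 * a}"
      by (rule has_integral_integral_lebesgue_on[OF L2_imp_integrable_lebesgue_on(1)[OF G]]) simp
    ultimately have S0: "S = 0" unfolding S_def by (simp add: integral_unique)
    define c where "c = (L2_inner I F (wave 0) - L2_inner I (g 0) (wave 0)) / of_real (2 * a)"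
    have "L2_inner I (g c) (wave 0) = L2_inner I F (wave 0)"
    proof -
      have "g c = (\<lambda>x. c * wave 0 x + g 0 x)" by (simp add: g_def w0 fun_eq_iff)
      then have "L2_inner I (g c) (wave 0) = c * L2_inner I (wave 0) (wave 0) + L2_inner I (g 0) (wave 0)"
        using gL wave_L2 by (simp add: L2_inner_linear_left)
      then show ?thesis using a by (simp add: wave_gram c_def)
    qed
    then have "L2_inner I (g c) (wave n) = L2_inner I F (wave n)" for n
      using coef[of n c] r1 S0 node_nonzero[of n] by (cases "n = 0") auto
    then show ?thesis using r1 S0 by (intro exI[of _ c]) simp
  qed
  then obtain c where c: "\<rho> * (\<i> * S + c) = c" "\<And>n. L2_inner I (g c) (wave n) = L2_inner I F (wave n)" by auto
  have "ae_eq I F (g c)"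
    using F gL c(2) by (intro fourier.unique) (auto simp: inner_amplitude)
  moreover have "Lim (at_right 0) (g c) = \<rho> * Lim (at_left (2 * a)) (g c)"
    unfolding boundary_limits[OF ac] g_ends c(1) ..
  ultimately have "\<exists>g. ae_eq I F g \<and> abs_continuous_on 0 (2 * a) g \<and> Lim (at_right 0) g = \<rho> * Lim (at_left (2 * a)) g \<and>
      (AE x in I. \<exists>g'. (g has_vector_derivative g') (at x) \<and> G x = - \<i> * g')"
    by (intro exI[of _ "g c"] conjI ac ae)
  then show "(F, G) \<in> diff_op a \<rho>"
    unfolding diff_op_def Let_def using F G by simp
qed

lemma mult_op_nodes:
  assumes f: "f \<in> L2_space \<omega>" and g: "g \<in> L2_space \<omega>"
  shows "(f, g) \<in> mult_op \<omega> \<longleftrightarrow> (\<forall>n. g (node n) = of_real (node n) * f (node n))"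
proof
  assume "(f, g) \<in> mult_op \<omega>"
  then have ae: "AE x in \<omega>. g x = of_real x * f x" by (simp add: mult_op_iff)
  show "\<forall>n. g (node n) = of_real (node n) * f (node n)"
  proof (rule allI, rule ccontr)
    fix n assume ne: "g (node n) \<noteq> of_real (node n) * f (node n)"
    have "AE x in \<omega>. x \<noteq> node n" using ae by eventually_elim (use ne in auto)
    then have "emeasure \<omega> {node n} = 0" by (subst (asm) AE_iff_measurable[of "{node n}"]) auto
    then show False using mass_at_zero[OF sin_node[of n]] mass_pos by (simp add: emeasure_singleton)
  qed
next
  assume n: "\<forall>n. g (node n) = of_real (node n) * f (node n)"
  have "AE x in \<omega>. g x = of_real x * f x" using AE_node by eventually_elim (use n in auto)
  then show "(f, g) \<in> mult_op \<omega>" using f g by (simp add: mult_op_iff)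
qed

text \<open>
  The unitary map sends the value f(node n) to the n-th Fourier coefficient, up to a factor that
  does not depend on n.
\<close>
theorem unitarily_equivalent_diff_op:
  "unitarily_equivalent \<omega> (mult_op \<omega>) I (diff_op a \<rho>)"
proof -
  obtain U where U: "unitary_map \<omega> I U" "\<And>f. f \<in> L2_space \<omega> \<Longrightarrow> U f \<in> L2_space I"
    "\<And>f n. f \<in> L2_space \<omega> \<Longrightarrow> L2_inner I (U f) (\<lambda>x. amplitude * wave n x) = L2_inner \<omega> f (spike n)"
  proof (rule fourier.unitary_exists)
    fix U assume u: "unitary_map \<omega> I U" "\<And>f. f \<in> L2_space \<omega> \<Longrightarrow> U f \<in> L2_space I"
      "\<And>f n. f \<in> L2_space \<omega> \<Longrightarrow> L2_inner I (U f) (\<lambda>x. amplitude * wave n x) = L2_inner \<omega> f (spike n)"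
    show thesis by (rule that[OF u])
  qed
  have coef: "amplitude * L2_inner I (U f) (wave n) = of_real mass * f (node n)" if "f \<in> L2_space \<omega>" for f n
    using U(3)[OF that] inner_amplitude[OF U(2)[OF that]] inner_spike by simp
  have "(f, g) \<in> mult_op \<omega> \<longleftrightarrow> (U f, U g) \<in> diff_op a \<rho>" if f: "f \<in> L2_space \<omega>" and g: "g \<in> L2_space \<omega>" for f g
  proof -
    have "L2_inner I (U g) (wave n) = of_real (node n) * L2_inner I (U f) (wave n) \<longleftrightarrow> g (node n) = of_real (node n) * f (node n)" for n
    proof -
      have "L2_inner I (U g) (wave n) = of_real (node n) * L2_inner I (U f) (wave n) \<longleftrightarrow>
          amplitude * L2_inner I (U g) (wave n) = of_real (node n) * (amplitude * L2_inner I (U f) (wave n))"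
        using amplitude(1) by (simp add: mult.left_commute[of _ amplitude])
      also have "\<dots> \<longleftrightarrow> of_real mass * g (node n) = of_real mass * (of_real (node n) * f (node n))"
        unfolding coef[OF f] coef[OF g] by (simp add: mult.left_commute)
      also have "\<dots> \<longleftrightarrow> g (node n) = of_real (node n) * f (node n)" using mass_pos by simp
      finally show ?thesis .
    qed
    then show ?thesis unfolding mult_op_nodes[OF f g] diff_op_iff using U(2)[OF f] U(2)[OF g] by simp
  qed
  then show ?thesis unfolding unitarily_equivalent_def by (intro exI[of _ U] conjI U(1)) simp
qed

end

theorem theorem5p11:
  fixes \<omega> :: "real measure"
  assumes borel: "sets \<omega> = sets borel"
    and normalized: "(\<integral>\<^sup>+x. ennreal (1 / (1 + x\<^sup>2)) \<partial>\<omega>) = 1"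
    and infinite_mass: "(\<integral>\<^sup>+x. 1 \<partial>\<omega>) = \<infinity>"
  shows
    "self_adjoint_op \<omega> (mult_op \<omega>) \<and>
     closed_operator \<omega> (mult_op_restr \<omega>) \<and> symmetric_op \<omega> (mult_op_restr \<omega>) \<and>
     deficiency_indices_one_one \<omega> (mult_op_restr \<omega>) \<and> prime_op \<omega> (mult_op_restr \<omega>) \<and>
     ((\<exists>S. quasi_hermitian_extension \<omega> (mult_op_restr \<omega>) S \<and> spectrum \<omega> S = {}) \<longleftrightarrow>
      (\<exists>a>0. \<exists>\<alpha>\<in>{0..<pi}. weyl_representation \<omega> a \<alpha>)) \<and>
     (\<forall>a>0. \<forall>\<alpha>\<in>{0..<pi}. weyl_representation \<omega> a \<alpha> \<longrightarrow>
        (\<exists>!\<beta>. phase_angle a \<alpha> \<beta>) \<and>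
        (\<forall>\<beta>. phase_angle a \<alpha> \<beta> \<longrightarrow>
           (\<forall>A\<in>sets borel. emeasure \<omega> A =
              ennreal (point_mass a \<alpha>) *
              (\<Sum>\<^sub>\<infinity>n::int. emeasure (return borel ((\<beta> + pi * of_int n) / a)) A)) \<and>
           unitarily_equivalent \<omega> (mult_op \<omega>)
             (lebesgue_on {0..2 * a}) (diff_op a (exp (- 2 * \<i> * of_real \<beta>)))))"
proof -
  interpret infinite_spectral_measure \<omega>
    by unfold_locales (fact borel normalized infinite_mass)+
  have phase: "phase_measure \<omega> a \<alpha> \<beta> l"
    if "a > 0" "0 \<le> \<alpha>" "\<alpha> < pi" "weyl_representation \<omega> a \<alpha>" "phase_angle a \<alpha> \<beta>"
      "l \<noteq> 0" "cos \<alpha> = l * cos \<beta>" "sin \<alpha> * tanh a = - l * sin \<beta>" for a \<alpha> \<beta> l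
  proof unfold_locales
    show "0 \<le> \<beta>" "\<beta> < pi" using that(5) by (auto simp: phase_angle_def split: if_splits)
  qed (use that in simp_all)
  have iff: "(\<exists>S. quasi_hermitian_extension \<omega> (mult_op_restr \<omega>) S \<and> spectrum \<omega> S = {}) \<longleftrightarrow>
      (\<exists>a>0. \<exists>\<alpha>\<in>{0..<pi}. weyl_representation \<omega> a \<alpha>)"
  proof
    assume "\<exists>S. quasi_hermitian_extension \<omega> (mult_op_restr \<omega>) S \<and> spectrum \<omega> S = {}"
    then obtain S where S: "quasi_hermitian_extension \<omega> (mult_op_restr \<omega>) S" "spectrum \<omega> S = {}" by blast
    obtain w where "S = ext w" "Im w \<noteq> 0" by (rule quasi_hermitian_extension_is_ext[OF S(1)])
    then show "\<exists>a>0. \<exists>\<alpha>\<in>{0..<pi}. weyl_representation \<omega> a \<alpha>"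
      using empty_spectrum_imp_weyl_representation[of w] S(2) by simp
  next
    assume "\<exists>a>0. \<exists>\<alpha>\<in>{0..<pi}. weyl_representation \<omega> a \<alpha>"
    then obtain a \<alpha> where w: "a > 0" "0 \<le> \<alpha>" "\<alpha> < pi" "weyl_representation \<omega> a \<alpha>" by auto
    obtain \<beta> where \<beta>: "phase_angle a \<alpha> \<beta>" using phase_angle_unique[OF w(1-3)] by blast
    obtain l where l: "l \<noteq> 0" "cos \<alpha> = l * cos \<beta>" "sin \<alpha> * tanh a = - l * sin \<beta>"
      by (rule phase_angle_polar[OF w(1-3) \<beta>])
    interpret P: phase_measure \<omega> a \<alpha> \<beta> l by (rule phase[OF w \<beta> l])
    have "Im P.asymptotic_value \<noteq> 0" using P.Im_asymptotic_value by simp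
    then show "\<exists>S. quasi_hermitian_extension \<omega> (mult_op_restr \<omega>) S \<and> spectrum \<omega> S = {}"
      using quasi_hermitian_ext P.empty_spectrum_asymptotic_extension by blast
  qed
  have rest: "(\<forall>A\<in>sets borel. emeasure \<omega> A = ennreal (point_mass a \<alpha>) *
              (\<Sum>\<^sub>\<infinity>n::int. emeasure (return borel ((\<beta> + pi * of_int n) / a)) A)) \<and>
           unitarily_equivalent \<omega> (mult_op \<omega>)
             (lebesgue_on {0..2 * a}) (diff_op a (exp (- 2 * \<i> * of_real \<beta>)))"
    if w: "a > 0" "0 \<le> \<alpha>" "\<alpha> < pi" "weyl_representation \<omega> a \<alpha>" and \<beta>: "phase_angle a \<alpha> \<beta>" for a \<alpha> \<beta>
  proof -
    obtain l where l: "l \<noteq> 0" "cos \<alpha> = l * cos \<beta>" "sin \<alpha> * tanh a = - l * sin \<beta>"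
      by (rule phase_angle_polar[OF w(1-3) \<beta>])
    interpret P: phase_measure \<omega> a \<alpha> \<beta> l by (rule phase[OF w \<beta> l])
    show ?thesis using P.emeasure_point_masses P.unitarily_equivalent_diff_op by blast
  qed
  show ?thesis
    using self_adjoint_mult_op closed_mult_op_restr symmetric_mult_op_restr deficiency_mult_op_restr
      prime_mult_op_restr[OF self_adjoint_mult_op] iff phase_angle_unique rest by auto
qed

end
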